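(* Let $I=(-1,1)$, let $(\rho_k)_{k\in\mathbb{N}}$ be a sequence of positive real numbers, and for each $k$ let $u_k\in C^{0,\frac12}(\mathbb{R})\cap C^\infty(I)$ be a solution to $$(-\Delta)^{\frac12}u_k=\rho_k\frac{e^{u_k}}{\int_I e^{u_k}\,dx}\ \text{ in } I,\qquad u_k\equiv 0\ \text{ in }\mathbb{R}\setminus I.$$ Then, up to passing to a subsequence, one of the following is true: (i) $(u_k)$ is bounded in $C^{0,\frac12}(\mathbb{R})\cap C^\ell_{\mathrm{loc}}(I)$ for every $\ell\in\mathbb{N}$. (ii) $\lim_{k\to\infty}u_k(0)=\infty$ and $\rho_k\uparrow 2\pi$ as $k\to\infty$ (convergence to $2\pi$ from below); moreover, for every $0<\sigma<\frac12$, $$u_k\to 2\pi G_0\quad\text{in } C^{0,\sigma}_{\mathrm{loc}}(\mathbb{R}\setminus\{0\}),$$ where $G_0$ is the Green function (with pole at $0$) of $(-\Delta)^{\frac12}$ on $I$ with Dirichlet boundary condition.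
   Context: For a function $u\in C^{0,\frac12}(\mathbb{R})\cap C^\infty(I)$ vanishing outside $I=(-1,1)$, the half-Laplacian is $$(-\Delta)^{\frac12}u(x)=\frac1\pi\,P.V.\int_{\mathbb{R}}\frac{u(x)-u(y)}{(x-y)^2}\,dy,\qquad x\in I.$$ There is no loss of generality in considering solutions in $C^{0,\frac12}(\mathbb{R})\cap C^\infty(I)$. For $x,y\in I$, $x\neq y$, the Green function of $(-\Delta)^{\frac12}$ on $I$ is $$G_x(y)=\tfrac1\pi\Big(\log\big(\sqrt{(1-|x|^2)(1-|y|^2)}+1-xy\big)-\log|x-y|\Big),$$ and $G_x(y)=0$ for $x\in I$, $y\in\mathbb{R}\setminus I$. $G_0$ denotes $G_x$ with $x=0$. The subscript "loc" means that the boundedness or convergence holds in the corresponding norm on every compact subset of the indicated set. *)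

theory Defs
  imports "HOL-Analysis.Analysis"
begin

text \<open>
  All norms are valued in \<^typ>\<open>ennreal\<close>, so that they are genuinely infinite on functions
  outside the corresponding space (and 0 on the empty set).
\<close>

definition sup_norm_on :: "real set \<Rightarrow> (real \<Rightarrow> real) \<Rightarrow> ennreal" where
  "sup_norm_on S f = (SUP x\<in>S. ennreal \<bar>f x\<bar>)"

definition holder_seminorm :: "real \<Rightarrow> real set \<Rightarrow> (real \<Rightarrow> real) \<Rightarrow> ennreal" where
  "holder_seminorm \<sigma> S f =
     (SUP (x, y)\<in>{(x, y). x \<in> S \<and> y \<in> S \<and> x \<noteq> y}. ennreal (\<bar>f x - f y\<bar> / \<bar>x - y\<bar> powr \<sigma>))"

definition holder_norm :: "real \<Rightarrow> real set \<Rightarrow> (real \<Rightarrow> real) \<Rightarrow> ennreal" where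
  "holder_norm \<sigma> S f = sup_norm_on S f + holder_seminorm \<sigma> S f"

definition smooth_on :: "real set \<Rightarrow> (real \<Rightarrow> real) \<Rightarrow> bool" where
  "smooth_on U f \<longleftrightarrow> (\<forall>n. (deriv ^^ n) f differentiable_on U)"

text \<open>
  The following two notions are used for open \<open>U\<close> only: \<^const>\<open>deriv\<close> takes the two-sided
  derivative, also at boundary points of the compact sets \<open>K\<close>.
\<close>

definition Cl_norm :: "nat \<Rightarrow> real set \<Rightarrow> (real \<Rightarrow> real) \<Rightarrow> ennreal" where
  "Cl_norm l K f = (\<Sum>j\<le>l. sup_norm_on K ((deriv ^^ j) f))"

definition bounded_in_Cl_loc :: "nat \<Rightarrow> real set \<Rightarrow> (nat \<Rightarrow> real \<Rightarrow> real) \<Rightarrow> bool" where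
  "bounded_in_Cl_loc l U f \<longleftrightarrow>
     (\<forall>K. compact K \<and> K \<subseteq> U \<longrightarrow> (\<exists>C::real. \<forall>k. Cl_norm l K (f k) \<le> ennreal C))"

definition bounded_in_holder :: "real \<Rightarrow> real set \<Rightarrow> (nat \<Rightarrow> real \<Rightarrow> real) \<Rightarrow> bool" where
  "bounded_in_holder \<sigma> S f \<longleftrightarrow> (\<exists>C::real. \<forall>k. holder_norm \<sigma> S (f k) \<le> ennreal C)"

definition tendsto_in_holder_loc ::
    "real \<Rightarrow> real set \<Rightarrow> (nat \<Rightarrow> real \<Rightarrow> real) \<Rightarrow> (real \<Rightarrow> real) \<Rightarrow> bool" where
  "tendsto_in_holder_loc \<sigma> U f g \<longleftrightarrow>
     (\<forall>K. compact K \<and> K \<subseteq> U \<longrightarrow> (\<lambda>k. holder_norm \<sigma> K (\<lambda>x. f k x - g x)) \<longlonglongrightarrow> 0)"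

definition has_pv_integral :: "(real \<Rightarrow> real) \<Rightarrow> real \<Rightarrow> real \<Rightarrow> bool" where
  "has_pv_integral f x L \<longleftrightarrow>
     (\<forall>\<epsilon>>0. set_integrable lborel {y. \<epsilon> < \<bar>x - y\<bar>} f) \<and>
     ((\<lambda>\<epsilon>. LBINT y:{y. \<epsilon> < \<bar>x - y\<bar>}. f y) \<longlongrightarrow> L) (at_right 0)"

definition has_half_laplacian :: "(real \<Rightarrow> real) \<Rightarrow> real \<Rightarrow> real \<Rightarrow> bool" where
  "has_half_laplacian u x v \<longleftrightarrow>
     (\<exists>L. has_pv_integral (\<lambda>y. (u x - u y) / (x - y)\<^sup>2) x L \<and> v = 1 / pi * L)"

definition half_liouville_solution :: "real \<Rightarrow> (real \<Rightarrow> real) \<Rightarrow> bool" where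
  "half_liouville_solution \<rho> u \<longleftrightarrow>
     holder_norm (1/2) UNIV u < \<infinity> \<and> smooth_on {-1<..<1} u \<and>
     (\<forall>x\<in>{-1<..<1}. has_half_laplacian u x (\<rho> * (exp (u x) / (LBINT y:{-1<..<1}. exp (u y))))) \<and>
     (\<forall>x. x \<notin> {-1<..<1} \<longrightarrow> u x = 0)"

text \<open>The value at the pole \<open>y = x\<close>, where \<^term>\<open>ln 0 = (0::real)\<close>, is meaningless.\<close>

definition green :: "real \<Rightarrow> real \<Rightarrow> real" where
  "green x y =
     (if x \<in> {-1<..<1} \<and> y \<in> {-1<..<1}
      then 1 / pi * (ln (sqrt ((1 - \<bar>x\<bar>\<^sup>2) * (1 - \<bar>y\<bar>\<^sup>2)) + 1 - x * y) - ln \<bar>x - y\<bar>)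
      else 0)"

end

theory Submission
  imports Defs "HOL-Complex_Analysis.Complex_Analysis"
begin

text \<open>
  Let \<open>f = lam * exp u\<close> be the right-hand side. Under the inverse Joukowski map, which takes the upper half-plane to
  the half disc \<open>norm w < 1, Re w > 0\<close> and the interval to the boundary arc, the Poisson extension of \<open>u\<close> becomes
  the real part of an explicit holomorphic function \<open>\<Phi> = gpot f\<close> on the disc, by the maximum principle and the
  Dirichlet-to-Neumann description of the half-Laplacian. The mean value property of \<open>(w * \<Phi>')\<^sup>2\<close> times powers of \<open>w\<close> gives
  the Pohozaev-type identities \<open>\<integral> y f = 0\<close> and \<open>\<rho> - 3 \<integral> y\<^sup>2 f = S\<^sup>2 / (2 pi)\<close> with \<open>S = \<integral> sqrt (1 - y\<^sup>2) f\<close>. As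
  \<open>S\<close> lies between \<open>\<rho> - \<integral> y\<^sup>2 f\<close> and \<open>\<rho>\<close>, one gets \<open>\<rho> < 2 pi\<close> and that \<open>\<integral> y\<^sup>2 f\<close> is comparable to \<open>2 pi - \<rho>\<close>.

  If \<open>\<rho> \<rightarrow> 2 pi\<close>, the densities therefore concentrate at \<open>0\<close>, and the potential representation yields convergence to the
  Green function: locally uniformly, and in Hoelder norm by interpolation with a uniform bound of higher exponent. If \<open>\<rho>\<close> stays
  below \<open>2 pi\<close>, the same identities rule out concentration of mass close to \<open>pi\<close> at any point, so \<open>u\<close> is bounded above by
  Jensen's inequality; the potential then gives the Hoelder bound, and reflecting \<open>exp \<Phi>\<close> across the interval gives the
  interior bounds on derivatives through Cauchy's inequality.
\<close>

section \<open>The Green potential on the unit disc\<close>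

text \<open>The obstacle is regularity at the endpoints. A solution is only Hoelder continuous with
  exponent 1/2 there, and on the disc nothing gives \<open>gpot' f\<close> a continuous extension to
  the circle. What is available is that \<open>gpot' f\<close> is bounded, and that
  \<open>Re (w * gpot' f w)\<close> has a nontangential limit on the arc, while the imaginary part
  is merely bounded. The identities are therefore integrated over circles of radius below 1: in the
  imaginary part of the square of \<open>w * gpot' f w\<close> the real factor is replaced by its
  limit, and the imaginary factor, a tangential derivative, is integrated by parts. Potentials of
  Hoelder densities are Lipschitz on the disc; the exponent 1/2 of the theorem is the loss of
  \<open>cpt\<close> at the endpoints of the interval. No compactness argument over the set of
  solutions is made. The bounds carried along the sequence depend only on the mass gap, on an upper
  bound of \<open>u\<close>, or on the distance to 0 or to the endpoints; the Hoelder constant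
  \<open>L\<close> of a single solution serves integrability and passages to the limit. The centre
  of the disc is the point at infinity of the half-plane; the value of \<open>gpot' f\<close> there
  produces \<open>S\<close>.\<close>

lemma norm_Ln_diff_le_powr:
  fixes a b :: complex
  assumes a: "a \<noteq> 0" "Re a \<ge> 0" and b: "b \<noteq> 0" "Re b \<ge> 0" and \<alpha>: "0 < \<alpha>" "\<alpha> \<le> 1"
  shows "norm (Ln a - Ln b) \<le> (3 / \<alpha> + 2 * pi) * norm (a - b) powr \<alpha> *
           (norm a powr (-\<alpha>) + norm b powr (-\<alpha>))"
proof -
  define m where "m = min (norm a) (norm b)"
  define d where "d = norm (a - b)"
  have m: "m > 0" using a b by (auto simp: m_def)
  have d0: "d \<ge> 0" by (simp add: d_def)
  have "norm (Ln a - Ln b) \<le> (3 / \<alpha> + 2 * pi) * (d / m) powr \<alpha>"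
  \<comment> \<open>Near case: the segment from \<open>b\<close> to \<open>a\<close> keeps distance
    \<open>m / 2\<close> from 0 and stays in the closed right half-plane, off the cut, so the mean
    value bound for \<open>Ln\<close> applies. Far case: \<open>q = d / m > 1/2\<close>, and the
    logarithmic growth of the modulus together with arguments of at most \<open>pi / 2\<close> is
    absorbed into \<open>q powr \<alpha>\<close>.\<close>
  proof (cases "d \<le> m / 2")
    case True
    have seg: "z \<notin> \<real>\<^sub>\<le>\<^sub>0 \<and> norm z \<ge> m / 2" if "z \<in> closed_segment b a" for z
    proof -
      from that obtain t where t: "0 \<le> t" "t \<le> 1" "z = (1 - t) *\<^sub>R b + t *\<^sub>R a"
        by (auto simp: closed_segment_def)
      have "Re z \<ge> 0" using t a b by simp
      have "a - z = (1 - t) *\<^sub>R (a - b)" by (simp add: t algebra_simps)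
      then have "norm (a - z) \<le> d" using t d0 by (simp add: d_def mult_left_le_one_le)
      moreover have "norm a \<ge> m" by (simp add: m_def)
      ultimately have *: "norm z \<ge> m / 2" using True norm_triangle_sub[of a z] by linarith
      then have "z \<noteq> 0" using m by auto
      then have "z \<notin> \<real>\<^sub>\<le>\<^sub>0" using \<open>Re z \<ge> 0\<close>
        by (auto simp: complex_nonpos_Reals_iff complex_eq_iff)
      then show ?thesis using * by simp
    qed
    have "norm (Ln a - Ln b) \<le> (2 / m) * norm (a - b)"
    proof (rule field_differentiable_bound[of "closed_segment b a"])
      show "(Ln has_field_derivative inverse z) (at z within closed_segment b a)"
        if "z \<in> closed_segment b a" for z
        using seg[OF that] has_field_derivative_Ln by (auto intro: has_field_derivative_at_within)
      show "norm (inverse z) \<le> 2 / m" if "z \<in> closed_segment b a" for z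
        using seg[OF that] m le_imp_inverse_le[of "m / 2" "norm z"] by (simp add: norm_inverse)
    qed auto
    also have "\<dots> = 2 * (d / m)" by (simp add: d_def)
    also have "d / m \<le> (d / m) powr \<alpha>"
    proof (cases "d = 0")
      case False
      then show ?thesis using True m d0 \<alpha> powr_mono'[of \<alpha> 1 "d / m"] by (simp add: field_simps)
    qed simp
    also have "2 * (d / m) powr \<alpha> \<le> (3 / \<alpha> + 2 * pi) * (d / m) powr \<alpha>"
    proof (rule mult_right_mono)
      have "3 / \<alpha> \<ge> 3" using \<alpha> by (simp add: divide_simps)
      then show "2 \<le> 3 / \<alpha> + 2 * pi" using pi_gt_zero by linarith
    qed simp
    finally show ?thesis by simp
  next
    case False
    define q where "q = d / m"
    have q: "q > 1 / 2" using False m by (simp add: q_def field_simps)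
    have "\<bar>ln (norm a) - ln (norm b)\<bar> \<le> ln (1 + q)"
    proof -
      have 1: "ln x - ln y \<le> ln (1 + q)" if "x \<le> y + d" "m \<le> y" "x > 0" for x y
      proof -
        have "x \<le> y * (1 + q)"
        proof -
          have "d = m * q" using m by (simp add: q_def)
          also have "\<dots> \<le> y * q" using that q by (intro mult_right_mono) auto
          finally show ?thesis using that by (simp add: algebra_simps)
        qed
        moreover have "y > 0" using that m by linarith
        ultimately have "ln x \<le> ln (y * (1 + q))" using that q by (subst ln_le_cancel_iff) auto
        also have "\<dots> = ln y + ln (1 + q)" using \<open>y > 0\<close> q by (subst ln_mult) auto
        finally show ?thesis by simp
      qed
      have "norm a \<le> norm b + d" "norm b \<le> norm a + d"
        using norm_triangle_sub[of a b] norm_triangle_sub[of b a] by (auto simp: d_def norm_minus_commute)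
      then show ?thesis using 1[of "norm a" "norm b"] 1[of "norm b" "norm a"] a b
        by (auto simp: m_def)
    qed
    also have "\<dots> \<le> (1 + q) powr \<alpha> / \<alpha>" using q \<alpha> by (intro ln_powr_bound) auto
    also have "\<dots> \<le> (3 * q) powr \<alpha> / \<alpha>" using q \<alpha> by (intro divide_right_mono powr_mono2) auto
    also have "\<dots> \<le> 3 * q powr \<alpha> / \<alpha>"
    proof (intro divide_right_mono)
      have "3 powr \<alpha> \<le> 3 powr (1::real)" using \<alpha> by (intro powr_mono) auto
      then show "(3 * q) powr \<alpha> \<le> 3 * q powr \<alpha>"
        using q by (subst powr_mult) (auto intro!: mult_right_mono)
    qed (use \<alpha> in auto)
    finally have re: "\<bar>Re (Ln a - Ln b)\<bar> \<le> 3 / \<alpha> * q powr \<alpha>" using a b by simp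
    have "\<bar>Im (Ln a)\<bar> \<le> pi / 2" "\<bar>Im (Ln b)\<bar> \<le> pi / 2" using Re_Ln_pos_le a b by auto
    then have "\<bar>Im (Ln a - Ln b)\<bar> \<le> pi" unfolding minus_complex.sel by linarith
    also have "\<dots> \<le> pi * (2 * q powr \<alpha>)"
    proof -
      have "1 / 2 \<le> (1 / 2) powr \<alpha>" using powr_mono'[of \<alpha> 1 "1/2::real"] \<alpha> by simp
      also have "\<dots> \<le> q powr \<alpha>" using q \<alpha> by (intro powr_mono2) auto
      finally show ?thesis by simp
    qed
    finally have "\<bar>Im (Ln a - Ln b)\<bar> \<le> 2 * pi * q powr \<alpha>" by simp
    with re cmod_le[of "Ln a - Ln b"] show ?thesis by (simp add: q_def algebra_simps)
  qed
  also have "(d / m) powr \<alpha> = d powr \<alpha> * m powr (-\<alpha>)"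
    using m d0 by (simp add: powr_divide powr_minus field_simps)
  also have "m powr (-\<alpha>) \<le> norm a powr (-\<alpha>) + norm b powr (-\<alpha>)"
    by (auto simp: m_def min_def)
  finally show ?thesis using \<alpha> by (simp add: d_def mult_left_mono mult.assoc)
qed

lemma has_integral_abs_powr_symmetric:
  assumes "\<beta> < (1::real)" "r \<ge> 0"
  shows "((\<lambda>s. \<bar>s\<bar> powr (-\<beta>)) has_integral 2 * r powr (1 - \<beta>) / (1 - \<beta>)) {-r..r}"
proof -
  have 1: "((\<lambda>s. \<bar>s\<bar> powr (-\<beta>)) has_integral (r powr (1 - \<beta>) / (1 - \<beta>))) {0..r}"
    using has_integral_powr_from_0[of "-\<beta>" r] assms
    by (subst has_integral_cong[of _ _ "\<lambda>s. s powr (-\<beta>)"]) (auto simp: add.commute)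
  have "((\<lambda>s. \<bar>s\<bar> powr (-\<beta>)) has_integral (r powr (1 - \<beta>) / (1 - \<beta>))) {-r..-0}"
    using has_integral_reflect_lemma_real[OF 1] by simp
  then have "((\<lambda>s. \<bar>s\<bar> powr (-\<beta>)) has_integral
     (r powr (1 - \<beta>) / (1 - \<beta>) + r powr (1 - \<beta>) / (1 - \<beta>))) {-r..r}"
    using 1 assms by (intro has_integral_combine[where c = 0 and a = "-r" and b = r]) auto
  then show ?thesis by simp
qed

text \<open>For \<open>c\<close> in the closed interval, \<open>y - c\<close> stays in
  \<open>{-2..2}\<close>, so one integral centred at 0 bounds all of them;
  \<open>2 * 2 powr (1 - \<beta>)\<close> is rounded up to 4.\<close>

lemma powr_singularity_integral:
  fixes \<beta> c :: real
  assumes \<beta>: "\<beta> < 1" and c: "\<bar>c\<bar> \<le> 1" and \<beta>0: "0 \<le> \<beta>"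
  shows "set_integrable lborel {-1<..<1} (\<lambda>y. \<bar>y - c\<bar> powr (-\<beta>))"
    and "(LBINT y:{-1<..<1}. \<bar>y - c\<bar> powr (-\<beta>)) \<le> 4 / (1 - \<beta>)"
proof -
  define k where "k = (\<lambda>s::real. indicator {-2..2} s *\<^sub>R (\<bar>s\<bar> powr (-\<beta>)))"
  have hi: "((\<lambda>s. \<bar>s\<bar> powr (-\<beta>)) has_integral 2 * 2 powr (1 - \<beta>) / (1 - \<beta>)) {-2..2}"
    using has_integral_abs_powr_symmetric[of \<beta> 2] \<beta> by simp
  have "(\<lambda>s. \<bar>s\<bar> powr (-\<beta>)) absolutely_integrable_on {-2..2}"
    using hi by (intro nonnegative_absolutely_integrable_1) (auto simp: integrable_on_def)
  then have ii: "integrable lborel k"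
    unfolding k_def set_integrable_def by (subst (asm) integrable_completion) (auto)
  have "integral\<^sup>L lborel k = integral {-2..2} (\<lambda>s. \<bar>s\<bar> powr (-\<beta>))"
    using set_borel_integral_eq_integral(2)[of "{-2..2}" "\<lambda>s. \<bar>s\<bar> powr (-\<beta>)"] ii
    by (simp add: k_def set_integrable_def set_lebesgue_integral_def)
  also have "\<dots> = 2 * 2 powr (1 - \<beta>) / (1 - \<beta>)" using hi by (rule integral_unique)
  finally have ik: "integral\<^sup>L lborel k = 2 * 2 powr (1 - \<beta>) / (1 - \<beta>)" .
  have it: "integrable lborel (\<lambda>y. k (y - c))"
    using lborel_integrable_real_affine[OF ii, of 1 "-c"] by simp
  have ikt: "(\<integral>y. k (y - c) \<partial>lborel) = integral\<^sup>L lborel k"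
    using lborel_integral_real_affine[of 1 k "-c"] by simp
  have le: "indicator {-1<..<1} y *\<^sub>R (\<bar>y - c\<bar> powr (-\<beta>)) \<le> k (y - c)" for y
    using c by (auto simp: k_def indicator_def)
  show si: "set_integrable lborel {-1<..<1} (\<lambda>y. \<bar>y - c\<bar> powr (-\<beta>))"
    unfolding set_integrable_def
    by (rule Bochner_Integration.integrable_bound[OF it]) (use le in \<open>auto simp: k_def\<close>)
  have "(LBINT y:{-1<..<1}. \<bar>y - c\<bar> powr (-\<beta>)) \<le> (\<integral>y. k (y - c) \<partial>lborel)"
    unfolding set_lebesgue_integral_def
    using si it le by (intro integral_mono) (auto simp: set_integrable_def)
  also have "\<dots> \<le> 4 / (1 - \<beta>)"
  proof -
    have "2 powr (1 - \<beta>) \<le> 2 powr (1::real)" using \<beta>0 by (intro powr_mono) auto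
    then show ?thesis using \<beta> by (auto simp: ikt ik divide_simps)
  qed
  finally show "(LBINT y:{-1<..<1}. \<bar>y - c\<bar> powr (-\<beta>)) \<le> 4 / (1 - \<beta>)" .
qed

definition cpt :: "real \<Rightarrow> complex" where
  "cpt y = Complex (sqrt (1 - y\<^sup>2)) y"

lemma Re_cpt [simp]: "Re (cpt y) = sqrt (1 - y\<^sup>2)" and Im_cpt [simp]: "Im (cpt y) = y"
  by (auto simp: cpt_def)

lemma norm_cpt [simp]: "\<bar>y\<bar> \<le> 1 \<Longrightarrow> norm (cpt y) = 1"
  by (simp add: cpt_def cmod_def abs_square_le_1)

lemma continuous_on_cpt [continuous_intros]:
  "continuous_on S f \<Longrightarrow> continuous_on S (\<lambda>x. cpt (f x))"
  by (auto simp: cpt_def Complex_eq intro!: continuous_intros)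

lemma measurable_cpt [measurable]: "cpt \<in> borel \<rightarrow>\<^sub>M borel"
  by (intro borel_measurable_continuous_onI continuous_intros)

lemma measurable_cnj_cpt [measurable]: "(\<lambda>y. cnj (cpt y)) \<in> borel \<rightarrow>\<^sub>M borel"
  by (intro borel_measurable_continuous_onI continuous_intros)

text \<open>The square root is lost at the endpoints, where \<open>sqrt (1 - x\<^sup>2)\<close> has
  infinite slope: \<open>(s - t)\<^sup>2 \<le> \<bar>s - t\<bar> * (s + t) = \<bar>x\<^sup>2 -
  y\<^sup>2\<bar>\<close>. Lipschitz bounds on the disc become bounds of exponent 1/2 on the
  interval here.\<close>

lemma norm_cpt_diff_le: "\<bar>x\<bar> \<le> 1 \<Longrightarrow> \<bar>y\<bar> \<le> 1 \<Longrightarrow> norm (cpt x - cpt y) \<le> 2 * sqrt \<bar>x - y\<bar>"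
proof -
  assume x: "\<bar>x\<bar> \<le> 1" and y: "\<bar>y\<bar> \<le> 1"
  define s t where "s = sqrt (1 - x\<^sup>2)" and "t = sqrt (1 - y\<^sup>2)"
  have st: "s \<ge> 0" "t \<ge> 0" using x y by (auto simp: s_def t_def abs_square_le_1)
  have sq: "s\<^sup>2 = 1 - x\<^sup>2" "t\<^sup>2 = 1 - y\<^sup>2" using x y by (auto simp: s_def t_def abs_square_le_1)
  have "(s - t)\<^sup>2 = \<bar>s - t\<bar> * \<bar>s - t\<bar>" by (simp add: power2_eq_square)
  also have "\<dots> \<le> \<bar>s - t\<bar> * (s + t)" using st by (intro mult_left_mono) auto
  also have "\<dots> = \<bar>(s - t) * (s + t)\<bar>" using st by (simp add: abs_mult)
  also have "(s - t) * (s + t) = y\<^sup>2 - x\<^sup>2" using sq by (simp add: power2_eq_square algebra_simps)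
  also have "\<bar>y\<^sup>2 - x\<^sup>2\<bar> = \<bar>x - y\<bar> * \<bar>x + y\<bar>" by (simp add: power2_eq_square abs_mult[symmetric] algebra_simps)
  also have "\<dots> \<le> \<bar>x - y\<bar> * 2" using x y by (intro mult_left_mono) auto
  finally have 1: "(s - t)\<^sup>2 \<le> 2 * \<bar>x - y\<bar>" by simp
  have "(x - y)\<^sup>2 = \<bar>x - y\<bar> * \<bar>x - y\<bar>" by (simp add: power2_eq_square)
  also have "\<dots> \<le> 2 * \<bar>x - y\<bar>" using x y by (intro mult_right_mono) auto
  finally have "(s - t)\<^sup>2 + (x - y)\<^sup>2 \<le> 4 * \<bar>x - y\<bar>" using 1 by linarith
  then have "norm (cpt x - cpt y) \<le> sqrt (4 * \<bar>x - y\<bar>)"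
    by (simp add: cmod_def s_def t_def)
  then show ?thesis by (simp add: real_sqrt_mult)
qed

lemma norm_one_plus_mult_cpt: "\<bar>y\<bar> \<le> 1 \<Longrightarrow> norm (1 + w * cpt y) = norm (w + cnj (cpt y))"
proof -
  assume y: "\<bar>y\<bar> \<le> 1"
  have "cpt y * cnj (cpt y) = 1" using y complex_norm_square[of "cpt y"] by simp
  then have "1 + w * cpt y = cpt y * (w + cnj (cpt y))" by (simp add: algebra_simps)
  then show ?thesis using y by (simp add: norm_mult)
qed

lemma norm_one_minus_mult_cnj_cpt: "\<bar>y\<bar> \<le> 1 \<Longrightarrow> norm (1 - w * cnj (cpt y)) = norm (cpt y - w)"
proof -
  assume y: "\<bar>y\<bar> \<le> 1"
  have "cpt y * cnj (cpt y) = 1" using y complex_norm_square[of "cpt y"] by simp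
  then have "1 - w * cnj (cpt y) = cnj (cpt y) * (cpt y - w)" by (simp add: algebra_simps)
  then show ?thesis using y by (simp add: norm_mult)
qed

text \<open>Projecting to imaginary parts replaces the distance in the disc by the distance of
  \<open>y\<close> to \<open>Im w\<close>, so the kernel estimates reduce to power singularities on
  the interval.\<close>

lemma norm_one_plus_ge: "\<bar>y\<bar> \<le> 1 \<Longrightarrow> norm (1 + w * cpt y) \<ge> \<bar>y - Im w\<bar>"
  using abs_Im_le_cmod[of "w + cnj (cpt y)"] by (simp add: norm_one_plus_mult_cpt)

lemma norm_one_minus_ge: "\<bar>y\<bar> \<le> 1 \<Longrightarrow> norm (1 - w * cnj (cpt y)) \<ge> \<bar>y - Im w\<bar>"
  using abs_Im_le_cmod[of "cpt y - w"] by (simp add: norm_one_minus_mult_cnj_cpt)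

lemma Re_one_plus_ge: "\<bar>y\<bar> \<le> 1 \<Longrightarrow> norm w \<le> 1 \<Longrightarrow> Re (1 + w * cpt y) \<ge> 0"
  using complex_Re_le_cmod[of "- (w * cpt y)"] by (simp add: norm_mult)

lemma Re_one_minus_ge: "\<bar>y\<bar> \<le> 1 \<Longrightarrow> norm w \<le> 1 \<Longrightarrow> Re (1 - w * cnj (cpt y)) \<ge> 0"
  using complex_Re_le_cmod[of "w * cnj (cpt y)"] by (simp add: norm_mult)

text \<open>
  \<open>cpt\<close> maps the interval to the right half of the unit circle, and on this arc the real part of
  \<open>gker (cpt x) y / pi\<close> is the Green function. The second logarithm is the image charge that makes the
  real part vanish on the imaginary axis.
\<close>

definition gker :: "complex \<Rightarrow> real \<Rightarrow> complex" where
  "gker w y = Ln (1 + w * cpt y) - Ln (1 - w * cnj (cpt y))"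

definition gpot :: "(real \<Rightarrow> real) \<Rightarrow> complex \<Rightarrow> complex" where
  "gpot h w = (LBINT y:{-1<..<1}. complex_of_real (h y) * gker w y) / pi"

lemma measurable_gker [measurable]: "gker w \<in> borel \<rightarrow>\<^sub>M borel"
  unfolding gker_def by measurable

text \<open>For \<open>norm w \<le> 1\<close> the arguments of both logarithms lie in the closed
  right half-plane, and \<open>y \<noteq> Im w\<close> keeps them nonzero. The estimate thus holds
  up to the arc, where the kernel is singular.\<close>

lemma gker_diff_le:
  assumes \<alpha>: "0 < \<alpha>" "\<alpha> \<le> 1" and w: "norm w \<le> 1" "norm w' \<le> 1" and y: "\<bar>y\<bar> \<le> 1" "y \<noteq> Im w" "y \<noteq> Im w'"
  shows "norm (gker w y - gker w' y) \<le> 2 * (3 / \<alpha> + 2 * pi) * norm (w - w') powr \<alpha> *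
           (\<bar>y - Im w\<bar> powr (-\<alpha>) + \<bar>y - Im w'\<bar> powr (-\<alpha>))"
proof -
  define K where "K = 3 / \<alpha> + 2 * pi"
  have K: "K \<ge> 0" using \<alpha> by (simp add: K_def)
  have "norm (Ln (1 + w * cpt y) - Ln (1 + w' * cpt y)) \<le> K * norm (w - w') powr \<alpha> *
           (\<bar>y - Im w\<bar> powr (-\<alpha>) + \<bar>y - Im w'\<bar> powr (-\<alpha>))" (is "?A \<le> ?R")
  proof -
    have "?A \<le> K * norm ((1 + w * cpt y) - (1 + w' * cpt y)) powr \<alpha> *
       (norm (1 + w * cpt y) powr (-\<alpha>) + norm (1 + w' * cpt y) powr (-\<alpha>))"
      unfolding K_def
      using norm_one_plus_ge[OF y(1), of w] norm_one_plus_ge[OF y(1), of w'] y w \<alpha>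
      by (intro norm_Ln_diff_le_powr Re_one_plus_ge) auto
    also have "(1 + w * cpt y) - (1 + w' * cpt y) = (w - w') * cpt y" by (simp add: algebra_simps)
    also have "norm ((w - w') * cpt y) = norm (w - w')" using y by (simp add: norm_mult)
    also have "K * norm (w - w') powr \<alpha> * (norm (1 + w * cpt y) powr (-\<alpha>) + norm (1 + w' * cpt y) powr (-\<alpha>)) \<le> ?R"
      using norm_one_plus_ge[OF y(1), of w] norm_one_plus_ge[OF y(1), of w'] y \<alpha> K
      by (intro mult_left_mono add_mono powr_mono2') auto
    finally show ?thesis .
  qed
  moreover have "norm (Ln (1 - w * cnj (cpt y)) - Ln (1 - w' * cnj (cpt y))) \<le> K * norm (w - w') powr \<alpha> *
           (\<bar>y - Im w\<bar> powr (-\<alpha>) + \<bar>y - Im w'\<bar> powr (-\<alpha>))" (is "?A \<le> ?R")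
  proof -
    have "?A \<le> K * norm ((1 - w * cnj (cpt y)) - (1 - w' * cnj (cpt y))) powr \<alpha> *
       (norm (1 - w * cnj (cpt y)) powr (-\<alpha>) + norm (1 - w' * cnj (cpt y)) powr (-\<alpha>))"
      unfolding K_def
      using norm_one_minus_ge[OF y(1), of w] norm_one_minus_ge[OF y(1), of w'] y w \<alpha>
      by (intro norm_Ln_diff_le_powr Re_one_minus_ge) auto
    also have "(1 - w * cnj (cpt y)) - (1 - w' * cnj (cpt y)) = - ((w - w') * cnj (cpt y))" by (simp add: algebra_simps)
    also have "norm (- ((w - w') * cnj (cpt y))) = norm (w - w')" using y by (simp add: norm_mult)
    also have "K * norm (w - w') powr \<alpha> * (norm (1 - w * cnj (cpt y)) powr (-\<alpha>) + norm (1 - w' * cnj (cpt y)) powr (-\<alpha>)) \<le> ?R"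
      using norm_one_minus_ge[OF y(1), of w] norm_one_minus_ge[OF y(1), of w'] y \<alpha> K
      by (intro mult_left_mono add_mono powr_mono2') auto
    finally show ?thesis .
  qed
  moreover have "norm (gker w y - gker w' y) \<le> norm (Ln (1 + w * cpt y) - Ln (1 + w' * cpt y)) +
      norm (Ln (1 - w * cnj (cpt y)) - Ln (1 - w' * cnj (cpt y)))"
    unfolding gker_def by (rule order_trans[OF _ norm_triangle_ineq4]) (simp add: algebra_simps)
  ultimately show ?thesis unfolding K_def[symmetric] by linarith
qed

lemma gker_0 [simp]: "gker 0 y = 0"
  by (simp add: gker_def)

lemma AE_lborel_neq: "AE y in lborel. y \<noteq> (c::real)"
  by (rule AE_I[of _ _ "{c}"]) auto

lemma set_integrable_gker:
  assumes w: "norm w \<le> 1" and h: "h \<in> borel_measurable borel" and B: "\<And>y. y \<in> {-1<..<1} \<Longrightarrow> \<bar>h y\<bar> \<le> B"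
  shows "set_integrable lborel {-1<..<1} (\<lambda>y. complex_of_real (h y) * gker w y)"
proof -
  note [measurable] = h
  have "\<bar>Im w\<bar> \<le> 1" using w abs_Im_le_cmod order_trans by blast
  then have i: "set_integrable lborel {-1<..<1} (\<lambda>y. \<bar>y - Im w\<bar> powr (-(1/2)))"
    by (intro powr_singularity_integral) auto
  have i0: "set_integrable lborel {-1<..<1} (\<lambda>y::real. \<bar>y - 0\<bar> powr (-(1/2)))"
    by (intro powr_singularity_integral) auto
  have B0: "B \<ge> 0" using B[of 0] by auto
  \<comment> \<open>Since \<open>gker 0 y = 0\<close>, the difference estimate with
    \<open>w' = 0\<close> bounds the kernel itself. The exponent 1/2 is one choice among those in
    (0,1).\<close>
  have "set_integrable lborel {-1<..<1} (\<lambda>y. B * (2 * (3 / (1/2) + 2 * pi) * norm w powr (1/2) * (\<bar>y - Im w\<bar> powr (-(1/2)) + \<bar>y - 0\<bar> powr (-(1/2)))))"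
    by (intro set_integrable_mult_right set_integral_add i i0)
  then show ?thesis
  proof (rule set_integrable_bound)
    show "set_borel_measurable lborel {-1<..<1} (\<lambda>y. complex_of_real (h y) * gker w y)"
      unfolding set_borel_measurable_def by measurable
    show "AE y in lborel. y \<in> {-1<..<1} \<longrightarrow> norm (complex_of_real (h y) * gker w y) \<le>
       norm (B * (2 * (3 / (1/2) + 2 * pi) * norm w powr (1/2) * (\<bar>y - Im w\<bar> powr (-(1/2)) + \<bar>y - 0\<bar> powr (-(1/2)))))"
      using AE_lborel_neq[of "Im w"] AE_lborel_neq[of 0]
    proof eventually_elim
      case (elim y)
      show ?case
      proof
        assume y: "y \<in> {-1<..<1}"
        have "norm (gker w y - gker 0 y) \<le> 2 * (3 / (1/2) + 2 * pi) * norm (w - 0) powr (1/2) * (\<bar>y - Im w\<bar> powr (-(1/2)) + \<bar>y - Im 0\<bar> powr (-(1/2)))"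
          using y w elim by (intro gker_diff_le) auto
        then have "norm (complex_of_real (h y) * gker w y) \<le> B * (2 * (3 / (1/2) + 2 * pi) * norm w powr (1/2) * (\<bar>y - Im w\<bar> powr (-(1/2)) + \<bar>y - 0\<bar> powr (-(1/2))))"
          unfolding norm_mult using B[OF y] B0 by (intro mult_mono) auto
        then show "norm (complex_of_real (h y) * gker w y) \<le>
       norm (B * (2 * (3 / (1/2) + 2 * pi) * norm w powr (1/2) * (\<bar>y - Im w\<bar> powr (-(1/2)) + \<bar>y - 0\<bar> powr (-(1/2)))))"
          by simp
      qed
    qed
  qed
qed

text \<open>16 is 2 for the two logarithms times 8 for the two singular integrals, each at most
  \<open>4 / (1 - \<alpha>)\<close>; the division by \<open>pi\<close> in \<open>gpot\<close> is
  given away.\<close>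

definition gpot_const :: "real \<Rightarrow> real" where
  "gpot_const \<alpha> = 16 * (3 / \<alpha> + 2 * pi) / (1 - \<alpha>)"

lemma gpot_const_nonneg: "0 < \<alpha> \<Longrightarrow> \<alpha> < 1 \<Longrightarrow> gpot_const \<alpha> \<ge> 0"
  by (simp add: gpot_const_def)

text \<open>Only the sup norm of \<open>h\<close> enters, hence every exponent below 1. The endpoint
  \<open>\<alpha> = 1\<close> costs a Hoelder condition on \<open>h\<close> and is the matter of
  \<open>gpot_lipschitz\<close>.\<close>

lemma gpot_holder:
  assumes \<alpha>: "0 < \<alpha>" "\<alpha> < 1" and w: "norm w \<le> 1" "norm w' \<le> 1"
    and h: "h \<in> borel_measurable borel" and B: "\<And>y. y \<in> {-1<..<1} \<Longrightarrow> \<bar>h y\<bar> \<le> B"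
  shows "norm (gpot h w - gpot h w') \<le> gpot_const \<alpha> * B * norm (w - w') powr \<alpha>"
proof -
  note [measurable] = h
  have im: "\<bar>Im w\<bar> \<le> 1" "\<bar>Im w'\<bar> \<le> 1" using w abs_Im_le_cmod order_trans by blast+
  note i = powr_singularity_integral(1)[OF \<alpha>(2) im(1)] powr_singularity_integral(1)[OF \<alpha>(2) im(2)]
  note v = powr_singularity_integral(2)[OF \<alpha>(2) im(1)] powr_singularity_integral(2)[OF \<alpha>(2) im(2)]
  have B0: "B \<ge> 0" using B[of 0] by auto
  define K where "K = B * (2 * (3 / \<alpha> + 2 * pi) * norm (w - w') powr \<alpha>)"
  have K: "K \<ge> 0" using B0 \<alpha> by (simp add: K_def)
  note g = set_integrable_gker[OF w(1) h B] set_integrable_gker[OF w(2) h B]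
  have "pi * norm (gpot h w - gpot h w') = norm ((LBINT y:{-1<..<1}. complex_of_real (h y) * gker w y) - (LBINT y:{-1<..<1}. complex_of_real (h y) * gker w' y))"
    by (simp add: gpot_def diff_divide_distrib[symmetric] norm_divide)
  also have "\<dots> = norm (LBINT y:{-1<..<1}. complex_of_real (h y) * gker w y - complex_of_real (h y) * gker w' y)"
    using g by (subst set_integral_diff(2)) auto
  also have "\<dots> \<le> (LBINT y:{-1<..<1}. norm (complex_of_real (h y) * gker w y - complex_of_real (h y) * gker w' y))"
    using g by (intro set_integral_norm_bound set_integral_diff(1)) auto
  also have "\<dots> \<le> (LBINT y:{-1<..<1}. K * (\<bar>y - Im w\<bar> powr (-\<alpha>) + \<bar>y - Im w'\<bar> powr (-\<alpha>)))"
  proof (rule set_integral_mono_AE)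
    show "set_integrable lborel {-1<..<1} (\<lambda>y. norm (complex_of_real (h y) * gker w y - complex_of_real (h y) * gker w' y))"
      using g by (intro set_integrable_norm set_integral_diff(1)) auto
    show "set_integrable lborel {-1<..<1} (\<lambda>y. K * (\<bar>y - Im w\<bar> powr (-\<alpha>) + \<bar>y - Im w'\<bar> powr (-\<alpha>)))"
      using i \<alpha> by (intro set_integrable_mult_right set_integral_add) auto
    show "AE y\<in>{-1<..<1} in lborel. norm (complex_of_real (h y) * gker w y - complex_of_real (h y) * gker w' y) \<le> K * (\<bar>y - Im w\<bar> powr (-\<alpha>) + \<bar>y - Im w'\<bar> powr (-\<alpha>))"
      using AE_lborel_neq[of "Im w"] AE_lborel_neq[of "Im w'"]
    proof eventually_elim
      case (elim y)
      show ?case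
      proof
        assume y: "y \<in> {-1<..<1}"
        have "norm (complex_of_real (h y) * gker w y - complex_of_real (h y) * gker w' y) = \<bar>h y\<bar> * norm (gker w y - gker w' y)"
          by (simp only: right_diff_distrib[symmetric] norm_mult norm_of_real)
        also have "\<dots> \<le> B * (2 * (3 / \<alpha> + 2 * pi) * norm (w - w') powr \<alpha> * (\<bar>y - Im w\<bar> powr (-\<alpha>) + \<bar>y - Im w'\<bar> powr (-\<alpha>)))"
          using y elim w \<alpha> B[OF y] B0 by (intro mult_mono gker_diff_le) auto
        finally show "norm (complex_of_real (h y) * gker w y - complex_of_real (h y) * gker w' y) \<le> K * (\<bar>y - Im w\<bar> powr (-\<alpha>) + \<bar>y - Im w'\<bar> powr (-\<alpha>))"
          by (simp add: K_def mult_ac)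
      qed
    qed
  qed
  also have "\<dots> = K * ((LBINT y:{-1<..<1}. \<bar>y - Im w\<bar> powr (-\<alpha>)) + (LBINT y:{-1<..<1}. \<bar>y - Im w'\<bar> powr (-\<alpha>)))"
    using i \<alpha> by simp
  also have "\<dots> \<le> K * (4 / (1 - \<alpha>) + 4 / (1 - \<alpha>))"
    using v \<alpha> K by (intro mult_left_mono add_mono) auto
  also have "\<dots> = gpot_const \<alpha> * B * norm (w - w') powr \<alpha>"
    by (simp add: K_def gpot_const_def)
  finally have "pi * norm (gpot h w - gpot h w') \<le> gpot_const \<alpha> * B * norm (w - w') powr \<alpha>" .
  moreover have "1 * norm (gpot h w - gpot h w') \<le> pi * norm (gpot h w - gpot h w')"
    using pi_gt3 by (intro mult_right_mono) auto
  ultimately show ?thesis by linarith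
qed

lemma set_lebesgue_integral_eq_integral_Icc:
  fixes q :: "real \<Rightarrow> 'a :: euclidean_space"
  assumes "continuous_on {-1..1} q"
  shows "set_integrable lborel {-1<..<1} q"
    and "(LBINT y:{-1<..<1}. q y) = integral {-1..1} q"
proof -
  have "set_integrable lborel {-1..1} q"
    using assms by (rule borel_integrable_atLeastAtMost')
  then show i: "set_integrable lborel {-1<..<1} q"
    by (rule set_integrable_subset) auto
  show "(LBINT y:{-1<..<1}. q y) = integral {-1..1} q"
    using set_borel_integral_eq_integral(2)[OF i] by (simp add: integral_open_interval_real)
qed

lemma circle_mean_value:
  fixes F :: "complex \<Rightarrow> complex"
  assumes F: "F holomorphic_on ball 0 R" and r: "0 < r" "r < R"
  shows "((\<lambda>t. F (of_real r * cis t)) has_integral 2 * pi * F 0) {0..2 * pi}"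
proof -
  have "F holomorphic_on cball 0 r" using r by (intro holomorphic_on_subset[OF F]) auto
  then have "((\<lambda>u. F u / (u - 0)) has_contour_integral (2 * of_real pi * \<i> * F 0)) (circlepath 0 r)"
    using r by (intro Cauchy_integral_circlepath_simple) auto
  then have "((\<lambda>t. F (0 + of_real r * cis t) / (0 + of_real r * cis t - 0) * of_real r * \<i> * cis t) has_integral
      2 * of_real pi * \<i> * F 0) {0..2 * pi}"
    unfolding circlepath_def by (subst (asm) has_contour_integral_part_circlepath_iff) auto
  then have "((\<lambda>t. \<i> * F (of_real r * cis t)) has_integral 2 * of_real pi * \<i> * F 0) {0..2 * pi}"
    by (rule has_integral_eq[rotated]) (use r in \<open>auto simp: field_simps\<close>)
  from has_integral_mult_right[OF this, of "-\<i>"] show ?thesis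
    by (simp add: algebra_simps)
qed

text \<open>The left half of the circle is folded onto the right half by
  \<open>cis (pi - t) = - cis (- t)\<close>. Rotating by \<open>- pi / 2\<close> first makes the
  period start at the lower end of the right half.\<close>

lemma half_circle_mean_value:
  fixes F :: "complex \<Rightarrow> complex"
  assumes F: "F holomorphic_on ball 0 R" and r: "0 < r" "r < R"
  shows "((\<lambda>t. F (of_real r * cis t) + F (- (of_real r * cis (-t)))) has_integral 2 * pi * F 0) {-pi/2..pi/2}"
proof -
  define G where "G = (\<lambda>t. F (of_real r * cis (t - pi / 2)))"
  have "(\<lambda>w. F (-\<i> * w)) holomorphic_on ball 0 R"
    by (intro holomorphic_on_compose_gen[OF _ F, unfolded o_def] holomorphic_intros) (auto simp: norm_mult)
  from circle_mean_value[OF this r]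
  have "((\<lambda>t. F (-\<i> * (of_real r * cis t))) has_integral 2 * pi * F 0) {0..2 * pi}" by simp
  moreover have "-\<i> * (of_real r * cis t) = of_real r * cis (t - pi / 2)" for t
    by (simp add: complex_eq_iff cos_diff sin_diff)
  ultimately have G: "(G has_integral 2 * pi * F 0) {0..2 * pi}" by (simp add: G_def)
  then have "G integrable_on {0..2*pi}" by (auto simp: integrable_on_def)
  then have "G integrable_on {0..pi}" "G integrable_on {pi..2*pi}"
    by (auto elim!: integrable_on_subinterval)
  then obtain A B where A: "(G has_integral A) {0..pi}" and B: "(G has_integral B) {pi..2*pi}"
    by (auto simp: integrable_on_def)
  have "(G has_integral (A + B)) {0..2*pi}"
    by (rule has_integral_combine[OF _ _ A B]) auto
  then have AB: "A + B = 2 * pi * F 0" using G by (rule has_integral_unique)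
  have 1: "((\<lambda>t. G (t + pi / 2)) has_integral A) {-pi/2..pi/2}"
    using has_integral_affinity'[of G A 0 pi 1 "pi / 2"] A by simp
  have "((\<lambda>t. G (t + 3 * pi / 2)) has_integral B) {-pi/2..pi/2}"
    using has_integral_affinity'[of G B pi "2 * pi" 1 "3 * pi / 2"] B by simp
  then have "((\<lambda>t. G (- t + 3 * pi / 2)) has_integral B) {-(pi/2)..-(-pi/2)}"
    by (rule iffD2[OF has_integral_reflect_real])
  then have 2: "((\<lambda>t. G (3 * pi / 2 - t)) has_integral B) {-pi/2..pi/2}"
    by (simp only: minus_divide_left minus_minus uminus_add_conv_diff)
  have e: "of_real r * cis (pi - t) = - (of_real r * cis (-t))" for t
    by (simp add: complex_eq_iff cos_diff sin_diff)
  show ?thesis using has_integral_add[OF 1 2] by (simp add: AB G_def e)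
qed

definition dker :: "complex \<Rightarrow> real \<Rightarrow> complex" where
  "dker w y = cpt y / (1 + w * cpt y) + cnj (cpt y) / (1 - w * cnj (cpt y))"

definition gpot' :: "(real \<Rightarrow> real) \<Rightarrow> complex \<Rightarrow> complex" where
  "gpot' h w = (LBINT y:{-1<..<1}. complex_of_real (h y) * dker w y) / pi"

lemma one_pm_nonzero:
  assumes "norm w < 1" "\<bar>y\<bar> \<le> 1"
  shows "1 + w * cpt y \<noteq> 0" "1 - w * cnj (cpt y) \<noteq> 0"
    "Re (1 + w * cpt y) > 0" "Re (1 - w * cnj (cpt y)) > 0"
proof -
  have "norm (w * cpt y) < 1" "norm (w * cnj (cpt y)) < 1" using assms by (auto simp: norm_mult)
  then show *: "Re (1 + w * cpt y) > 0" "Re (1 - w * cnj (cpt y)) > 0"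
    using abs_Re_le_cmod[of "w * cpt y"] abs_Re_le_cmod[of "w * cnj (cpt y)"]
    by (auto simp del: times_complex.sel Re_cpt Im_cpt)
  show "1 + w * cpt y \<noteq> 0" "1 - w * cnj (cpt y) \<noteq> 0"
    using * by (metis less_irrefl zero_complex.sel(1))+
qed

lemma one_pm_not_nonpos:
  assumes "norm w < 1" "\<bar>y\<bar> \<le> 1"
  shows "1 + w * cpt y \<notin> \<real>\<^sub>\<le>\<^sub>0" "1 - w * cnj (cpt y) \<notin> \<real>\<^sub>\<le>\<^sub>0"
  using one_pm_nonzero(3,4)[OF assms]
  by (auto simp: complex_nonpos_Reals_iff simp del: times_complex.sel plus_complex.sel minus_complex.sel)

lemma continuous_on_dker:
  assumes "norm w < 1" "continuous_on UNIV h"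
  shows "continuous_on {-1..1} (\<lambda>y. complex_of_real (h y) * dker w y)"
  unfolding dker_def using one_pm_nonzero[OF assms(1)]
  by (intro continuous_intros continuous_on_subset[OF assms(2)]) auto

lemma continuous_on_gker:
  assumes "norm w < 1" "continuous_on UNIV h"
  shows "continuous_on {-1..1} (\<lambda>y. complex_of_real (h y) * gker w y)"
  unfolding gker_def using one_pm_not_nonpos[OF assms(1)]
  by (intro continuous_intros continuous_on_subset[OF assms(2)]) (auto simp del: times_complex.sel plus_complex.sel minus_complex.sel)

lemma has_field_derivative_gker:
  assumes "norm w < 1" "\<bar>y\<bar> \<le> 1"
  shows "((\<lambda>w. gker w y) has_field_derivative dker w y) (at w within S)"
proof -
  note nz = one_pm_nonzero[OF assms]
  show ?thesis using one_pm_not_nonpos[OF assms]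
    unfolding gker_def dker_def
    by (auto intro!: derivative_eq_intros simp: field_simps)
qed

lemma has_field_derivative_gpot:
  assumes w: "norm w < 1" and h: "continuous_on UNIV h"
  shows "(gpot h has_field_derivative gpot' h w) (at w)"
proof -
  define U where "U = ball (0::complex) 1"
  have U: "w' \<in> U \<longleftrightarrow> norm w' < 1" for w' by (simp add: U_def)
  have g: "gpot h w' = integral (cbox (-1) 1) (\<lambda>y. complex_of_real (h y) * gker w' y) / pi" if "w' \<in> U" for w'
    unfolding gpot_def using set_lebesgue_integral_eq_integral_Icc(2)[OF continuous_on_gker[OF _ h]] that by (simp add: U)
  have g': "gpot' h w = integral (cbox (-1) 1) (\<lambda>y. complex_of_real (h y) * dker w y) / pi"
    unfolding gpot'_def using set_lebesgue_integral_eq_integral_Icc(2)[OF continuous_on_dker[OF w h]] by simp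
  have cdk: "continuous_on (U \<times> cbox (-1) 1) (\<lambda>(x, t). complex_of_real (h t) * dker x t)"
    unfolding dker_def split_beta using one_pm_nonzero
    by (intro continuous_intros continuous_on_compose2[OF h] continuous_on_compose2[OF continuous_on_cpt[OF continuous_on_id, of UNIV]]) (auto simp: U)
  have "((\<lambda>x. integral (cbox (-1) 1) (\<lambda>y. complex_of_real (h y) * gker x y)) has_field_derivative
      integral (cbox (-1) 1) (\<lambda>y. complex_of_real (h y) * dker w y)) (at w within U)"
  proof (rule leibniz_rule_field_derivative[OF _ _ cdk])
    show "((\<lambda>x. complex_of_real (h t) * gker x t) has_field_derivative complex_of_real (h t) * dker x t) (at x within U)"
      if "x \<in> U" "t \<in> cbox (-1) 1" for x t
      using that by (intro DERIV_cmult has_field_derivative_gker) (auto simp: U)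
    show "(\<lambda>y. complex_of_real (h y) * gker x y) integrable_on cbox (-1) 1" if "x \<in> U" for x
      using continuous_on_gker[OF _ h, of x] that by (intro integrable_continuous) (auto simp: U)
  qed (use w in \<open>auto simp: U_def\<close>)
  then have "((\<lambda>x. integral (cbox (-1) 1) (\<lambda>y. complex_of_real (h y) * gker x y) / pi) has_field_derivative gpot' h w) (at w within U)"
    unfolding g' by (rule DERIV_cdivide)
  then have "((\<lambda>x. integral (cbox (-1) 1) (\<lambda>y. complex_of_real (h y) * gker x y) / pi) has_field_derivative gpot' h w) (at w)"
    using w at_within_open[of w U] by (simp only: U_def open_ball mem_ball_0)
  then show ?thesis
    by (rule has_field_derivative_transform_within_open[of _ _ _ U]) (use w g in \<open>auto simp: U_def\<close>)
qed

lemma gpot_holomorphic: "continuous_on UNIV h \<Longrightarrow> gpot h holomorphic_on ball 0 1"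
  unfolding holomorphic_on_open[OF open_ball] using has_field_derivative_gpot[of _ h] by (metis mem_ball_0)

lemma gpot'_eq_deriv: "continuous_on UNIV h \<Longrightarrow> norm w < 1 \<Longrightarrow> gpot' h w = deriv (gpot h) w"
  using DERIV_imp_deriv[OF has_field_derivative_gpot] by simp

lemma gpot'_holomorphic: "continuous_on UNIV h \<Longrightarrow> gpot' h holomorphic_on ball 0 1"
  using holomorphic_deriv[OF gpot_holomorphic, of h] gpot'_eq_deriv[of h]
  by (subst holomorphic_cong[OF refl, of _ _ "deriv (gpot h)"]) auto

lemma dker_reflect: "dker (- cnj w) y = cnj (dker w y)"
  by (simp add: dker_def)

lemma gpot'_reflect: "gpot' h (- cnj w) = cnj (gpot' h w)"
proof -
  have "gpot' h (- cnj w) = (LBINT y:{-1<..<1}. cnj (complex_of_real (h y) * dker w y)) / pi"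
    by (simp add: gpot'_def dker_reflect)
  also have "(LBINT y:{-1<..<1}. cnj (complex_of_real (h y) * dker w y)) = cnj (LBINT y:{-1<..<1}. complex_of_real (h y) * dker w y)"
    unfolding set_lebesgue_integral_def complex_cnj_scaleR[symmetric] by (rule Bochner_Integration.integral_cnj)
  finally show ?thesis by (simp add: gpot'_def)
qed

lemma cpt_sin: "\<bar>t\<bar> \<le> pi / 2 \<Longrightarrow> cpt (sin t) = cis t"
  using cos_ge_zero[of t] by (simp add: complex_eq_iff cos_squared_eq[symmetric] abs_le_iff)

text \<open>Equivalently, the potential of the density 1 is \<open>w\<close>, whose real part on the
  arc is \<open>sqrt (1 - x\<^sup>2)\<close>. With \<open>y = sin t\<close> the integrand,
  conjugated, is the folded form of a function \<open>F\<close> holomorphic near the closed disc, so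
  the integral is \<open>2 * pi * F 0 = pi\<close>.\<close>

lemma gpot'_one:
  assumes w: "norm w < 1"
  shows "gpot' (\<lambda>_. 1) w = 1"
proof -
  define q where "q = dker w"
  have q: "continuous_on {-1..1} q"
    using continuous_on_dker[OF w, of "\<lambda>_. 1"] by (simp add: q_def)
  define F where "F = (\<lambda>\<xi>. (1 + \<xi>\<^sup>2) / (2 * (1 - cnj w * \<xi>)))"
  \<comment> \<open>A radius strictly between 1 and the modulus \<open>1 / norm w\<close> of the
    pole of \<open>F\<close>.\<close>
  define R where "R = 2 / (1 + norm w)"
  have R: "R > 1" using w by (auto simp: R_def field_simps add_pos_nonneg)
  have nz: "1 - cnj w * \<xi> \<noteq> 0" if "\<xi> \<in> ball 0 R" for \<xi>
  proof
    assume "1 - cnj w * \<xi> = 0"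
    then have "norm (cnj w * \<xi>) = 1" by (metis eq_iff_diff_eq_0 norm_one)
    then have "norm w * norm \<xi> = 1" by (simp add: norm_mult)
    moreover have "norm w * norm \<xi> \<le> norm w * R" using that by (intro mult_left_mono) auto
    moreover have "norm w * R < 1" using w by (simp add: R_def field_simps add_pos_nonneg)
    ultimately show False by simp
  qed
  have "F holomorphic_on ball 0 R" unfolding F_def
    using nz by (intro holomorphic_intros) auto
  from half_circle_mean_value[OF this, of 1] R
  have mv: "((\<lambda>t. F (cis t) + F (- cis (-t))) has_integral pi) {-pi/2..pi/2}"
    by (simp add: F_def)
  have "((\<lambda>t. cos t *\<^sub>R q (sin t)) has_integral integral {sin (-pi/2)..sin (pi/2)} q) {-pi/2..pi/2}"
  proof (rule has_integral_substitution[where c = "-1" and d = 1])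
    show "continuous_on {-1..1} q" by (rule q)
    show "(sin has_real_derivative cos x) (at x within {-pi/2..pi/2})" for x by (auto intro!: derivative_eq_intros)
  qed (auto simp: sin_minus)
  then have 1: "((\<lambda>t. cos t *\<^sub>R q (sin t)) has_integral integral {-1..1} q) {-pi/2..pi/2}"
    by (simp add: sin_minus)
  have "F (cis t) + F (- cis (-t)) = cnj (cos t *\<^sub>R q (sin t))" if "t \<in> {-pi/2..pi/2}" for t
  proof -
    have c: "cpt (sin t) = cis t" using that by (intro cpt_sin) auto
    have n1: "1 - cnj w * cis t \<noteq> 0" using nz[of "cis t"] R by simp
    have n2: "1 + cnj w * cis (-t) \<noteq> 0" using nz[of "- cis (-t)"] R by simp
    have p: "(cis s)\<^sup>2 + 1 = 2 * of_real (cos s) * cis s" for s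
      by (simp add: complex_eq_iff power2_eq_square sin_squared_eq algebra_simps)
    have "F (cis t) = of_real (cos t) * cis t / (1 - cnj w * cis t)"
      unfolding F_def using p[of t] mult_divide_mult_cancel_left[of 2 "of_real (cos t) * cis t" "1 - cnj w * cis t"]
      by (simp only: add.commute[of 1] mult.assoc) simp
    moreover have "F (- cis (-t)) = of_real (cos t) * cis (-t) / (1 + cnj w * cis (-t))"
      unfolding F_def using p[of "-t"] mult_divide_mult_cancel_left[of 2 "of_real (cos t) * cis (-t)" "1 + cnj w * cis (-t)"]
      by (simp only: add.commute[of 1] mult.assoc power2_minus mult_minus_right diff_minus_eq_add cos_minus) simp
    ultimately show ?thesis by (simp add: q_def dker_def c cis_cnj scaleR_conv_of_real algebra_simps)
  qed
  then have "((\<lambda>t. cnj (cos t *\<^sub>R q (sin t))) has_integral pi) {-pi/2..pi/2}"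
    by (rule has_integral_eq[OF _ mv])
  moreover have "((\<lambda>t. cnj (cos t *\<^sub>R q (sin t))) has_integral cnj (integral {-1..1} q)) {-pi/2..pi/2}"
    using has_integral_cnj[THEN iffD2, OF 1] by (simp only: o_def)
  ultimately have "cnj (integral {-1..1} q) = pi" by (rule has_integral_unique[rotated])
  then have "integral {-1..1} q = pi" by (metis complex_cnj_cnj complex_cnj_complex_of_real)
  moreover have "gpot' (\<lambda>_. 1) w = integral {-1..1} q / pi"
    using set_lebesgue_integral_eq_integral_Icc(2)[OF q] by (simp add: gpot'_def q_def)
  ultimately show ?thesis by simp
qed

text \<open>The hypothesis on \<open>C\<close> says that \<open>w\<close> lies in a Stolz angle at
  \<open>cpt x\<close>. There the distance from \<open>w\<close> to any other boundary point is
  comparable to the distance of that point from \<open>cpt x\<close>.\<close>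

lemma cpt_dist_le:
  assumes y: "\<bar>y\<bar> \<le> 1" and w: "norm w < 1" and C: "norm (w - cpt x) \<le> C * (1 - norm w)" "C \<ge> 0"
  shows "norm (cpt y - cpt x) \<le> (1 + C) * norm (cpt y - w)"
proof -
  have "1 - norm w \<le> norm (cpt y - w)" using norm_triangle_ineq2[of "cpt y" w] y by simp
  then have "C * (1 - norm w) \<le> C * norm (cpt y - w)" using C by (intro mult_left_mono) auto
  then have "norm (w - cpt x) \<le> C * norm (cpt y - w)" using C by linarith
  moreover have "norm (cpt y - cpt x) \<le> norm (cpt y - w) + norm (w - cpt x)"
    using norm_triangle_ineq[of "cpt y - w" "w - cpt x"] by simp
  ultimately show ?thesis by (simp add: algebra_simps)
qed

text \<open>\<open>- cnj (cpt y)\<close> is the mirror image of \<open>cpt y\<close> in the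
  imaginary axis, hence the farther of the two from a point on the right. The image charge never
  dominates.\<close>

lemma norm_plus_cnj_ge:
  assumes "\<bar>y\<bar> \<le> 1" "Re w \<ge> 0"
  shows "norm (cpt y - w) \<le> norm (w + cnj (cpt y))"
proof -
  have "0 \<le> Re w * sqrt (1 - y\<^sup>2)" using assms by (simp add: abs_square_le_1)
  then show ?thesis unfolding cmod_def
    by (intro real_sqrt_le_mono) (simp add: power2_eq_square algebra_simps)
qed

lemma norm_dker_le:
  assumes y: "\<bar>y\<bar> \<le> 1" and w: "norm w < 1" "Re w \<ge> 0"
  shows "norm (dker w y) \<le> 2 / norm (cpt y - w)"
proof -
  have p: "norm (cpt y - w) > 0" using y w by (auto simp: norm_cpt)
  have "norm (dker w y) \<le> norm (cpt y / (1 + w * cpt y)) + norm (cnj (cpt y) / (1 - w * cnj (cpt y)))"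
    unfolding dker_def by (rule norm_triangle_ineq)
  also have "\<dots> = 1 / norm (w + cnj (cpt y)) + 1 / norm (cpt y - w)"
    using y by (simp add: norm_divide norm_one_plus_mult_cpt norm_one_minus_mult_cnj_cpt)
  also have "1 / norm (w + cnj (cpt y)) \<le> 1 / norm (cpt y - w)"
    using norm_plus_cnj_ge[OF y w(2)] p less_le_trans[OF p norm_plus_cnj_ge[OF y w(2)]]
    by (intro divide_left_mono mult_pos_pos) auto
  finally show ?thesis by simp
qed

text \<open>The kernel is of order \<open>1 / D\<close> in the chord length \<open>D\<close>,
  uniformly in the Stolz angle. The Hoelder condition on \<open>h\<close>, also measured in chords,
  gains \<open>sqrt D\<close>, and what is left is integrable in \<open>y\<close> independently of
  \<open>w\<close>.\<close>

lemma dker_dominated: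
  assumes y: "\<bar>y\<bar> \<le> 1" and x: "\<bar>x\<bar> \<le> 1" and w: "norm w < 1" "Re w \<ge> 0"
    and C: "norm (w - cpt x) \<le> C * (1 - norm w)" "C \<ge> 0"
    and h: "\<bar>h y - h x\<bar> \<le> B * sqrt (norm (cpt y - cpt x))" "B \<ge> 0"
  shows "norm (complex_of_real (h y - h x) * dker w y) \<le> 2 * (1 + C) * B * \<bar>y - x\<bar> powr (-(1/2))"
proof (cases "y = x")
  case False
  define D where "D = norm (cpt y - cpt x)"
  have Dy: "\<bar>y - x\<bar> \<le> D" using abs_Im_le_cmod[of "cpt y - cpt x"] by (simp add: D_def)
  then have D0: "D > 0" using False by auto
  have "D \<le> (1 + C) * norm (cpt y - w)" unfolding D_def using y w C by (intro cpt_dist_le) auto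
  moreover have p: "norm (cpt y - w) > 0" using y w by auto
  ultimately have "1 / norm (cpt y - w) \<le> (1 + C) / D" using D0 by (simp add: field_simps)
  then have "norm (dker w y) \<le> 2 * ((1 + C) / D)" using norm_dker_le[OF y w] by linarith
  then have "norm (complex_of_real (h y - h x) * dker w y) \<le> (B * sqrt D) * (2 * ((1 + C) / D))"
    unfolding norm_mult norm_of_real using h D0 by (intro mult_mono) (auto simp: D_def)
  also have "\<dots> = 2 * (1 + C) * B * (sqrt D / D)" by simp
  also have "sqrt D / D = D powr (-(1/2))"
    using D0 by (simp add: powr_minus powr_half_sqrt field_simps)
  also have "2 * (1 + C) * B * D powr (-(1/2)) \<le> 2 * (1 + C) * B * \<bar>y - x\<bar> powr (-(1/2))"
    using Dy False C h by (intro mult_left_mono powr_mono2') auto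
  finally show ?thesis .
qed (use C h in auto)

text \<open>Subtracting the constant density \<open>h x\<close>, whose contribution is known from
  \<open>gpot'_one\<close>, leaves an integrand that stays integrable as \<open>w\<close> approaches
  \<open>cpt x\<close>.\<close>

lemma gpot'_eq:
  assumes w: "norm w < 1" and h: "continuous_on UNIV h"
  shows "gpot' h w = h x + (LBINT y:{-1<..<1}. complex_of_real (h y - h x) * dker w y) / pi"
proof -
  have i: "set_integrable lborel {-1<..<1} (\<lambda>y. complex_of_real (h y) * dker w y)"
    by (intro set_lebesgue_integral_eq_integral_Icc continuous_on_dker w h)
  have i1: "set_integrable lborel {-1<..<1} (\<lambda>y. complex_of_real 1 * dker w y)"
    by (intro set_lebesgue_integral_eq_integral_Icc continuous_on_dker w) auto
  then have i2: "set_integrable lborel {-1<..<1} (\<lambda>y. complex_of_real (h x) * (complex_of_real 1 * dker w y))"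
    by (rule set_integrable_mult_right)
  have "(LBINT y:{-1<..<1}. complex_of_real (h y - h x) * dker w y) =
        (LBINT y:{-1<..<1}. complex_of_real (h y) * dker w y - complex_of_real (h x) * (complex_of_real 1 * dker w y))"
    by (simp add: algebra_simps)
  also have "\<dots> = (LBINT y:{-1<..<1}. complex_of_real (h y) * dker w y) - complex_of_real (h x) * (LBINT y:{-1<..<1}. complex_of_real 1 * dker w y)"
    using i i2 by (subst set_integral_diff(2)) auto
  also have "\<dots> / pi = gpot' h w - h x * gpot' (\<lambda>_. 1) w"
    by (simp add: gpot'_def diff_divide_distrib)
  finally show ?thesis using gpot'_one[OF w] by simp
qed

lemma gpot'_bound:
  assumes x: "\<bar>x\<bar> \<le> 1" and w: "norm w < 1" "Re w \<ge> 0"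
    and C: "norm (w - cpt x) \<le> C * (1 - norm w)" "C \<ge> 0"
    and hc: "continuous_on UNIV h"
    and h: "\<And>y. \<bar>y\<bar> \<le> 1 \<Longrightarrow> \<bar>h y - h x\<bar> \<le> B * sqrt (norm (cpt y - cpt x))" "B \<ge> 0"
  shows "norm (gpot' h w) \<le> \<bar>h x\<bar> + 16 * (1 + C) * B"
proof -
  note sing = powr_singularity_integral[of "1/2" x]
  have i: "set_integrable lborel {-1<..<1} (\<lambda>y. complex_of_real (h y - h x) * dker w y)"
    by (intro set_lebesgue_integral_eq_integral_Icc continuous_on_dker w continuous_intros hc)
  have "norm (LBINT y:{-1<..<1}. complex_of_real (h y - h x) * dker w y) \<le> (LBINT y:{-1<..<1}. norm (complex_of_real (h y - h x) * dker w y))"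
    using i by (rule set_integral_norm_bound)
  also have "\<dots> \<le> (LBINT y:{-1<..<1}. 2 * (1 + C) * B * \<bar>y - x\<bar> powr (-(1/2)))"
    using i sing x
    by (intro set_integral_mono set_integrable_norm set_integrable_mult_right dker_dominated w C h) auto
  also have "\<dots> = 2 * (1 + C) * B * (LBINT y:{-1<..<1}. \<bar>y - x\<bar> powr (-(1/2)))" by simp
  also have "\<dots> \<le> 2 * (1 + C) * B * (4 / (1 - 1/2))"
    using sing x C h by (intro mult_left_mono) auto
  finally have *: "norm (LBINT y:{-1<..<1}. complex_of_real (h y - h x) * dker w y) \<le> 16 * (1 + C) * B" by (simp only: mult_ac) simp
  have "norm ((LBINT y:{-1<..<1}. complex_of_real (h y - h x) * dker w y) / pi) \<le> 16 * (1 + C) * B"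
  proof -
    have "norm ((LBINT y:{-1<..<1}. complex_of_real (h y - h x) * dker w y) / pi) \<le> norm (LBINT y:{-1<..<1}. complex_of_real (h y - h x) * dker w y) / 1"
      unfolding norm_divide using pi_gt3 by (intro divide_left_mono) auto
    then show ?thesis using * by simp
  qed
  then show ?thesis unfolding gpot'_eq[OF w(1) hc, of x]
    by (intro order_trans[OF norm_triangle_ineq] add_mono) auto
qed

lemma radial_point:
  assumes w: "norm w \<le> 1" "Re w \<ge> 0"
  obtains x where "\<bar>x\<bar> \<le> 1" "norm (w - cpt x) \<le> 1 * (1 - norm w)"
proof (cases "w = 0")
  case True
  show ?thesis by (rule that[of 0]) (auto simp: True cpt_def cmod_def)
next
  case False
  define x where "x = Im w / norm w"
  have x: "\<bar>x\<bar> \<le> 1" using abs_Im_le_cmod[of w] False by (simp add: x_def field_simps)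
  have "sqrt (1 - x\<^sup>2) = Re w / norm w"
  proof (rule real_sqrt_unique)
    have "(Re w)\<^sup>2 + (Im w)\<^sup>2 = (norm w)\<^sup>2" by (simp add: cmod_def)
    then show "(Re w / norm w)\<^sup>2 = 1 - x\<^sup>2" using False by (simp add: x_def field_simps)
  qed (use w in auto)
  then have "cpt x = w / norm w" by (simp add: complex_eq_iff x_def Re_divide_of_real Im_divide_of_real)
  then have "w - cpt x = of_real (norm w - 1) * (w / norm w)" using False by (simp add: field_simps)
  then have "norm (w - cpt x) = \<bar>norm w - 1\<bar> * norm (w / norm w)" by (simp only: norm_mult norm_of_real)
  then have "norm (w - cpt x) = 1 - norm w" using False w by (simp add: norm_divide)
  then show ?thesis using x by (intro that[of x]) auto
qed

text \<open>Each point of the right half disc lies on the radius to some \<open>cpt x\<close>, which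
  is approach with \<open>C = 1\<close>; this gives \<open>16 * (1 + 1) = 32\<close>. The left half
  follows by \<open>gpot'_reflect\<close>, and the closed disc by shrinking towards 0.\<close>

lemma gpot_lipschitz:
  assumes hc: "continuous_on UNIV h"
    and h: "\<And>x y. \<bar>x\<bar> \<le> 1 \<Longrightarrow> \<bar>y\<bar> \<le> 1 \<Longrightarrow> \<bar>h y - h x\<bar> \<le> B * sqrt (norm (cpt y - cpt x))" "B \<ge> 0"
    and A: "\<And>x. \<bar>x\<bar> \<le> 1 \<Longrightarrow> \<bar>h x\<bar> \<le> A"
  shows "\<And>w. norm w < 1 \<Longrightarrow> norm (gpot' h w) \<le> A + 32 * B"
    and "\<And>w w'. norm w \<le> 1 \<Longrightarrow> norm w' \<le> 1 \<Longrightarrow> norm (gpot h w - gpot h w') \<le> (A + 32 * B) * norm (w - w')"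
proof -
  show d: "norm (gpot' h w) \<le> A + 32 * B" if w: "norm w < 1" for w
  proof -
    have *: "norm (gpot' h w) \<le> A + 32 * B" if w: "norm w < 1" "Re w \<ge> 0" for w
    proof -
      obtain x where x: "\<bar>x\<bar> \<le> 1" "norm (w - cpt x) \<le> 1 * (1 - norm w)" using radial_point[of w] w by auto
      have "norm (gpot' h w) \<le> \<bar>h x\<bar> + 16 * (1 + 1) * B"
        using x by (intro gpot'_bound w hc h) auto
      then show ?thesis using A[OF x(1)] by simp
    qed
    show ?thesis
    proof (cases "Re w \<ge> 0")
      case False
      then have "norm (gpot' h (- cnj w)) \<le> A + 32 * B" using w by (intro *) auto
      then show ?thesis by (simp add: gpot'_reflect)
    qed (use * w in auto)
  qed
  have lip: "norm (gpot h w - gpot h w') \<le> (A + 32 * B) * norm (w - w')" if "norm w < 1" "norm w' < 1" for w w'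
  proof (rule field_differentiable_bound[of "ball 0 1"])
    show "(gpot h has_field_derivative gpot' h z) (at z within ball 0 1)" if "z \<in> ball 0 1" for z
      using has_field_derivative_gpot[OF _ hc, of z] that by (auto intro: has_field_derivative_at_within)
  qed (use that d in auto)
  show "norm (gpot h w - gpot h w') \<le> (A + 32 * B) * norm (w - w')" if w: "norm w \<le> 1" "norm w' \<le> 1" for w w'
  proof -
    have cont: "continuous_on (cball 0 1) (gpot h)"
    proof -
      have hm: "h \<in> borel_measurable borel" using hc by (rule borel_measurable_continuous_onI)
      have "norm (gpot h x - gpot h y) \<le> gpot_const (1/2) * A * norm (x - y) powr (1/2)" if "x \<in> cball 0 1" "y \<in> cball 0 1" for x y
        using that by (intro gpot_holder hm A) auto
      show ?thesis unfolding continuous_on_def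
      proof
        fix y :: complex assume y: "y \<in> cball 0 1"
        have "((\<lambda>x. gpot_const (1/2) * A * norm (x - y) powr (1/2)) \<longlongrightarrow> gpot_const (1/2) * A * norm (y - y) powr (1/2)) (at y within cball 0 1)"
          by (intro tendsto_intros) auto
        then have "((\<lambda>x. gpot_const (1/2) * A * norm (x - y) powr (1/2)) \<longlongrightarrow> 0) (at y within cball 0 1)" by simp
        then have "((\<lambda>x. gpot h x - gpot h y) \<longlongrightarrow> 0) (at y within cball 0 1)"
          by (rule Lim_null_comparison[rotated])
             (use y \<open>\<And>x y. x \<in> cball 0 1 \<Longrightarrow> y \<in> cball 0 1 \<Longrightarrow> _\<close> in \<open>auto simp: eventually_at_filter\<close>)
        then show "(gpot h \<longlongrightarrow> gpot h y) (at y within cball 0 1)" by (simp add: LIM_zero_iff)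
      qed
    qed
    define s where "s n = 1 - 1 / real (n + 2)" for n
    have s: "s \<longlonglongrightarrow> 1" unfolding s_def by real_asymp
    have s01: "0 \<le> s n" "s n < 1" for n by (auto simp: s_def field_simps)
    have lim: "(\<lambda>n. gpot h (of_real (s n) * w)) \<longlonglongrightarrow> gpot h w" if "norm w \<le> 1" for w
    proof -
      have "(\<lambda>n. of_real (s n) * w) \<longlonglongrightarrow> of_real 1 * w" by (intro tendsto_intros s)
      moreover have "norm (of_real (s n) * w) \<le> 1" for n
        using s01[of n] that by (simp add: norm_mult mult_le_one)
      ultimately show ?thesis using that
        by (intro continuous_on_tendsto_compose[OF cont]) auto
    qed
    have less: "norm (of_real (s n) * w) < 1" if "norm w \<le> 1" for n and w :: complex
      using s01[of n] that mult_left_mono[of "norm w" 1 "s n"] by (simp add: norm_mult)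
    show ?thesis
    proof (rule LIMSEQ_le)
      show "(\<lambda>n. norm (gpot h (of_real (s n) * w) - gpot h (of_real (s n) * w'))) \<longlonglongrightarrow> norm (gpot h w - gpot h w')"
        by (intro tendsto_intros lim w)
      show "(\<lambda>n. (A + 32 * B) * norm (of_real (s n) * w - of_real (s n) * w')) \<longlonglongrightarrow> (A + 32 * B) * norm (w - w')"
      proof -
        have "(\<lambda>n. (A + 32 * B) * norm (of_real (s n) * w - of_real (s n) * w')) \<longlonglongrightarrow> (A + 32 * B) * norm (of_real 1 * w - of_real 1 * w')"
          by (intro tendsto_intros s)
        then show ?thesis by simp
      qed
      show "\<exists>N. \<forall>n\<ge>N. norm (gpot h (of_real (s n) * w) - gpot h (of_real (s n) * w')) \<le> (A + 32 * B) * norm (of_real (s n) * w - of_real (s n) * w')"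
        using lip less w by blast
    qed
  qed
qed

text \<open>\<open>\<zeta> / (1 - \<zeta>)\<close> maps the unit circle to the line of real part
  \<open>-1/2\<close>, and the two terms of the kernel enter with opposite signs. So the radial
  derivative of the Green function vanishes on the arc off its pole.\<close>

lemma Re_mult_dker_boundary:
  assumes "\<bar>x\<bar> \<le> 1" "\<bar>y\<bar> \<le> 1" "x \<noteq> y"
  shows "Re (cpt x * dker (cpt x) y) = 0"
proof -
  have *: "Re (\<zeta> / (1 - \<zeta>)) = -1/2" if "norm \<zeta> = 1" "\<zeta> \<noteq> 1" for \<zeta> :: complex
  proof -
    have "(Re \<zeta>)\<^sup>2 + (Im \<zeta>)\<^sup>2 = 1" using that by (simp add: cmod_def)
    moreover have "(1 - Re \<zeta>)\<^sup>2 + (Im \<zeta>)\<^sup>2 \<noteq> 0"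
      using that by (auto simp: sum_power2_eq_zero_iff complex_eq_iff)
    ultimately show ?thesis by (simp add: Re_divide power2_eq_square field_simps)
  qed
  have 1: "1 + cpt x * cpt y \<noteq> 0" "1 - cpt x * cnj (cpt y) \<noteq> 0"
    using norm_one_plus_ge[OF assms(2), of "cpt x"] norm_one_minus_ge[OF assms(2), of "cpt x"] assms by auto
  have "cpt x * dker (cpt x) y = - ((- (cpt x * cpt y)) / (1 - (- (cpt x * cpt y)))) + (cpt x * cnj (cpt y)) / (1 - cpt x * cnj (cpt y))"
    by (simp add: dker_def algebra_simps)
  moreover have "- (cpt x * cpt y) \<noteq> 1" using 1(1) by (metis add.left_inverse)
  moreover from this have "Re ((- (cpt x * cpt y)) / (1 - (- (cpt x * cpt y)))) = -1/2"
    using 1 assms by (intro *) (auto simp: norm_mult simp del: norm_minus_cancel intro!: norm_minus_cancel[THEN trans])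
  moreover have "Re ((cpt x * cnj (cpt y)) / (1 - cpt x * cnj (cpt y))) = -1/2"
    using 1 assms by (intro *) (auto simp: norm_mult)
  ultimately show ?thesis by simp
qed

text \<open>\<open>Re (w * gpot' h w)\<close> is the radial derivative of
  \<open>Re (gpot h)\<close>. By \<open>gpot'_eq\<close> it is \<open>h x * Re w\<close> plus an
  integral that tends to 0 by dominated convergence, because the kernel vanishes on the arc in the
  limit. The factor \<open>sqrt (1 - x\<^sup>2) = Re (cpt x)\<close> is the conformal factor of the
  map to the interval.\<close>

lemma nontangential_limit:
  assumes x: "\<bar>x\<bar> \<le> 1" and w: "\<And>n. norm (w n) < 1" "\<And>n. Re (w n) \<ge> 0" "w \<longlonglongrightarrow> cpt x"
    and C: "\<And>n. norm (w n - cpt x) \<le> C * (1 - norm (w n))" "C \<ge> 0"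
    and hc: "continuous_on UNIV h"
    and h: "\<And>y. \<bar>y\<bar> \<le> 1 \<Longrightarrow> \<bar>h y - h x\<bar> \<le> B * sqrt (norm (cpt y - cpt x))" "B \<ge> 0"
  shows "(\<lambda>n. Re (w n * gpot' h (w n))) \<longlonglongrightarrow> h x * sqrt (1 - x\<^sup>2)"
proof -
  note [measurable] = borel_measurable_continuous_onI[OF hc]
  have i: "set_integrable lborel {-1<..<1} (\<lambda>y. complex_of_real (h y - h x) * dker (w n) y)" for n
    by (intro set_lebesgue_integral_eq_integral_Icc continuous_on_dker w continuous_intros hc)
  define J where "J = (\<lambda>n. LBINT y:{-1<..<1}. (h y - h x) * Re (w n * dker (w n) y))"
  have eq: "Re (w n * gpot' h (w n)) = h x * Re (w n) + J n / pi" for n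
  proof -
    have "w n * gpot' h (w n) = h x * w n + (LBINT y:{-1<..<1}. w n * (complex_of_real (h y - h x) * dker (w n) y)) / pi"
      unfolding gpot'_eq[OF w(1) hc, of n x] set_integral_mult_right
      by (simp only: distrib_left times_divide_eq_right mult.commute[of "w n" "complex_of_real (h x)"])
    moreover have "Re (LBINT y:{-1<..<1}. w n * (complex_of_real (h y - h x) * dker (w n) y)) = J n"
    proof -
      have "set_integrable lborel {-1<..<1} (\<lambda>y. w n * (complex_of_real (h y - h x) * dker (w n) y))"
        using i by (rule set_integrable_mult_right)
      then have "Re (LBINT y:{-1<..<1}. w n * (complex_of_real (h y - h x) * dker (w n) y)) =
        (\<integral>y. Re (indicator {-1<..<1} y *\<^sub>R (w n * (complex_of_real (h y - h x) * dker (w n) y))) \<partial>lborel)"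
        unfolding set_lebesgue_integral_def set_integrable_def by (rule integral_Re[symmetric])
      also have "\<dots> = J n" unfolding J_def set_lebesgue_integral_def
        by (intro Bochner_Integration.integral_cong) (auto simp: algebra_simps)
      finally show ?thesis .
    qed
    ultimately show ?thesis by (simp add: Re_divide_of_real)
  qed
  have "J \<longlonglongrightarrow> (LBINT y:{-1<..<1}. (h y - h x) * 0)"
    unfolding J_def set_lebesgue_integral_def
  proof (rule integral_dominated_convergence)
    show "integrable lborel (\<lambda>y. indicator {-1<..<1} y *\<^sub>R (2 * (1 + C) * B * \<bar>y - x\<bar> powr (-(1/2))))"
      using powr_singularity_integral(1)[of "1/2" x] x
      by (fold set_integrable_def) (intro set_integrable_mult_right, auto)
    show "AE y in lborel. (\<lambda>n. indicator {-1<..<1} y *\<^sub>R ((h y - h x) * Re (w n * dker (w n) y))) \<longlonglongrightarrow> indicator {-1<..<1} y *\<^sub>R ((h y - h x) * 0)"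
      using AE_lborel_neq[of x]
    proof eventually_elim
      case (elim y)
      show ?case
      proof (cases "y \<in> {-1<..<1}")
        case True
        have "\<bar>y\<bar> \<le> 1" using True by auto
        then have nz: "1 + cpt x * cpt y \<noteq> 0" "1 - cpt x * cnj (cpt y) \<noteq> 0"
          using norm_one_plus_ge[of y "cpt x"] norm_one_minus_ge[of y "cpt x"] True elim by auto
        have "(\<lambda>n. Re (w n * dker (w n) y)) \<longlonglongrightarrow> Re (cpt x * dker (cpt x) y)"
          unfolding dker_def by (intro tendsto_intros w nz)
        also have "Re (cpt x * dker (cpt x) y) = 0" using x True elim by (intro Re_mult_dker_boundary) auto
        finally show ?thesis by (intro tendsto_intros)
      qed auto
    qed
    show "AE y in lborel. norm (indicator {-1<..<1} y *\<^sub>R ((h y - h x) * Re (w n * dker (w n) y))) \<le> indicator {-1<..<1} y *\<^sub>R (2 * (1 + C) * B * \<bar>y - x\<bar> powr (-(1/2)))" for n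
    proof (intro AE_I2)
      fix y :: real
      show "norm (indicator {-1<..<1} y *\<^sub>R ((h y - h x) * Re (w n * dker (w n) y))) \<le> indicator {-1<..<1} y *\<^sub>R (2 * (1 + C) * B * \<bar>y - x\<bar> powr (-(1/2)))"
      proof (cases "y \<in> {-1<..<1}")
        case True
        have "\<bar>Re (w n * dker (w n) y)\<bar> \<le> norm (w n * dker (w n) y)" by (rule abs_Re_le_cmod)
        also have "\<dots> \<le> 1 * norm (dker (w n) y)" unfolding norm_mult using w(1)[of n] by (intro mult_right_mono) auto
        finally have "\<bar>h y - h x\<bar> * \<bar>Re (w n * dker (w n) y)\<bar> \<le> \<bar>h y - h x\<bar> * norm (dker (w n) y)"
          by (intro mult_left_mono) auto
        also have "\<dots> = norm (complex_of_real (h y - h x) * dker (w n) y)" by (simp only: norm_mult norm_of_real)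
        also have "\<dots> \<le> 2 * (1 + C) * B * \<bar>y - x\<bar> powr (-(1/2))"
          using True x by (intro dker_dominated w C h) auto
        finally show ?thesis using True by (simp add: abs_mult)
      qed auto
    qed
  qed (measurable, simp_all add: dker_def)
  then have "J \<longlonglongrightarrow> 0" by simp
  then have "(\<lambda>n. h x * Re (w n) + J n / pi) \<longlonglongrightarrow> h x * Re (cpt x) + 0 / pi"
    by (intro tendsto_intros w) auto
  then show ?thesis unfolding eq by simp
qed

section \<open>Representation of solutions by the Green potential\<close>

lemma gpot_0 [simp]: "gpot h 0 = 0"
  by (simp add: gpot_def set_lebesgue_integral_def)

lemma gpot_continuous_on:
  assumes hm: "h \<in> borel_measurable borel" and A: "\<And>y. y \<in> {-1<..<1} \<Longrightarrow> \<bar>h y\<bar> \<le> A"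
  shows "continuous_on (cball 0 1) (gpot h)"
  unfolding continuous_on_def
proof
  fix y :: complex assume y: "y \<in> cball 0 1"
  have *: "norm (gpot h x - gpot h y) \<le> gpot_const (1/2) * A * norm (x - y) powr (1/2)" if "x \<in> cball 0 1" for x
    using that y by (intro gpot_holder hm A) auto
  have "((\<lambda>x. gpot_const (1/2) * A * norm (x - y) powr (1/2)) \<longlongrightarrow> gpot_const (1/2) * A * norm (y - y) powr (1/2)) (at y within cball 0 1)"
    by (intro tendsto_intros) auto
  then have "((\<lambda>x. gpot_const (1/2) * A * norm (x - y) powr (1/2)) \<longlongrightarrow> 0) (at y within cball 0 1)" by simp
  then have "((\<lambda>x. gpot h x - gpot h y) \<longlongrightarrow> 0) (at y within cball 0 1)"
    by (rule Lim_null_comparison[rotated]) (use * in \<open>auto simp: eventually_at_filter\<close>)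
  then show "(gpot h \<longlongrightarrow> gpot h y) (at y within cball 0 1)" by (simp add: LIM_zero_iff)
qed

lemma Re_gker:
  assumes "norm w \<le> 1" "\<bar>y\<bar> \<le> 1" "y \<noteq> Im w"
  shows "Re (gker w y) = ln (norm (1 + w * cpt y)) - ln (norm (1 - w * cnj (cpt y)))"
proof -
  have "1 + w * cpt y \<noteq> 0" "1 - w * cnj (cpt y) \<noteq> 0"
    using norm_one_plus_ge[OF assms(2), of w] norm_one_minus_ge[OF assms(2), of w] assms by auto
  then show ?thesis by (simp add: gker_def del: times_complex.sel plus_complex.sel)
qed

lemma Re_gpot:
  assumes w: "norm w \<le> 1" and hm: "h \<in> borel_measurable borel" and A: "\<And>y. y \<in> {-1<..<1} \<Longrightarrow> \<bar>h y\<bar> \<le> A"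
  shows "Re (gpot h w) = (LBINT y:{-1<..<1}. h y * Re (gker w y)) / pi"
    and "set_integrable lborel {-1<..<1} (\<lambda>y. h y * Re (gker w y))"
proof -
  note i = set_integrable_gker[OF w hm A, unfolded set_integrable_def]
  have "Re (LBINT y:{-1<..<1}. complex_of_real (h y) * gker w y) = (\<integral>y. Re (indicator {-1<..<1} y *\<^sub>R (complex_of_real (h y) * gker w y)) \<partial>lborel)"
    unfolding set_lebesgue_integral_def by (rule integral_Re[symmetric]) (rule i)
  then show "Re (gpot h w) = (LBINT y:{-1<..<1}. h y * Re (gker w y)) / pi"
    by (simp add: gpot_def Re_divide_of_real set_lebesgue_integral_def)
  show "set_integrable lborel {-1<..<1} (\<lambda>y. h y * Re (gker w y))"
    using integrable_Re[OF i] by (simp add: set_integrable_def)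
qed

lemma Re_gpot_imaginary:
  assumes w: "norm w \<le> 1" "Re w = 0" and hm: "h \<in> borel_measurable borel" and A: "\<And>y. y \<in> {-1<..<1} \<Longrightarrow> \<bar>h y\<bar> \<le> A"
  shows "Re (gpot h w) = 0"
proof -
  have "(LBINT y:{-1<..<1}. h y * Re (gker w y)) = 0"
    unfolding set_lebesgue_integral_def
  proof (rule integral_eq_zero_AE)
    show "AE y in lborel. indicator {-1<..<1} y *\<^sub>R (h y * Re (gker w y)) = 0"
      using AE_lborel_neq[of "Im w"]
    proof eventually_elim
      case (elim y)
      have "cnj w = - w" using w by (simp add: complex_eq_iff)
      then have "1 - w * cnj (cpt y) = cnj (1 + w * cpt y)" by simp
      then have "norm (1 - w * cnj (cpt y)) = norm (1 + w * cpt y)" by (metis complex_mod_cnj)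
      then show ?case using Re_gker[of w y] w elim by (cases "y \<in> {-1<..<1}") (auto simp: abs_le_iff)
    qed
  qed
  then show ?thesis using Re_gpot(1)[OF w(1) hm A] by simp
qed

lemma gpot_minus: "gpot (\<lambda>y. - h y) w = - gpot h w"
  by (simp add: gpot_def set_lebesgue_integral_def)

section \<open>Poisson extension and its holomorphic completion on the half disc\<close>

lemma integral_inverse_one_plus_square:
  "integrable lborel (\<lambda>s::real. 1 / (1 + s\<^sup>2))" "(\<integral>s. 1 / (1 + s\<^sup>2) \<partial>lborel) = pi"
proof -
  have l: "((arctan \<circ> real_of_ereal) \<longlongrightarrow> - (pi / 2)) (at_right (-\<infinity>))"
    "((arctan \<circ> real_of_ereal) \<longlongrightarrow> pi / 2) (at_left \<infinity>)"
    by (auto simp: ereal_tendsto_simps tendsto_arctan_at_top tendsto_arctan_at_bot)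
  have d: "DERIV arctan x :> 1 / (1 + x\<^sup>2)" for x :: real
    by (auto intro!: derivative_eq_intros simp: divide_inverse)
  have c: "isCont (\<lambda>x. 1 / (1 + x\<^sup>2)) x" for x :: real
    by (intro continuous_intros) (auto simp: power2_eq_square add_nonneg_eq_0_iff)
  note I = interval_integral_FTC_nonneg[of "-\<infinity>" "\<infinity>" arctan "\<lambda>x. 1 / (1 + x\<^sup>2)", OF _ d c _ l]
  from I show "integrable lborel (\<lambda>s::real. 1 / (1 + s\<^sup>2))" "(\<integral>s. 1 / (1 + s\<^sup>2) \<partial>lborel) = pi"
    by (auto simp: set_integrable_def interval_lebesgue_integral_def set_lebesgue_integral_def add_nonneg_nonneg)
qed

lemma integrable_over_one_plus_square: "integrable lborel (\<lambda>s::real. c * (1 / (1 + s\<^sup>2)) :: real)"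
  using integral_inverse_one_plus_square(1) by (rule integrable_mult_right)

lemma lborel_integrable_shift:
  fixes f :: "real \<Rightarrow> real"
  shows "integrable lborel (\<lambda>s. f (x + s)) \<longleftrightarrow> integrable lborel f" "(\<integral>s. f (x + s) \<partial>lborel) = integral\<^sup>L lborel f"
  using lborel_integrable_real_affine_iff[of 1 f x] lborel_integral_real_affine[of 1 f x] by auto

text \<open>
  \<open>Psi u \<eta>\<close> is holomorphic with real part the Poisson extension of \<open>u\<close> at height
  \<open>Im (joukowski w) + \<eta>\<close>; the shift by \<open>\<eta> > 0\<close> keeps it regular on the boundary arc.
\<close>

definition pois :: "(real \<Rightarrow> real) \<Rightarrow> real \<Rightarrow> real \<Rightarrow> real" where
  "pois u x t = (LBINT y:{-1<..<1}. u y * (t / ((x - y)\<^sup>2 + t\<^sup>2))) / pi"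

definition Psi :: "(real \<Rightarrow> real) \<Rightarrow> real \<Rightarrow> complex \<Rightarrow> complex" where
  "Psi u \<eta> w = integral {-1..1} (\<lambda>y. complex_of_real (u y) * (2 * \<i> * w / (1 - w\<^sup>2 + 2 * \<i> * w * (y - \<i> * \<eta>)))) / (\<i> * pi)"

text \<open>It sends \<open>cis t\<close> to \<open>sin t\<close>, so it inverts \<open>cpt\<close>
  on the arc; it sends the imaginary diameter to the real line outside the interval and the origin
  to infinity.\<close>

definition joukowski :: "complex \<Rightarrow> complex" where
  "joukowski w = (w - 1 / w) / (2 * \<i>)"

lemma Im_joukowski: "w \<noteq> 0 \<Longrightarrow> Im (joukowski w) = Re w * (1 / (norm w)\<^sup>2 - 1) / 2"
proof -
  have "Im (c / (2 * \<i>)) = - Re c / 2" for c by (simp add: Im_divide power2_eq_square)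
  then have "Im (joukowski w) = - Re (w - 1 / w) / 2" unfolding joukowski_def .
  also have "Re (1 / w) = Re w / (norm w)\<^sup>2" by (simp add: Re_divide cmod_power2)
  then have "- Re (w - 1 / w) / 2 = Re w * (1 / (norm w)\<^sup>2 - 1) / 2" by (simp add: algebra_simps)
  finally show ?thesis .
qed

lemma Im_joukowski_nonneg:
  assumes "w \<noteq> 0" "norm w \<le> 1" "Re w \<ge> 0" shows "Im (joukowski w) \<ge> 0"
proof -
  have "(norm w)\<^sup>2 \<le> 1" "(norm w)\<^sup>2 > 0" using assms by (auto simp: power_le_one)
  then have "1 / (norm w)\<^sup>2 \<ge> 1" by simp
  then show ?thesis unfolding Im_joukowski[OF assms(1)] using assms by simp
qed

text \<open>The fraction is the Cauchy kernel at \<open>joukowski w + \<i> * \<eta>\<close> with the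
  denominator \<open>w\<close> cleared, so that it is also regular at \<open>w = 0\<close>.\<close>

lemma Psi_denominator:
  fixes w :: complex and \<eta> y :: real
  assumes "norm w \<le> 1" "Re w \<ge> 0" "\<eta> > 0"
  shows "1 - w\<^sup>2 + 2 * \<i> * w * (complex_of_real y - \<i> * \<eta>) \<noteq> 0"
    and "w \<noteq> 0 \<Longrightarrow> 2 * \<i> * w / (1 - w\<^sup>2 + 2 * \<i> * w * (complex_of_real y - \<i> * \<eta>)) = 1 / (of_real y - (joukowski w + \<i> * \<eta>))"
proof -
  have e: "1 - w\<^sup>2 + 2 * \<i> * w * (complex_of_real y - \<i> * \<eta>) = 2 * \<i> * w * (of_real y - (joukowski w + \<i> * \<eta>))" if "w \<noteq> 0"
    using that by (simp add: joukowski_def field_simps power2_eq_square)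
  have n: "of_real y - (joukowski w + \<i> * \<eta>) \<noteq> 0" if "w \<noteq> 0"
    using Im_joukowski_nonneg[OF that assms(1,2)] assms(3) by (auto simp: complex_eq_iff)
  show "1 - w\<^sup>2 + 2 * \<i> * w * (complex_of_real y - \<i> * \<eta>) \<noteq> 0"
    using e n by (cases "w = 0") auto
  show "w \<noteq> 0 \<Longrightarrow> 2 * \<i> * w / (1 - w\<^sup>2 + 2 * \<i> * w * (complex_of_real y - \<i> * \<eta>)) = 1 / (of_real y - (joukowski w + \<i> * \<eta>))"
    using e n by simp
qed

lemma Re_Psi:
  assumes w: "norm w \<le> 1" "Re w \<ge> 0" "w \<noteq> 0" and \<eta>: "\<eta> > 0" and u: "continuous_on UNIV u"
  shows "Re (Psi u \<eta> w) = pois u (Re (joukowski w)) (Im (joukowski w) + \<eta>)"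
proof -
  define X T where "X = Re (joukowski w)" and "T = Im (joukowski w) + \<eta>"
  have T: "T > 0" using Im_joukowski_nonneg[OF w(3,1,2)] \<eta> by (simp add: T_def)
  define q where "q = (\<lambda>y::real. complex_of_real (u y) / (of_real y - (joukowski w + \<i> * \<eta>)))"
  have nz: "of_real y - (joukowski w + \<i> * \<eta>) \<noteq> 0" for y
    using T by (auto simp: complex_eq_iff T_def)
  have qc: "continuous_on {-1..1} q" unfolding q_def
    by (intro continuous_intros continuous_on_subset[OF u]) (use nz in auto)
  have "Psi u \<eta> w = integral {-1..1} q / (\<i> * pi)"
    unfolding Psi_def q_def using Psi_denominator(2)[OF w(1,2) \<eta> w(3)] by simp
  also have "integral {-1..1} q = (LBINT y:{-1<..<1}. q y)"
    using set_lebesgue_integral_eq_integral_Icc(2)[OF qc] by simp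
  finally have 1: "Re (Psi u \<eta> w) = Im (LBINT y:{-1<..<1}. q y) / pi"
    by (simp add: Re_divide Im_divide power2_eq_square)
  have "Im (LBINT y:{-1<..<1}. q y) = (\<integral>y. Im (indicator {-1<..<1} y *\<^sub>R q y) \<partial>lborel)"
    using set_lebesgue_integral_eq_integral_Icc(1)[OF qc] unfolding set_lebesgue_integral_def set_integrable_def
    by (rule integral_Im[symmetric])
  also have "Im (q y) = u y * (T / ((X - y)\<^sup>2 + T\<^sup>2))" for y
  proof -
    have "of_real y - (joukowski w + \<i> * \<eta>) = Complex (y - X) (- T)"
      by (simp add: complex_eq_iff X_def T_def)
    then have "q y = of_real (u y) / Complex (y - X) (- T)" by (simp add: q_def)
    then show ?thesis by (simp add: Im_divide power2_commute)
  qed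
  then have "(\<integral>y. Im (indicator {-1<..<1} y *\<^sub>R q y) \<partial>lborel) = (LBINT y:{-1<..<1}. u y * (T / ((X - y)\<^sup>2 + T\<^sup>2)))"
    by (simp add: set_lebesgue_integral_def)
  finally show ?thesis using 1 by (simp add: pois_def X_def T_def)
qed

text \<open>\<open>U\<close> need not be open: with the closure of the half disc the same statement
  yields continuity up to the boundary, as the maximum principle requires.\<close>

lemma Psi_holomorphic:
  assumes u: "continuous_on UNIV u" and \<eta>: "\<eta> > 0" and U: "convex U" "U \<subseteq> {w. norm w \<le> 1 \<and> Re w \<ge> 0}"
  shows "Psi u \<eta> holomorphic_on U"
proof -
  define D where "D = (\<lambda>w y. 1 - w\<^sup>2 + 2 * \<i> * w * (complex_of_real y - \<i> * \<eta>))"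
  have D: "D w y \<noteq> 0" if "w \<in> U" for w y
    using that U \<eta> Psi_denominator(1)[of w \<eta> y] by (auto simp: D_def)
  define q where "q = (\<lambda>w y. complex_of_real (u y) * (2 * \<i> * w / D w y))"
  define q' where "q' = (\<lambda>w y. complex_of_real (u y) * ((2 * \<i> * D w y - 2 * \<i> * w * (- 2 * w + 2 * \<i> * (complex_of_real y - \<i> * \<eta>))) / (D w y * D w y)))"
  have "(\<lambda>w. integral (cbox (-1) 1) (q w)) holomorphic_on U"
  proof (rule leibniz_rule_holomorphic)
    show "((\<lambda>w. q w t) has_field_derivative q' w t) (at w within U)" if "w \<in> U" for w t
      using D[OF that, of t] unfolding q_def q'_def
      by (intro DERIV_cmult) (auto simp: D_def intro!: derivative_eq_intros)
    show "q w integrable_on cbox (-1) 1" if "w \<in> U" for w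
      unfolding q_def using D[OF that]
      by (intro integrable_continuous continuous_intros continuous_on_subset[OF u]) (auto simp: D_def intro!: continuous_intros)
    show "continuous_on (U \<times> cbox (-1) 1) (\<lambda>(w, t). q' w t)"
      unfolding q'_def split_beta using D
      by (intro continuous_intros continuous_on_compose2[OF u]) (auto simp: D_def intro!: continuous_intros)
  qed (rule U)
  then have "(\<lambda>w. integral (cbox (-1) 1) (q w) / (\<i> * pi)) holomorphic_on U"
    by (intro holomorphic_intros) auto
  then show ?thesis by (simp add: Psi_def q_def D_def cong: holomorphic_cong)
qed

locale half_order =
  fixes u :: "real \<Rightarrow> real" and L :: real
  assumes L: "L \<ge> 0" and hol: "\<And>x y. \<bar>u x - u y\<bar> \<le> L * sqrt \<bar>x - y\<bar>"
    and out: "\<And>x. x \<notin> {-1<..<1} \<Longrightarrow> u x = 0"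
begin

lemma cont: "continuous_on UNIV u"
  unfolding continuous_on_def
proof
  fix y :: real
  have "((\<lambda>x. L * sqrt \<bar>x - y\<bar>) \<longlongrightarrow> L * sqrt \<bar>y - y\<bar>) (at y)" by (intro tendsto_intros)
  then have "((\<lambda>x. L * sqrt \<bar>x - y\<bar>) \<longlongrightarrow> 0) (at y)" by simp
  then have "((\<lambda>x. u x - u y) \<longlongrightarrow> 0) (at y)"
    by (rule Lim_null_comparison[rotated]) (use hol in auto)
  then show "(u \<longlongrightarrow> u y) (at y within UNIV)" by (simp add: LIM_zero_iff)
qed

lemma cont_on [continuous_intros]: "continuous_on S f \<Longrightarrow> continuous_on S (\<lambda>x. u (f x))"
  by (rule continuous_on_compose2[OF cont]) auto

lemma meas [measurable]: "u \<in> borel_measurable borel"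
  using cont by (rule borel_measurable_continuous_onI)

definition "M = 2 * L"

lemma bound: "\<bar>u x\<bar> \<le> M"
proof (cases "x \<in> {-1<..<1}")
  case True
  have "\<bar>u x - u 1\<bar> \<le> L * sqrt \<bar>x - 1\<bar>" by (rule hol)
  also have "\<dots> \<le> L * sqrt 4" using True L by (intro mult_left_mono real_sqrt_le_mono) auto
  finally show ?thesis using out[of 1] by (simp add: M_def)
qed (use out L in \<open>simp add: M_def\<close>)

lemma M_nonneg: "M \<ge> 0" using L by (simp add: M_def)

lemma pois_eq:
  assumes t: "t > 0"
  shows "pois u x t = (\<integral>s. u (x + t * s) / (1 + s\<^sup>2) \<partial>lborel) / pi"
    and "integrable lborel (\<lambda>s. u (x + t * s) / (1 + s\<^sup>2))"
proof -
  have "(LBINT y:{-1<..<1}. u y * (t / ((x - y)\<^sup>2 + t\<^sup>2))) = (\<integral>y. u y * (t / ((x - y)\<^sup>2 + t\<^sup>2)) \<partial>lborel)"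
    unfolding set_lebesgue_integral_def
  proof (intro Bochner_Integration.integral_cong refl)
    fix y show "indicator {-1<..<1} y *\<^sub>R (u y * (t / ((x - y)\<^sup>2 + t\<^sup>2))) = u y * (t / ((x - y)\<^sup>2 + t\<^sup>2))"
      using out[of y] by (cases "y \<in> {-1<..<1}") auto
  qed
  also have "\<dots> = t * (\<integral>s. u (x + t * s) * (t / ((x - (x + t * s))\<^sup>2 + t\<^sup>2)) \<partial>lborel)"
    using t lborel_integral_real_affine[of t "\<lambda>y. u y * (t / ((x - y)\<^sup>2 + t\<^sup>2))" x] by simp
  also have "\<dots> = (\<integral>s. u (x + t * s) / (1 + s\<^sup>2) \<partial>lborel)"
    unfolding integral_mult_right_zero[symmetric]
  proof (intro Bochner_Integration.integral_cong refl)
    fix s :: real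
    define q where "q = 1 + s\<^sup>2"
    have "(x - (x + t * s))\<^sup>2 + t\<^sup>2 = t\<^sup>2 * q" by (simp add: q_def power2_eq_square algebra_simps)
    then show "t * (u (x + t * s) * (t / ((x - (x + t * s))\<^sup>2 + t\<^sup>2))) = u (x + t * s) / (1 + s\<^sup>2)"
      using t unfolding q_def[symmetric] by (simp add: power2_eq_square)
  qed
  finally show "pois u x t = (\<integral>s. u (x + t * s) / (1 + s\<^sup>2) \<partial>lborel) / pi" by (simp add: pois_def)
  show "integrable lborel (\<lambda>s. u (x + t * s) / (1 + s\<^sup>2))"
  proof (rule Bochner_Integration.integrable_bound)
    show "integrable lborel (\<lambda>s. M * (1 / (1 + s\<^sup>2)))" by (rule integrable_over_one_plus_square)
    show "AE s in lborel. norm (u (x + t * s) / (1 + s\<^sup>2)) \<le> norm (M * (1 / (1 + s\<^sup>2)))"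
      using bound M_nonneg by (intro AE_I2) (auto simp: abs_divide intro!: divide_right_mono)
  qed measurable
qed

text \<open>A modulus, uniform in \<open>x\<close>, for the convergence of the Poisson extension to
  its boundary values. The truncation at \<open>2 * M\<close> provides the majorant
  \<open>2 * M / (1 + s\<^sup>2)\<close> for every \<open>t\<close>.\<close>

definition "\<kappa> t = (\<integral>s. min (L * sqrt (t * \<bar>s\<bar>)) (2 * M) / (1 + s\<^sup>2) \<partial>lborel) / pi"

lemma \<kappa>_integrable: "t \<ge> 0 \<Longrightarrow> integrable lborel (\<lambda>s. min (L * sqrt (t * \<bar>s\<bar>)) (2 * M) / (1 + s\<^sup>2))"
proof (rule Bochner_Integration.integrable_bound)
  assume t: "t \<ge> 0"
  show "integrable lborel (\<lambda>s. (2 * M) * (1 / (1 + s\<^sup>2)))" by (rule integrable_over_one_plus_square)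
  show "AE s in lborel. norm (min (L * sqrt (t * \<bar>s\<bar>)) (2 * M) / (1 + s\<^sup>2)) \<le> norm ((2 * M) * (1 / (1 + s\<^sup>2)))"
    using M_nonneg L t by (intro AE_I2) (auto simp: abs_divide intro!: divide_right_mono)
qed measurable

lemma pois_diff_le:
  assumes t: "t > 0"
  shows "\<bar>pois u x t - u x\<bar> \<le> \<kappa> t"
proof -
  have i0: "integrable lborel (\<lambda>s. u x * (1 / (1 + s\<^sup>2)))" by (rule integrable_over_one_plus_square)
  have "pi * (pois u x t - u x) = (\<integral>s. u (x + t * s) / (1 + s\<^sup>2) \<partial>lborel) - (\<integral>s. u x * (1 / (1 + s\<^sup>2)) \<partial>lborel)"
    unfolding integral_mult_right_zero integral_inverse_one_plus_square(2)
    by (simp add: pois_eq[OF t] field_simps)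
  also have "\<dots> = (\<integral>s. u (x + t * s) / (1 + s\<^sup>2) - u x * (1 / (1 + s\<^sup>2)) \<partial>lborel)"
    using pois_eq(2)[OF t] i0 by simp
  also have "\<bar>\<dots>\<bar> \<le> (\<integral>s. min (L * sqrt (t * \<bar>s\<bar>)) (2 * M) / (1 + s\<^sup>2) \<partial>lborel)"
  proof (rule integral_abs_bound_integral)
    show "integrable lborel (\<lambda>s. u (x + t * s) / (1 + s\<^sup>2) - u x * (1 / (1 + s\<^sup>2)))"
      by (intro Bochner_Integration.integrable_diff pois_eq t i0)
    show "integrable lborel (\<lambda>s. min (L * sqrt (t * \<bar>s\<bar>)) (2 * M) / (1 + s\<^sup>2))" using t by (intro \<kappa>_integrable) auto
    fix s :: real
    have "\<bar>u (x + t * s) - u x\<bar> \<le> L * sqrt (t * \<bar>s\<bar>)" using hol[of "x + t * s" x] t by (simp add: abs_mult)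
    moreover have "\<bar>u (x + t * s) - u x\<bar> \<le> 2 * M" using bound[of x] bound[of "x + t * s"] by linarith
    ultimately show "\<bar>u (x + t * s) / (1 + s\<^sup>2) - u x * (1 / (1 + s\<^sup>2))\<bar> \<le> min (L * sqrt (t * \<bar>s\<bar>)) (2 * M) / (1 + s\<^sup>2)"
      by (simp add: diff_divide_distrib[symmetric] abs_divide) (auto intro!: divide_right_mono)
  qed
  finally have "\<bar>pi * (pois u x t - u x)\<bar> \<le> pi * \<kappa> t" by (simp add: \<kappa>_def)
  then show ?thesis by (simp add: abs_mult)
qed

lemma \<kappa>_tendsto:
  assumes "\<And>n. t n \<ge> 0" "t \<longlonglongrightarrow> 0"
  shows "(\<lambda>n. \<kappa> (t n)) \<longlonglongrightarrow> 0"
proof -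
  have "(\<lambda>n. \<integral>s. min (L * sqrt (t n * \<bar>s\<bar>)) (2 * M) / (1 + s\<^sup>2) \<partial>lborel) \<longlonglongrightarrow> (\<integral>s. 0 \<partial>(lborel :: real measure))"
  proof (rule integral_dominated_convergence)
    show "integrable lborel (\<lambda>s. (2 * M) * (1 / (1 + s\<^sup>2)))" by (rule integrable_over_one_plus_square)
    show "AE s in lborel. norm (min (L * sqrt (t n * \<bar>s\<bar>)) (2 * M) / (1 + s\<^sup>2)) \<le> (2 * M) * (1 / (1 + s\<^sup>2))" for n
      using M_nonneg L assms(1)[of n] by (intro AE_I2) (auto simp: abs_divide intro!: divide_right_mono)
    show "AE s in lborel. (\<lambda>n. min (L * sqrt (t n * \<bar>s\<bar>)) (2 * M) / (1 + s\<^sup>2)) \<longlonglongrightarrow> 0"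
    proof (intro AE_I2)
      fix s :: real
      have "(\<lambda>n. min (L * sqrt (t n * \<bar>s\<bar>)) (2 * M) / (1 + s\<^sup>2)) \<longlonglongrightarrow> min (L * sqrt (0 * \<bar>s\<bar>)) (2 * M) / (1 + s\<^sup>2)"
        by (intro tendsto_intros assms) (smt (verit) zero_le_power2)
      then show "(\<lambda>n. min (L * sqrt (t n * \<bar>s\<bar>)) (2 * M) / (1 + s\<^sup>2)) \<longlonglongrightarrow> 0" using M_nonneg by simp
    qed
  qed measurable
  from tendsto_divide[OF this tendsto_const, of pi] show ?thesis by (simp add: \<kappa>_def)
qed

lemma pois_tendsto:
  assumes T: "T > 0" and t: "\<And>n. t n \<ge> 0" "t \<longlonglongrightarrow> 0"
  shows "(\<lambda>n. pois u x (T + t n)) \<longlonglongrightarrow> pois u x T"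
proof -
  have Tn: "T + t n > 0" for n using T t(1)[of n] by linarith
  have "(\<lambda>n. \<integral>s. u (x + (T + t n) * s) / (1 + s\<^sup>2) \<partial>lborel) \<longlonglongrightarrow> (\<integral>s. u (x + (T + 0) * s) / (1 + s\<^sup>2) \<partial>lborel)"
  proof (rule integral_dominated_convergence)
    show "integrable lborel (\<lambda>s. M * (1 / (1 + s\<^sup>2)))" by (rule integrable_over_one_plus_square)
    show "AE s in lborel. norm (u (x + (T + t n) * s) / (1 + s\<^sup>2)) \<le> M * (1 / (1 + s\<^sup>2))" for n
      using bound by (intro AE_I2) (auto simp: abs_divide intro!: divide_right_mono)
    show "AE s in lborel. (\<lambda>n. u (x + (T + t n) * s) / (1 + s\<^sup>2)) \<longlonglongrightarrow> u (x + (T + 0) * s) / (1 + s\<^sup>2)"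
      by (intro AE_I2 tendsto_intros t continuous_on_tendsto_compose[OF cont]) (auto, smt (verit) zero_le_power2)
  qed measurable
  from tendsto_divide[OF this tendsto_const, of pi] show ?thesis
    using Tn T by (simp add: pois_eq)
qed

end

section \<open>Maximum principle in the half disc and the inverse Joukowski map\<close>

definition half_disc :: "complex set" where
  "half_disc = {w. norm w < 1 \<and> Re w > 0}"

lemma half_disc:
  "open half_disc" "convex half_disc" "bounded half_disc" "interior half_disc = half_disc"
  "closure half_disc \<subseteq> {w. norm w \<le> 1 \<and> Re w \<ge> 0}"
  "frontier half_disc \<subseteq> {w. norm w \<le> 1 \<and> Re w \<ge> 0 \<and> (norm w = 1 \<or> Re w = 0)}"
proof -
  have e: "half_disc = ball 0 1 \<inter> {w. Re w > 0}" by (auto simp: half_disc_def)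
  show o: "open half_disc" unfolding e by (intro open_Int open_ball open_halfspace_Re_gt)
  show "convex half_disc" unfolding e by (intro convex_Int convex_ball convex_halfspace_Re_gt)
  show "bounded half_disc" unfolding e by (intro bounded_Int) auto
  show i: "interior half_disc = half_disc" using o by (rule interior_open)
  have "half_disc \<subseteq> cball 0 1 \<inter> {w. Re w \<ge> 0}" by (auto simp: half_disc_def)
  then have "closure half_disc \<subseteq> cball 0 1 \<inter> {w. Re w \<ge> 0}"
    by (rule closure_minimal) (intro closed_Int closed_cball closed_halfspace_Re_ge)
  then show c: "closure half_disc \<subseteq> {w. norm w \<le> 1 \<and> Re w \<ge> 0}" by auto
  show "frontier half_disc \<subseteq> {w. norm w \<le> 1 \<and> Re w \<ge> 0 \<and> (norm w = 1 \<or> Re w = 0)}"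
    using c unfolding frontier_def i by (fastforce simp: half_disc_def)
qed

lemma joukowski_cpt: "\<bar>x\<bar> \<le> 1 \<Longrightarrow> joukowski (cpt x) = of_real x"
proof -
  assume x: "\<bar>x\<bar> \<le> 1"
  have "cpt x * cnj (cpt x) = 1" using x complex_norm_square[of "cpt x"] by simp
  then have "1 / cpt x = cnj (cpt x)" by (metis divide_eq_eq mult.commute mult_eq_0_iff zero_neq_one nonzero_mult_div_cancel_left)
  then show ?thesis by (simp add: joukowski_def complex_eq_iff Re_divide Im_divide)
qed

lemma cpt_of_circle:
  assumes "norm w = 1" "Re w \<ge> 0" shows "w = cpt (Im w)" "\<bar>Im w\<bar> \<le> 1"
proof -
  have "(Re w)\<^sup>2 + (Im w)\<^sup>2 = 1" using assms by (simp add: cmod_def)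
  then have "sqrt (1 - (Im w)\<^sup>2) = Re w" using assms by (intro real_sqrt_unique) auto
  then show "w = cpt (Im w)" by (simp add: complex_eq_iff)
  show "\<bar>Im w\<bar> \<le> 1" using abs_Im_le_cmod[of w] assms by simp
qed

context half_order
begin

text \<open>Maximum principle for the real part of
  \<open>Psi u \<eta> - gpot h - \<delta> * w\<close>. On the arc the hypothesis applies up to
  \<open>\<kappa> \<eta>\<close>. On the imaginary diameter \<open>gpot h\<close> and
  \<open>\<delta> * w\<close> have real part 0, and the Poisson extension sits above points where
  \<open>u\<close> vanishes, so it is at most \<open>\<kappa> \<eta>\<close>. Then
  \<open>\<eta>\<close> tends to 0.\<close>

lemma pois_minus_gpot_le:
  assumes hc: "continuous_on UNIV h"
    and m: "m \<ge> 0" "\<And>x. \<bar>x\<bar> \<le> 1 \<Longrightarrow> u x - Re (gpot h (cpt x)) - \<delta> * sqrt (1 - x\<^sup>2) \<le> m"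
    and w: "w \<in> half_disc"
  shows "pois u (Re (joukowski w)) (Im (joukowski w)) - Re (gpot h w) - \<delta> * Re w \<le> m"
proof -
  have hm: "h \<in> borel_measurable borel" using hc by (rule borel_measurable_continuous_onI)
  obtain A where A: "\<And>y. y \<in> {-1..1} \<Longrightarrow> \<bar>h y\<bar> \<le> A"
    using compact_imp_bounded[OF compact_continuous_image[OF continuous_on_subset[OF hc], of "{-1..1}"]]
    by (auto simp: bounded_iff) (metis atLeastAtMost_iff)
  then have A': "\<And>y. y \<in> {-1<..<1} \<Longrightarrow> \<bar>h y\<bar> \<le> A" by auto
  have wn: "norm w < 1" "Re w > 0" "w \<noteq> 0" using w by (auto simp: half_disc_def)
  have z0: "Im (joukowski w) > 0"
    unfolding Im_joukowski[OF wn(3)] using wn by (auto intro!: mult_pos_pos simp: field_simps power_less_one_iff)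
  define \<eta> where "\<eta> n = 1 / real (Suc n)" for n
  have \<eta>: "\<eta> n > 0" "\<eta> \<longlonglongrightarrow> 0" for n
    unfolding \<eta>_def by (simp, rule LIMSEQ_inverse_real_of_nat[unfolded inverse_eq_divide])
  have "pois u (Re (joukowski w)) (Im (joukowski w) + \<eta> n) - Re (gpot h w) - \<delta> * Re w \<le> m + \<kappa> (\<eta> n)" for n
  proof -
    define \<Theta> where "\<Theta> = (\<lambda>w. Psi u (\<eta> n) w - gpot h w - complex_of_real \<delta> * w)"
    have cl: "closure half_disc \<subseteq> cball 0 1" using half_disc(5) by auto
    have "Re (\<Theta> w) \<le> m + \<kappa> (\<eta> n)"
    proof (rule maximum_real_frontier[of \<Theta> half_disc])
      show "\<Theta> holomorphic_on interior half_disc" unfolding \<Theta>_def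
        by (intro holomorphic_intros Psi_holomorphic cont \<eta> holomorphic_on_subset[OF gpot_holomorphic[OF hc]])
           (use half_disc in \<open>auto simp: half_disc_def\<close>)
      have "continuous_on (closure half_disc) (Psi u (\<eta> n))"
        by (intro holomorphic_on_imp_continuous_on Psi_holomorphic cont \<eta> convex_closure half_disc)
      then show "continuous_on (closure half_disc) \<Theta>" unfolding \<Theta>_def
        by (intro continuous_intros continuous_on_subset[OF gpot_continuous_on[OF hm A'] cl])
      show "bounded half_disc" "w \<in> half_disc" by (fact half_disc, fact w)
      fix z assume "z \<in> frontier half_disc"
      then have z: "norm z \<le> 1" "Re z \<ge> 0" "norm z = 1 \<or> Re z = 0" using half_disc(6) by auto
      have le: "pois u x (\<eta> n) \<le> u x + \<kappa> (\<eta> n)" for x using pois_diff_le[of "\<eta> n" x] \<eta>(1)[of n] by linarith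
      have \<kappa>0: "\<kappa> (\<eta> n) \<ge> 0" using pois_diff_le[of "\<eta> n" 0] \<eta>(1)[of n] by linarith
      show "Re (\<Theta> z) \<le> m + \<kappa> (\<eta> n)"
      proof (cases "norm z = 1")
        case True
        define x where "x = Im z"
        have x: "\<bar>x\<bar> \<le> 1" "z = cpt x" using cpt_of_circle[OF True z(2)] by (auto simp: x_def)
        have nz: "z \<noteq> 0" using True by auto
        have "Re (Psi u (\<eta> n) z) = pois u x (\<eta> n)"
          using Re_Psi[OF z(1,2) nz \<eta>(1) cont, of n] joukowski_cpt[OF x(1)] norm_cpt[OF x(1)] by (auto simp: x(2))
        then show ?thesis using m(2)[OF x(1)] le[of x] by (simp add: \<Theta>_def x(2))
      next
        case False
        then have re: "Re z = 0" using z by auto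
        have g: "Re (gpot h z) = 0" by (rule Re_gpot_imaginary[OF z(1) re hm A'])
        show ?thesis
        \<comment> \<open>The origin is the point at infinity of the half-plane, where
          \<open>Psi\<close> vanishes.\<close>
        proof (cases "z = 0")
          case True
          then show ?thesis using m \<kappa>0 by (simp add: \<Theta>_def Psi_def)
        next
          case nz: False
          define X where "X = Re (joukowski z)"
          have "Im (joukowski z) = 0" using re nz by (simp add: Im_joukowski)
          then have 1: "Re (Psi u (\<eta> n) z) = pois u X (\<eta> n)"
            using Re_Psi[OF z(1,2) nz \<eta>(1) cont, of n] by (simp add: X_def)
          have "X \<notin> {-1<..<1}"
          proof -
            define s where "s = Im z"
            have zs: "z = \<i> * s" "s \<noteq> 0" using re nz by (auto simp: s_def complex_eq_iff)
            have X: "X = (s + 1 / s) / 2" by (simp add: X_def joukowski_def zs(1) Re_divide Im_divide power2_eq_square field_simps)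
            have "(s + 1 / s)\<^sup>2 = (s - 1 / s)\<^sup>2 + 4" using zs(2) by (simp add: power2_eq_square field_simps)
            then have "X\<^sup>2 \<ge> 1" unfolding X power_divide by simp
            then show ?thesis using abs_square_less_1[of X] by auto
          qed
          then show ?thesis using out[of X] le[of X] 1 g m re by (simp add: \<Theta>_def)
        qed
      qed
    qed
    then show ?thesis using Re_Psi[OF _ _ wn(3) \<eta>(1) cont, of n] wn by (simp add: \<Theta>_def)
  qed
  moreover have "(\<lambda>n. pois u (Re (joukowski w)) (Im (joukowski w) + \<eta> n) - Re (gpot h w) - \<delta> * Re w) \<longlonglongrightarrow> pois u (Re (joukowski w)) (Im (joukowski w)) - Re (gpot h w) - \<delta> * Re w"
    using z0 \<eta> by (intro tendsto_intros pois_tendsto) (auto intro: less_imp_le)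
  moreover have "(\<lambda>n. m + \<kappa> (\<eta> n)) \<longlonglongrightarrow> m + 0"
    using \<eta> by (intro tendsto_intros \<kappa>_tendsto) (auto intro: less_imp_le)
  ultimately show ?thesis by (intro LIMSEQ_le[of _ _ _ m]) auto
qed

end

text \<open>Of the two solutions of \<open>joukowski w = z\<close>, the principal root selects the
  one with value \<open>cpt x\<close> on the interval and in the half disc for \<open>z\<close> in
  the upper half-plane.\<close>

definition joukowski_inv :: "complex \<Rightarrow> complex" where
  "joukowski_inv z = csqrt (1 - z\<^sup>2) + \<i> * z"

lemma one_minus_square_not_nonpos:
  assumes "Im z > 0 \<or> (Im z = 0 \<and> \<bar>Re z\<bar> < 1) \<or> norm z < 1"
  shows "1 - z\<^sup>2 \<notin> \<real>\<^sub>\<le>\<^sub>0"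
proof
  assume "1 - z\<^sup>2 \<in> \<real>\<^sub>\<le>\<^sub>0"
  then have 1: "Re z * Im z = 0" and 2: "1 \<le> (Re z)\<^sup>2 - (Im z)\<^sup>2"
    by (auto simp: complex_nonpos_Reals_iff power2_eq_square)
  have "(Re z)\<^sup>2 \<ge> 1" using 2 by (smt (verit) zero_le_power2)
  then have r: "\<bar>Re z\<bar> \<ge> 1" using abs_square_less_1[of "Re z"] by linarith
  then have "Im z = 0" using 1 by auto
  then show False using assms r abs_Re_le_cmod[of z] by linarith
qed

lemma Re_csqrt_one_minus_pos:
  assumes "1 - z\<^sup>2 \<notin> \<real>\<^sub>\<le>\<^sub>0" shows "Re (csqrt (1 - z\<^sup>2)) > 0"
proof (rule ccontr)
  assume "\<not> ?thesis"
  then have 0: "Re (csqrt (1 - z\<^sup>2)) = 0" using csqrt_principal[of "1 - z\<^sup>2"] by auto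
  have "q\<^sup>2 \<in> \<real>\<^sub>\<le>\<^sub>0" if "Re q = 0" for q
    using that by (simp add: complex_nonpos_Reals_iff Re_power2 Im_power2)
  from this[OF 0] show False using assms by (simp only: power2_csqrt)
qed

lemma joukowski_inv_mult: "joukowski_inv z * (csqrt (1 - z\<^sup>2) - \<i> * z) = 1"
proof -
  have "joukowski_inv z * (csqrt (1 - z\<^sup>2) - \<i> * z) = (csqrt (1 - z\<^sup>2))\<^sup>2 + z\<^sup>2"
    by (simp add: joukowski_inv_def power2_eq_square algebra_simps)
  then show ?thesis by simp
qed

lemma joukowski_inv_nonzero: "joukowski_inv z \<noteq> 0"
  using joukowski_inv_mult[of z] by auto

lemma joukowski_joukowski_inv: "joukowski (joukowski_inv z) = z"
proof -
  have "1 / joukowski_inv z = csqrt (1 - z\<^sup>2) - \<i> * z" using joukowski_inv_mult[of z] joukowski_inv_nonzero[of z] by (simp add: field_simps)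
  then show ?thesis by (simp add: joukowski_def) (simp add: joukowski_inv_def)
qed

text \<open>The square root \<open>a + \<i> * b\<close> satisfies
  \<open>a\<^sup>2 - b\<^sup>2 = 1 - x\<^sup>2 + y\<^sup>2\<close> and
  \<open>a * b = - x * y\<close>. If \<open>a \<le> y\<close>, the second equation gives
  \<open>x\<^sup>2 \<le> b\<^sup>2\<close>, which contradicts the first. So the real part
  \<open>a - y\<close> is positive, and then \<open>Im_joukowski\<close> forces the norm below
  1.\<close>

lemma joukowski_inv_in_half_disc:
  assumes "Im z > 0" shows "joukowski_inv z \<in> half_disc"
proof -
  have nn: "1 - z\<^sup>2 \<notin> \<real>\<^sub>\<le>\<^sub>0" using assms by (intro one_minus_square_not_nonpos) auto
  define x y a b where "x = Re z" and "y = Im z" and "a = Re (csqrt (1 - z\<^sup>2))" and "b = Im (csqrt (1 - z\<^sup>2))"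
  have a: "a > 0" unfolding a_def by (rule Re_csqrt_one_minus_pos[OF nn])
  have y: "y > 0" using assms by (simp add: y_def)
  obtain q where q: "q = csqrt (1 - z\<^sup>2)" "q\<^sup>2 = 1 - z\<^sup>2" by simp
  then have "Re (q\<^sup>2) = Re (1 - z\<^sup>2)" "Im (q\<^sup>2) = Im (1 - z\<^sup>2)" by (simp_all only: q(2))
  then have e: "a\<^sup>2 - b\<^sup>2 = 1 - x\<^sup>2 + y\<^sup>2" "a * b = - x * y"
    unfolding a_def b_def x_def y_def q(1)[symmetric] by (simp_all add: Re_power2 Im_power2 mult.commute)
  have ay: "a > y"
  proof (rule ccontr)
    assume "\<not> a > y"
    then have ay: "a \<le> y" by simp
    have "a\<^sup>2 * b\<^sup>2 = x\<^sup>2 * y\<^sup>2" using e(2) by (metis power_mult_distrib power2_minus mult_minus_left)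
    moreover have "a\<^sup>2 * b\<^sup>2 \<le> y\<^sup>2 * b\<^sup>2" using ay a by (intro mult_right_mono power_mono) auto
    ultimately have "y\<^sup>2 * x\<^sup>2 \<le> y\<^sup>2 * b\<^sup>2" by (simp add: mult.commute)
    then have "x\<^sup>2 \<le> b\<^sup>2" using y by simp
    moreover have "a\<^sup>2 \<le> y\<^sup>2" using ay a by (intro power_mono) auto
    ultimately show False using e(1) by linarith
  qed
  then have re: "Re (joukowski_inv z) > 0" by (simp add: joukowski_inv_def a_def y_def)
  have "Re (joukowski_inv z) * (1 / (norm (joukowski_inv z))\<^sup>2 - 1) / 2 > 0"
    using Im_joukowski[OF joukowski_inv_nonzero, of z] assms by (simp add: joukowski_joukowski_inv)
  then have "1 / (norm (joukowski_inv z))\<^sup>2 - 1 > 0" using re by (simp add: zero_less_mult_iff)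
  then have "(norm (joukowski_inv z))\<^sup>2 < 1" using joukowski_inv_nonzero[of z] by (simp add: field_simps)
  then have "norm (joukowski_inv z) < 1" using power_less_imp_less_base[of "norm (joukowski_inv z)" 2 1] by simp
  then show ?thesis using re by (simp add: half_disc_def)
qed

lemma joukowski_inv_real: "\<bar>x\<bar> \<le> 1 \<Longrightarrow> joukowski_inv (of_real x) = cpt x"
proof -
  assume "\<bar>x\<bar> \<le> 1"
  then have "0 \<le> 1 - x\<^sup>2" by (simp add: abs_square_le_1)
  have "csqrt (complex_of_real y) = of_real (sqrt y)" if "y \<ge> 0" for y using that by simp
  from this[OF \<open>0 \<le> 1 - x\<^sup>2\<close>] have "csqrt (complex_of_real (1 - x\<^sup>2)) = of_real (sqrt (1 - x\<^sup>2))" .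
  then show ?thesis by (simp add: joukowski_inv_def complex_eq_iff)
qed

lemma has_field_derivative_joukowski_inv:
  assumes "1 - z\<^sup>2 \<notin> \<real>\<^sub>\<le>\<^sub>0"
  shows "(joukowski_inv has_field_derivative \<i> * joukowski_inv z / csqrt (1 - z\<^sup>2)) (at z within A)"
proof -
  have nz: "csqrt (1 - z\<^sup>2) \<noteq> 0" using Re_csqrt_one_minus_pos[OF assms] by auto
  have "((\<lambda>z. 1 - z\<^sup>2) has_field_derivative - (2 * z)) (at z within A)"
    by (auto intro!: derivative_eq_intros)
  from has_field_derivative_csqrt'[OF this assms]
  have "((\<lambda>z. csqrt (1 - z\<^sup>2) + \<i> * z) has_field_derivative - (2 * z) / (2 * csqrt (1 - z\<^sup>2)) + \<i> * 1) (at z within A)"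
    by (intro DERIV_add DERIV_cmult DERIV_ident)
  also have "- (2 * z) / (2 * csqrt (1 - z\<^sup>2)) + \<i> * 1 = \<i> * joukowski_inv z / csqrt (1 - z\<^sup>2)"
    using nz by (simp add: joukowski_inv_def field_simps)
  finally show ?thesis unfolding joukowski_inv_def[abs_def] .
qed

lemma continuous_on_joukowski_inv: "continuous_on {z. 1 - z\<^sup>2 \<notin> \<real>\<^sub>\<le>\<^sub>0} joukowski_inv"
  by (rule DERIV_continuous_on[OF has_field_derivative_joukowski_inv]) simp

text \<open>Vertical lines over interior points are mapped into Stolz angles: differentiability
  gives distance of order \<open>t\<close> to \<open>cpt x\<close>, and \<open>Im_joukowski\<close>
  gives \<open>t\<close> of order \<open>1 - norm w\<close>.\<close>

lemma joukowski_inv_vertical_nontangential: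
  assumes x: "\<bar>x\<bar> < 1"
  obtains T C where "T > 0" "C \<ge> 0"
    "\<And>t. 0 < t \<Longrightarrow> t < T \<Longrightarrow> norm (joukowski_inv (of_real x + \<i> * of_real t) - cpt x) \<le> C * (1 - norm (joukowski_inv (of_real x + \<i> * of_real t)))"
proof -
  have nn: "1 - (complex_of_real x)\<^sup>2 \<notin> \<real>\<^sub>\<le>\<^sub>0" using x by (intro one_minus_square_not_nonpos) auto
  define D where "D = \<i> * joukowski_inv (of_real x) / csqrt (1 - (complex_of_real x)\<^sup>2)"
  have "(joukowski_inv has_field_derivative D) (at (of_real x))" unfolding D_def by (rule has_field_derivative_joukowski_inv[OF nn])
  then have "((\<lambda>h. norm ((joukowski_inv (of_real x + h) - joukowski_inv (of_real x)) / h)) \<longlongrightarrow> norm D) (at 0)"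
    unfolding DERIV_def by (rule tendsto_norm)
  then have "eventually (\<lambda>h. norm ((joukowski_inv (of_real x + h) - joukowski_inv (of_real x)) / h) < norm D + 1) (at 0)"
    by (rule order_tendstoD) simp
  then obtain d1 where d1: "d1 > 0" "\<And>h. h \<noteq> 0 \<Longrightarrow> dist h 0 < d1 \<Longrightarrow> norm ((joukowski_inv (of_real x + h) - joukowski_inv (of_real x)) / h) < norm D + 1"
    unfolding eventually_at by auto
  \<comment> \<open>The second bound keeps the image within \<open>1 / 4\<close> of the circle, so
    that \<open>norm w \<ge> 3 / 4\<close> below.\<close>
  define T where "T = min d1 (1 / (4 * (norm D + 1)))"
  have p: "norm D + 1 > 0" by (simp add: add_nonneg_pos)
  have T: "T > 0" using d1 p by (simp add: T_def)
  show ?thesis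
  proof (rule that[OF T])
    show "2 * (norm D + 1) \<ge> 0" using p by simp
    fix t assume t: "0 < t" "t < T"
    define w where "w = joukowski_inv (of_real x + \<i> * of_real t)"
    have "norm ((joukowski_inv (of_real x + \<i> * of_real t) - joukowski_inv (of_real x)) / (\<i> * of_real t)) < norm D + 1"
      using t by (intro d1) (auto simp: T_def norm_mult)
    then have 1: "norm (w - cpt x) \<le> (norm D + 1) * t"
      using t x by (simp add: joukowski_inv_real w_def norm_divide norm_mult field_simps)
    also have "\<dots> \<le> (norm D + 1) * T" using t p by (intro mult_left_mono) auto
    also have "\<dots> \<le> (norm D + 1) * (1 / (4 * (norm D + 1)))" using p by (intro mult_left_mono) (auto simp: T_def)
    also have "\<dots> = 1 / 4" using p by simp
    finally have "norm (w - cpt x) \<le> 1 / 4" .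
    then have w34: "norm w \<ge> 3 / 4" using x norm_triangle_ineq2[of "cpt x" w] by (simp add: norm_minus_commute)
    have wd: "w \<in> half_disc" unfolding w_def using t by (intro joukowski_inv_in_half_disc) auto
    then have w1: "norm w < 1" "Re w > 0" by (auto simp: half_disc_def)
    have "Re w * (1 / (norm w)\<^sup>2 - 1) / 2 = t"
      using Im_joukowski[OF joukowski_inv_nonzero, of "of_real x + \<i> * of_real t"] by (simp add: joukowski_joukowski_inv w_def)
    then have "2 * t = Re w * (1 / (norm w)\<^sup>2 - 1)" by simp
    also have "\<dots> \<le> 1 * (1 / (norm w)\<^sup>2 - 1)"
    proof (rule mult_right_mono)
      have "(norm w)\<^sup>2 \<le> 1" "(norm w)\<^sup>2 > 0" using w1 w34 by (auto simp: power_le_one)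
      then show "0 \<le> 1 / (norm w)\<^sup>2 - 1" by simp
    qed (use w1 complex_Re_le_cmod[of w] in linarith)
    finally have "2 * t * (norm w)\<^sup>2 \<le> (1 / (norm w)\<^sup>2 - 1) * (norm w)\<^sup>2" by (intro mult_right_mono) auto
    also have "\<dots> = 1 - (norm w)\<^sup>2" using w34 by (auto simp: left_diff_distrib)
    finally have "2 * t * (norm w)\<^sup>2 \<le> 1 - (norm w)\<^sup>2" .
    moreover have "(3 / 4)\<^sup>2 \<le> (norm w)\<^sup>2" using w34 by (intro power_mono) auto
    then have "t \<le> 2 * t * (norm w)\<^sup>2" using t by (simp add: power2_eq_square)
    moreover have "1 - (norm w)\<^sup>2 = (1 - norm w) * (1 + norm w)" by (simp add: power2_eq_square algebra_simps)
    moreover have "(1 - norm w) * (1 + norm w) \<le> (1 - norm w) * 2" using w1 by (intro mult_left_mono) auto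
    ultimately have "t \<le> (1 - norm w) * 2" by linarith
    then have "(norm D + 1) * t \<le> (norm D + 1) * ((1 - norm w) * 2)" using p by (intro mult_left_mono) auto
    then show "norm (joukowski_inv (of_real x + \<i> * of_real t) - cpt x) \<le> 2 * (norm D + 1) * (1 - norm (joukowski_inv (of_real x + \<i> * of_real t)))"
      using 1 unfolding w_def by (simp only: mult_ac)
  qed
qed

lemma MVT_interior:
  fixes f :: "real \<Rightarrow> real"
  assumes "a < b" "continuous_on {a..b} f" "\<And>x. a < x \<Longrightarrow> x < b \<Longrightarrow> (f has_real_derivative f' x) (at x)"
  shows "\<exists>z>a. z < b \<and> f b - f a = (b - a) * f' z"
proof -
  obtain z where "a < z" "z < b" "f b - f a = f' z * (b - a)"
    by (rule mvt[OF assms(1,2), of "\<lambda>x h. f' x * h"]) (use assms(3) in \<open>auto simp: has_field_derivative_def\<close>)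
  then show ?thesis by (auto simp: mult.commute)
qed

context half_order
begin

text \<open>A Hopf-type argument. If \<open>u\<close> exceeded the potential somewhere,
  \<open>u - Re gpot - \<delta> * sqrt (1 - x\<^sup>2)\<close> would have a positive maximum
  \<open>m\<close> at an interior \<open>x0\<close>. The maximum principle carries the bound
  \<open>m\<close> into the half-plane, so moving up from \<open>x0\<close> the Poisson extension
  falls at least as fast as the comparison function. The rates are \<open>h x0\<close> and
  \<open>h x0 + \<delta>\<close>, a contradiction.\<close>

lemma le_Re_gpot:
  assumes hc: "continuous_on UNIV h"
    and h: "\<And>x y. \<bar>x\<bar> \<le> 1 \<Longrightarrow> \<bar>y\<bar> \<le> 1 \<Longrightarrow> \<bar>h y - h x\<bar> \<le> B * sqrt (norm (cpt y - cpt x))" "B \<ge> 0"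
    and N: "\<And>x. \<bar>x\<bar> < 1 \<Longrightarrow> ((\<lambda>t. (u x - pois u x t) / t) \<longlongrightarrow> h x) (at_right 0)"
    and x1: "\<bar>x1\<bar> \<le> 1"
  shows "u x1 \<le> Re (gpot h (cpt x1))"
proof (rule ccontr)
  assume neg: "\<not> ?thesis"
  have hm: "h \<in> borel_measurable borel" using hc by (rule borel_measurable_continuous_onI)
  obtain A where A: "\<And>y. y \<in> {-1..1} \<Longrightarrow> \<bar>h y\<bar> \<le> A"
    using compact_imp_bounded[OF compact_continuous_image[OF continuous_on_subset[OF hc], of "{-1..1}"]]
    by (auto simp: bounded_iff) (metis atLeastAtMost_iff)
  then have A': "\<And>y. y \<in> {-1<..<1} \<Longrightarrow> \<bar>h y\<bar> \<le> A" by auto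
  have A'': "\<bar>h y\<bar> \<le> A" if "\<bar>y\<bar> \<le> 1" for y using A[of y] that by (simp add: abs_le_iff[of y])
  note gc = gpot_continuous_on[OF hm A']
  define d where "d = u x1 - Re (gpot h (cpt x1))"
  have d: "d > 0" using neg by (simp add: d_def)
  \<comment> \<open>The penalty \<open>\<delta> * sqrt (1 - x\<^sup>2)\<close> is at most
    \<open>d / 2\<close>, so half of the excess \<open>d\<close> at \<open>x1\<close>
    survives.\<close>
  define \<delta> where "\<delta> = d / 2"
  define \<phi> where "\<phi> = (\<lambda>x. u x - Re (gpot h (cpt x)) - \<delta> * sqrt (1 - x\<^sup>2))"
  have "continuous_on {-1..1} \<phi>" unfolding \<phi>_def
    by (intro continuous_intros continuous_on_compose2[OF gc]) auto
  then obtain x0 where x0: "x0 \<in> {-1..1}" "\<And>x. x \<in> {-1..1} \<Longrightarrow> \<phi> x \<le> \<phi> x0"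
    using continuous_attains_sup[of "{-1..1}" \<phi>] by auto
  define m where "m = \<phi> x0"
  have "\<phi> x1 \<ge> d / 2"
  proof -
    have "sqrt (1 - x1\<^sup>2) \<le> 1" by simp
    then have "\<delta> * sqrt (1 - x1\<^sup>2) \<le> \<delta> * 1" using d by (intro mult_left_mono) (auto simp: \<delta>_def)
    then show ?thesis by (simp add: \<phi>_def d_def \<delta>_def)
  qed
  then have m: "m > 0" using x0(2)[of x1] x1 d unfolding m_def by (auto simp: abs_le_iff)
  have "\<bar>x0\<bar> \<noteq> 1"
  proof
    assume *: "\<bar>x0\<bar> = 1"
    then have "x0\<^sup>2 = 1" by (metis power2_abs one_power2)
    moreover from this have "Re (gpot h (cpt x0)) = 0"
      using * by (intro Re_gpot_imaginary[OF _ _ hm A']) auto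
    moreover have "x0 \<notin> {-1<..<1}" using * by auto
    ultimately have "\<phi> x0 = 0" using out[of x0] by (simp add: \<phi>_def)
    then show False using m by (simp add: m_def)
  qed
  then have x0': "\<bar>x0\<bar> < 1" using x0(1) by auto
  have main: "pois u x0 t - Re (gpot h (joukowski_inv (of_real x0 + \<i> * of_real t))) - \<delta> * Re (joukowski_inv (of_real x0 + \<i> * of_real t)) \<le> m" if "t > 0" for t
    using pois_minus_gpot_le[OF hc _ _ joukowski_inv_in_half_disc[of "of_real x0 + \<i> * of_real t"], of m \<delta>] that m x0(2)
    by (auto simp: joukowski_joukowski_inv \<phi>_def m_def abs_le_iff)
  obtain T C where T: "T > 0" "C \<ge> 0"
    "\<And>t. 0 < t \<Longrightarrow> t < T \<Longrightarrow> norm (joukowski_inv (of_real x0 + \<i> * of_real t) - cpt x0) \<le> C * (1 - norm (joukowski_inv (of_real x0 + \<i> * of_real t)))"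
    using joukowski_inv_vertical_nontangential[OF x0'] by blast
  define c where "c = (\<lambda>t. complex_of_real x0 + \<i> * of_real t)"
  define p where "p = (\<lambda>t. Re (gpot h (joukowski_inv (c t)) + of_real \<delta> * joukowski_inv (c t)))"
  define S where "S = (\<lambda>t. csqrt (1 - (c t)\<^sup>2))"
  define p' where "p' = (\<lambda>t. - Re (joukowski_inv (c t) * (gpot' h (joukowski_inv (c t)) + of_real \<delta>) / S t))"
  have nn: "1 - (c t)\<^sup>2 \<notin> \<real>\<^sub>\<le>\<^sub>0" if "t \<ge> 0" for t
    using that x0' by (intro one_minus_square_not_nonpos) (auto simp: c_def)
  have hd: "joukowski_inv (c t) \<in> half_disc" if "t > 0" for t using that by (intro joukowski_inv_in_half_disc) (simp add: c_def)
  have omc: "continuous_on {0..} (\<lambda>t. joukowski_inv (c t))"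
    using nn by (intro continuous_on_compose2[OF continuous_on_joukowski_inv]) (auto simp: c_def intro!: continuous_intros)
  have omle: "norm (joukowski_inv (c t)) \<le> 1" if "t \<ge> 0" for t
  proof (cases "t = 0")
    case True
    then show ?thesis using x0' by (simp add: c_def joukowski_inv_real)
  next
    case False
    then show ?thesis using hd[of t] that by (simp add: half_disc_def)
  qed
  have pc: "continuous_on {0..} p" unfolding p_def
    using omle by (intro continuous_intros continuous_on_compose2[OF gc omc] omc) auto
  have pd: "(p has_real_derivative p' t) (at t)" if t: "t > 0" for t
  proof -
    have w: "norm (joukowski_inv (c t)) < 1" using hd[OF t] by (simp add: half_disc_def)
    have o: "(joukowski_inv has_field_derivative \<i> * joukowski_inv (c t) / S t) (at (c t))"
      unfolding S_def using t by (intro has_field_derivative_joukowski_inv nn) auto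
    have "((\<lambda>z. gpot h (joukowski_inv z)) has_field_derivative gpot' h (joukowski_inv (c t)) * (\<i> * joukowski_inv (c t) / S t)) (at (c t))"
      by (rule DERIV_chain2[where f = "gpot h" and g = joukowski_inv, OF has_field_derivative_gpot[OF w hc] o])
    then have d1: "((\<lambda>z. gpot h (joukowski_inv z) + of_real \<delta> * joukowski_inv z) has_field_derivative
            gpot' h (joukowski_inv (c t)) * (\<i> * joukowski_inv (c t) / S t) + of_real \<delta> * (\<i> * joukowski_inv (c t) / S t)) (at (c t))"
      by (intro DERIV_add DERIV_cmult o)
    have d2: "(c has_vector_derivative \<i>) (at t)"
      unfolding c_def by (auto intro!: derivative_eq_intros simp: scaleR_conv_of_real)
    have "((\<lambda>t. gpot h (joukowski_inv (c t)) + of_real \<delta> * joukowski_inv (c t)) has_vector_derivative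
        \<i> * (gpot' h (joukowski_inv (c t)) * (\<i> * joukowski_inv (c t) / S t) + of_real \<delta> * (\<i> * joukowski_inv (c t) / S t))) (at t)"
      using field_vector_diff_chain_at[OF d2 d1] by (simp only: o_def)
    from bounded_linear.has_vector_derivative[OF bounded_linear_Re this]
    have "(p has_vector_derivative Re (\<i> * (gpot' h (joukowski_inv (c t)) * (\<i> * joukowski_inv (c t) / S t) + of_real \<delta> * (\<i> * joukowski_inv (c t) / S t)))) (at t)"
      by (simp only: p_def)
    also have "\<i> * (gpot' h (joukowski_inv (c t)) * (\<i> * joukowski_inv (c t) / S t) + of_real \<delta> * (\<i> * joukowski_inv (c t) / S t)) = - (joukowski_inv (c t) * (gpot' h (joukowski_inv (c t)) + of_real \<delta>) / S t)"
    proof -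
      have "\<i> * (g * (\<i> * q) + d * (\<i> * q)) = - (q * (g + d))" for g d q :: complex
        by (simp add: complex_eq_iff algebra_simps)
      from this[of _ "joukowski_inv (c t) / S t"] show ?thesis by (simp only: times_divide_eq_right times_divide_eq_left)
    qed
    finally show ?thesis by (simp only: p'_def has_real_derivative_iff_has_vector_derivative uminus_complex.sel)
  qed
  define t where "t = (\<lambda>n::nat. T / real (n + 2))"
  have t: "0 < t n" "t n < T" for n
    using T(1) mult_strict_left_mono[of 1 "real (n + 2)" T] by (auto simp: t_def pos_divide_less_eq)
  have tl: "t \<longlonglongrightarrow> 0" unfolding t_def by real_asymp
  \<comment> \<open>The derivative of \<open>p\<close> is available only for positive heights. The
    mean value theorem turns the difference quotient at the boundary into such a derivative, where
    \<open>nontangential_limit\<close> applies.\<close>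
  have "\<exists>\<xi>. 0 < \<xi> \<and> \<xi> < t n \<and> p (t n) - p 0 = t n * p' \<xi>" for n
  proof -
    have "\<exists>z>0. z < t n \<and> p (t n) - p 0 = (t n - 0) * p' z"
      by (rule MVT_interior) (use t pd pc in \<open>auto intro: continuous_on_subset\<close>)
    then show ?thesis by auto
  qed
  then obtain \<xi> where \<xi>: "\<And>n. 0 < \<xi> n" "\<And>n. \<xi> n < t n" "\<And>n. p (t n) - p 0 = t n * p' (\<xi> n)" by metis
  have \<xi>l: "\<xi> \<longlonglongrightarrow> 0"
    by (rule real_tendsto_sandwich[OF _ _ tendsto_const tl]) (use \<xi> in \<open>auto intro!: always_eventually less_imp_le\<close>)
  define w where "w = (\<lambda>n. joukowski_inv (c (\<xi> n)))"
  have wl: "w \<longlonglongrightarrow> cpt x0"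
  proof -
    have "(\<lambda>n. joukowski_inv (c (\<xi> n))) \<longlonglongrightarrow> joukowski_inv (c 0)"
      by (rule continuous_on_tendsto_compose[OF omc \<xi>l]) (use \<xi> in \<open>auto intro!: always_eventually less_imp_le\<close>)
    then show ?thesis using x0' by (simp add: w_def c_def joukowski_inv_real)
  qed
  have Sl: "(\<lambda>n. S (\<xi> n)) \<longlonglongrightarrow> of_real (sqrt (1 - x0\<^sup>2))"
  proof -
    have "S = (\<lambda>t. joukowski_inv (c t) - \<i> * c t)" by (simp add: S_def joukowski_inv_def)
    then have "continuous_on {0..} S"
      by (simp only:) (intro continuous_intros omc, auto simp: c_def intro!: continuous_intros)
    then have "(\<lambda>n. S (\<xi> n)) \<longlonglongrightarrow> S 0"
      by (rule continuous_on_tendsto_compose[OF _ \<xi>l]) (use \<xi> in \<open>auto intro!: always_eventually less_imp_le\<close>)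
    moreover have "S 0 = joukowski_inv (of_real x0) - \<i> * of_real x0" by (simp add: S_def c_def joukowski_inv_def)
    then have "S 0 = of_real (sqrt (1 - x0\<^sup>2))" using x0' by (simp add: joukowski_inv_real complex_eq_iff)
    ultimately show ?thesis by simp
  qed
  define s0 where "s0 = sqrt (1 - x0\<^sup>2)"
  have s0: "s0 > 0" using x0' by (simp add: s0_def abs_square_less_1)
  have wd: "norm (w n) < 1" "Re (w n) > 0" for n using hd[OF \<xi>(1)] by (auto simp: w_def half_disc_def)
  have ml: "(\<lambda>n. Re (w n * gpot' h (w n))) \<longlonglongrightarrow> h x0 * s0"
    unfolding s0_def
  proof (rule nontangential_limit[where C = C and B = B])
    show "norm (w n - cpt x0) \<le> C * (1 - norm (w n))" for n
      using T(3)[of "\<xi> n"] \<xi>(1,2)[of n] t(2)[of n] by (simp add: w_def c_def)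
    show "\<bar>h y - h x0\<bar> \<le> B * sqrt (norm (cpt y - cpt x0))" if "\<bar>y\<bar> \<le> 1" for y using that x0' by (intro h) auto
  qed (use x0' wd wl T hc h(2) in \<open>auto intro: less_imp_le\<close>)
  define q where "q = (\<lambda>n. w n * (gpot' h (w n) + of_real \<delta>))"
  have ql: "(\<lambda>n. Re (q n)) \<longlonglongrightarrow> h x0 * s0 + \<delta> * s0"
  proof -
    have "(\<lambda>n. Re (w n * gpot' h (w n)) + \<delta> * Re (w n)) \<longlonglongrightarrow> h x0 * s0 + \<delta> * Re (cpt x0)"
      by (intro tendsto_intros ml wl)
    then show ?thesis by (simp add: q_def s0_def algebra_simps)
  qed
  define K where "K = A + 32 * B + \<delta>"
  have qb: "norm (q n) \<le> K" for n
  proof -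
    have "norm (gpot' h (w n)) \<le> A + 32 * B"
      by (rule gpot_lipschitz(1)[OF hc h A'']) (use wd in auto)
    then have 1: "norm (gpot' h (w n) + of_real \<delta>) \<le> K"
      using norm_triangle_ineq[of "gpot' h (w n)" "of_real \<delta>"] d by (simp add: K_def \<delta>_def)
    have "norm (q n) \<le> 1 * norm (gpot' h (w n) + of_real \<delta>)"
      unfolding q_def norm_mult using wd(1)[of n] by (intro mult_right_mono) auto
    then show ?thesis using 1 by simp
  qed
  have rl: "(\<lambda>n. 1 / S (\<xi> n)) \<longlonglongrightarrow> of_real (1 / s0)"
    using tendsto_divide[OF tendsto_const Sl, of 1] s0 by (simp add: s0_def)
  \<comment> \<open>Only the real part of \<open>q n\<close> is known to converge. Its imaginary
    part is bounded and is multiplied by \<open>Im (1 / S)\<close>, which tends to 0 because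
    \<open>S\<close> has a real limit.\<close>
  have "(\<lambda>n. Im (q n) * Im (1 / S (\<xi> n))) \<longlonglongrightarrow> 0"
  proof (rule Lim_null_comparison)
    show "\<forall>\<^sub>F n in sequentially. norm (Im (q n) * Im (1 / S (\<xi> n))) \<le> K * \<bar>Im (1 / S (\<xi> n))\<bar>"
      using order_trans[OF abs_Im_le_cmod qb] by (intro always_eventually allI) (auto simp: abs_mult intro!: mult_right_mono)
    have "(\<lambda>n. K * \<bar>Im (1 / S (\<xi> n))\<bar>) \<longlonglongrightarrow> K * \<bar>Im (complex_of_real (1 / s0))\<bar>"
      by (intro tendsto_intros rl)
    then show "(\<lambda>n. K * \<bar>Im (1 / S (\<xi> n))\<bar>) \<longlonglongrightarrow> 0" by simp
  qed
  then have "(\<lambda>n. - (Re (q n) * Re (1 / S (\<xi> n)) - Im (q n) * Im (1 / S (\<xi> n)))) \<longlonglongrightarrow> - ((h x0 * s0 + \<delta> * s0) * Re (complex_of_real (1 / s0)) - 0)"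
    by (intro tendsto_intros ql rl)
  moreover have "p' (\<xi> n) = - (Re (q n) * Re (1 / S (\<xi> n)) - Im (q n) * Im (1 / S (\<xi> n)))" for n
  proof -
    have "p' (\<xi> n) = - Re (q n * (1 / S (\<xi> n)))" by (simp add: p'_def q_def w_def)
    then show ?thesis by (simp only: times_complex.sel)
  qed
  ultimately have p'l: "(\<lambda>n. p' (\<xi> n)) \<longlonglongrightarrow> - (h x0 + \<delta>)"
    using s0 by (simp add: distrib_right[symmetric])
  have "(\<lambda>n. (u x0 - pois u x0 (t n)) / t n) \<longlonglongrightarrow> h x0"
    by (rule filterlim_compose[OF N[OF x0']], rule tendsto_imp_filterlim_at_right[OF tl]) (use t(1) in auto)
  moreover have "- p' (\<xi> n) \<le> (u x0 - pois u x0 (t n)) / t n" for n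
  proof -
    have "pois u x0 (t n) - p (t n) \<le> m" using main[OF t(1)] by (simp add: p_def c_def algebra_simps)
    moreover have "p 0 = u x0 - m" using x0' by (simp add: p_def c_def joukowski_inv_real m_def \<phi>_def algebra_simps)
    ultimately have "- (t n * p' (\<xi> n)) \<le> u x0 - pois u x0 (t n)" using \<xi>(3)[of n] by linarith
    then show ?thesis using t(1)[of n] by (simp add: field_simps)
  qed
  moreover have "(\<lambda>n. - p' (\<xi> n)) \<longlonglongrightarrow> - (- (h x0 + \<delta>))" by (intro tendsto_intros p'l)
  ultimately have "- (- (h x0 + \<delta>)) \<le> h x0" by (intro LIMSEQ_le) auto
  then show False using d by (simp add: \<delta>_def)
qed

end

section \<open>The half-Laplacian as a normal derivative\<close>

lemma smooth_on_deriv: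
  assumes "smooth_on U f" "open U" "x \<in> U"
  shows "((deriv ^^ n) f has_real_derivative (deriv ^^ Suc n) f x) (at x)"
proof -
  have "(deriv ^^ n) f differentiable (at x)"
    using assms by (auto simp: smooth_on_def differentiable_on_eq_differentiable_at)
  then show ?thesis by (simp add: DERIV_deriv_iff_real_differentiable)
qed

context half_order
begin

definition "Df x s = 2 * u x - u (x + s) - u (x - s)"

lemma measurable_Df [measurable]: "Df x \<in> borel_measurable borel"
  unfolding Df_def by measurable

text \<open>Near 0 the second difference is of order \<open>s\<^sup>2\<close> by smoothness around
  \<open>x\<close>; elsewhere it is at most \<open>4 * M\<close>. The weight
  \<open>1 + s\<^sup>2\<close> merges both regimes into a single majorant
  \<open>K / (1 + s\<^sup>2)\<close> for \<open>Df x s / s\<^sup>2\<close>.\<close>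

lemma second_difference_bound:
  assumes sm: "smooth_on {-1<..<1} u" and x: "\<bar>x\<bar> < 1"
  obtains K where "K \<ge> 0" "\<And>s. \<bar>Df x s\<bar> * (1 + s\<^sup>2) \<le> K * s\<^sup>2"
proof -
  define \<delta> where "\<delta> = (1 - \<bar>x\<bar>) / 2"
  have \<delta>: "\<delta> > 0" "\<delta> \<le> 1" using x by (auto simp: \<delta>_def)
  have inI: "y \<in> {-1<..<1}" if "y \<in> {x - \<delta>..x + \<delta>}" for y
    using that x by (auto simp: \<delta>_def abs_if field_simps split: if_splits)
  note d = smooth_on_deriv[OF sm open_greaterThanLessThan]
  have d0: "(u has_real_derivative deriv u y) (at y)" if "y \<in> {x - \<delta>..x + \<delta>}" for y
    using d[OF inI[OF that], of 0] by simp
  have d1: "(deriv u has_real_derivative deriv (deriv u) y) (at y)" if "y \<in> {x - \<delta>..x + \<delta>}" for y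
    using d[OF inI[OF that], of 1] by simp
  have d2: "(deriv (deriv u) has_real_derivative deriv (deriv (deriv u)) y) (at y)" if "y \<in> {x - \<delta>..x + \<delta>}" for y
    using d[OF inI[OF that], of 2] by (simp add: numeral_2_eq_2)
  have "continuous_on {x - \<delta>..x + \<delta>} (deriv (deriv u))"
    using d2 DERIV_isCont by (blast intro: continuous_at_imp_continuous_on)
  then have "bounded (deriv (deriv u) ` {x - \<delta>..x + \<delta>})"
    by (intro compact_imp_bounded compact_continuous_image) auto
  then obtain C where C: "\<And>y. y \<in> {x - \<delta>..x + \<delta>} \<Longrightarrow> \<bar>deriv (deriv u) y\<bar> \<le> C"
    unfolding bounded_iff by (metis imageI real_norm_def)
  have C0: "C \<ge> 0" using C[of x] \<delta> by auto
  have near: "\<bar>Df x s\<bar> \<le> 2 * C * s\<^sup>2" if s: "\<bar>s\<bar> \<le> \<delta>" for s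
  proof -
    define \<phi> where "\<phi> = (\<lambda>s. u (x + s) + u (x - s))"
    have "norm (\<phi> s - \<phi> 0) \<le> (2 * C * \<bar>s\<bar>) * norm (s - 0)"
    proof (rule field_differentiable_bound[of "{-\<bar>s\<bar>..\<bar>s\<bar>}" \<phi> "\<lambda>s. deriv u (x + s) - deriv u (x - s)"])
      fix r assume r: "r \<in> {-\<bar>s\<bar>..\<bar>s\<bar>}"
      then have m: "x + r \<in> {x - \<delta>..x + \<delta>}" "x - r \<in> {x - \<delta>..x + \<delta>}" using s by auto
      have "((\<lambda>s. u (x + s)) has_real_derivative deriv u (x + r) * 1) (at r)"
        by (rule DERIV_chain2[where f = u and g = "\<lambda>s. x + s", OF d0[OF m(1)]]) (auto intro!: derivative_eq_intros)
      moreover have "((\<lambda>s. u (x - s)) has_real_derivative deriv u (x - r) * (-1)) (at r)"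
        by (rule DERIV_chain2[where f = u and g = "\<lambda>s. x - s", OF d0[OF m(2)]]) (auto intro!: derivative_eq_intros)
      ultimately have "(\<phi> has_real_derivative deriv u (x + r) * 1 + deriv u (x - r) * (-1)) (at r)"
        unfolding \<phi>_def by (rule DERIV_add)
      then show "(\<phi> has_real_derivative deriv u (x + r) - deriv u (x - r)) (at r within {-\<bar>s\<bar>..\<bar>s\<bar>})"
        by (simp add: has_field_derivative_at_within)
      have "norm (deriv u (x + r) - deriv u (x - r)) \<le> C * norm ((x + r) - (x - r))"
        by (rule field_differentiable_bound[of "{x - \<delta>..x + \<delta>}" _ "deriv (deriv u)"])
           (use d1 C m in \<open>auto intro: has_field_derivative_at_within\<close>)
      also have "\<dots> \<le> C * (2 * \<bar>s\<bar>)" using r C0 by (intro mult_left_mono) auto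
      finally show "norm (deriv u (x + r) - deriv u (x - r)) \<le> 2 * C * \<bar>s\<bar>" by simp
    qed auto
    also have "\<dots> = 2 * C * s\<^sup>2" by (simp add: power2_eq_square)
    finally show ?thesis by (simp add: \<phi>_def Df_def abs_minus_commute algebra_simps)
  qed
  have far: "\<bar>Df x s\<bar> \<le> 4 * M" for s
    using bound[of x] bound[of "x + s"] bound[of "x - s"] by (simp add: Df_def)
  define K where "K = 4 * C + 4 * M * (1 / \<delta>\<^sup>2 + 1)"
  have K2: "4 * M * (1 / \<delta>\<^sup>2 + 1) \<ge> 0" using M_nonneg by simp
  show ?thesis
  proof (rule that)
    show "K \<ge> 0" using C0 K2 by (simp add: K_def)
    fix s
    show "\<bar>Df x s\<bar> * (1 + s\<^sup>2) \<le> K * s\<^sup>2"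
    proof (cases "\<bar>s\<bar> \<le> \<delta>")
      case True
      then have "s\<^sup>2 \<le> 1" using \<delta> by (simp add: abs_square_le_1)
      then have "\<bar>Df x s\<bar> * (1 + s\<^sup>2) \<le> (2 * C * s\<^sup>2) * 2" using near[OF True] C0 by (intro mult_mono) auto
      also have "\<dots> \<le> 4 * C * s\<^sup>2 + 4 * M * (1 / \<delta>\<^sup>2 + 1) * s\<^sup>2"
        using mult_nonneg_nonneg[OF K2 zero_le_power2[of s]] by simp
      also have "\<dots> = K * s\<^sup>2" by (simp only: K_def distrib_right)
      finally show ?thesis .
    next
      case False
      then have "\<delta>\<^sup>2 \<le> \<bar>s\<bar>\<^sup>2" using \<delta> by (intro power_mono) auto
      then have "1 \<le> s\<^sup>2 / \<delta>\<^sup>2" using \<delta> by simp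
      then have "1 + s\<^sup>2 \<le> (1 / \<delta>\<^sup>2 + 1) * s\<^sup>2" by (simp add: algebra_simps)
      then have "\<bar>Df x s\<bar> * (1 + s\<^sup>2) \<le> (4 * M) * ((1 / \<delta>\<^sup>2 + 1) * s\<^sup>2)"
        using far[of s] M_nonneg by (intro mult_mono) auto
      also have "\<dots> \<le> 4 * C * s\<^sup>2 + 4 * M * (1 / \<delta>\<^sup>2 + 1) * s\<^sup>2"
        using mult_nonneg_nonneg[OF C0 zero_le_power2[of s]] by simp
      also have "\<dots> = K * s\<^sup>2" by (simp only: K_def distrib_right)
      finally show ?thesis .
    qed
  qed
qed

text \<open>Against an even kernel the odd part of the increment cancels. This is what makes the
  principal value absolutely convergent at a point of smoothness.\<close>

lemma symmetrized_integral:
  assumes k: "\<And>s. k (- s) = k s" and i: "integrable lborel (\<lambda>s. (u x - u (x + s)) * k s)"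
  shows "(\<integral>s. (u x - u (x + s)) * k s \<partial>lborel) = (\<integral>s. Df x s * k s \<partial>lborel) / 2"
proof -
  have i': "integrable lborel (\<lambda>s. (u x - u (x - s)) * k s)"
    using lborel_integrable_real_affine[OF i, of "-1" 0] by (simp add: k)
  have e: "(\<integral>s. (u x - u (x - s)) * k s \<partial>lborel) = (\<integral>s. (u x - u (x + s)) * k s \<partial>lborel)"
    using lborel_integral_real_affine[of "-1" "\<lambda>s. (u x - u (x + s)) * k s" 0] by (simp add: k)
  have "(\<integral>s. Df x s * k s \<partial>lborel) = (\<integral>s. (u x - u (x + s)) * k s + (u x - u (x - s)) * k s \<partial>lborel)"
    by (intro Bochner_Integration.integral_cong) (auto simp: Df_def algebra_simps)
  then show ?thesis using i i' e by simp
qed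

text \<open>The conditions are met by the cut-off kernels of the principal value and by the kernels
  \<open>1 / (s\<^sup>2 + t\<^sup>2)\<close> of the Poisson quotient, so both limits are the same
  integral.\<close>

lemma second_difference_integral_limit:
  assumes sm: "smooth_on {-1<..<1} u" and x: "\<bar>x\<bar> < 1"
    and k: "\<And>n. k n \<in> borel_measurable borel" "\<And>n s. 0 \<le> k n s" "\<And>n s. k n s * s\<^sup>2 \<le> 1"
      "\<And>s. s \<noteq> 0 \<Longrightarrow> (\<lambda>n. k n s) \<longlonglongrightarrow> 1 / s\<^sup>2"
  shows "(\<lambda>n. \<integral>s. Df x s * k n s \<partial>lborel) \<longlonglongrightarrow> (\<integral>s. Df x s / s\<^sup>2 \<partial>lborel)"
proof -
  note [measurable] = k(1)
  obtain K where K: "K \<ge> 0" "\<And>s. \<bar>Df x s\<bar> * (1 + s\<^sup>2) \<le> K * s\<^sup>2"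
    using second_difference_bound[OF sm x] by blast
  show ?thesis
  proof (rule integral_dominated_convergence)
    show "integrable lborel (\<lambda>s. K * (1 / (1 + s\<^sup>2)))" by (rule integrable_over_one_plus_square)
    show "AE s in lborel. (\<lambda>n. Df x s * k n s) \<longlonglongrightarrow> Df x s / s\<^sup>2"
      using AE_lborel_neq[of 0]
    proof eventually_elim
      case (elim s)
      show ?case using tendsto_mult_left[OF k(4)[OF elim], of "Df x s"] by simp
    qed
    show "AE s in lborel. norm (Df x s * k n s) \<le> K * (1 / (1 + s\<^sup>2))" for n
    proof (intro AE_I2)
      fix s :: real
      have p: "1 + s\<^sup>2 > 0" by (simp add: add_pos_nonneg)
      have "\<bar>Df x s\<bar> * (1 + s\<^sup>2) * k n s \<le> K * s\<^sup>2 * k n s" using K k by (intro mult_right_mono) auto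
      also have "K * s\<^sup>2 * k n s = K * (k n s * s\<^sup>2)" by simp
      also have "\<dots> \<le> K * 1" using K k by (intro mult_left_mono) auto
      finally have "(\<bar>Df x s\<bar> * k n s) * (1 + s\<^sup>2) \<le> K" by (simp add: mult_ac)
      then show "norm (Df x s * k n s) \<le> K * (1 / (1 + s\<^sup>2))"
        using p k(2)[of n s] by (simp add: abs_mult pos_le_divide_eq)
    qed
  qed measurable
qed

lemma pois_quotient:
  assumes t: "t > 0"
  shows "(u x - pois u x t) / t = (\<integral>s. Df x s * (1 / (s\<^sup>2 + t\<^sup>2)) \<partial>lborel) / (2 * pi)"
proof -
  define g where "g = (\<lambda>s. (u x - u (x + s)) * (1 / (s\<^sup>2 + t\<^sup>2)))"
  define h where "h = (\<lambda>s. u x * (1 / (1 + s\<^sup>2)) - u (x + t * s) / (1 + s\<^sup>2))"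
  have gh: "g (0 + t * s) = h s / t\<^sup>2" for s
  proof -
    have "(t * s)\<^sup>2 + t\<^sup>2 = t\<^sup>2 * (1 + s\<^sup>2)" by (simp add: power2_eq_square algebra_simps)
    then have "g (0 + t * s) = (u x - u (x + t * s)) * (1 / (t\<^sup>2 * (1 + s\<^sup>2)))" by (simp add: g_def)
    also have "\<dots> = (u x - u (x + t * s)) / (1 + s\<^sup>2) / t\<^sup>2" by (simp add: mult.commute)
    also have "\<dots> = h s / t\<^sup>2" by (simp add: h_def diff_divide_distrib)
    finally show ?thesis .
  qed
  have i: "integrable lborel h" unfolding h_def
    by (intro Bochner_Integration.integrable_diff integrable_over_one_plus_square pois_eq t)
  have "(\<integral>s. h s \<partial>lborel) = (\<integral>s. u x * (1 / (1 + s\<^sup>2)) \<partial>lborel) - (\<integral>s. u (x + t * s) / (1 + s\<^sup>2) \<partial>lborel)"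
    unfolding h_def by (intro Bochner_Integration.integral_diff integrable_over_one_plus_square pois_eq t)
  also have "\<dots> = pi * (u x - pois u x t)"
    unfolding integral_mult_right_zero integral_inverse_one_plus_square(2) by (simp add: pois_eq[OF t] algebra_simps)
  finally have hi: "(\<integral>s. h s \<partial>lborel) = pi * (u x - pois u x t)" .
  have "integrable lborel (\<lambda>s. g (0 + t * s))" using i unfolding gh by simp
  then have gi: "integrable lborel g" using t by (subst (asm) lborel_integrable_real_affine_iff) auto
  have "(\<integral>s. g s \<partial>lborel) = t * (\<integral>s. h s / t\<^sup>2 \<partial>lborel)"
    using lborel_integral_real_affine[of t g 0] t unfolding gh by simp
  also have "\<dots> = pi * ((u x - pois u x t) / t)" using t by (simp add: hi power2_eq_square)
  finally have 1: "(\<integral>s. g s \<partial>lborel) = pi * ((u x - pois u x t) / t)" .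
  have 2: "(\<integral>s. g s \<partial>lborel) = (\<integral>s. Df x s * (1 / (s\<^sup>2 + t\<^sup>2)) \<partial>lborel) / 2"
    unfolding g_def by (rule symmetrized_integral) (use gi in \<open>auto simp: g_def\<close>)
  have "(u x - pois u x t) / t = pi * ((u x - pois u x t) / t) / pi" by simp
  also have "\<dots> = (\<integral>s. Df x s * (1 / (s\<^sup>2 + t\<^sup>2)) \<partial>lborel) / 2 / pi"
    by (simp only: 1[symmetric] 2)
  finally show ?thesis by simp
qed

text \<open>
  The half-Laplacian is the Dirichlet-to-Neumann map of the Poisson extension.
\<close>

lemma normal_derivative:
  assumes sm: "smooth_on {-1<..<1} u" and x: "\<bar>x\<bar> < 1" and hl: "has_half_laplacian u x v"
  shows "((\<lambda>t. (u x - pois u x t) / t) \<longlongrightarrow> v) (at_right 0)"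
proof -
  define J where "J = (\<integral>s. Df x s / s\<^sup>2 \<partial>lborel)"
  obtain V where V: "has_pv_integral (\<lambda>y. (u x - u y) / (x - y)\<^sup>2) x V" "v = 1 / pi * V"
    using hl by (auto simp: has_half_laplacian_def)
  have VJ: "V = J / 2"
  proof -
    define \<epsilon> where "\<epsilon> = (\<lambda>n. 1 / real (Suc n))"
    have \<epsilon>: "\<epsilon> n > 0" for n by (simp add: \<epsilon>_def)
    have \<epsilon>l: "\<epsilon> \<longlonglongrightarrow> 0" unfolding \<epsilon>_def by real_asymp
    have "filterlim \<epsilon> (at_right 0) sequentially"
      using \<epsilon> by (intro tendsto_imp_filterlim_at_right[OF \<epsilon>l]) auto
    then have 1: "(\<lambda>n. LBINT y:{y. \<epsilon> n < \<bar>x - y\<bar>}. (u x - u y) / (x - y)\<^sup>2) \<longlonglongrightarrow> V"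
      using V(1) unfolding has_pv_integral_def by (auto intro: filterlim_compose)
    define k where "k = (\<lambda>n s. indicator {s. \<epsilon> n < \<bar>s\<bar>} s * (1 / s\<^sup>2) :: real)"
    have eq: "(LBINT y:{y. \<epsilon> n < \<bar>x - y\<bar>}. (u x - u y) / (x - y)\<^sup>2) = (\<integral>s. Df x s * k n s \<partial>lborel) / 2" for n
    proof -
      define g where "g = (\<lambda>y. indicator {y. \<epsilon> n < \<bar>x - y\<bar>} y *\<^sub>R ((u x - u y) / (x - y)\<^sup>2))"
      have gk: "g (x + s) = (u x - u (x + s)) * k n s" for s
        by (auto simp: g_def k_def indicator_def)
      have gi: "integrable lborel g"
        using V(1) \<epsilon>[of n] unfolding has_pv_integral_def set_integrable_def g_def by blast
      have "integrable lborel (\<lambda>s. g (x + s))" using gi by (simp add: lborel_integrable_shift)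
      then have "(\<integral>s. g (x + s) \<partial>lborel) = (\<integral>s. Df x s * k n s \<partial>lborel) / 2"
        unfolding gk by (intro symmetrized_integral) (auto simp: k_def indicator_def)
      then show ?thesis
        unfolding lborel_integrable_shift by (simp add: g_def set_lebesgue_integral_def)
    qed
    have lim: "(\<lambda>n. \<integral>s. Df x s * k n s \<partial>lborel) \<longlonglongrightarrow> J"
      unfolding J_def
    proof (rule second_difference_integral_limit[OF sm x])
      show "k n \<in> borel_measurable borel" for n unfolding k_def by measurable
      show "0 \<le> k n s" "k n s * s\<^sup>2 \<le> 1" for n s by (auto simp: k_def indicator_def)
      show "(\<lambda>n. k n s) \<longlonglongrightarrow> 1 / s\<^sup>2" if "s \<noteq> 0" for s
      proof (rule tendsto_eventually)
        have "\<forall>\<^sub>F n in sequentially. \<epsilon> n < \<bar>s\<bar>" using order_tendstoD(2)[OF \<epsilon>l, of "\<bar>s\<bar>"] that by simp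
        then show "\<forall>\<^sub>F n in sequentially. k n s = 1 / s\<^sup>2" by eventually_elim (simp add: k_def)
      qed
    qed
    have "(\<lambda>n. LBINT y:{y. \<epsilon> n < \<bar>x - y\<bar>}. (u x - u y) / (x - y)\<^sup>2) \<longlonglongrightarrow> J / 2"
      unfolding eq by (rule tendsto_divide[OF lim tendsto_const]) simp
    with 1 show ?thesis by (rule LIMSEQ_unique)
  qed
  have v: "v = J / (2 * pi)" by (simp add: V(2) VJ)
  show ?thesis
  proof (rule tendsto_at_right_sequentially[of 0 1])
    fix t :: "nat \<Rightarrow> real" assume t: "\<And>n. 0 < t n" "t \<longlonglongrightarrow> 0"
    have "(\<lambda>n. \<integral>s. Df x s * (1 / (s\<^sup>2 + (t n)\<^sup>2)) \<partial>lborel) \<longlonglongrightarrow> J"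
      unfolding J_def
    proof (rule second_difference_integral_limit[OF sm x])
      show "0 \<le> 1 / (s\<^sup>2 + (t n)\<^sup>2)" "1 / (s\<^sup>2 + (t n)\<^sup>2) * s\<^sup>2 \<le> 1" for n s
        using t(1)[of n] by (auto simp: divide_le_eq_1 add_pos_nonneg add_nonneg_pos)
      show "(\<lambda>n. 1 / (s\<^sup>2 + (t n)\<^sup>2)) \<longlonglongrightarrow> 1 / s\<^sup>2" if "s \<noteq> 0" for s
      proof -
        have "(\<lambda>n. 1 / (s\<^sup>2 + (t n)\<^sup>2)) \<longlonglongrightarrow> 1 / (s\<^sup>2 + 0\<^sup>2)"
          using that by (intro tendsto_intros t) auto
        then show ?thesis by simp
      qed
    qed measurable
    then have "(\<lambda>n. (\<integral>s. Df x s * (1 / (s\<^sup>2 + (t n)\<^sup>2)) \<partial>lborel) / (2 * pi)) \<longlonglongrightarrow> v"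
      unfolding v by (intro tendsto_divide tendsto_const) auto
    then show "(\<lambda>n. (u x - pois u x (t n)) / t n) \<longlonglongrightarrow> v" using t by (simp add: pois_quotient)
  qed auto
qed

end

lemma half_order_minus: "half_order u L \<Longrightarrow> half_order (\<lambda>x. - u x) L"
  unfolding half_order_def by (auto simp: abs_minus_commute)

lemma pois_minus: "pois (\<lambda>x. - u x) x t = - pois u x t"
  by (simp add: pois_def set_lebesgue_integral_def)

context half_order
begin

text \<open>The one-sided comparison \<open>le_Re_gpot\<close> is applied to \<open>u\<close> and to
  \<open>- u\<close>, all hypotheses being symmetric under the change of sign.\<close>

lemma eq_Re_gpot:
  assumes sm: "smooth_on {-1<..<1} u" and hc: "continuous_on UNIV h"
    and h: "\<And>x y. \<bar>x\<bar> \<le> 1 \<Longrightarrow> \<bar>y\<bar> \<le> 1 \<Longrightarrow> \<bar>h y - h x\<bar> \<le> B * sqrt (norm (cpt y - cpt x))" "B \<ge> 0"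
    and hl: "\<And>x. \<bar>x\<bar> < 1 \<Longrightarrow> has_half_laplacian u x (h x)"
    and x: "\<bar>x\<bar> \<le> 1"
  shows "u x = Re (gpot h (cpt x))"
proof (rule antisym)
  note N = normal_derivative[OF sm _ hl]
  show "u x \<le> Re (gpot h (cpt x))" by (rule le_Re_gpot[OF hc h N x])
  have "- u x \<le> Re (gpot (\<lambda>y. - h y) (cpt x))"
  proof (rule half_order.le_Re_gpot[OF half_order_minus[OF half_order_axioms]])
    show "continuous_on UNIV (\<lambda>y. - h y)" by (intro continuous_intros hc)
    show "\<bar>- h y - - h x\<bar> \<le> B * sqrt (norm (cpt y - cpt x))" if "\<bar>x\<bar> \<le> 1" "\<bar>y\<bar> \<le> 1" for x y
      using h(1)[OF that] by (simp add: abs_minus_commute)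
    show "((\<lambda>t. (- u x - pois (\<lambda>x. - u x) x t) / t) \<longlongrightarrow> - h x) (at_right 0)" if "\<bar>x\<bar> < 1" for x
      using tendsto_minus[OF N[OF that that]] by (simp add: pois_minus minus_divide_left)
  qed (rule h x)+
  then show "Re (gpot h (cpt x)) \<le> u x" by (simp add: gpot_minus)
qed

end

section \<open>Moment identities\<close>

lemma has_integral_sin_substitution:
  fixes q :: "real \<Rightarrow> real"
  assumes "continuous_on {-1..1} q"
  shows "((\<lambda>t. cos t * q (sin t)) has_integral integral {-1..1} q) {-pi/2..pi/2}"
proof -
  have "((\<lambda>t. cos t *\<^sub>R q (sin t)) has_integral integral {sin (-pi/2)..sin (pi/2)} q) {-pi/2..pi/2}"
  proof (rule has_integral_substitution[where c = "-1" and d = 1])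
    show "(sin has_real_derivative cos x) (at x within {-pi/2..pi/2})" for x by (auto intro!: derivative_eq_intros)
  qed (auto simp: sin_minus assms)
  then show ?thesis by (simp add: sin_minus)
qed

text \<open>Under either symmetry the values on the left half circle are, up to sign, conjugate to
  those on the right, so one component doubles in the folded integral.\<close>

lemma half_circle_Re_Im:
  fixes F :: "complex \<Rightarrow> complex"
  assumes F: "F holomorphic_on ball 0 1" and r: "0 < r" "r < 1"
  shows "(\<And>w. F (- cnj w) = cnj (F w)) \<Longrightarrow> ((\<lambda>t. Re (F (of_real r * cis t))) has_integral pi * Re (F 0)) {-pi/2..pi/2}"
    and "(\<And>w. F (- cnj w) = - cnj (F w)) \<Longrightarrow> ((\<lambda>t. Im (F (of_real r * cis t))) has_integral pi * Im (F 0)) {-pi/2..pi/2}"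
proof -
  have c: "- (of_real r * cis (- t)) = - cnj (of_real r * cis t)" for t by (simp add: cis_cnj)
  note mv = half_circle_mean_value[OF F r, unfolded c]
  show "((\<lambda>t. Re (F (of_real r * cis t))) has_integral pi * Re (F 0)) {-pi/2..pi/2}"
    if "\<And>w. F (- cnj w) = cnj (F w)"
  proof -
    have "((\<lambda>t. Re (F (of_real r * cis t) + F (- cnj (of_real r * cis t)))) has_integral Re (2 * pi * F 0)) {-pi/2..pi/2}"
      using mv by (rule has_integral_Re)
    then have "((\<lambda>t. 2 * Re (F (of_real r * cis t))) has_integral 2 * (pi * Re (F 0))) {-pi/2..pi/2}"
      unfolding that by (simp add: mult.assoc)
    from has_integral_mult_right[OF this, of "1/2"] show ?thesis by simp
  qed
  show "((\<lambda>t. Im (F (of_real r * cis t))) has_integral pi * Im (F 0)) {-pi/2..pi/2}"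
    if "\<And>w. F (- cnj w) = - cnj (F w)"
  proof -
    have "((\<lambda>t. Im (F (of_real r * cis t) + F (- cnj (of_real r * cis t)))) has_integral Im (2 * pi * F 0)) {-pi/2..pi/2}"
      using mv by (rule has_integral_Im)
    then have "((\<lambda>t. 2 * Im (F (of_real r * cis t))) has_integral 2 * (pi * Im (F 0))) {-pi/2..pi/2}"
      unfolding that by (simp add: mult.assoc)
    from has_integral_mult_right[OF this, of "1/2"] show ?thesis by simp
  qed
qed

text \<open>
  Mean value property of \<open>w ^ m * (w * gpot' h w)\<^sup>2\<close> for suitable \<open>m\<close>. On the boundary arc the imaginary part
  of the square is a multiple of the derivative of \<open>exp u\<close> when \<open>h\<close> is the right-hand side of the equation, which turns
  these two identities into \<open>first_moment\<close> and \<open>second_moment\<close> below.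
\<close>

lemma gpot'_squared_moments:
  assumes hc: "continuous_on UNIV h" and r: "0 < r" "r < 1"
  defines "H \<equiv> \<lambda>t. of_real r * cis t * gpot' h (of_real r * cis t)"
  shows "((\<lambda>t. cos t * Im ((H t)\<^sup>2)) has_integral 0) {-pi/2..pi/2}"
    and "((\<lambda>t. sin (2 * t) * Im ((H t)\<^sup>2)) has_integral pi * r\<^sup>2 * (Re (gpot' h 0))\<^sup>2 / 2) {-pi/2..pi/2}"
proof -
  note hol = gpot'_holomorphic[OF hc]
  \<comment> \<open>Items 1 to 4 are \<open>m = 1, -1, 2, -2\<close>. The first two combine to the
    factor \<open>2 * cos t\<close>, the last two to \<open>sin (2 * t)\<close>. Only
    \<open>m = -2\<close> has a nonzero value at the centre; it becomes the right-hand side of the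
    second identity.\<close>
  have 1: "((\<lambda>t. Im ((of_real r * cis t) ^ 3 * (gpot' h (of_real r * cis t))\<^sup>2)) has_integral pi * Im (0 ^ 3 * (gpot' h 0)\<^sup>2)) {-pi/2..pi/2}"
    by (rule half_circle_Re_Im(2)[OF _ r]) (auto intro!: holomorphic_intros hol simp: gpot'_reflect power3_eq_cube power2_eq_square)
  have 2: "((\<lambda>t. Im (of_real r * cis t * (gpot' h (of_real r * cis t))\<^sup>2)) has_integral pi * Im (0 * (gpot' h 0)\<^sup>2)) {-pi/2..pi/2}"
    by (rule half_circle_Re_Im(2)[OF _ r]) (auto intro!: holomorphic_intros hol simp: gpot'_reflect power2_eq_square)
  have 3: "((\<lambda>t. Re ((of_real r * cis t) ^ 4 * (gpot' h (of_real r * cis t))\<^sup>2)) has_integral pi * Re (0 ^ 4 * (gpot' h 0)\<^sup>2)) {-pi/2..pi/2}"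
    by (rule half_circle_Re_Im(1)[OF _ r]) (auto intro!: holomorphic_intros hol simp: gpot'_reflect power4_eq_xxxx power2_eq_square)
  have 4: "((\<lambda>t. Re ((gpot' h (of_real r * cis t))\<^sup>2)) has_integral pi * Re ((gpot' h 0)\<^sup>2)) {-pi/2..pi/2}"
    by (rule half_circle_Re_Im(1)[OF _ r]) (auto intro!: holomorphic_intros hol simp: gpot'_reflect power2_eq_square)
  have im0: "Im (gpot' h 0) = 0"
    using gpot'_reflect[of h 0] by (simp add: complex_eq_iff)
  define G where "G = (\<lambda>t. (gpot' h (of_real r * cis t))\<^sup>2)"
  have H2: "(H t)\<^sup>2 = of_real (r\<^sup>2) * (cis (2 * t) * G t)" for t
    by (simp add: H_def G_def power_mult_distrib Complex.DeMoivre)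
  have ReIm: "Re (of_real c * z) = c * Re z" "Im (of_real c * z) = c * Im z" for c z by simp_all
  have c3: "(of_real r * cis t) ^ 3 * G t = of_real (r ^ 3) * (cis (3 * t) * G t)"
    and c4: "(of_real r * cis t) ^ 4 * G t = of_real (r ^ 4) * (cis (4 * t) * G t)" for t
    by (simp_all add: power_mult_distrib Complex.DeMoivre)
  show "((\<lambda>t. cos t * Im ((H t)\<^sup>2)) has_integral 0) {-pi/2..pi/2}"
  proof -
    have "((\<lambda>t. 1 / (2 * r) * Im ((of_real r * cis t) ^ 3 * G t) + r / 2 * Im (of_real r * cis t * G t)) has_integral 1 / (2 * r) * 0 + r / 2 * 0) {-pi/2..pi/2}"
      using 1 2 unfolding G_def by (intro has_integral_add has_integral_mult_right) auto
    moreover have "1 / (2 * r) * Im ((of_real r * cis t) ^ 3 * G t) + r / 2 * Im (of_real r * cis t * G t) = cos t * Im ((H t)\<^sup>2)" for t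
    proof -
      have "cis (3 * t) + cis t = of_real (2 * cos t) * cis (2 * t)"
      proof -
        have "cis (3 * t) = cis (2 * t) * cis t" "cis t = cis (2 * t) * cis (- t)" by (simp_all add: cis_mult)
        then have "cis (3 * t) + cis t = cis (2 * t) * (cis t + cis (- t))" by (simp only: distrib_left)
        moreover have "cis t + cis (- t) = of_real (2 * cos t)" by (simp add: complex_eq_iff)
        ultimately show ?thesis by (simp only: mult.commute)
      qed
      then have "Im (cis (3 * t) * G t) + Im (cis t * G t) = 2 * cos t * Im (cis (2 * t) * G t)"
        by (metis ReIm(2) distrib_right mult.assoc plus_complex.sel(2))
      moreover have "1 / (2 * r) * Im ((of_real r * cis t) ^ 3 * G t) = r\<^sup>2 / 2 * Im (cis (3 * t) * G t)"
        unfolding c3 ReIm using r by (simp add: power2_eq_square power3_eq_cube)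
      moreover have "r / 2 * Im (of_real r * cis t * G t) = r\<^sup>2 / 2 * Im (cis t * G t)"
        unfolding mult.assoc ReIm by (simp add: power2_eq_square)
      moreover have "cos t * Im ((H t)\<^sup>2) = r\<^sup>2 / 2 * (2 * cos t * Im (cis (2 * t) * G t))"
        unfolding H2 ReIm by simp
      ultimately show ?thesis by (simp only: distrib_left[symmetric])
    qed
    ultimately show ?thesis by simp
  qed
  show "((\<lambda>t. sin (2 * t) * Im ((H t)\<^sup>2)) has_integral pi * r\<^sup>2 * (Re (gpot' h 0))\<^sup>2 / 2) {-pi/2..pi/2}"
  proof -
    have "((\<lambda>t. r\<^sup>2 / 2 * Re (G t) - 1 / (2 * r\<^sup>2) * Re ((of_real r * cis t) ^ 4 * G t)) has_integral r\<^sup>2 / 2 * (pi * Re ((gpot' h 0)\<^sup>2)) - 1 / (2 * r\<^sup>2) * 0) {-pi/2..pi/2}"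
      using 3 4 unfolding G_def by (intro has_integral_diff has_integral_mult_right) auto
    moreover have "r\<^sup>2 / 2 * Re (G t) - 1 / (2 * r\<^sup>2) * Re ((of_real r * cis t) ^ 4 * G t) = sin (2 * t) * Im ((H t)\<^sup>2)" for t
    proof -
      have "1 - cis (4 * t) = - \<i> * (of_real (2 * sin (2 * t)) * cis (2 * t))"
      proof -
        have "cis (4 * t) = cis (2 * t) * cis (2 * t)" "1 = cis (2 * t) * cis (- (2 * t))" by (simp_all add: cis_mult)
        then have "1 - cis (4 * t) = cis (2 * t) * (cis (- (2 * t)) - cis (2 * t))" by (simp only: right_diff_distrib)
        moreover have "cis (- (2 * t)) - cis (2 * t) = - \<i> * of_real (2 * sin (2 * t))" by (simp add: complex_eq_iff)
        ultimately show ?thesis by (simp only: mult_ac)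
      qed
      then have "G t - cis (4 * t) * G t = - \<i> * (of_real (2 * sin (2 * t)) * (cis (2 * t) * G t))"
        by (metis left_diff_distrib mult.assoc mult_1)
      then have "Re (G t - cis (4 * t) * G t) = Re (- \<i> * (of_real (2 * sin (2 * t)) * (cis (2 * t) * G t)))" by (rule arg_cong)
      also have "\<dots> = 2 * sin (2 * t) * Im (cis (2 * t) * G t)"
        by (simp only: mult_minus_left uminus_complex.sel Re_i_times ReIm minus_minus)
      finally have "Re (G t) - Re (cis (4 * t) * G t) = 2 * sin (2 * t) * Im (cis (2 * t) * G t)" by (simp only: minus_complex.sel)
      moreover have "1 / (2 * r\<^sup>2) * Re ((of_real r * cis t) ^ 4 * G t) = r\<^sup>2 / 2 * Re (cis (4 * t) * G t)"
        unfolding c4 ReIm using r by (simp add: power2_eq_square power4_eq_xxxx)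
      moreover have "sin (2 * t) * Im ((H t)\<^sup>2) = r\<^sup>2 / 2 * (2 * sin (2 * t) * Im (cis (2 * t) * G t))"
        unfolding H2 ReIm by simp
      ultimately show ?thesis by (simp only: right_diff_distrib[symmetric])
    qed
    ultimately show ?thesis using im0 by (simp add: Re_power2 mult_ac)
  qed
qed

context half_order
begin

lemma exp_holder:
  assumes "c \<ge> 0"
  shows "\<bar>c * exp (u y) - c * exp (u x)\<bar> \<le> (c * exp M * L) * sqrt (norm (cpt y - cpt x))"
proof -
  have "norm (exp (u y) - exp (u x)) \<le> exp M * norm (u y - u x)"
  proof (rule field_differentiable_bound[of "{-M..M}" exp exp])
    show "(exp has_real_derivative exp z) (at z within {-M..M})" for z by (auto intro!: derivative_eq_intros)
  qed (use bound[of x] bound[of y] in \<open>auto simp: abs_le_iff\<close>)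
  also have "\<dots> \<le> exp M * (L * sqrt \<bar>y - x\<bar>)" using hol[of y x] by simp
  also have "\<dots> \<le> exp M * (L * sqrt (norm (cpt y - cpt x)))"
    using abs_Im_le_cmod[of "cpt y - cpt x"] L by (intro mult_left_mono real_sqrt_le_mono) auto
  finally have "\<bar>exp (u y) - exp (u x)\<bar> \<le> exp M * (L * sqrt (norm (cpt y - cpt x)))" by simp
  then have "c * \<bar>exp (u y) - exp (u x)\<bar> \<le> c * (exp M * (L * sqrt (norm (cpt y - cpt x))))" using assms by (intro mult_left_mono) auto
  then show ?thesis using assms by (simp add: abs_mult right_diff_distrib[symmetric] mult_ac)
qed

end

text \<open>From here on the equation enters only in the integrated form \<open>repr\<close>;
  \<open>lam\<close> stands for the mass divided by the integral of \<open>exp u\<close>.\<close>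

locale liouville = half_order u L for u L +
  fixes lam :: real and f :: "real \<Rightarrow> real"
  assumes lam: "lam > 0" and f_def: "f = (\<lambda>y. lam * exp (u y))"
    and repr: "\<And>x. \<bar>x\<bar> \<le> 1 \<Longrightarrow> u x = Re (gpot f (cpt x))"
begin

lemma lam0: "lam \<noteq> 0" using lam by simp

lemma f_pos: "f x > 0" using lam by (simp add: f_def)

lemma f_cont: "continuous_on UNIV f" unfolding f_def by (intro continuous_intros cont)

lemma f_meas [measurable]: "f \<in> borel_measurable borel"
  using f_cont by (rule borel_measurable_continuous_onI)

lemma f_le: "\<bar>f x\<bar> \<le> lam * exp M"
  using lam bound[of x] by (simp add: f_def abs_mult abs_le_iff)

lemma f_holder: "\<bar>x\<bar> \<le> 1 \<Longrightarrow> \<bar>y\<bar> \<le> 1 \<Longrightarrow> \<bar>f y - f x\<bar> \<le> (lam * exp M * L) * sqrt (norm (cpt y - cpt x))"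
  using exp_holder[of lam y x] lam by (simp add: f_def)

text \<open>Write \<open>Im (H\<^sup>2) = 2 * Re H * Im H\<close> on the circle of radius
  \<open>r n\<close>. There \<open>- Im H\<close> is the derivative of
  \<open>a n = Re (gpot f)\<close> along the circle, while \<open>Re H\<close> tends to
  \<open>lam * exp u * cos t\<close>. After this replacement \<open>exp (a n) * Im H\<close> is a
  total derivative, and integration by parts moves it onto \<open>Y * cos\<close>.\<close>

lemma moment_limit:
  fixes Y Z' :: "real \<Rightarrow> real"
  assumes Y: "continuous_on UNIV Y" "\<And>t. \<bar>Y t\<bar> \<le> 1" and Z': "continuous_on UNIV Z'"
    "\<And>t. ((\<lambda>t. Y t * cos t) has_real_derivative Z' t) (at t)"
    and I: "\<And>r. 0 < r \<Longrightarrow> r < 1 \<Longrightarrow> ((\<lambda>t. Y t * Im ((of_real r * cis t * gpot' f (of_real r * cis t))\<^sup>2)) has_integral c * r\<^sup>2) {-pi/2..pi/2}"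
  shows "2 * lam * integral {-pi/2..pi/2} (\<lambda>t. Z' t * exp (u (sin t))) = c"
proof -
  define D where "D = {-pi/2..pi/2}"
  define B where "B = lam * exp M * L"
  have B: "B \<ge> 0" using lam L by (simp add: B_def)
  note fh = f_holder[folded B_def]
  define A where "A = lam * exp M"
  have A: "\<bar>f x\<bar> \<le> A" for x using f_le by (simp add: A_def)
  define K where "K = A + 32 * B"
  have K: "norm (gpot' f w) \<le> K" if "norm w < 1" for w unfolding K_def
    by (rule gpot_lipschitz(1)[OF f_cont fh B A that])
  define r where "r = (\<lambda>n::nat. 1 - 1 / real (n + 2))"
  have r: "0 < r n" "r n < 1" for n by (auto simp: r_def field_simps)
  have rl: "r \<longlonglongrightarrow> 1" unfolding r_def by real_asymp
  define w where "w = (\<lambda>n t. of_real (r n) * cis t)"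
  have w1: "norm (w n t) < 1" for n t using r[of n] by (simp add: w_def norm_mult)
  define H where "H = (\<lambda>n t. w n t * gpot' f (w n t))"
  have HK: "norm (H n t) \<le> K" for n t
  proof -
    have "norm (H n t) \<le> 1 * norm (gpot' f (w n t))" unfolding H_def norm_mult using w1[of n t] by (intro mult_right_mono) auto
    then show ?thesis using K[OF w1, of n t] by simp
  qed
  have K0: "K \<ge> 0" using HK[of 0 0] norm_ge_zero order_trans by blast
  define a where "a = (\<lambda>n t. Re (gpot f (w n t)))"
  have ga: "continuous_on (cball 0 1) (gpot f)" by (rule gpot_continuous_on[OF f_meas A])
  have wc: "continuous_on S (w n)" for S n unfolding w_def by (intro continuous_intros)
  have ac: "continuous_on S (a n)" for S n unfolding a_def
    by (intro continuous_intros continuous_on_compose2[OF ga wc]) (use less_imp_le[OF w1] in auto)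
  have Hc: "continuous_on S (H n)" for S n unfolding H_def
    by (intro continuous_intros wc continuous_on_compose2[OF holomorphic_on_imp_continuous_on[OF gpot'_holomorphic[OF f_cont]] wc]) (use w1 in auto)
  have Yc: "continuous_on S Y" for S using Y(1) continuous_on_subset by blast
  have Z'c: "continuous_on S Z'" for S using Z'(1) continuous_on_subset by blast
  have ad: "(a n has_real_derivative - Im (H n t)) (at t)" for n t
  proof -
    have d1: "((\<lambda>t. \<i> * complex_of_real t) has_vector_derivative \<i>) (at t)"
      by (auto intro!: derivative_eq_intros simp: scaleR_conv_of_real)
    have "(cis has_vector_derivative \<i> * cis t) (at t)"
      using field_vector_diff_chain_at[OF d1 DERIV_exp] by (simp only: o_def cis_conv_exp[symmetric])
    from bounded_linear.has_vector_derivative[OF bounded_linear_mult_right this]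
    have "(w n has_vector_derivative of_real (r n) * (\<i> * cis t)) (at t)" by (simp only: w_def)
    then have d2: "(w n has_vector_derivative \<i> * w n t) (at t)" by (simp add: w_def mult_ac)
    from field_vector_diff_chain_at[OF d2 has_field_derivative_gpot[OF w1 f_cont]]
    have "((\<lambda>t. gpot f (w n t)) has_vector_derivative \<i> * w n t * gpot' f (w n t)) (at t)" by (simp only: o_def)
    from bounded_linear.has_vector_derivative[OF bounded_linear_Re this]
    have "(a n has_vector_derivative Re (\<i> * w n t * gpot' f (w n t))) (at t)" by (simp only: a_def)
    also have "Re (\<i> * w n t * gpot' f (w n t)) = - Im (H n t)" unfolding H_def mult.assoc by (rule Re_i_times)
    finally show ?thesis by (simp only: has_real_derivative_iff_has_vector_derivative)
  qed
  \<comment> \<open>The error of the replacement, with \<open>a n\<close> still in place of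
    \<open>u\<close>. It is bounded because \<open>H\<close> is, and tends to 0 pointwise although
    \<open>Im H\<close> need not converge.\<close>
  define F where "F = (\<lambda>n t. Y t * (Re (H n t) - lam * exp (a n t) * cos t) * Im (H n t))"
  have al: "(\<lambda>n. a n t) \<longlonglongrightarrow> u (sin t)" if "t \<in> D" for t
  proof -
    have t: "\<bar>t\<bar> \<le> pi / 2" using that by (auto simp: D_def abs_le_iff)
    have "(\<lambda>n. w n t) \<longlonglongrightarrow> of_real 1 * cis t" unfolding w_def by (intro tendsto_intros rl)
    then have "(\<lambda>n. w n t) \<longlonglongrightarrow> cpt (sin t)" using t by (simp add: cpt_sin)
    then have "(\<lambda>n. gpot f (w n t)) \<longlonglongrightarrow> gpot f (cpt (sin t))"
      by (intro continuous_on_tendsto_compose[OF ga]) (use w1 in \<open>auto intro!: always_eventually less_imp_le\<close>)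
    then have "(\<lambda>n. a n t) \<longlonglongrightarrow> Re (gpot f (cpt (sin t)))" unfolding a_def by (rule tendsto_Re)
    then show ?thesis using repr[of "sin t"] by simp
  qed
  have a_le: "\<bar>a n t\<bar> \<le> gpot_const (1/2) * A" for n t
  proof -
    have "norm (gpot f (w n t) - gpot f 0) \<le> gpot_const (1/2) * A * norm (w n t - 0) powr (1/2)"
      using w1[of n t] by (intro gpot_holder f_meas A) auto
    also have "\<dots> \<le> gpot_const (1/2) * A * 1"
      using w1[of n t] gpot_const_nonneg[of "1/2"] A[of 0]
      by (intro mult_left_mono powr_le1) (auto intro!: mult_nonneg_nonneg)
    finally show ?thesis using abs_Re_le_cmod[of "gpot f (w n t)"] unfolding a_def by simp
  qed
  have Hl: "(\<lambda>n. Re (H n t)) \<longlonglongrightarrow> lam * exp (u (sin t)) * cos t" if "t \<in> D" for t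
  proof -
    have t: "\<bar>t\<bar> \<le> pi / 2" using that by (auto simp: D_def abs_le_iff)
    have c: "cpt (sin t) = cis t" using t by (rule cpt_sin)
    have ct: "cos t \<ge> 0" using t by (intro cos_ge_zero) (auto simp: abs_le_iff)
    have "(\<lambda>n. Re (w n t * gpot' f (w n t))) \<longlonglongrightarrow> f (sin t) * sqrt (1 - (sin t)\<^sup>2)"
    proof (rule nontangential_limit[where C = 1 and B = B])
      show "(\<lambda>n. w n t) \<longlonglongrightarrow> cpt (sin t)"
      proof -
        have "(\<lambda>n. w n t) \<longlonglongrightarrow> of_real 1 * cis t" unfolding w_def by (intro tendsto_intros rl)
        then show ?thesis by (simp add: c)
      qed
      show "norm (w n t - cpt (sin t)) \<le> 1 * (1 - norm (w n t))" for n
      proof -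
        have "w n t - cpt (sin t) = of_real (r n - 1) * cis t" by (simp add: w_def c algebra_simps)
        then have "norm (w n t - cpt (sin t)) = \<bar>r n - 1\<bar>" by (simp only: norm_mult norm_of_real norm_cis mult_1_right)
        then show ?thesis using r[of n] by (simp add: w_def norm_mult)
      qed
      show "0 \<le> Re (w n t)" for n using ct r[of n] by (simp add: w_def)
    qed (use w1 f_cont fh B in auto)
    moreover have "sqrt (1 - (sin t)\<^sup>2) = cos t" using ct by (simp add: cos_squared_eq[symmetric])
    ultimately show ?thesis by (simp add: H_def f_def)
  qed
  have Flim: "(\<lambda>n. integral D (F n)) \<longlonglongrightarrow> integral D (\<lambda>t. 0)"
  proof (rule dominated_convergence(2))
    show "F n integrable_on D" for n unfolding F_def D_def
      by (intro integrable_continuous_real continuous_intros ac Hc Yc)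
    show "(\<lambda>t. (K + lam * exp (gpot_const (1/2) * A)) * K) integrable_on D" unfolding D_def by (rule integrable_const_ivl)
    show "norm (F n t) \<le> (K + lam * exp (gpot_const (1/2) * A)) * K" if "t \<in> D" for n t
    proof -
      have 1: "\<bar>Re (H n t)\<bar> \<le> K" "\<bar>Im (H n t)\<bar> \<le> K"
        using HK[of n t] abs_Re_le_cmod[of "H n t"] abs_Im_le_cmod[of "H n t"] by linarith+
      have "\<bar>lam * exp (a n t) * cos t\<bar> \<le> lam * exp (gpot_const (1/2) * A) * 1"
        unfolding abs_mult using lam a_le[of n t] by (intro mult_mono) auto
      then have 2: "\<bar>Re (H n t) - lam * exp (a n t) * cos t\<bar> \<le> K + lam * exp (gpot_const (1/2) * A)" using 1(1) by linarith
      have "norm (F n t) \<le> 1 * (K + lam * exp (gpot_const (1/2) * A)) * K"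
        unfolding F_def real_norm_def abs_mult
        using 1(2) 2 Y(2)[of t] K0 lam by (intro mult_mono) auto
      then show ?thesis by simp
    qed
    show "(\<lambda>n. F n t) \<longlonglongrightarrow> 0" if "t \<in> D" for t
    proof (rule Lim_null_comparison)
      show "\<forall>\<^sub>F n in sequentially. norm (F n t) \<le> \<bar>Re (H n t) - lam * exp (a n t) * cos t\<bar> * K"
      proof (intro always_eventually allI)
        fix n
        have "\<bar>Im (H n t)\<bar> \<le> K" using HK[of n t] abs_Im_le_cmod[of "H n t"] by linarith
        then have "norm (F n t) \<le> 1 * \<bar>Re (H n t) - lam * exp (a n t) * cos t\<bar> * K"
          unfolding F_def real_norm_def abs_mult using Y(2)[of t] by (intro mult_mono) auto
        then show "norm (F n t) \<le> \<bar>Re (H n t) - lam * exp (a n t) * cos t\<bar> * K" by simp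
      qed
      have "(\<lambda>n. \<bar>Re (H n t) - lam * exp (a n t) * cos t\<bar> * K) \<longlonglongrightarrow> \<bar>lam * exp (u (sin t)) * cos t - lam * exp (u (sin t)) * cos t\<bar> * K"
        by (intro tendsto_intros Hl al that)
      then show "(\<lambda>n. \<bar>Re (H n t) - lam * exp (a n t) * cos t\<bar> * K) \<longlonglongrightarrow> 0" by simp
    qed
  qed
  have Elim: "(\<lambda>n. integral D (\<lambda>t. Z' t * exp (a n t))) \<longlonglongrightarrow> integral D (\<lambda>t. Z' t * exp (u (sin t)))"
  proof (rule dominated_convergence(2))
    show "(\<lambda>t. Z' t * exp (a n t)) integrable_on D" for n unfolding D_def
      by (intro integrable_continuous_real continuous_intros ac Z'c)
    show "(\<lambda>t. \<bar>Z' t\<bar> * exp (gpot_const (1/2) * A)) integrable_on D" unfolding D_def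
      by (intro integrable_continuous_real continuous_intros Z'c)
    show "norm (Z' t * exp (a n t)) \<le> \<bar>Z' t\<bar> * exp (gpot_const (1/2) * A)" for n t
      using a_le[of n t] by (auto simp: abs_mult intro!: mult_left_mono)
    show "(\<lambda>n. Z' t * exp (a n t)) \<longlonglongrightarrow> Z' t * exp (u (sin t))" if "t \<in> D" for t
      by (intro tendsto_intros al that)
  qed
  have eq: "c * (r n)\<^sup>2 = 2 * integral D (F n) + 2 * lam * integral D (\<lambda>t. Z' t * exp (a n t))" for n
  proof -
    \<comment> \<open>The factor \<open>cos t\<close> makes the boundary terms vanish at
      \<open>pi / 2\<close> and \<open>- pi / 2\<close>, that is, at the endpoints of the
      interval.\<close>
    define q where "q = (\<lambda>t. Y t * cos t * exp (a n t))"
    have "((\<lambda>t. Z' t * exp (a n t) - Y t * cos t * exp (a n t) * Im (H n t)) has_integral q (pi/2) - q (-pi/2)) D"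
      unfolding D_def
    proof (rule fundamental_theorem_of_calculus)
      fix t assume "t \<in> {- pi / 2..pi / 2}"
      have "((\<lambda>t. exp (a n t)) has_real_derivative exp (a n t) * (- Im (H n t))) (at t)"
        by (rule DERIV_chain2[where f = exp, OF DERIV_exp ad])
      from DERIV_mult[OF Z'(2) this]
      have "(q has_real_derivative Z' t * exp (a n t) + exp (a n t) * (- Im (H n t)) * (Y t * cos t)) (at t)"
        by (simp only: q_def)
      also have "Z' t * exp (a n t) + exp (a n t) * (- Im (H n t)) * (Y t * cos t) = Z' t * exp (a n t) - Y t * cos t * exp (a n t) * Im (H n t)" by simp
      finally show "(q has_vector_derivative Z' t * exp (a n t) - Y t * cos t * exp (a n t) * Im (H n t)) (at t within {- pi / 2..pi / 2})"
        by (simp only: has_real_derivative_iff_has_vector_derivative has_vector_derivative_at_within)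
    qed simp
    moreover have "q (pi / 2) = 0" "q (- pi / 2) = 0" by (auto simp: q_def)
    ultimately have 1: "integral D (\<lambda>t. Z' t * exp (a n t) - Y t * cos t * exp (a n t) * Im (H n t)) = 0" by (simp add: integral_unique)
    have i1: "(\<lambda>t. Z' t * exp (a n t)) integrable_on D" unfolding D_def
      by (intro integrable_continuous_real continuous_intros ac Z'c)
    have i2: "(\<lambda>t. Y t * cos t * exp (a n t) * Im (H n t)) integrable_on D" unfolding D_def
      by (intro integrable_continuous_real continuous_intros ac Hc Yc)
    have i3: "F n integrable_on D" unfolding F_def D_def
      by (intro integrable_continuous_real continuous_intros ac Hc Yc)
    have 2: "integral D (\<lambda>t. Z' t * exp (a n t)) = integral D (\<lambda>t. Y t * cos t * exp (a n t) * Im (H n t))"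
      using 1 integral_diff[OF i1 i2] by simp
    have "c * (r n)\<^sup>2 = integral D (\<lambda>t. Y t * Im ((H n t)\<^sup>2))"
      using integral_unique[OF I[OF r, of n]] by (simp only: D_def H_def w_def)
    also have "(\<lambda>t. Y t * Im ((H n t)\<^sup>2)) = (\<lambda>t. 2 * F n t + 2 * lam * (Y t * cos t * exp (a n t) * Im (H n t)))"
      by (auto simp: F_def Im_power2 algebra_simps)
    also have "integral D (\<lambda>t. 2 * F n t + 2 * lam * (Y t * cos t * exp (a n t) * Im (H n t))) = integral D (\<lambda>t. 2 * F n t) + integral D (\<lambda>t. 2 * lam * (Y t * cos t * exp (a n t) * Im (H n t)))"
      by (intro Henstock_Kurzweil_Integration.integral_add integrable_on_mult_right i2 i3)
    also have "\<dots> = 2 * integral D (F n) + 2 * lam * integral D (\<lambda>t. Y t * cos t * exp (a n t) * Im (H n t))" by simp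
    finally show ?thesis by (simp only: 2)
  qed
  have "(\<lambda>n. c * (r n)\<^sup>2) \<longlonglongrightarrow> c * 1\<^sup>2" by (intro tendsto_intros rl)
  moreover have "(\<lambda>n. c * (r n)\<^sup>2) \<longlonglongrightarrow> 2 * integral D (\<lambda>t. 0) + 2 * lam * integral D (\<lambda>t. Z' t * exp (u (sin t)))"
    unfolding eq by (intro tendsto_intros Flim Elim)
  ultimately have "c * 1\<^sup>2 = 2 * integral D (\<lambda>t. 0) + 2 * lam * integral D (\<lambda>t. Z' t * exp (u (sin t)))" by (rule LIMSEQ_unique)
  then show ?thesis by (simp add: D_def)
qed

abbreviation "\<rho> \<equiv> integral {-1..1} f"
abbreviation "q2 \<equiv> integral {-1..1} (\<lambda>y. y\<^sup>2 * f y)"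

lemma f_cont_on [continuous_intros]: "continuous_on S f" using f_cont continuous_on_subset by blast

text \<open>The choice \<open>Y = cos\<close> gives \<open>Z' t = - 2 * sin t * cos t\<close>, which
  is the weight \<open>- 2 * y\<close> after \<open>y = sin t\<close>; the centre of the disc
  contributes nothing.\<close>

lemma first_moment: "integral {-1..1} (\<lambda>y. y * f y) = 0"
proof -
  have "2 * lam * integral {-pi/2..pi/2} (\<lambda>t. (- (2 * sin t * cos t)) * exp (u (sin t))) = 0"
  proof (rule moment_limit[where Y = cos])
    show "((\<lambda>t. cos t * cos t) has_real_derivative - (2 * sin t * cos t)) (at t)" for t :: real
      by (auto intro!: derivative_eq_intros)
    show "((\<lambda>t. cos t * Im ((of_real r * cis t * gpot' f (of_real r * cis t))\<^sup>2)) has_integral 0 * r\<^sup>2) {-pi/2..pi/2}" if "0 < r" "r < 1" for r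
      using gpot'_squared_moments(1)[OF f_cont that] by simp
  qed (auto intro!: continuous_intros)
  moreover have "((\<lambda>t. cos t * (- 2 * sin t * (f (sin t) / lam))) has_integral integral {-1..1} (\<lambda>y. - 2 * y * (f y / lam))) {-pi/2..pi/2}"
    by (intro has_integral_sin_substitution continuous_intros) (auto simp: lam0)
  then have "integral {-pi/2..pi/2} (\<lambda>t. (- (2 * sin t * cos t)) * exp (u (sin t))) = integral {-1..1} (\<lambda>y. - 2 * y * (f y / lam))"
    using lam by (intro integral_unique) (simp add: f_def mult_ac)
  moreover have "integral {-1..1} (\<lambda>y. - 2 * y * (f y / lam)) = (- 2 / lam) * integral {-1..1} (\<lambda>y. y * f y)"
    by (subst integral_mult_right[symmetric]) (simp add: mult_ac)
  ultimately show ?thesis using lam by simp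
qed

text \<open>The choice \<open>Y t = sin (2 * t)\<close> gives the weight
  \<open>2 - 6 * y\<^sup>2\<close>. The square of \<open>S\<close> is the contribution of the
  centre, since \<open>gpot' f 0 = 2 * S / pi\<close>.\<close>

lemma second_moment: "\<rho> - 3 * q2 = (integral {-1..1} (\<lambda>y. sqrt (1 - y\<^sup>2) * f y))\<^sup>2 / (2 * pi)"
proof -
  define S where "S = integral {-1..1} (\<lambda>y. sqrt (1 - y\<^sup>2) * f y)"
  have g0: "Re (gpot' f 0) = 2 * S / pi"
  proof -
    have e: "(\<lambda>y. complex_of_real (f y) * dker 0 y) = (\<lambda>y. complex_of_real (2 * (sqrt (1 - y\<^sup>2) * f y)))"
      by (auto simp: dker_def complex_eq_iff)
    have "gpot' f 0 = integral {-1..1} (\<lambda>y. complex_of_real (2 * (sqrt (1 - y\<^sup>2) * f y))) / pi"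
      using set_lebesgue_integral_eq_integral_Icc(2)[OF continuous_on_dker[of 0, OF _ f_cont]] unfolding gpot'_def e by simp
    also have "integral {-1..1} (\<lambda>y. complex_of_real (2 * (sqrt (1 - y\<^sup>2) * f y))) = of_real (integral {-1..1} (\<lambda>y. 2 * (sqrt (1 - y\<^sup>2) * f y)))"
    proof -
      have "(\<lambda>y. 2 * (sqrt (1 - y\<^sup>2) * f y)) integrable_on {-1..1}"
        by (intro integrable_continuous_real continuous_intros)
      from integral_linear[OF this bounded_linear_of_real[where 'a = complex]] show ?thesis by (simp add: o_def)
    qed
    also have "integral {-1..1} (\<lambda>y. 2 * (sqrt (1 - y\<^sup>2) * f y)) = 2 * S" by (simp add: S_def)
    finally show ?thesis by (simp add: Re_divide_of_real)
  qed
  have "2 * lam * integral {-pi/2..pi/2} (\<lambda>t. (cos t * (2 - 6 * (sin t)\<^sup>2)) * exp (u (sin t))) = pi * (2 * S / pi)\<^sup>2 / 2"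
  proof (rule moment_limit[where Y = "\<lambda>t. sin (2 * t)"])
    show "((\<lambda>t. sin (2 * t) * cos t) has_real_derivative cos t * (2 - 6 * (sin t)\<^sup>2)) (at t)" for t :: real
    proof -
      have "((\<lambda>t. sin (2 * t) * cos t) has_real_derivative 2 * cos (2 * t) * cos t - sin (2 * t) * sin t) (at t)"
        by (auto intro!: derivative_eq_intros)
      also have "2 * cos (2 * t) * cos t - sin (2 * t) * sin t = cos t * (2 - 6 * (sin t)\<^sup>2)"
        unfolding cos_double_sin sin_double by (simp add: power2_eq_square algebra_simps)
      finally show ?thesis .
    qed
    show "((\<lambda>t. sin (2 * t) * Im ((of_real r * cis t * gpot' f (of_real r * cis t))\<^sup>2)) has_integral pi * (2 * S / pi)\<^sup>2 / 2 * r\<^sup>2) {-pi/2..pi/2}" if "0 < r" "r < 1" for r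
      using gpot'_squared_moments(2)[OF f_cont that] by (simp add: g0 mult_ac)
  qed (auto intro!: continuous_intros)
  moreover have "((\<lambda>t. cos t * ((2 - 6 * (sin t)\<^sup>2) * (f (sin t) / lam))) has_integral integral {-1..1} (\<lambda>y. (2 - 6 * y\<^sup>2) * (f y / lam))) {-pi/2..pi/2}"
    by (intro has_integral_sin_substitution continuous_intros) (auto simp: lam0)
  then have "integral {-pi/2..pi/2} (\<lambda>t. (cos t * (2 - 6 * (sin t)\<^sup>2)) * exp (u (sin t))) = integral {-1..1} (\<lambda>y. (2 - 6 * y\<^sup>2) * (f y / lam))"
    using lam by (intro integral_unique) (simp add: f_def mult_ac)
  moreover have "integral {-1..1} (\<lambda>y. (2 - 6 * y\<^sup>2) * (f y / lam)) = (2 * \<rho> - 6 * q2) / lam"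
  proof -
    have "integral {-1..1} (\<lambda>y. (2 - 6 * y\<^sup>2) * (f y / lam)) = integral {-1..1} (\<lambda>y. 2 / lam * f y - 6 / lam * (y\<^sup>2 * f y))"
      by (intro integral_cong) (simp add: algebra_simps diff_divide_distrib)
    also have "\<dots> = 2 / lam * \<rho> - 6 / lam * q2"
      by (subst Henstock_Kurzweil_Integration.integral_diff) (auto intro!: integrable_continuous_real continuous_intros simp: lam0)
    finally show ?thesis by (simp add: diff_divide_distrib)
  qed
  ultimately have "2 * (2 * \<rho> - 6 * q2) = pi * (2 * S / pi)\<^sup>2 / 2" using lam by simp
  then show ?thesis unfolding S_def[symmetric] by (simp add: power2_eq_square field_simps)
qed

end

section \<open>The Green function on the interval\<close>

text \<open>The squared distances of \<open>cpt x\<close> from the image point and from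
  \<open>cpt y\<close> are \<open>2 * (1 - x * y + s * t)\<close> and
  \<open>2 * (1 - x * y - s * t)\<close>. Their product simplifies by \<open>(1 - x * y)\<^sup>2 -
  (1 - x\<^sup>2) * (1 - y\<^sup>2) = (x - y)\<^sup>2\<close>.\<close>

lemma sum_diff_cpt:
  assumes "\<bar>x\<bar> \<le> 1" "\<bar>y\<bar> \<le> 1"
  shows "(norm (1 + cpt x * cpt y))\<^sup>2 = 2 * (1 - x * y + sqrt (1 - x\<^sup>2) * sqrt (1 - y\<^sup>2))"
    and "norm (1 + cpt x * cpt y) * norm (cpt y - cpt x) = 2 * \<bar>x - y\<bar>"
proof -
  define s t where "s = sqrt (1 - x\<^sup>2)" and "t = sqrt (1 - y\<^sup>2)"
  have sq: "s\<^sup>2 = 1 - x\<^sup>2" "t\<^sup>2 = 1 - y\<^sup>2" using assms by (auto simp: s_def t_def abs_square_le_1)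
  have "(norm (1 + cpt x * cpt y))\<^sup>2 = (1 + (s * t - x * y))\<^sup>2 + (s * y + x * t)\<^sup>2"
    by (simp add: cmod_power2 s_def t_def)
  also have "\<dots> = 1 + 2 * (s * t - x * y) + (s\<^sup>2 + x\<^sup>2) * (t\<^sup>2 + y\<^sup>2)" by (simp add: power2_eq_square algebra_simps)
  also have "\<dots> = 2 * (1 - x * y + s * t)" by (simp add: sq)
  finally have 1: "(norm (1 + cpt x * cpt y))\<^sup>2 = 2 * (1 - x * y + s * t)" .
  then show "(norm (1 + cpt x * cpt y))\<^sup>2 = 2 * (1 - x * y + sqrt (1 - x\<^sup>2) * sqrt (1 - y\<^sup>2))" by (simp only: s_def t_def)
  have "(norm (cpt y - cpt x))\<^sup>2 = (t - s)\<^sup>2 + (y - x)\<^sup>2" by (simp add: cmod_power2 s_def t_def)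
  also have "\<dots> = (s\<^sup>2 + x\<^sup>2) + (t\<^sup>2 + y\<^sup>2) - 2 * (s * t + x * y)" by (simp add: power2_eq_square algebra_simps)
  also have "\<dots> = 2 * (1 - x * y - s * t)" by (simp add: sq)
  finally have 2: "(norm (cpt y - cpt x))\<^sup>2 = 2 * (1 - x * y - s * t)" .
  have "(norm (1 + cpt x * cpt y) * norm (cpt y - cpt x))\<^sup>2 = 4 * ((1 - x * y)\<^sup>2 - s\<^sup>2 * t\<^sup>2)"
    unfolding power_mult_distrib 1 2 by (simp add: power2_eq_square algebra_simps)
  also have "\<dots> = (2 * \<bar>x - y\<bar>)\<^sup>2" by (simp add: sq) (simp add: power2_eq_square algebra_simps)
  finally show "norm (1 + cpt x * cpt y) * norm (cpt y - cpt x) = 2 * \<bar>x - y\<bar>"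
    by (rule power2_eq_imp_eq) auto
qed

text \<open>This is \<open>pi\<close> times the Green function, in a form that also makes sense at
  the endpoints and inherits the disc estimates of \<open>gker\<close>.\<close>

definition gf :: "real \<Rightarrow> real \<Rightarrow> real" where
  "gf x y = Re (gker (cpt x) y)"

lemma gf_eq:
  assumes "\<bar>x\<bar> \<le> 1" "\<bar>y\<bar> \<le> 1" "y \<noteq> x"
  shows "gf x y = ln ((1 - x * y + sqrt (1 - x\<^sup>2) * sqrt (1 - y\<^sup>2)) / \<bar>x - y\<bar>)"
    and "0 < 1 - x * y + sqrt (1 - x\<^sup>2) * sqrt (1 - y\<^sup>2)"
proof -
  define P where "P = norm (1 + cpt x * cpt y)"
  define N where "N = norm (cpt y - cpt x)"
  have p: "P > 0" "N > 0"
    using sum_diff_cpt(2)[OF assms(1,2)] assms(3) by (auto simp: P_def N_def)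
  have P2: "P\<^sup>2 = 2 * (1 - x * y + sqrt (1 - x\<^sup>2) * sqrt (1 - y\<^sup>2))" using sum_diff_cpt(1)[OF assms(1,2)] by (simp add: P_def)
  then show pos: "0 < 1 - x * y + sqrt (1 - x\<^sup>2) * sqrt (1 - y\<^sup>2)" using p by (metis zero_less_power zero_less_mult_pos zero_less_numeral)
  have "gf x y = ln P - ln N"
    unfolding gf_def P_def N_def using assms by (subst Re_gker) (auto simp: norm_one_minus_mult_cnj_cpt)
  also have "\<dots> = ln (P / N)" using p by (simp add: ln_div)
  also have "P / N = P\<^sup>2 / (P * N)" using p by (simp add: power2_eq_square)
  also have "\<dots> = (1 - x * y + sqrt (1 - x\<^sup>2) * sqrt (1 - y\<^sup>2)) / \<bar>x - y\<bar>"
  proof -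
    have "P * N = 2 * \<bar>x - y\<bar>" using sum_diff_cpt(2)[OF assms(1,2)] by (simp add: P_def N_def)
    then show ?thesis unfolding P2 by (simp only: mult_divide_mult_cancel_left[of 2] zero_neq_numeral[symmetric] not_False_eq_True)
  qed
  finally show "gf x y = ln ((1 - x * y + sqrt (1 - x\<^sup>2) * sqrt (1 - y\<^sup>2)) / \<bar>x - y\<bar>)" .
qed

text \<open>The kernel is \<open>ln (P / N)\<close>: the image point is the farther one, so
  \<open>N \<le> P\<close>; two points of the disc give \<open>P \<le> 2\<close>; and
  \<open>N \<ge> \<bar>y - x\<bar>\<close> by projection.\<close>

lemma gf_bounds:
  assumes "\<bar>x\<bar> \<le> 1" "\<bar>y\<bar> \<le> 1" "y \<noteq> x"
  shows "0 \<le> gf x y" "gf x y \<le> ln (2 / \<bar>y - x\<bar>)"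
proof -
  define P where "P = norm (1 + cpt x * cpt y)"
  define N where "N = norm (cpt y - cpt x)"
  have p: "P > 0" "N > 0"
    using sum_diff_cpt(2)[OF assms(1,2)] assms(3) by (auto simp: P_def N_def)
  have g: "gf x y = ln P - ln N"
    unfolding gf_def P_def N_def using assms by (subst Re_gker) (auto simp: norm_one_minus_mult_cnj_cpt)
  have "N \<le> P" using norm_plus_cnj_ge[OF assms(2), of "cpt x"] assms norm_one_plus_mult_cpt[OF assms(2), of "cpt x"]
    by (simp add: N_def P_def abs_square_le_1)
  then show "0 \<le> gf x y" using p by (simp add: g)
  have "P \<le> norm (1::complex) + norm (cpt x * cpt y)" unfolding P_def by (rule norm_triangle_ineq)
  then have "P \<le> 2" using assms by (simp add: norm_mult)
  then have "ln P \<le> ln 2" using p by simp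
  moreover have "\<bar>y - x\<bar> \<le> N" using abs_Im_le_cmod[of "cpt y - cpt x"] by (simp add: N_def)
  then have "ln \<bar>y - x\<bar> \<le> ln N" using assms p by simp
  ultimately show "gf x y \<le> ln (2 / \<bar>y - x\<bar>)" using assms by (simp add: g ln_div)
qed

lemma gf_nonneg: "\<bar>x\<bar> \<le> 1 \<Longrightarrow> \<bar>y\<bar> \<le> 1 \<Longrightarrow> y \<noteq> x \<Longrightarrow> 0 \<le> gf x y"
  by (rule gf_bounds)

lemma green_eq_gf:
  assumes "\<bar>x\<bar> < 1" "\<bar>y\<bar> < 1" "y \<noteq> x" shows "green x y = gf x y / pi"
proof -
  have I: "x \<in> {-1<..<1} \<and> y \<in> {-1<..<1}" using assms by auto
  define P where "P = 1 - x * y + sqrt (1 - x\<^sup>2) * sqrt (1 - y\<^sup>2)"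
  have "P > 0" "gf x y = ln (P / \<bar>x - y\<bar>)" using gf_eq[of x y] assms by (auto simp: P_def)
  then have "gf x y = ln P - ln \<bar>x - y\<bar>" using assms by (simp add: ln_div)
  moreover have "sqrt ((1 - \<bar>x\<bar>\<^sup>2) * (1 - \<bar>y\<bar>\<^sup>2)) + 1 - x * y = P"
    by (simp only: P_def power2_abs real_sqrt_mult)
  ultimately show ?thesis using I by (simp add: green_def)
qed

lemma abs_le_one_of_subset: "A \<subseteq> {-1<..<1} \<Longrightarrow> y \<in> A \<Longrightarrow> \<bar>y\<bar> \<le> (1::real)"
proof -
  assume "A \<subseteq> {-1<..<1}" "y \<in> A"
  then have "y \<in> {-1<..<1}" by blast
  then show ?thesis by auto
qed

section \<open>Mass and second moment\<close>

context liouville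
begin

lemma f_integrable: "A \<in> sets lborel \<Longrightarrow> A \<subseteq> {-1<..<1} \<Longrightarrow> set_integrable lborel A f"
  using set_lebesgue_integral_eq_integral_Icc(1)[OF f_cont_on] by (rule set_integrable_subset) auto

lemma \<rho>_eq: "\<rho> = (LBINT y:{-1<..<1}. f y)"
  using set_lebesgue_integral_eq_integral_Icc(2)[OF f_cont_on] by simp

lemma f_gf_integrable:
  assumes "\<bar>x\<bar> \<le> 1" "A \<in> sets lborel" "A \<subseteq> {-1<..<1}"
  shows "set_integrable lborel A (\<lambda>y. f y * gf x y)"
proof (rule set_integrable_subset[of lborel "{-1<..<1}"])
  show "set_integrable lborel {-1<..<1} (\<lambda>y. f y * gf x y)"
    using Re_gpot(2)[OF _ f_meas f_le, of "cpt x"] assms(1) unfolding gf_def by simp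
qed (use assms in auto)

lemma u_eq: "\<bar>x\<bar> \<le> 1 \<Longrightarrow> u x = (LBINT y:{-1<..<1}. f y * gf x y) / pi"
  using Re_gpot(1)[OF _ f_meas f_le, of "cpt x"] repr[of x] by (simp add: gf_def)

lemma mass_mono: "A \<in> sets lborel \<Longrightarrow> B \<in> sets lborel \<Longrightarrow> A \<subseteq> B \<Longrightarrow> B \<subseteq> {-1<..<1} \<Longrightarrow> (LBINT y:A. f y) \<le> (LBINT y:B. f y)"
  unfolding set_lebesgue_integral_def
  using f_integrable[of A] f_integrable[of B] f_pos less_imp_le
  by (intro integral_mono) (auto simp: set_integrable_def indicator_def subset_iff)

lemma \<rho>_pos: "\<rho> > 0"
proof -
  have "\<rho> \<ge> integral {-1..1} (\<lambda>y::real. lam * exp (- M))"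
  proof (intro integral_le integrable_continuous_real continuous_intros)
    fix y :: real
    have "- M \<le> u y" using bound[of y] by linarith
    then show "lam * exp (- M) \<le> f y" using lam by (simp add: f_def)
  qed
  moreover have "integral {-1..1} (\<lambda>y::real. lam * exp (- M)) = 2 * (lam * exp (- M))" by simp
  ultimately show ?thesis using lam by (smt (verit) exp_gt_zero mult_pos_pos)
qed

lemma gf_AE: "\<bar>x\<bar> \<le> 1 \<Longrightarrow> A \<subseteq> {-1<..<1} \<Longrightarrow> AE y\<in>A in lborel. 0 \<le> f y * gf x y"
  using AE_lborel_neq[of x]
proof eventually_elim
  case (elim y)
  show ?case
  proof
    assume "y \<in> A"
    then have "\<bar>y\<bar> \<le> 1" using elim(2) by (rule abs_le_one_of_subset[rotated])
    then show "0 \<le> f y * gf x y" using f_pos[of y] gf_nonneg[of x y] elim by (intro mult_nonneg_nonneg) auto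
  qed
qed

lemma far_potential:
  assumes x: "\<bar>x\<bar> \<le> 1" and A: "A \<in> sets lborel" "A \<subseteq> {-1<..<1}" and d: "0 < d" "d \<le> 2" "\<And>y. y \<in> A \<Longrightarrow> d \<le> \<bar>y - x\<bar>"
  shows "(LBINT y:A. f y * gf x y) \<le> ln (2 / d) * \<rho>"
proof -
  have l: "ln (2 / d) \<ge> 0" using d by simp
  have "(LBINT y:A. f y * gf x y) \<le> (LBINT y:A. ln (2 / d) * f y)"
  proof (rule set_integral_mono)
    show "set_integrable lborel A (\<lambda>y. f y * gf x y)" by (intro f_gf_integrable x A)
    show "set_integrable lborel A (\<lambda>y. ln (2 / d) * f y)" by (intro set_integrable_mult_right f_integrable A)
    fix y assume y: "y \<in> A"
    then have "y \<noteq> x" using d(1) d(3)[OF y] by auto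
    then have "gf x y \<le> ln (2 / \<bar>y - x\<bar>)" using abs_le_one_of_subset[OF A(2) y] x by (intro gf_bounds) auto
    also have "\<dots> \<le> ln (2 / d)" using d(1) d(3)[OF y] by (intro ln_mono divide_left_mono) auto
    finally show "f y * gf x y \<le> ln (2 / d) * f y" using f_pos[of y] by (simp add: mult.commute)
  qed
  also have "\<dots> = ln (2 / d) * (LBINT y:A. f y)" by simp
  also have "\<dots> \<le> ln (2 / d) * \<rho>" unfolding \<rho>_eq using A l by (intro mult_left_mono mass_mono) auto
  finally show ?thesis .
qed

lemma u_nonneg: "0 \<le> u x"
proof (cases "\<bar>x\<bar> \<le> 1")
  case True
  have "0 \<le> (LBINT y:{-1<..<1}. f y * gf x y)"
    unfolding set_lebesgue_integral_def
    using gf_AE[OF True, of "{-1<..<1}"] by (intro integral_nonneg_AE) (auto elim!: eventually_mono simp: indicator_def)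
  then show ?thesis using u_eq[OF True] by simp
next
  case False
  then have "x \<notin> {-1<..<1}" by auto
  then show ?thesis using out[of x] by simp
qed

lemma f_ge_lam: "lam \<le> f x"
  using lam u_nonneg[of x] by (simp add: f_def)

text \<open>As \<open>u \<ge> 0\<close>, the density is at least \<open>lam\<close>, and the
  integral of \<open>y\<^sup>2\<close> is \<open>2 / 3\<close>. So a small second moment forces a
  small \<open>lam\<close>, which is how the density away from the centre is controlled under
  blow-up.\<close>

lemma q2_pos: "q2 > 0" and lam_le_q2: "lam \<le> 3 / 2 * q2"
proof -
  have "((\<lambda>y::real. y\<^sup>2) has_integral 1 ^ 3 / 3 - (-1) ^ 3 / 3) {-1..1}"
    by (rule fundamental_theorem_of_calculus)
       (auto intro!: derivative_eq_intros simp: has_real_derivative_iff_has_vector_derivative[symmetric])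
  then have "((\<lambda>y::real. lam * y\<^sup>2) has_integral lam * (2 / 3)) {-1..1}" by (intro has_integral_mult_right) simp
  moreover have "((\<lambda>y. y\<^sup>2 * f y) has_integral q2) {-1..1}"
    by (intro integrable_integral integrable_continuous_real continuous_intros)
  ultimately have "lam * (2 / 3) \<le> q2"
    by (rule has_integral_le) (use mult_right_mono[OF f_ge_lam zero_le_power2] in \<open>simp add: mult.commute\<close>)
  then show "q2 > 0" "lam \<le> 3 / 2 * q2" using lam by auto
qed

abbreviation "S \<equiv> integral {-1..1} (\<lambda>y. sqrt (1 - y\<^sup>2) * f y)"

text \<open>For \<open>y\<close> in the closed interval,
  \<open>1 - y\<^sup>2 \<le> sqrt (1 - y\<^sup>2) \<le> 1\<close>.\<close>

lemma S_le: "S \<le> \<rho>" and S_ge: "\<rho> - q2 \<le> S" and S_nonneg: "S \<ge> 0"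
proof -
  show "S \<le> \<rho>"
  proof (intro integral_le integrable_continuous_real continuous_intros)
    fix y :: real assume "y \<in> {-1..1}"
    then have "sqrt (1 - y\<^sup>2) * f y \<le> 1 * f y" using f_pos[of y] by (intro mult_right_mono) auto
    then show "sqrt (1 - y\<^sup>2) * f y \<le> f y" by simp
  qed
  have "\<rho> - q2 = integral {-1..1} (\<lambda>y. f y - y\<^sup>2 * f y)"
    by (rule Henstock_Kurzweil_Integration.integral_diff[symmetric]) (intro integrable_continuous_real continuous_intros)+
  also have "\<dots> \<le> S"
  proof (intro integral_le integrable_continuous_real continuous_intros)
    fix y :: real assume "y \<in> {-1..1}"
    then have a: "0 \<le> 1 - y\<^sup>2" "1 - y\<^sup>2 \<le> 1" by (auto simp: abs_square_le_1 abs_le_iff)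
    then have "(1 - y\<^sup>2)\<^sup>2 \<le> 1 - y\<^sup>2" by (simp add: power2_eq_square mult_left_le)
    then have "1 - y\<^sup>2 \<le> sqrt (1 - y\<^sup>2)" using a by (intro real_le_rsqrt)
    then have "(1 - y\<^sup>2) * f y \<le> sqrt (1 - y\<^sup>2) * f y" using f_pos[of y] by (intro mult_right_mono) auto
    then show "f y - y\<^sup>2 * f y \<le> sqrt (1 - y\<^sup>2) * f y" by (simp add: algebra_simps)
  qed
  finally show "\<rho> - q2 \<le> S" .
  show "S \<ge> 0" using f_pos less_imp_le
    by (intro Henstock_Kurzweil_Integration.integral_nonneg integrable_continuous_real continuous_intros) (auto intro!: mult_nonneg_nonneg simp: abs_square_le_1 abs_le_iff)
qed

lemma second_moment': "2 * pi * (\<rho> - 3 * q2) = S\<^sup>2"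
  using second_moment by simp

lemma q2_le: "q2 \<le> \<rho> / 3"
proof -
  have "0 \<le> 2 * pi * (\<rho> - 3 * q2)" unfolding second_moment' by simp
  then have "0 \<le> \<rho> - 3 * q2" using pi_gt_zero by (simp add: zero_le_mult_iff)
  then show ?thesis by simp
qed

lemma moment_upper: "\<rho> * (2 * pi - \<rho>) \<le> 6 * pi * q2"
proof -
  have "S\<^sup>2 \<le> \<rho>\<^sup>2" using S_le S_nonneg by (intro power_mono) auto
  then show ?thesis using second_moment' by (simp add: power2_eq_square algebra_simps)
qed

text \<open>Squaring \<open>\<rho> - q2 \<le> S\<close> turns the second moment identity into
  \<open>r\<^sup>2 - 2 * pi * r \<le> q * (2 * r - 6 * pi - q)\<close>. If
  \<open>r \<ge> 2 * pi\<close>, the left side is nonnegative, which forces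
  \<open>r \<ge> 3 * pi\<close>; but the right side is at most \<open>(r - 3 * pi)\<^sup>2\<close>,
  its maximum over \<open>q\<close>, which gives \<open>4 * r \<le> 9 * pi\<close>. Once
  \<open>r < 2 * pi\<close>, the bracket is at most \<open>- 2 * pi\<close>, and this is
  \<open>moment_lower\<close>.\<close>

lemma \<rho>_less: "\<rho> < 2 * pi" and moment_lower: "2 * pi * q2 \<le> \<rho> * (2 * pi - \<rho>)"
proof -
  define r q where "r = \<rho>" and "q = q2"
  have q: "q > 0" "q \<le> r / 3" using q2_pos q2_le by (auto simp: q_def r_def)
  have "(r - q)\<^sup>2 \<le> S\<^sup>2" using S_ge q by (intro power_mono) (auto simp: q_def r_def)
  then have main: "r\<^sup>2 - 2 * pi * r \<le> q * (2 * r - 6 * pi - q)"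
    using second_moment' unfolding r_def[symmetric] q_def[symmetric] by (simp add: power2_eq_square algebra_simps)
  have rl: "r < 2 * pi"
  proof (rule ccontr)
    assume "\<not> r < 2 * pi"
    then have r: "r \<ge> 2 * pi" by simp
    then have "0 \<le> r * (r - 2 * pi)" using pi_gt_zero by (intro mult_nonneg_nonneg) linarith+
    then have "0 \<le> q * (2 * r - 6 * pi - q)" using main by (simp add: power2_eq_square algebra_simps)
    then have "0 \<le> 2 * r - 6 * pi - q" using q by (simp add: zero_le_mult_iff)
    then have r3: "r \<ge> 3 * pi" using q by linarith
    have "0 \<le> (q - (r - 3 * pi))\<^sup>2" by simp
    then have "q * (2 * r - 6 * pi - q) \<le> (r - 3 * pi)\<^sup>2" by (simp add: power2_eq_square algebra_simps)
    then have "r\<^sup>2 - 2 * pi * r \<le> (r - 3 * pi)\<^sup>2" using main by linarith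
    then have "4 * (pi * r) \<le> 9 * (pi * pi)" by (simp add: power2_eq_square algebra_simps)
    then have "pi * (4 * r) \<le> pi * (9 * pi)" by simp
    then have "4 * r \<le> 9 * pi" using pi_gt_zero by (simp only: mult_le_cancel_left_pos)
    then show False using r3 pi_gt_zero by linarith
  qed
  then show "\<rho> < 2 * pi" by (simp add: r_def)
  have "q * (2 * r - 6 * pi - q) \<le> q * (- 2 * pi)" using rl q by (intro mult_left_mono) auto
  then show "2 * pi * q2 \<le> \<rho> * (2 * pi - \<rho>)" using main unfolding r_def[symmetric] q_def[symmetric] by (simp add: power2_eq_square algebra_simps)
qed

lemma lam_le: "lam \<le> pi"
  using lam_le_q2 q2_le \<rho>_less by linarith

end

text \<open>The midpoint of 1 and \<open>pi / m\<close>. It exceeds 1 for \<open>0 < m < pi\<close>,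
  while \<open>bndp m * m / pi = bndt m\<close> stays below 1, as an integrable singularity
  requires.\<close>

definition bndp :: "real \<Rightarrow> real" where "bndp m = (1 + pi / m) / 2"
definition bndt :: "real \<Rightarrow> real" where "bndt m = (m / pi + 1) / 2"
definition bnd1 :: "real \<Rightarrow> real \<Rightarrow> real" where
  "bnd1 r m = exp (bndp m * (2 * ln (4 / r))) * (2 + (2 * pi / m) * (2 powr bndt m * (4 / (1 - bndt m))))"
definition bnd :: "real \<Rightarrow> real \<Rightarrow> real" where
  "bnd r m = 2 * ln (8 / r) + bnd1 r m + (2 * (bndp m / (bndp m - 1))) powr (bndp m / (bndp m - 1)) * (2 powr (1/2) * 8)"

context liouville
begin

text \<open>Jensen's inequality for \<open>exp\<close> through its tangent at \<open>c\<close>: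
  \<open>exp c * (1 + z - c) \<le> exp z\<close> with \<open>z = (p * m / pi) * gf x y\<close>,
  integrated against \<open>f\<close> over \<open>B\<close>. The measure may have less mass than
  \<open>m\<close>; the deficit is paid by \<open>exp c * (1 - c) \<le> 1\<close> and produces the
  summand 1.\<close>

lemma jensen_step:
  assumes x: "\<bar>x\<bar> \<le> 1" and B: "B \<in> sets lborel" "B \<subseteq> {-1<..<1}"
    and m: "0 < m" "(LBINT y:B. f y) \<le> m" and p: "p > 0" "p * m / pi < 1"
  shows "exp (p * ((LBINT y:B. f y * gf x y) / pi)) \<le> 1 + (1 / m) * (LBINT y:B. f y * (2 / \<bar>y - x\<bar>) powr (p * m / pi))"
    and "set_integrable lborel B (\<lambda>y. f y * (2 / \<bar>y - x\<bar>) powr (p * m / pi))"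
proof -
  define \<theta> where "\<theta> = p * m / pi"
  have \<theta>: "0 \<le> \<theta>" "\<theta> < 1" using m p by (auto simp: \<theta>_def)
  define A where "A = lam * exp M"
  have fi: "set_integrable lborel B f" by (intro f_integrable B)
  have gi: "set_integrable lborel B (\<lambda>y. f y * gf x y)" by (intro f_gf_integrable x B)
  have si: "set_integrable lborel {-1<..<1} (\<lambda>y. A * (2 powr \<theta> * \<bar>y - x\<bar> powr (-\<theta>)))"
    using \<theta> x by (intro set_integrable_mult_right powr_singularity_integral)
  have pe: "(2 / \<bar>y - x\<bar>) powr \<theta> = 2 powr \<theta> * \<bar>y - x\<bar> powr (-\<theta>)" for y
    by (simp add: powr_divide powr_minus field_simps)
  have hi: "set_integrable lborel B (\<lambda>y. f y * (2 / \<bar>y - x\<bar>) powr \<theta>)"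
  proof (rule set_integrable_bound)
    show "set_integrable lborel B (\<lambda>y. A * (2 powr \<theta> * \<bar>y - x\<bar> powr (-\<theta>)))"
      using si by (rule set_integrable_subset) (use B in auto)
    show "set_borel_measurable lborel B (\<lambda>y. f y * (2 / \<bar>y - x\<bar>) powr \<theta>)"
      unfolding set_borel_measurable_def using B(1) by measurable
    show "AE y in lborel. y \<in> B \<longrightarrow> norm (f y * (2 / \<bar>y - x\<bar>) powr \<theta>) \<le> norm (A * (2 powr \<theta> * \<bar>y - x\<bar> powr (-\<theta>)))"
    proof (intro AE_I2 impI)
      fix y assume "y \<in> B"
      have "\<bar>f y\<bar> * (2 powr \<theta> * \<bar>y - x\<bar> powr (-\<theta>)) \<le> A * (2 powr \<theta> * \<bar>y - x\<bar> powr (-\<theta>))"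
        using f_le[of y] unfolding A_def by (intro mult_right_mono) auto
      moreover have "A \<ge> 0" using lam by (simp add: A_def)
      ultimately show "norm (f y * (2 / \<bar>y - x\<bar>) powr \<theta>) \<le> norm (A * (2 powr \<theta> * \<bar>y - x\<bar> powr (-\<theta>)))"
        unfolding pe by (simp add: abs_mult)
    qed
  qed
  then show "set_integrable lborel B (\<lambda>y. f y * (2 / \<bar>y - x\<bar>) powr (p * m / pi))" by (simp add: \<theta>_def)
  define c where "c = p * ((LBINT y:B. f y * gf x y) / pi)"
  define k where "k = (\<lambda>y. exp c * (1 + \<theta> * gf x y - c))"
  have ki: "set_integrable lborel B (\<lambda>y. exp c * ((1 - c) * f y + \<theta> * (f y * gf x y)))"
    by (intro set_integrable_mult_right set_integral_add fi gi)
  have "(LBINT y:B. exp c * ((1 - c) * f y + \<theta> * (f y * gf x y))) \<le> (LBINT y:B. f y * (2 / \<bar>y - x\<bar>) powr \<theta>)"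
  proof (rule set_integral_mono_AE[OF ki hi])
    show "AE y\<in>B in lborel. exp c * ((1 - c) * f y + \<theta> * (f y * gf x y)) \<le> f y * (2 / \<bar>y - x\<bar>) powr \<theta>"
      using AE_lborel_neq[of x]
    proof eventually_elim
      case (elim y)
      show ?case
      proof
        assume y: "y \<in> B"
        have y1: "\<bar>y\<bar> \<le> 1" using abs_le_one_of_subset[OF B(2) y] .
        have "exp c * (1 + (\<theta> * gf x y - c)) \<le> exp c * exp (\<theta> * gf x y - c)" by (intro mult_left_mono exp_ge_add_one_self) auto
        also have "\<dots> = exp (\<theta> * gf x y)" by (simp add: exp_add[symmetric])
        also have "\<dots> \<le> exp (\<theta> * ln (2 / \<bar>y - x\<bar>))" using gf_bounds[OF x y1 elim] \<theta> by (simp add: mult_left_mono)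
        also have "\<dots> = (2 / \<bar>y - x\<bar>) powr \<theta>" using elim by (simp add: powr_def)
        finally have "f y * (exp c * (1 + (\<theta> * gf x y - c))) \<le> f y * (2 / \<bar>y - x\<bar>) powr \<theta>" using f_pos[of y] by (intro mult_left_mono) auto
        then show "exp c * ((1 - c) * f y + \<theta> * (f y * gf x y)) \<le> f y * (2 / \<bar>y - x\<bar>) powr \<theta>" by (simp add: algebra_simps)
      qed
    qed
  qed
  also have "(LBINT y:B. exp c * ((1 - c) * f y + \<theta> * (f y * gf x y))) = exp c * ((1 - c) * (LBINT y:B. f y) + \<theta> * (LBINT y:B. f y * gf x y))"
    using fi gi by (subst set_integral_mult_right, subst set_integral_add(2)) auto
  also have "\<theta> * (LBINT y:B. f y * gf x y) = m * c" by (simp add: \<theta>_def c_def)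
  finally have *: "exp c * ((1 - c) * (LBINT y:B. f y) + m * c) \<le> (LBINT y:B. f y * (2 / \<bar>y - x\<bar>) powr \<theta>)" .
  have "exp c * (1 - c) \<le> 1"
  proof -
    have "exp c * (1 + (- c)) \<le> exp c * exp (- c)" by (intro mult_left_mono exp_ge_add_one_self) auto
    then show ?thesis by (simp add: exp_minus)
  qed
  then have "(exp c * (1 - c)) * (m - (LBINT y:B. f y)) \<le> 1 * (m - (LBINT y:B. f y))" using m by (intro mult_right_mono) auto
  moreover have "(LBINT y:B. f y) \<ge> 0" unfolding set_lebesgue_integral_def
    using f_pos less_imp_le by (intro integral_nonneg_AE) (auto simp: indicator_def)
  ultimately have "exp c * m \<le> m + (LBINT y:B. f y * (2 / \<bar>y - x\<bar>) powr \<theta>)" using * by (simp add: algebra_simps)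
  then have "exp c \<le> (m + (LBINT y:B. f y * (2 / \<bar>y - x\<bar>) powr \<theta>)) / m" using m by (simp add: pos_le_divide_eq)
  then show "exp (p * ((LBINT y:B. f y * gf x y) / pi)) \<le> 1 + (1 / m) * (LBINT y:B. f y * (2 / \<bar>y - x\<bar>) powr (p * m / pi))"
    using m by (simp add: c_def \<theta>_def add_divide_distrib)
qed

end

section \<open>Local upper bounds\<close>

text \<open>A Young inequality without optimal constants: either \<open>g\<close> is at most
  \<open>exp ((p - 1) * v)\<close>, or \<open>v\<close> is below
  \<open>ln g / (p - 1)\<close>.\<close>

lemma mult_exp_le:
  fixes g v p :: real
  assumes "g \<ge> 0" "p > 1"
  shows "g * exp v \<le> exp (p * v) + g powr (p / (p - 1))"
proof (cases "g \<le> exp ((p - 1) * v)")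
  case True
  then have "g * exp v \<le> exp ((p - 1) * v) * exp v" by (intro mult_right_mono) auto
  also have "\<dots> = exp (p * v)" by (simp add: exp_add[symmetric] algebra_simps)
  finally show ?thesis by (simp add: add_increasing2)
next
  case False
  then have g: "g > 0" using exp_gt_zero[of "(p - 1) * v"] by linarith
  have "(p - 1) * v < ln g" using False g ln_less_cancel_iff[of "exp ((p - 1) * v)" g] by simp
  then have "v \<le> ln g / (p - 1)" using assms by (simp add: pos_le_divide_eq mult.commute)
  then have "g * exp v \<le> g * exp (ln g / (p - 1))" using g by simp
  also have "\<dots> = exp (ln g + ln g / (p - 1))" using g by (simp add: exp_add)
  also have "ln g + ln g / (p - 1) = p / (p - 1) * ln g" using assms by (simp add: field_simps)
  also have "exp (p / (p - 1) * ln g) = g powr (p / (p - 1))" using g by (simp add: powr_def)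
  finally show ?thesis by (simp add: add_increasing)
qed

text \<open>In \<open>ln z \<le> z powr a / a\<close> the choice \<open>a = 1 / (2 * s)\<close>
  leaves the exponent 1/2 after raising to the power \<open>s\<close>.\<close>

lemma ln_powr_le_powr:
  fixes z s :: real
  assumes "z \<ge> 1" "s > 0" "0 \<le> g" "g \<le> ln z"
  shows "g powr s \<le> (2 * s) powr s * z powr (1/2)"
proof -
  have "ln z \<le> z powr (1 / (2 * s)) / (1 / (2 * s))" using assms by (intro ln_powr_bound) auto
  then have "g \<le> (2 * s) * z powr (1 / (2 * s))" using assms by (simp add: mult.commute)
  then have "g powr s \<le> ((2 * s) * z powr (1 / (2 * s))) powr s" using assms by (intro powr_mono2) auto
  also have "\<dots> = (2 * s) powr s * z powr (1/2)" using assms by (simp add: powr_mult powr_powr)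
  finally show ?thesis .
qed

lemma powr_ratio: "(2 / \<bar>y - x\<bar>) powr \<theta> = 2 powr \<theta> * \<bar>y - x\<bar> powr (-\<theta>)" for x y \<theta> :: real
  by (simp add: powr_divide powr_minus field_simps)

context liouville
begin

text \<open>Mass at distance at least \<open>d\<close> sees a kernel of at most
  \<open>ln (2 / d)\<close>, and its total is below \<open>2 * pi\<close>.\<close>

lemma split_potential:
  assumes x: "\<bar>x\<bar> \<le> 1" and B: "B \<in> sets lborel" "B \<subseteq> {-1<..<1}" and d: "0 < d" "d \<le> 2"
    "\<And>y. y \<in> {-1<..<1} - B \<Longrightarrow> d \<le> \<bar>y - x\<bar>"
  shows "u x \<le> (LBINT y:B. f y * gf x y) / pi + 2 * ln (2 / d)"
proof -
  have "(LBINT y:{-1<..<1}. f y * gf x y) = (LBINT y:B \<union> ({-1<..<1} - B). f y * gf x y)"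
    using B(2) by (simp add: Un_absorb1)
  also have "\<dots> = (LBINT y:B. f y * gf x y) + (LBINT y:{-1<..<1} - B. f y * gf x y)"
    using B by (intro set_integral_Un f_gf_integrable x) auto
  also have "(LBINT y:{-1<..<1} - B. f y * gf x y) \<le> ln (2 / d) * \<rho>"
    using B by (intro far_potential x d) auto
  also have "ln (2 / d) * \<rho> \<le> ln (2 / d) * (2 * pi)" using \<rho>_less d by (intro mult_left_mono) auto
  finally have "pi * u x \<le> (LBINT y:B. f y * gf x y) + ln (2 / d) * (2 * pi)" using u_eq[OF x] by simp
  then have "u x \<le> ((LBINT y:B. f y * gf x y) + ln (2 / d) * (2 * pi)) / pi" by (simp add: pos_le_divide_eq mult.commute)
  then show ?thesis by (simp add: add_divide_distrib)
qed

text \<open>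
  The Brezis--Merle argument: mass below \<open>pi\<close> in a ball makes \<open>exp (p * u)\<close> integrable there for some
  \<open>p > 1\<close>, by Jensen's inequality for the measure \<open>f y dy\<close>.
\<close>

lemma exp_integral_bound:
  assumes r: "0 < r" "r \<le> 1" and m: "0 < m" "m < pi"
    and mass: "(LBINT y:{-1<..<1} \<inter> {x1 - r<..<x1 + r}. f y) \<le> m"
  shows "(LBINT x:{-1<..<1} \<inter> {x1 - r/2<..<x1 + r/2}. exp (bndp m * u x)) \<le> bnd1 r m"
proof -
  define p \<theta> where "p = bndp m" and "\<theta> = bndt m"
  have p: "p > 1" using m by (simp add: p_def bndp_def)
  have \<theta>: "0 \<le> \<theta>" "\<theta> < 1" using m by (auto simp: \<theta>_def bndt_def)
  have p\<theta>: "p * m / pi = \<theta>" using m by (simp add: p_def \<theta>_def bndp_def bndt_def field_simps)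
  define B B' where "B = {-1<..<1} \<inter> {x1 - r<..<x1 + r}" and "B' = {-1<..<1} \<inter> {x1 - r/2<..<x1 + r/2}"
  have B: "B \<in> sets lborel" "B \<subseteq> {-1<..<1}" "B' \<in> sets lborel" "B' \<subseteq> {-1<..<1}" by (auto simp: B_def B'_def)
  define E where "E = exp (p * (2 * ln (4 / r)))"
  have E: "E > 0" by (simp add: E_def)
  define k where "k = (\<lambda>x y. indicator B y * (f y * (2 / \<bar>y - x\<bar>) powr \<theta>))"
  have k0: "k x y \<ge> 0" for x y using f_pos[of y] by (auto simp: k_def indicator_def less_imp_le)
  have km: "(\<lambda>(x, y). k x y) \<in> borel_measurable (borel \<Otimes>\<^sub>M borel)"
    unfolding k_def using B(1) by measurable
  define J where "J = (\<lambda>x. \<integral>\<^sup>+ y. ennreal (k x y) \<partial>lborel)"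
  have A: "ennreal (exp (p * u x)) \<le> ennreal E * (1 + ennreal (1 / m) * J x)" if x: "x \<in> B'" for x
  proof -
    have x1: "\<bar>x\<bar> \<le> 1" using abs_le_one_of_subset[OF B(4) x] .
    have "u x \<le> (LBINT y:B. f y * gf x y) / pi + 2 * ln (2 / (r / 2))"
    proof (rule split_potential[OF x1 B(1,2)])
      fix y assume "y \<in> {-1<..<1} - B"
      then have "y \<notin> {x1 - r<..<x1 + r}" by (auto simp: B_def)
      moreover have "x \<in> {x1 - r/2<..<x1 + r/2}" using x by (simp add: B'_def)
      ultimately show "r / 2 \<le> \<bar>y - x\<bar>" by (auto simp: abs_if)
    qed (use r in auto)
    then have "p * u x \<le> p * ((LBINT y:B. f y * gf x y) / pi + 2 * ln (4 / r))" using p by simp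
    then have "exp (p * u x) \<le> E * exp (p * ((LBINT y:B. f y * gf x y) / pi))"
      by (simp add: E_def exp_add[symmetric] algebra_simps)
    also have "exp (p * ((LBINT y:B. f y * gf x y) / pi)) \<le> 1 + (1 / m) * (LBINT y:B. f y * (2 / \<bar>y - x\<bar>) powr \<theta>)"
      using jensen_step(1)[OF x1 B(1,2) m(1), of p] mass p \<theta> unfolding p\<theta> B_def by simp
    finally have 1: "exp (p * u x) \<le> E * (1 + (1 / m) * (LBINT y:B. f y * (2 / \<bar>y - x\<bar>) powr \<theta>))" using E by simp
    have ki: "integrable lborel (k x)"
      using jensen_step(2)[OF x1 B(1,2) m(1), of p] mass p \<theta> unfolding p\<theta> B_def k_def set_integrable_def by simp
    have kv: "(LBINT y:B. f y * (2 / \<bar>y - x\<bar>) powr \<theta>) = integral\<^sup>L lborel (k x)"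
      by (simp add: set_lebesgue_integral_def k_def)
    have J: "J x = ennreal (integral\<^sup>L lborel (k x))" unfolding J_def
      using ki k0 by (intro nn_integral_eq_integral) auto
    have "ennreal (exp (p * u x)) \<le> ennreal (E * (1 + (1 / m) * integral\<^sup>L lborel (k x)))"
      using 1 unfolding kv by (rule ennreal_leI)
    also have "\<dots> = ennreal E * (1 + ennreal (1 / m) * J x)"
    proof -
      have I0: "0 \<le> integral\<^sup>L lborel (k x)" using k0 by (intro integral_nonneg_AE) auto
      have c0: "0 \<le> 1 / m * integral\<^sup>L lborel (k x)" using I0 m by simp
      have "ennreal (E * (1 + (1 / m) * integral\<^sup>L lborel (k x))) = ennreal E * ennreal (1 + (1 / m) * integral\<^sup>L lborel (k x))"
        using E c0 by (intro ennreal_mult) auto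
      also have "ennreal (1 + (1 / m) * integral\<^sup>L lborel (k x)) = ennreal 1 + ennreal ((1 / m) * integral\<^sup>L lborel (k x))"
        using c0 by (intro ennreal_plus) auto
      also have "ennreal ((1 / m) * integral\<^sup>L lborel (k x)) = ennreal (1 / m) * ennreal (integral\<^sup>L lborel (k x))"
        using I0 m by (intro ennreal_mult) auto
      finally show ?thesis by (simp only: J ennreal_1)
    qed
    finally show ?thesis .
  qed
  have Jm: "J \<in> borel_measurable lborel"
    unfolding J_def using km by (intro lborel.borel_measurable_nn_integral) (auto simp: split_beta')
  \<comment> \<open>Tonelli: integrated in \<open>x\<close> first, the power singularity is bounded
    independently of \<open>y\<close>, and what remains is the total mass, below
    \<open>2 * pi\<close>.\<close>
  have JI: "(\<integral>\<^sup>+ x. J x * indicator {-1<..<1} x \<partial>lborel) \<le> ennreal (2 * pi * (2 powr \<theta> * (4 / (1 - \<theta>))))"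
  proof -
    have "(\<integral>\<^sup>+ x. J x * indicator {-1<..<1} x \<partial>lborel) = (\<integral>\<^sup>+ x. \<integral>\<^sup>+ y. ennreal (k x y) * indicator {-1<..<1} x \<partial>lborel \<partial>lborel)"
      unfolding J_def using km by (intro nn_integral_cong nn_integral_multc[symmetric]) (auto simp: k_def)
    also have "\<dots> = (\<integral>\<^sup>+ y. \<integral>\<^sup>+ x. ennreal (k x y) * indicator {-1<..<1} x \<partial>lborel \<partial>lborel)"
    proof (rule lborel_pair.Fubini')
      show "(\<lambda>(y, x). ennreal (k x y) * indicator {-1<..<1} x) \<in> borel_measurable (lborel \<Otimes>\<^sub>M lborel)"
        unfolding k_def using B(1) by measurable
    qed
    also have "\<dots> \<le> (\<integral>\<^sup>+ y. ennreal (indicator {-1<..<1} y * f y) * ennreal (2 powr \<theta> * (4 / (1 - \<theta>))) \<partial>lborel)"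
    proof (rule nn_integral_mono)
      fix y :: real
      show "(\<integral>\<^sup>+ x. ennreal (k x y) * indicator {-1<..<1} x \<partial>lborel) \<le> ennreal (indicator {-1<..<1} y * f y) * ennreal (2 powr \<theta> * (4 / (1 - \<theta>)))"
      proof (cases "y \<in> B")
        case True
        then have y: "\<bar>y\<bar> \<le> 1" "y \<in> {-1<..<1}" using abs_le_one_of_subset[OF B(2) True] subsetD[OF B(2) True] by simp_all
        note sing = powr_singularity_integral[of \<theta> y, OF \<theta>(2) y(1) \<theta>(1)]
        have "(\<integral>\<^sup>+ x. ennreal (k x y) * indicator {-1<..<1} x \<partial>lborel) = (\<integral>\<^sup>+ x. ennreal (f y * 2 powr \<theta> * (indicator {-1<..<1} x * \<bar>x - y\<bar> powr (-\<theta>))) \<partial>lborel)"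
          using True f_pos[of y] by (intro nn_integral_cong) (auto simp: k_def powr_ratio abs_minus_commute indicator_def mult_ac)
        also have "\<dots> = ennreal (\<integral>x. f y * 2 powr \<theta> * (indicator {-1<..<1} x * \<bar>x - y\<bar> powr (-\<theta>)) \<partial>lborel)"
          using sing(1) f_pos[of y] unfolding set_integrable_def
          by (intro nn_integral_eq_integral) (auto intro!: mult_nonneg_nonneg less_imp_le)
        also have "(\<integral>x. f y * 2 powr \<theta> * (indicator {-1<..<1} x * \<bar>x - y\<bar> powr (-\<theta>)) \<partial>lborel) = f y * 2 powr \<theta> * (LBINT x:{-1<..<1}. \<bar>x - y\<bar> powr (-\<theta>))"
          by (simp add: set_lebesgue_integral_def)
        also have "\<dots> \<le> f y * 2 powr \<theta> * (4 / (1 - \<theta>))" using sing(2) f_pos[of y] by (intro mult_left_mono) auto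
        finally have "(\<integral>\<^sup>+ x. ennreal (k x y) * indicator {-1<..<1} x \<partial>lborel) \<le> ennreal (f y * (2 powr \<theta> * (4 / (1 - \<theta>))))"
          by (simp add: ennreal_leI mult.assoc)
        also have "\<dots> = ennreal (f y) * ennreal (2 powr \<theta> * (4 / (1 - \<theta>)))"
          using \<theta> f_pos[of y] by (intro ennreal_mult) (auto simp: less_imp_le)
        finally show ?thesis using y by simp
      next
        case False
        then show ?thesis by (simp add: k_def)
      qed
    qed
    also have "\<dots> = (\<integral>\<^sup>+ y. ennreal (indicator {-1<..<1} y * f y) \<partial>lborel) * ennreal (2 powr \<theta> * (4 / (1 - \<theta>)))"
      by (intro nn_integral_multc) measurable
    also have "(\<integral>\<^sup>+ y. ennreal (indicator {-1<..<1} y * f y) \<partial>lborel) = ennreal \<rho>"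
      unfolding \<rho>_eq set_lebesgue_integral_def using f_integrable[of "{-1<..<1}"] f_pos
      by (subst nn_integral_eq_integral) (auto simp: set_integrable_def less_imp_le)
    also have "ennreal \<rho> * ennreal (2 powr \<theta> * (4 / (1 - \<theta>))) \<le> ennreal (2 * pi) * ennreal (2 powr \<theta> * (4 / (1 - \<theta>)))"
      using \<rho>_less by (intro mult_right_mono ennreal_leI) auto
    also have "\<dots> = ennreal (2 * pi * (2 powr \<theta> * (4 / (1 - \<theta>))))"
      using \<theta> by (intro ennreal_mult[symmetric]) auto
    finally show ?thesis .
  qed
  have "(\<integral>\<^sup>+ x. ennreal (exp (p * u x)) * indicator B' x \<partial>lborel) \<le> (\<integral>\<^sup>+ x. ennreal E * (indicator {-1<..<1} x + ennreal (1 / m) * (J x * indicator {-1<..<1} x)) \<partial>lborel)"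
    using A B(4) by (intro nn_integral_mono) (auto simp: indicator_def)
  also have "\<dots> = ennreal E * ((\<integral>\<^sup>+ x. indicator {-1<..<1::real} x \<partial>lborel) + ennreal (1 / m) * (\<integral>\<^sup>+ x. J x * indicator {-1<..<1} x \<partial>lborel))"
    using Jm by (simp add: nn_integral_cmult nn_integral_add)
  also have "(\<integral>\<^sup>+ x. indicator {-1<..<1::real} x \<partial>lborel) = ennreal 2" by simp
  also have "ennreal E * (ennreal 2 + ennreal (1 / m) * (\<integral>\<^sup>+ x. J x * indicator {-1<..<1} x \<partial>lborel)) \<le> ennreal E * (ennreal 2 + ennreal (1 / m) * ennreal (2 * pi * (2 powr \<theta> * (4 / (1 - \<theta>)))))"
    by (intro mult_left_mono add_left_mono JI) auto
  also have "\<dots> = ennreal (bnd1 r m)"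
  proof -
    have "bnd1 r m = E * (2 + 1 / m * (2 * pi * (2 powr \<theta> * (4 / (1 - \<theta>)))))"
      by (simp add: bnd1_def E_def p_def \<theta>_def mult.assoc)
    moreover define Q where "Q = 2 * pi * (2 powr \<theta> * (4 / (1 - \<theta>)))"
    moreover have Q: "Q \<ge> 0" using \<theta> by (simp add: Q_def)
    moreover have "ennreal (E * (2 + 1 / m * Q)) = ennreal E * ennreal (2 + 1 / m * Q)"
      using E m Q by (intro ennreal_mult) auto
    moreover have "ennreal (2 + 1 / m * Q) = ennreal 2 + ennreal (1 / m * Q)" using m Q by (intro ennreal_plus) auto
    moreover have "ennreal (1 / m * Q) = ennreal (1 / m) * ennreal Q" using m Q by (intro ennreal_mult) auto
    ultimately show ?thesis by (simp only: Q_def)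
  qed
  finally have fin: "(\<integral>\<^sup>+ x. ennreal (exp (p * u x)) * indicator B' x \<partial>lborel) \<le> ennreal (bnd1 r m)" .
  have "set_integrable lborel {-1<..<1} (\<lambda>x. exp (p * u x))"
    by (intro set_lebesgue_integral_eq_integral_Icc continuous_intros)
  then have ei: "set_integrable lborel B' (\<lambda>x. exp (p * u x))" by (rule set_integrable_subset) (use B in auto)
  have "(\<integral>\<^sup>+ x. ennreal (exp (p * u x)) * indicator B' x \<partial>lborel) = (\<integral>\<^sup>+ x. ennreal (indicator B' x *\<^sub>R exp (p * u x)) \<partial>lborel)"
    by (intro nn_integral_cong) (auto simp: indicator_def)
  also have "\<dots> = ennreal (LBINT x:B'. exp (p * u x))"
    using ei unfolding set_integrable_def set_lebesgue_integral_def by (intro nn_integral_eq_integral) auto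
  finally have "ennreal (LBINT x:B'. exp (p * u x)) \<le> ennreal (bnd1 r m)" using fin by simp
  moreover have "bnd1 r m \<ge> 0" using m \<theta> unfolding bnd1_def \<theta>_def by (intro mult_nonneg_nonneg add_nonneg_nonneg) auto
  ultimately show ?thesis by (simp add: B'_def p_def)
qed

text \<open>\<open>f * gf = lam * (gf * exp u)\<close> is split by \<open>mult_exp_le\<close> into
  \<open>exp (p * u)\<close>, bounded on the ball of radius \<open>r / 2\<close> by
  \<open>exp_integral_bound\<close>, and a power of \<open>gf\<close> with the conjugate exponent
  \<open>s\<close>, integrable uniformly in \<open>x\<close>. The remaining factor is
  \<open>lam \<le> pi\<close>, so no bound on \<open>u\<close> is presupposed.\<close>

lemma local_bound:
  assumes r: "0 < r" "r \<le> 1" and m: "0 < m" "m < pi"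
    and mass: "(LBINT y:{-1<..<1} \<inter> {x1 - r<..<x1 + r}. f y) \<le> m"
    and x: "\<bar>x\<bar> \<le> 1" "\<bar>x - x1\<bar> \<le> r / 4"
  shows "u x \<le> bnd r m"
proof -
  define p s where "p = bndp m" and "s = p / (p - 1)"
  have p: "p > 1" using m by (simp add: p_def bndp_def)
  have s: "s > 0" using p by (simp add: s_def)
  define B' where "B' = {-1<..<1} \<inter> {x1 - r/2<..<x1 + r/2}"
  have B: "B' \<in> sets lborel" "B' \<subseteq> {-1<..<1}" by (auto simp: B'_def)
  note sing = powr_singularity_integral[of "1/2" x, OF _ x(1)]
  have 1: "u x \<le> (LBINT y:B'. f y * gf x y) / pi + 2 * ln (2 / (r / 4))"
  proof (rule split_potential[OF x(1) B])
    fix y assume "y \<in> {-1<..<1} - B'"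
    then have "y \<notin> {x1 - r/2<..<x1 + r/2}" by (auto simp: B'_def)
    then show "r / 4 \<le> \<bar>y - x\<bar>" using x(2) by (auto simp: abs_if split: if_splits)
  qed (use r in auto)
  have "set_integrable lborel {-1<..<1} (\<lambda>x. exp (p * u x))"
    by (intro set_lebesgue_integral_eq_integral_Icc continuous_intros)
  then have ei: "set_integrable lborel B' (\<lambda>x. exp (p * u x))" by (rule set_integrable_subset) (use B in auto)
  define c where "c = (2 * s) powr s * 2 powr (1/2)"
  have c: "c \<ge> 0" by (simp add: c_def)
  have si: "set_integrable lborel B' (\<lambda>y. c * \<bar>y - x\<bar> powr (-(1/2)))"
    by (rule set_integrable_subset[of lborel "{-1<..<1}"]) (use B sing in \<open>auto intro!: set_integrable_mult_right\<close>)
  have si': "set_integrable lborel {-1<..<1} (\<lambda>y. c * \<bar>y - x\<bar> powr (-(1/2)))"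
    using sing by (auto intro!: set_integrable_mult_right)
  have "(LBINT y:B'. f y * gf x y) \<le> (LBINT y:B'. lam * (exp (p * u y) + c * \<bar>y - x\<bar> powr (-(1/2))))"
  proof (rule set_integral_mono_AE[OF f_gf_integrable[OF x(1) B]])
    show "set_integrable lborel B' (\<lambda>y. lam * (exp (p * u y) + c * \<bar>y - x\<bar> powr (-(1/2))))"
      by (intro set_integrable_mult_right set_integral_add ei si)
    show "AE y\<in>B' in lborel. f y * gf x y \<le> lam * (exp (p * u y) + c * \<bar>y - x\<bar> powr (-(1/2)))"
      using AE_lborel_neq[of x]
    proof eventually_elim
      case (elim y)
      show ?case
      proof
        assume y: "y \<in> B'"
        have y1: "\<bar>y\<bar> \<le> 1" using abs_le_one_of_subset[OF B(2) y] .
        note g = gf_bounds[OF x(1) y1 elim]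
        have "gf x y * exp (u y) \<le> exp (p * u y) + gf x y powr s" unfolding s_def using g p by (intro mult_exp_le) auto
        also have "gf x y powr s \<le> (2 * s) powr s * (2 / \<bar>y - x\<bar>) powr (1/2)"
        proof (rule ln_powr_le_powr[OF _ s g])
          have "\<bar>y - x\<bar> \<le> 2" using y1 x(1) by linarith
          then show "1 \<le> 2 / \<bar>y - x\<bar>" using elim by simp
        qed
        also have "\<dots> = c * \<bar>y - x\<bar> powr (-(1/2))" by (simp add: powr_ratio c_def)
        finally have "lam * (gf x y * exp (u y)) \<le> lam * (exp (p * u y) + c * \<bar>y - x\<bar> powr (-(1/2)))" using lam by (intro mult_left_mono) auto
        then show "f y * gf x y \<le> lam * (exp (p * u y) + c * \<bar>y - x\<bar> powr (-(1/2)))" by (simp add: f_def mult_ac)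
      qed
    qed
  qed
  also have "\<dots> = lam * ((LBINT y:B'. exp (p * u y)) + (LBINT y:B'. c * \<bar>y - x\<bar> powr (-(1/2))))"
    using ei si by (subst set_integral_mult_right, subst set_integral_add(2)) auto
  also have "\<dots> \<le> lam * (bnd1 r m + c * 8)"
  proof (intro mult_left_mono add_mono)
    show "(LBINT y:B'. exp (p * u y)) \<le> bnd1 r m" unfolding B'_def p_def by (rule exp_integral_bound[OF r m mass])
    have "(LBINT y:B'. c * \<bar>y - x\<bar> powr (-(1/2))) \<le> (LBINT y:{-1<..<1}. c * \<bar>y - x\<bar> powr (-(1/2)))"
      unfolding set_lebesgue_integral_def
      using si si' B(2) c by (intro integral_mono) (auto simp: set_integrable_def indicator_def)
    also have "\<dots> \<le> c * 8" using sing c by (auto intro!: mult_left_mono)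
    finally show "(LBINT y:B'. c * \<bar>y - x\<bar> powr (-(1/2))) \<le> c * 8" .
  qed (use lam in auto)
  also have "\<dots> \<le> pi * (bnd1 r m + c * 8)"
  proof (rule mult_right_mono[OF lam_le])
    have "bnd1 r m \<ge> 0" using m unfolding bnd1_def bndt_def by (intro mult_nonneg_nonneg add_nonneg_nonneg) (auto simp: field_simps)
    then show "0 \<le> bnd1 r m + c * 8" using c by simp
  qed
  finally have "(LBINT y:B'. f y * gf x y) / pi \<le> bnd1 r m + c * 8" by (simp add: pos_divide_le_eq mult.commute)
  then show ?thesis using 1 by (simp add: bnd_def p_def[symmetric] s_def[symmetric] c_def)
qed

end

section \<open>No concentration below the critical mass\<close>

context liouville
begin

text \<open>Each \<open>x\<close> between \<open>x0 + r\<close> and \<open>x0 + 1 / 100\<close> sees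
  the mass from distance at most \<open>2 * (x - x0)\<close>. Hence
  \<open>u x \<ge> ln (1 / (8 * (x - x0))) - 1\<close>, and \<open>f x\<close> is at least
  \<open>lam / (8 * exp 1)\<close> times \<open>1 / (x - x0)\<close>. Integrated, this is
  \<open>lam / (8 * exp 1) * (T - ln 100)\<close>, and the total mass is below
  \<open>2 * pi\<close>.\<close>

lemma lam_le_of_mass:
  assumes T: "T \<ge> 20" and x0: "\<bar>x0\<bar> \<le> 1" and m: "m = pi * (1 - 1 / T)" and r: "r = exp (- T)"
    and mass: "(LBINT y:{-1<..<1} \<inter> {x0 - r<..<x0 + r}. f y) > m"
  shows "lam * (T - ln 100) \<le> 16 * pi * exp 1"
proof -
  define B where "B = {-1<..<1} \<inter> {x0 - r<..<x0 + r}"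
  have B: "B \<in> sets lborel" "B \<subseteq> {-1<..<1}" by (auto simp: B_def)
  have r0: "r > 0" by (simp add: r)
  have r1: "r \<le> 1 / 100"
  proof -
    have "2 ^ 7 \<le> exp (1::real) ^ 7" using exp_ge_add_one_self[of 1] by (intro power_mono) auto
    also have "\<dots> = exp 7" by (simp add: exp_of_nat_mult[symmetric])
    also have "\<dots> \<le> exp T" using T by simp
    finally have "100 \<le> exp T" by simp
    then show ?thesis by (simp add: r exp_minus field_simps)
  qed
  have m0: "m \<ge> 19 / 20 * pi" using T by (simp add: m field_simps)
  \<comment> \<open>Near an endpoint the Green function degenerates. The bound
    \<open>q2 \<le> \<rho> / 3\<close> excludes this: mass \<open>19 / 20 * pi\<close> at
    \<open>\<bar>y\<bar> \<ge> 84 / 100\<close> would give a second moment above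
    \<open>2 * pi / 3\<close>, since \<open>0.84 * 0.84 * 0.95\<close> is about
    \<open>0.670\<close>.\<close>
  have x085: "\<bar>x0\<bar> \<le> 85 / 100"
  proof (rule ccontr)
    assume "\<not> ?thesis"
    then have big: "\<bar>x0\<bar> > 85 / 100" by simp
    have q: "q2 = (LBINT y:{-1<..<1}. y\<^sup>2 * f y)"
      by (intro set_lebesgue_integral_eq_integral_Icc(2)[symmetric] continuous_intros)
    have qi: "set_integrable lborel {-1<..<1} (\<lambda>y. y\<^sup>2 * f y)"
      by (intro set_lebesgue_integral_eq_integral_Icc(1) continuous_intros)
    have "(84 / 100)\<^sup>2 * (LBINT y:B. f y) = (LBINT y:B. (84 / 100)\<^sup>2 * f y)" by simp
    also have "\<dots> \<le> q2" unfolding q set_lebesgue_integral_def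
    proof (intro integral_mono)
      show "integrable lborel (\<lambda>y. indicator B y *\<^sub>R ((84 / 100)\<^sup>2 * f y))"
        using f_integrable[OF B] by (fold set_integrable_def) (intro set_integrable_mult_right)
      show "integrable lborel (\<lambda>y. indicator {-1<..<1} y *\<^sub>R (y\<^sup>2 * f y))" using qi by (simp add: set_integrable_def)
      fix y :: real
      show "indicator B y *\<^sub>R ((84 / 100)\<^sup>2 * f y) \<le> indicator {-1<..<1} y *\<^sub>R (y\<^sup>2 * f y)"
      proof (cases "y \<in> B")
        case True
        then have "\<bar>y\<bar> \<ge> 84 / 100" using big r1 by (auto simp: B_def abs_if split: if_splits)
        then have "(84 / 100)\<^sup>2 \<le> \<bar>y\<bar>\<^sup>2" by (intro power_mono) auto
        then show ?thesis using True B f_pos[of y] by (auto simp: indicator_def intro!: mult_right_mono less_imp_le)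
      next
        case False
        then show ?thesis using f_pos[of y] by (auto simp: indicator_def less_imp_le)
      qed
    qed
    also have "q2 \<le> 2 * pi / 3" using q2_le \<rho>_less by linarith
    finally have "(84 / 100)\<^sup>2 * (LBINT y:B. f y) \<le> 2 * pi / 3" .
    moreover have "(84 / 100)\<^sup>2 * (19 / 20 * pi) \<le> (84 / 100)\<^sup>2 * (LBINT y:B. f y)"
      using m0 mass by (intro mult_left_mono) (auto simp: B_def)
    ultimately have "(84 / 100)\<^sup>2 * (19 / 20 * pi) \<le> 2 * pi / 3" by linarith
    then have "((84 / 100)\<^sup>2 * (19 / 20)) * pi \<le> (2 / 3) * pi" by simp
    then have "(84 / 100)\<^sup>2 * (19 / 20) \<le> (2 / 3 :: real)" using pi_gt_zero by (simp only: mult_le_cancel_right_pos)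
    then show False by (simp add: power2_eq_square)
  qed
  define d where "d = (1 / 100 :: real)"
  have lower: "f x \<ge> lam / (8 * exp 1) * (1 / (x - x0))" if x: "x0 + r \<le> x" "x \<le> x0 + d" for x
  proof -
    define t where "t = x - x0"
    have t: "r \<le> t" "t \<le> 1 / 100" "t > 0" using x r0 by (auto simp: t_def d_def)
    have x1: "\<bar>x\<bar> \<le> 86 / 100" using x085 t by (auto simp: t_def)
    define l where "l = ln (1 / (8 * t))"
    have l: "l \<ge> 0" using t by (simp add: l_def)
    have "l * m \<le> l * (LBINT y:B. f y)" using l mass by (intro mult_left_mono) (auto simp: B_def)
    also have "\<dots> = (LBINT y:B. l * f y)" by simp
    also have "\<dots> \<le> (LBINT y:{-1<..<1}. f y * gf x y)" unfolding set_lebesgue_integral_def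
    proof (rule integral_mono_AE)
      show "integrable lborel (\<lambda>y. indicator B y *\<^sub>R (l * f y))"
        using f_integrable[OF B] by (fold set_integrable_def) (intro set_integrable_mult_right)
      show "integrable lborel (\<lambda>y. indicator {-1<..<1} y *\<^sub>R (f y * gf x y))"
        using f_gf_integrable[of x "{-1<..<1}"] x1 by (simp add: set_integrable_def)
      show "AE y in lborel. indicator B y *\<^sub>R (l * f y) \<le> indicator {-1<..<1} y *\<^sub>R (f y * gf x y)"
        using AE_lborel_neq[of x]
      proof eventually_elim
        case (elim y)
        show ?case
        proof (cases "y \<in> B")
          case True
          then have yI: "y \<in> {-1<..<1}" and y: "x0 - r < y" "y < x0 + r" by (auto simp: B_def)
          have y1: "\<bar>y\<bar> \<le> 86 / 100" using y x085 r1 by (auto simp: abs_if split: if_splits)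
          have xy: "\<bar>x - y\<bar> \<le> 2 * t" using y t by (auto simp: t_def abs_if)
          have "\<bar>x * y\<bar> \<le> (86 / 100) * (86 / 100)" unfolding abs_mult using x1 y1 by (intro mult_mono) auto
          then have "x * y \<le> 3 / 4" by (simp add: abs_le_iff)
          moreover have "sqrt (1 - x\<^sup>2) * sqrt (1 - y\<^sup>2) \<ge> 0" using x1 y1 by (simp add: abs_square_le_1)
          ultimately have c: "1 / 4 \<le> 1 - x * y + sqrt (1 - x\<^sup>2) * sqrt (1 - y\<^sup>2)" by linarith
          have "1 / (8 * t) = (1 / 4) / (2 * t)" by simp
          also have "\<dots> \<le> (1 - x * y + sqrt (1 - x\<^sup>2) * sqrt (1 - y\<^sup>2)) / \<bar>x - y\<bar>"
            using c xy t elim by (intro frac_le) auto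
          finally have "l \<le> gf x y" unfolding l_def using gf_eq(1)[of x y] x1 y1 elim t by (auto intro!: ln_mono)
          then show ?thesis using True yI f_pos[of y] by (simp add: mult.commute)
        next
          case False
          have "0 \<le> f y * gf x y" if "y \<in> {-1<..<1}"
            using that f_pos[of y] gf_nonneg[of x y] elim x1 by (intro mult_nonneg_nonneg) auto
          then show ?thesis using False by (auto simp: indicator_def)
        qed
      qed
    qed
    also have "\<dots> = pi * u x" using u_eq[of x] x1 by simp
    finally have "pi * (l * (1 - 1 / T)) \<le> pi * u x" by (simp add: m mult_ac)
    then have "l * (1 - 1 / T) \<le> u x" using pi_gt_zero by (simp only: mult_le_cancel_left_pos)
    \<comment> \<open>Since \<open>x\<close> is at distance at least \<open>r = exp (- T)\<close>
      from \<open>x0\<close>, the logarithm \<open>l\<close> is at most \<open>T\<close>. The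
      missing fraction \<open>1 / T\<close> of the mass thus costs only the constant 1.\<close>
    moreover have "l / T \<le> 1"
    proof -
      have "l \<le> ln (1 / r)" unfolding l_def using t r0 by (intro ln_mono divide_left_mono) auto
      also have "\<dots> = T" by (simp add: r ln_div)
      finally show ?thesis using T by simp
    qed
    ultimately have "l - 1 \<le> u x" by (simp add: algebra_simps)
    then have "exp (l - 1) \<le> exp (u x)" by simp
    moreover have "exp (l - 1) = 1 / (8 * exp 1) * (1 / t)" using t by (simp add: l_def exp_diff)
    ultimately have "lam * (1 / (8 * exp 1) * (1 / t)) \<le> lam * exp (u x)" using lam by (intro mult_left_mono) auto
    then show ?thesis by (simp add: f_def t_def)
  qed
  have "((\<lambda>x. 1 / (x - x0)) has_integral ln (x0 + d - x0) - ln (x0 + r - x0)) {x0 + r..x0 + d}"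
    using r0 r1 by (intro fundamental_theorem_of_calculus)
      (auto intro!: derivative_eq_intros simp: d_def has_real_derivative_iff_has_vector_derivative[symmetric])
  then have hi: "((\<lambda>x. lam / (8 * exp 1) * (1 / (x - x0))) has_integral lam / (8 * exp 1) * (ln d - ln r)) {x0 + r..x0 + d}"
    by (intro has_integral_mult_right) simp
  have sub: "{x0 + r..x0 + d} \<subseteq> {-1..1}" using x085 r0 by (auto simp: d_def)
  have fi: "f integrable_on {x0 + r..x0 + d}" by (intro integrable_continuous_real continuous_intros)
  have "lam / (8 * exp 1) * (ln d - ln r) \<le> integral {x0 + r..x0 + d} f"
    by (rule has_integral_le[OF hi integrable_integral[OF fi]]) (use lower in auto)
  also have "\<dots> \<le> \<rho>"
    by (rule integral_subset_le[OF sub fi]) (auto intro!: integrable_continuous_real continuous_intros less_imp_le f_pos)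
  also have "ln d - ln r = T - ln 100" by (simp add: d_def r ln_div)
  finally have "lam / (8 * exp 1) * (T - ln 100) \<le> 2 * pi" using \<rho>_less by linarith
  then show ?thesis by (simp add: field_simps)
qed

text \<open>
  If nearly the mass \<open>pi\<close> sat within distance \<open>exp (- T)\<close> of \<open>x0\<close>, the logarithmic potential of that mass
  would force \<open>lam\<close>, hence the density away from \<open>x0\<close>, to be small. The first moment then forces \<open>x0\<close> close to
  \<open>0\<close>, so the second moment is small, contradicting \<open>moment_upper\<close> since \<open>\<rho>\<close> is away from \<open>2 * pi\<close>.
\<close>

lemma no_concentration:
  assumes \<epsilon>: "0 < \<epsilon>" "\<epsilon> \<le> 1" "\<rho> \<le> 2 * pi - \<epsilon>"
    and R: "0 < R" "R \<le> 1 / 100" "(50 * pi + 1) * R < \<epsilon> / 12"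
    and T: "T = 2 * pi / \<epsilon> + 20 + ln (1 / R) + ln 100 + 64 * pi * exp (1 + bnd R (pi - \<epsilon> / 2)) / R"
    and m: "m = pi * (1 - 1 / T)" and r: "r = exp (- T)" and x0: "\<bar>x0\<bar> \<le> 1"
  shows "(LBINT y:{-1<..<1} \<inter> {x0 - r<..<x0 + r}. f y) \<le> m"
proof (rule ccontr)
  assume "\<not> ?thesis"
  then have mass: "(LBINT y:{-1<..<1} \<inter> {x0 - r<..<x0 + r}. f y) > m" by simp
  define C where "C = bnd R (pi - \<epsilon> / 2)"
  have lnR: "ln (1 / R) \<ge> 0" using R by simp
  have ln100: "ln 100 \<ge> (0::real)" by simp
  have t1: "2 * pi / \<epsilon> \<ge> 0" "64 * pi * exp (1 + C) / R \<ge> 0" using \<epsilon> R by auto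
  \<comment> \<open>The summands of \<open>T\<close> in turn: \<open>2 * pi / \<epsilon>\<close>
    brings \<open>m\<close> above \<open>pi - \<epsilon> / 2\<close>; 20 is required by
    \<open>lam_le_of_mass\<close>; \<open>ln (1 / R)\<close> brings \<open>r\<close> below
    \<open>R\<close>; the last two make \<open>lam * exp C\<close> at most
    \<open>R / 4\<close>.\<close>
  have T20: "T \<ge> 20" and T1: "T \<ge> 2 * pi / \<epsilon>" and T2: "T \<ge> ln (1 / R)" and T3: "T - ln 100 \<ge> 64 * pi * exp (1 + C) / R"
    using lnR ln100 t1 unfolding T C_def by linarith+
  have rR: "r \<le> R"
  proof -
    have "exp (- T) \<le> exp (- ln (1 / R))" using T2 by simp
    also have "\<dots> = R" using R by (simp add: ln_div)
    finally show ?thesis by (simp add: r)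
  qed
  have m1: "m \<ge> pi - \<epsilon> / 2"
  proof -
    have "2 * pi \<le> \<epsilon> * T" using T1 \<epsilon> by (simp add: field_simps)
    then have "pi / T \<le> \<epsilon> / 2" using T20 by (simp add: field_simps)
    then show ?thesis by (simp add: m algebra_simps)
  qed
  have "lam * (T - ln 100) \<le> 16 * pi * exp 1" by (rule lam_le_of_mass[OF T20 x0 m r mass])
  moreover have "lam * (64 * pi * exp (1 + C) / R) \<le> lam * (T - ln 100)" using T3 lam by (intro mult_left_mono) auto
  ultimately have "lam * (64 * pi * exp (1 + C) / R) \<le> 16 * pi * exp 1" by linarith
  then have "(16 * pi * exp 1) * (lam * exp C * 4) \<le> (16 * pi * exp 1) * R" using R by (simp add: exp_add field_simps)
  then have K4: "lam * exp C * 4 \<le> R" using pi_gt_zero by (simp only: mult_le_cancel_left_pos mult_pos_pos exp_gt_zero zero_less_numeral)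
  define K where "K = lam * exp C"
  have K: "K > 0" "K * 4 \<le> R" using K4 lam by (auto simp: K_def)
  \<comment> \<open>The balls around \<open>x\<close> and \<open>x0\<close> are disjoint, so the one
    around \<open>x\<close> holds at most \<open>\<rho> - m \<le> pi - \<epsilon> / 2\<close>, and
    \<open>local_bound\<close> applies there.\<close>
  have far: "f x \<le> K" if x: "\<bar>x\<bar> \<le> 1" "\<bar>x - x0\<bar> \<ge> 2 * R" for x
  proof -
    have "u x \<le> C" unfolding C_def
    proof (rule local_bound[of R "pi - \<epsilon> / 2" x])
      define A B where "A = {-1<..<1} \<inter> {x - R<..<x + R}" and "B = {-1<..<1} \<inter> {x0 - r<..<x0 + r}"
      have AB: "A \<in> sets lborel" "A \<subseteq> {-1<..<1}" "B \<in> sets lborel" "B \<subseteq> {-1<..<1}" by (auto simp: A_def B_def)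
      have "A \<inter> B = {}" using x(2) rR by (auto simp: A_def B_def abs_if split: if_splits)
      then have "(LBINT y:A. f y) + (LBINT y:B. f y) = (LBINT y:A \<union> B. f y)"
        using AB by (intro set_integral_Un[symmetric] f_integrable) auto
      also have "\<dots> \<le> \<rho>" unfolding \<rho>_eq using AB by (intro mass_mono) auto
      finally show "(LBINT y:{-1<..<1} \<inter> {x - R<..<x + R}. f y) \<le> pi - \<epsilon> / 2"
        using mass m1 \<epsilon> by (simp add: A_def B_def)
    qed (use R \<epsilon> x pi_gt3 in auto)
    then show ?thesis using lam by (simp add: f_def K_def)
  qed
  have \<rho>1: "\<rho> \<ge> pi / 2"
  proof -
    have "(LBINT y:{-1<..<1} \<inter> {x0 - r<..<x0 + r}. f y) \<le> \<rho>" unfolding \<rho>_eq by (intro mass_mono) auto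
    then show ?thesis using mass m1 \<epsilon> pi_gt3 by linarith
  qed
  have fc: "f integrable_on {-1..1}" by (intro integrable_continuous_real continuous_intros)
  \<comment> \<open>By \<open>first_moment\<close>, \<open>x0 * \<rho>\<close> is the integral of
    \<open>(x0 - y) * f y\<close>. Within \<open>2 * R\<close> of \<open>x0\<close> the first factor
    is small, elsewhere the density is at most \<open>K\<close>.\<close>
  have "\<bar>x0\<bar> * \<rho> \<le> 2 * R * \<rho> + 4 * K"
  proof -
    have "integral {-1..1} (\<lambda>y. (x0 - y) * f y) = integral {-1..1} (\<lambda>y. x0 * f y - y * f y)" by (simp add: left_diff_distrib)
    also have "\<dots> = x0 * \<rho> - integral {-1..1} (\<lambda>y. y * f y)"
      by (subst Henstock_Kurzweil_Integration.integral_diff) (auto intro!: integrable_continuous_real continuous_intros)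
    finally have "x0 * \<rho> = integral {-1..1} (\<lambda>y. (x0 - y) * f y)" using first_moment by simp
    moreover have "norm (integral {-1..1} (\<lambda>y. (x0 - y) * f y)) \<le> integral {-1..1} (\<lambda>y. 2 * R * f y + 2 * K)"
    proof (rule integral_norm_bound_integral)
      show "norm ((x0 - y) * f y) \<le> 2 * R * f y + 2 * K" if "y \<in> {-1..1}" for y
      proof -
        have y: "\<bar>y\<bar> \<le> 1" using that by auto
        have n: "norm ((x0 - y) * f y) = \<bar>y - x0\<bar> * f y" using f_pos[of y] by (simp add: abs_mult)
        show ?thesis
        proof (cases "\<bar>y - x0\<bar> \<ge> 2 * R")
          case True
          have "\<bar>y - x0\<bar> * f y \<le> 2 * K" using far[OF y True] y x0 f_pos[of y] K by (intro mult_mono) auto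
          moreover have "0 \<le> 2 * R * f y" using R f_pos[of y] by simp
          ultimately show ?thesis using n by linarith
        next
          case False
          then have "\<bar>y - x0\<bar> * f y \<le> 2 * R * f y" using f_pos[of y] by (intro mult_right_mono) auto
          then show ?thesis using n K by linarith
        qed
      qed
    qed (intro integrable_continuous_real continuous_intros)+
    moreover have "integral {-1..1} (\<lambda>y. 2 * R * f y + 2 * K) = 2 * R * \<rho> + 4 * K"
      by (subst Henstock_Kurzweil_Integration.integral_add) (auto intro!: integrable_continuous_real continuous_intros)
    ultimately have "\<bar>x0 * \<rho>\<bar> \<le> 2 * R * \<rho> + 4 * K" by simp
    then show ?thesis using \<rho>_pos by (simp add: abs_mult)
  qed
  also have "\<dots> \<le> 2 * R * \<rho> + R * \<rho>" using K \<rho>1 pi_gt3 R mult_left_mono[of 1 \<rho> R] by linarith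
  finally have "\<bar>x0\<bar> * \<rho> \<le> (3 * R) * \<rho>" by (simp add: algebra_simps)
  then have x3: "\<bar>x0\<bar> \<le> 3 * R" using \<rho>_pos by simp
  have "q2 \<le> integral {-1..1} (\<lambda>y. 25 * R\<^sup>2 * f y + K)"
  proof (rule integral_le)
    show "y\<^sup>2 * f y \<le> 25 * R\<^sup>2 * f y + K" if "y \<in> {-1..1}" for y
    proof -
      have y: "\<bar>y\<bar> \<le> 1" using that by auto
      show ?thesis
      proof (cases "\<bar>y - x0\<bar> \<ge> 2 * R")
        case True
        have "y\<^sup>2 * f y \<le> 1 * K" using far[OF y True] y f_pos[of y] K by (intro mult_mono) (auto simp: abs_square_le_1)
        moreover have "0 \<le> 25 * R\<^sup>2 * f y" using f_pos[of y] by simp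
        ultimately show ?thesis by linarith
      next
        case False
        then have "\<bar>y\<bar> \<le> 5 * R" using x3 by linarith
        then have "\<bar>y\<bar>\<^sup>2 \<le> (5 * R)\<^sup>2" by (intro power_mono) auto
        then have "y\<^sup>2 * f y \<le> 25 * R\<^sup>2 * f y" using f_pos[of y] by (intro mult_right_mono) (auto simp: power_mult_distrib)
        then show ?thesis using K by linarith
      qed
    qed
  qed (intro integrable_continuous_real continuous_intros)+
  also have "\<dots> = 25 * R\<^sup>2 * \<rho> + 2 * K"
    by (subst Henstock_Kurzweil_Integration.integral_add) (auto intro!: integrable_continuous_real continuous_intros)
  also have "\<dots> \<le> 25 * R\<^sup>2 * (2 * pi) + R" using \<rho>_less K by (intro add_mono mult_left_mono) auto
  also have "25 * R\<^sup>2 * (2 * pi) \<le> 50 * pi * R" using R pi_gt_zero by (simp add: power2_eq_square mult_left_le_one_le)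
  finally have q: "q2 < \<epsilon> / 12" using R(3) by (simp add: algebra_simps)
  \<comment> \<open>The threshold \<open>\<epsilon> / 12\<close> for \<open>q2\<close> is the one at
    which \<open>6 * pi * q2\<close> meets this lower bound.\<close>
  have "pi / 2 * \<epsilon> \<le> \<rho> * (2 * pi - \<rho>)" using \<rho>1 \<epsilon> by (intro mult_mono) auto
  also have "\<dots> \<le> 6 * pi * q2" by (rule moment_upper)
  also have "\<dots> < 6 * pi * (\<epsilon> / 12)" using q by (intro mult_strict_left_mono) auto
  finally show False by simp
qed

end

text \<open>All radii and masses are fixed from \<open>\<epsilon>\<close> alone before a solution is
  chosen, so the constant is the same for all of them.\<close>

lemma uniform_sup_bound:
  assumes "\<epsilon> > 0"
  shows "\<exists>C. \<forall>u L lam f x. liouville u L lam f \<and> integral {-1..1} f \<le> 2 * pi - \<epsilon> \<longrightarrow> u x \<le> C"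
proof -
  define e where "e = min \<epsilon> 1"
  have e: "0 < e" "e \<le> 1" "e \<le> \<epsilon>" using assms by (auto simp: e_def)
  \<comment> \<open>The factor 24 leaves half of the margin \<open>e / 12\<close> required by
    \<open>no_concentration\<close>.\<close>
  define R where "R = min (1 / 100) (e / (24 * (50 * pi + 1)))"
  have p: "50 * pi + 1 > 0" using pi_gt_zero by linarith
  have R: "0 < R" "R \<le> 1 / 100" "(50 * pi + 1) * R < e / 12"
  proof -
    show "0 < R" using e p by (auto simp: R_def)
    show "R \<le> 1 / 100" unfolding R_def by (rule min.cobounded1)
    have "(50 * pi + 1) * R \<le> (50 * pi + 1) * (e / (24 * (50 * pi + 1)))" using p by (intro mult_left_mono) (auto simp: R_def)
    also have "\<dots> = e / 24"
    proof -
      have "c * (e / (24 * c)) = e / 24" if "c > 0" for c :: real using that by simp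
      then show ?thesis using p by blast
    qed
    finally show "(50 * pi + 1) * R < e / 12" using e by linarith
  qed
  define T where "T = 2 * pi / e + 20 + ln (1 / R) + ln 100 + 64 * pi * exp (1 + bnd R (pi - e / 2)) / R"
  define m r where "m = pi * (1 - 1 / T)" and "r = exp (- T)"
  have "ln (1 / R) \<ge> 0" "ln 100 \<ge> (0::real)" "2 * pi / e \<ge> 0" "64 * pi * exp (1 + bnd R (pi - e / 2)) / R \<ge> 0" using R e by auto
  then have T: "T \<ge> 20" unfolding T_def by linarith
  have m: "0 < m" "m < pi" using T by (auto simp: m_def field_simps)
  have r: "0 < r" "r \<le> 1" using T by (auto simp: r_def)
  have "u x \<le> max 0 (bnd r m)" if l: "liouville u L lam f" and i: "integral {-1..1} f \<le> 2 * pi - \<epsilon>" for u L lam f x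
  proof -
    interpret liouville u L lam f by (rule l)
    show ?thesis
    proof (cases "\<bar>x\<bar> \<le> 1")
      case True
      have "(LBINT y:{-1<..<1} \<inter> {x - r<..<x + r}. f y) \<le> m"
        using i e by (intro no_concentration[OF e(1,2) _ R T_def m_def r_def True]) auto
      from local_bound[OF r m this True] have "u x \<le> bnd r m" using r by simp
      then show ?thesis by simp
    next
      case False
      then have "x \<notin> {-1<..<1}" by auto
      then show ?thesis using out[of x] by simp
    qed
  qed
  then show ?thesis by blast
qed

text \<open>The nearest-point retraction onto the closed interval. Functions that vanish outside are
  invariant under it, so estimates proved for \<open>\<bar>x\<bar> \<le> 1\<close> extend to the
  line with the same constant.\<close>

definition clamp1 :: "real \<Rightarrow> real" where "clamp1 x = max (-1) (min 1 x)"

lemma clamp1: "\<bar>clamp1 x\<bar> \<le> 1" "\<bar>clamp1 x - clamp1 y\<bar> \<le> \<bar>x - y\<bar>" "\<bar>x\<bar> \<le> 1 \<Longrightarrow> clamp1 x = x" "\<bar>x\<bar> > 1 \<Longrightarrow> \<bar>clamp1 x\<bar> = 1"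
  unfolding clamp1_def by linarith+

context half_order
begin
lemma u_clamp1: "u (clamp1 x) = u x"
proof (cases "\<bar>x\<bar> \<le> 1")
  case False
  then have "x \<notin> {-1<..<1}" "clamp1 x \<notin> {-1<..<1}" using clamp1(4)[of x] by auto
  then show ?thesis using out by simp
qed (simp add: clamp1)
end

text \<open>Twice the Lipschitz constant \<open>A + 32 * B\<close> of \<open>gpot_lipschitz\<close>
  with the bound \<open>A = pi * exp C\<close> for the density and its Hoelder constant
  \<open>B = A * (gpot_const (1/2) * A)\<close>; the 2 comes from
  \<open>norm_cpt_diff_le\<close>.\<close>

definition hconst :: "real \<Rightarrow> real" where
  "hconst C = 2 * (pi * exp C + 32 * (pi * exp C * (gpot_const (1/2) * (pi * exp C))))"

context liouville
begin

text \<open>A two-step bootstrap: a bounded density makes \<open>u\<close> Hoelder of exponent 1/2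
  in the chord length, hence the density as well, so the potential is Lipschitz in the chord length,
  and this is exponent 1/2 on the line.\<close>

lemma half_holder_bound:
  assumes C: "\<And>x. u x \<le> C"
  shows "\<bar>u x - u y\<bar> \<le> hconst C * sqrt \<bar>x - y\<bar>"
proof -
  define A where "A = pi * exp C"
  have A: "\<bar>f x\<bar> \<le> A" for x
  proof -
    have "f x \<le> pi * exp C" unfolding f_def using lam_le lam C[of x] by (intro mult_mono) auto
    then show ?thesis using f_pos[of x] by (simp add: A_def)
  qed
  define K where "K = gpot_const (1/2) * A"
  have A0: "A \<ge> 0" using A[of 0] by linarith
  have K: "K \<ge> 0" unfolding K_def using gpot_const_nonneg[of "1/2"] A0 by simp
  have h1: "\<bar>u x - u y\<bar> \<le> K * sqrt (norm (cpt x - cpt y))" if "\<bar>x\<bar> \<le> 1" "\<bar>y\<bar> \<le> 1" for x y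
  proof -
    have "\<bar>u x - u y\<bar> = \<bar>Re (gpot f (cpt x) - gpot f (cpt y))\<bar>" using repr that by simp
    also have "\<dots> \<le> norm (gpot f (cpt x) - gpot f (cpt y))" by (rule abs_Re_le_cmod)
    also have "\<dots> \<le> gpot_const (1/2) * A * norm (cpt x - cpt y) powr (1/2)"
      using that by (intro gpot_holder f_meas A) auto
    finally show ?thesis by (simp add: K_def powr_half_sqrt)
  qed
  have h2: "\<bar>f y - f x\<bar> \<le> (A * K) * sqrt (norm (cpt y - cpt x))" if "\<bar>x\<bar> \<le> 1" "\<bar>y\<bar> \<le> 1" for x y
  proof -
    have "norm (exp (u y) - exp (u x)) \<le> exp C * norm (u y - u x)"
    proof (rule field_differentiable_bound[of "{..C}" exp exp])
      show "(exp has_real_derivative exp z) (at z within {..C})" for z by (auto intro!: derivative_eq_intros)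
    qed (use C in auto)
    also have "\<dots> \<le> exp C * (K * sqrt (norm (cpt y - cpt x)))" using h1[OF that(2,1)] by (intro mult_left_mono) auto
    finally have "lam * norm (exp (u y) - exp (u x)) \<le> pi * (exp C * (K * sqrt (norm (cpt y - cpt x))))"
      using lam_le lam by (intro mult_mono) auto
    then show ?thesis using lam by (simp add: f_def right_diff_distrib[symmetric] abs_mult A_def mult_ac)
  qed
  have AK: "A * K \<ge> 0" using A0 K by simp
  have lip: "\<bar>u x - u y\<bar> \<le> hconst C * sqrt \<bar>x - y\<bar>" if "\<bar>x\<bar> \<le> 1" "\<bar>y\<bar> \<le> 1" for x y
  proof -
    have "\<bar>u x - u y\<bar> = \<bar>Re (gpot f (cpt x) - gpot f (cpt y))\<bar>" using repr that by simp
    also have "\<dots> \<le> norm (gpot f (cpt x) - gpot f (cpt y))" by (rule abs_Re_le_cmod)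
    also have "\<dots> \<le> (A + 32 * (A * K)) * norm (cpt x - cpt y)"
      by (rule gpot_lipschitz(2)[OF f_cont h2 AK A]) (use that in auto)
    also have "\<dots> \<le> (A + 32 * (A * K)) * (2 * sqrt \<bar>x - y\<bar>)"
      using norm_cpt_diff_le[OF that] A0 AK by (intro mult_left_mono) auto
    also have "\<dots> = hconst C * sqrt \<bar>x - y\<bar>" by (simp add: hconst_def K_def A_def)
    finally show ?thesis .
  qed
  have h0: "hconst C \<ge> 0" unfolding hconst_def using A0 AK by (simp add: A_def K_def)
  have "\<bar>u x - u y\<bar> = \<bar>u (clamp1 x) - u (clamp1 y)\<bar>" by (simp add: u_clamp1)
  also have "\<dots> \<le> hconst C * sqrt \<bar>clamp1 x - clamp1 y\<bar>" by (intro lip clamp1)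
  also have "\<dots> \<le> hconst C * sqrt \<bar>x - y\<bar>" using clamp1(2) h0 by (intro mult_left_mono real_sqrt_le_mono) auto
  finally show ?thesis .
qed

end

section \<open>Interior estimates of higher order\<close>

lemma Im_Ln_polar: "c > 0 \<Longrightarrow> \<bar>g\<bar> < pi \<Longrightarrow> Im (Ln (of_real c * cis g)) = g"
proof -
  assume c: "c > 0" and g: "\<bar>g\<bar> < pi"
  have "of_real c * cis g = exp (Complex (ln c) g)" using c by (simp add: exp_eq_polar)
  then have "Ln (of_real c * cis g) = Complex (ln c) g" using g by (simp add: Ln_exp)
  then show ?thesis by simp
qed

text \<open>On the arc \<open>1 + cis s = 2 * cos (s / 2) * cis (s / 2)\<close>, so the arguments of
  both factors are half angles. Their difference jumps by \<open>pi\<close> as \<open>x\<close>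
  crosses \<open>y\<close>, and this jump is what produces the primitive of
  \<open>f\<close>.\<close>

lemma Im_gker_boundary:
  assumes x: "\<bar>x\<bar> \<le> 1" and y: "\<bar>y\<bar> < 1" "y \<noteq> x"
  shows "Im (gker (cpt x) y) = arcsin y + pi / 2 * sgn (x - y)"
proof -
  define a b where "a = arcsin x" and "b = arcsin y"
  have a: "\<bar>a\<bar> \<le> pi / 2" "sin a = x" using x arcsin[of x] by (auto simp: a_def abs_le_iff)
  have b: "\<bar>b\<bar> < pi / 2" "sin b = y" using y arcsin_lt_bounded[of y] by (auto simp: b_def abs_less_iff)
  have cx: "cpt x = cis a" using cpt_sin[OF a(1)] a(2) by simp
  have cy: "cpt y = cis b" using cpt_sin[of b] b by simp
  have half: "1 + cis s = of_real (2 * cos (s / 2)) * cis (s / 2)" for s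
  proof -
    have "cis (s / 2) * cis (s / 2) = cis s" "cis (s / 2) * cis (- (s / 2)) = 1" by (simp_all add: cis_mult)
    then have "1 + cis s = cis (s / 2) * (cis (s / 2) + cis (- (s / 2)))" by (simp add: distrib_left)
    also have "cis (s / 2) + cis (- (s / 2)) = of_real (2 * cos (s / 2))" by (simp add: complex_eq_iff)
    finally show ?thesis by (simp add: mult.commute)
  qed
  have "(a + b) / 2 < pi / 2" "- (pi / 2) < (a + b) / 2" using a b by (simp_all add: abs_le_iff abs_less_iff)
  then have ab2: "\<bar>(a + b) / 2\<bar> < pi / 2" unfolding abs_less_iff by linarith
  then have c: "cos ((a + b) / 2) > 0" by (intro cos_gt_zero_pi) auto
  have "1 + cpt x * cpt y = of_real (2 * cos ((a + b) / 2)) * cis ((a + b) / 2)"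
    using half[of "a + b"] by (simp add: cx cy cis_mult)
  then have 1: "Im (Ln (1 + cpt x * cpt y)) = (a + b) / 2"
    using c ab2 pi_gt_zero by (simp only:) (rule Im_Ln_polar, auto)
  have ab: "a \<noteq> b" using a(2) b(2) y(2) by auto
  have mono: "x > y \<longleftrightarrow> a > b" using sin_mono_less_eq[of b a] a b by (auto simp: abs_le_iff abs_less_iff)
  \<comment> \<open>The shift by \<open>pi\<close> writes \<open>1 - cis (a - b)\<close> as
    \<open>1 + cis\<close>, and its sign puts the half angle between \<open>- pi / 2\<close> and
    \<open>pi / 2\<close>, where the principal branch returns it.\<close>
  define e where "e = (if a > b then 1 else - 1 :: real)"
  have h2: "1 + cis (a - b - e * pi) = 1 - cpt x * cnj (cpt y)"
    by (simp add: e_def cx cy cis_cnj cis_mult complex_eq_iff cos_diff sin_diff cos_add sin_add)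
  have s: "\<bar>(a - b - e * pi) / 2\<bar> < pi / 2" using a b ab by (auto simp: e_def abs_if field_simps split: if_splits)
  then have c2: "cos ((a - b - e * pi) / 2) > 0" by (intro cos_gt_zero_pi) auto
  have "1 - cpt x * cnj (cpt y) = of_real (2 * cos ((a - b - e * pi) / 2)) * cis ((a - b - e * pi) / 2)"
    unfolding h2[symmetric] by (rule half)
  then have 2: "Im (Ln (1 - cpt x * cnj (cpt y))) = (a - b - e * pi) / 2"
    using c2 s pi_gt_zero by (simp only:) (rule Im_Ln_polar, auto)
  have "e = sgn (x - y)" using mono y(2) ab by (auto simp: e_def sgn_if)
  then show ?thesis using 1 2 by (simp add: gker_def b_def field_simps)
qed

context liouville
begin

text \<open>The jump \<open>pi\<close> of the conjugate kernel against the factor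
  \<open>1 / pi\<close> in \<open>gpot\<close> leaves the mass to the left of \<open>x\<close>; the
  rest of the kernel does not depend on \<open>x\<close>.\<close>

lemma Im_gpot_boundary:
  obtains c where "\<And>x. \<bar>x\<bar> \<le> 1 \<Longrightarrow> Im (gpot f (cpt x)) = c + integral {-1..x} f"
proof (rule that)
  fix x :: real assume x: "\<bar>x\<bar> \<le> 1"
  note i = set_integrable_gker[OF _ f_meas f_le, of "cpt x", unfolded set_integrable_def]
  have "Im (LBINT y:{-1<..<1}. complex_of_real (f y) * gker (cpt x) y) = (\<integral>y. Im (indicator {-1<..<1} y *\<^sub>R (complex_of_real (f y) * gker (cpt x) y)) \<partial>lborel)"
    unfolding set_lebesgue_integral_def using x by (intro integral_Im[symmetric] i) auto
  also have "\<dots> = (\<integral>y. indicator {-1<..<1} y *\<^sub>R (f y * (arcsin y - pi / 2) + pi * (indicator {-1<..<x} y * f y)) \<partial>lborel)"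
  proof (rule integral_cong_AE)
    show "AE y in lborel. Im (indicator {-1<..<1} y *\<^sub>R (complex_of_real (f y) * gker (cpt x) y)) = indicator {-1<..<1} y *\<^sub>R (f y * (arcsin y - pi / 2) + pi * (indicator {-1<..<x} y * f y))"
      using AE_lborel_neq[of x]
    proof eventually_elim
      case (elim y)
      show ?case
      proof (cases "y \<in> {-1<..<1}")
        case True
        then have "Im (gker (cpt x) y) = arcsin y + pi / 2 * sgn (x - y)" using x elim by (intro Im_gker_boundary) auto
        then show ?thesis using True elim by (auto simp: sgn_if indicator_def algebra_simps)
      qed auto
    qed
    show "(\<lambda>y. indicator {-1<..<1} y *\<^sub>R (f y * (arcsin y - pi / 2) + pi * (indicator {-1<..<x} y * f y))) \<in> borel_measurable lborel"
    proof -
      have "(\<lambda>y. indicator {-1..1} y *\<^sub>R arcsin y) \<in> borel_measurable borel"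
        by (rule borel_measurable_continuous_on_indicator) (auto intro!: continuous_intros)
      then have "(\<lambda>y. indicator {-1<..<1} y *\<^sub>R (f y * (indicator {-1..1} y *\<^sub>R arcsin y - pi / 2) + pi * (indicator {-1<..<x} y * f y))) \<in> borel_measurable lborel"
        by measurable
      also have "(\<lambda>y. indicator {-1<..<1} y *\<^sub>R (f y * (indicator {-1..1} y *\<^sub>R arcsin y - pi / 2) + pi * (indicator {-1<..<x} y * f y))) = (\<lambda>y. indicator {-1<..<1} y *\<^sub>R (f y * (arcsin y - pi / 2) + pi * (indicator {-1<..<x} y * f y)))"
        by (auto simp: indicator_def)
      finally show ?thesis .
    qed
  qed measurable
  also have "\<dots> = (\<integral>y. indicator {-1<..<1} y *\<^sub>R (f y * (arcsin y - pi / 2)) + pi * (indicator {-1<..<x} y *\<^sub>R f y) \<partial>lborel)"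
    using x by (intro Bochner_Integration.integral_cong) (auto simp: indicator_def)
  also have "\<dots> = (LBINT y:{-1<..<1}. f y * (arcsin y - pi / 2)) + pi * (LBINT y:{-1<..<x}. f y)"
  proof -
    have "set_integrable lborel {-1<..<1} (\<lambda>y. f y * (arcsin y - pi / 2))"
      by (intro set_lebesgue_integral_eq_integral_Icc continuous_intros) auto
    moreover have "set_integrable lborel {-1<..<x} f" using x by (intro f_integrable) auto
    ultimately show ?thesis unfolding set_integrable_def set_lebesgue_integral_def by simp
  qed
  also have "(LBINT y:{-1<..<x}. f y) = integral {-1..x} f"
  proof -
    have "set_integrable lborel {-1<..<x} f" using x by (intro f_integrable) auto
    from set_borel_integral_eq_integral(2)[OF this] show ?thesis by (simp add: integral_open_interval_real)
  qed
  finally show "Im (gpot f (cpt x)) = (LBINT y:{-1<..<1}. f y * (arcsin y - pi / 2)) / pi + integral {-1..x} f"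
    by (simp add: gpot_def Im_divide_of_real add_divide_distrib)
qed

text \<open>Maximum principle on the half disc: the boundary values are \<open>u\<close> on the arc,
  between 0 and \<open>C\<close>, and 0 on the imaginary diameter.\<close>

lemma Re_gpot_bounds:
  assumes C: "\<And>x. u x \<le> C" and w: "norm w \<le> 1" "Re w \<ge> 0"
  shows "Re (gpot f w) \<le> C" "0 \<le> Re (gpot f w)"
proof -
  have C0: "C \<ge> 0" using C[of 0] u_nonneg[of 0] by linarith
  have bd: "0 \<le> Re (gpot f z) \<and> Re (gpot f z) \<le> C" if "norm z \<le> 1" "Re z \<ge> 0" "norm z = 1 \<or> Re z = 0" for z
  proof (cases "norm z = 1")
    case True
    then show ?thesis using cpt_of_circle[OF True that(2)] repr[of "Im z"] C[of "Im z"] u_nonneg[of "Im z"] by metis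
  next
    case False
    then show ?thesis using Re_gpot_imaginary[OF that(1) _ f_meas f_le] that C0 by auto
  qed
  have hol: "gpot f holomorphic_on interior half_disc" unfolding half_disc(4)
    by (rule holomorphic_on_subset[OF gpot_holomorphic[OF f_cont]]) (auto simp: half_disc_def)
  have con: "continuous_on (closure half_disc) (gpot f)"
    by (rule continuous_on_subset[OF gpot_continuous_on[OF f_meas f_le]]) (use half_disc(5) in auto)
  have "0 \<le> Re (gpot f w) \<and> Re (gpot f w) \<le> C"
  proof (cases "w \<in> half_disc")
    case True
    have "Re (gpot f w) \<le> C"
      by (rule maximum_real_frontier[OF hol con half_disc(3) _ True]) (use bd half_disc(6) in blast)
    moreover have "Re (- gpot f w) \<le> 0"
      by (rule maximum_real_frontier[of "\<lambda>w. - gpot f w", OF _ _ half_disc(3) _ True])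
         (use bd half_disc(6) in \<open>auto intro!: holomorphic_intros hol continuous_intros con\<close>)
    ultimately show ?thesis by simp
  next
    case False
    then have "norm w = 1 \<or> Re w = 0" using w by (auto simp: half_disc_def)
    then show ?thesis using bd w by blast
  qed
  then show "Re (gpot f w) \<le> C" "0 \<le> Re (gpot f w)" by auto
qed

text \<open>
  With \<open>P = exp (gpot f (joukowski_inv z))\<close> and \<open>N\<close> a primitive of \<open>\<i> * lam * P\<close> one has \<open>N = P / norm P\<close> on the
  real line, so that \<open>P\<close> and the reflection of \<open>P / N\<^sup>2\<close> agree there and glue to a holomorphic function.
\<close>

lemma analytic_extension:
  assumes C: "\<And>x. u x \<le> C" and R: "0 < R" "R < 1 - \<bar>x0\<bar>" "R \<le> 1 / (4 * pi * exp C)"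
  obtains Q V where "Q holomorphic_on ball (complex_of_real x0) R"
    "\<And>z. z \<in> ball (complex_of_real x0) R \<Longrightarrow> norm (Q z) \<le> 4 * exp C \<and> norm (Q z) \<ge> 4 / 9"
    "\<And>x. \<bar>x - x0\<bar> < R \<Longrightarrow> Q (of_real x) = exp (of_real (u x) + \<i> * of_real (V x))"
    "\<And>x. \<bar>x - x0\<bar> < R \<Longrightarrow> (V has_real_derivative f x) (at x)"
proof -
  obtain c where c: "\<And>x. \<bar>x\<bar> \<le> 1 \<Longrightarrow> Im (gpot f (cpt x)) = c + integral {-1..x} f"
    using Im_gpot_boundary by blast
  define V where "V = (\<lambda>x. c + integral {-1..x} f)"
  have inI: "\<bar>x\<bar> < 1" if "\<bar>x - x0\<bar> \<le> R" for x using that R by linarith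
  have Vd: "(V has_real_derivative f x) (at x)" if "\<bar>x\<bar> < 1" for x
  proof -
    have "((\<lambda>x. integral {-1..x} f) has_real_derivative f x) (at x within {-1..1})"
      by (rule integral_has_real_derivative[OF f_cont_on]) (use that in auto)
    then have "((\<lambda>x. integral {-1..x} f) has_real_derivative f x) (at x)"
      using that by (subst (asm) at_within_interior) (auto simp: abs_less_iff)
    then show ?thesis unfolding V_def by (auto intro!: derivative_eq_intros)
  qed
  define D where "D = cball (complex_of_real x0) R \<inter> {z. Im z \<ge> 0}"
  define P where "P = (\<lambda>z. exp (gpot f (joukowski_inv z)))"
  have n1: "norm z < 1" if "z \<in> cball (complex_of_real x0) R" for z
  proof -
    have "norm z \<le> norm (complex_of_real x0) + norm (z - of_real x0)" by (metis add_diff_cancel_left' diff_add_cancel norm_triangle_ineq add.commute)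
    then show ?thesis using that R by (simp add: dist_norm norm_minus_commute)
  qed
  have nn: "1 - z\<^sup>2 \<notin> \<real>\<^sub>\<le>\<^sub>0" if "z \<in> cball (complex_of_real x0) R" for z
    using n1[OF that] by (intro one_minus_square_not_nonpos) auto
  have real_in: "z = of_real (Re z)" "\<bar>Re z - x0\<bar> \<le> R" if "z \<in> cball (complex_of_real x0) R" "Im z = 0" for z
  proof -
    show 1: "z = of_real (Re z)" using that by (simp add: complex_eq_iff)
    have "\<bar>Re z - x0\<bar> \<le> norm (z - of_real x0)" using abs_Re_le_cmod[of "z - of_real x0"] by simp
    then show "\<bar>Re z - x0\<bar> \<le> R" using that by (simp add: dist_norm norm_minus_commute)
  qed
  have omc: "norm (joukowski_inv z) \<le> 1 \<and> Re (joukowski_inv z) \<ge> 0" if "z \<in> D" for z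
  proof (cases "Im z = 0")
    case True
    then have "z = of_real (Re z)" "\<bar>Re z - x0\<bar> \<le> R" using real_in that by (auto simp: D_def)
    then show ?thesis using inI[of "Re z"] joukowski_inv_real[of "Re z"] by (metis Re_cpt abs_square_le_1 diff_ge_0_iff_ge less_imp_le norm_cpt order_refl real_sqrt_ge_zero)
  next
    case False
    then have "joukowski_inv z \<in> half_disc" using that by (intro joukowski_inv_in_half_disc) (auto simp: D_def)
    then show ?thesis by (auto simp: half_disc_def)
  qed
  have Pn: "norm (P z) \<le> exp C \<and> norm (P z) \<ge> 1" if "z \<in> D" for z
    using Re_gpot_bounds[OF C, of "joukowski_inv z"] omc[OF that] by (simp add: P_def)
  have Pc: "continuous_on D P" unfolding P_def
  proof (intro continuous_intros continuous_on_compose2[OF gpot_continuous_on[OF f_meas f_le]])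
    show "continuous_on D joukowski_inv" by (rule continuous_on_subset[OF continuous_on_joukowski_inv]) (use nn in \<open>auto simp: D_def\<close>)
    show "joukowski_inv ` D \<subseteq> cball 0 1" using omc by auto
  qed
  have Ph: "P field_differentiable at z" if "norm z < 1" "Im z > 0" for z
  proof -
    have "1 - z\<^sup>2 \<notin> \<real>\<^sub>\<le>\<^sub>0" using that by (intro one_minus_square_not_nonpos) auto
    from has_field_derivative_joukowski_inv[OF this] have o: "joukowski_inv field_differentiable at z" by (auto simp: field_differentiable_def)
    have "norm (joukowski_inv z) < 1" using joukowski_inv_in_half_disc[OF that(2)] by (simp add: half_disc_def)
    from has_field_derivative_gpot[OF this f_cont] have "gpot f field_differentiable at (joukowski_inv z)" by (auto simp: field_differentiable_def)
    from field_differentiable_compose[OF o this] have "(\<lambda>z. gpot f (joukowski_inv z)) field_differentiable at z" by (simp add: o_def)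
    from field_differentiable_compose[OF this field_differentiable_within_exp] show ?thesis by (simp add: P_def o_def)
  qed
  have Dconv: "convex D" unfolding D_def by (intro convex_Int convex_cball convex_halfspace_Im_ge)
  have intD: "norm z < 1 \<and> Im z > 0" if "z \<in> interior D" for z
  proof -
    have "interior D \<subseteq> interior {z. Im z \<ge> 0}" unfolding D_def by (intro interior_mono) auto
    also have "\<dots> = {z. Im z > 0}"
      using interior_halfspace_ge[of "\<i>" 0] by (simp add: inner_complex_def)
    finally have "Im z > 0" using that by auto
    moreover have "z \<in> D" using that interior_subset by blast
    ultimately show ?thesis using n1 by (auto simp: D_def)
  qed
  \<comment> \<open>\<open>D\<close> is convex, \<open>P\<close> is continuous on it and holomorphic
    inside, so a primitive exists up to the real segment; \<open>N\<close> is normalised below by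
    its value \<open>cis (V x0)\<close> at the centre.\<close>
  obtain g where g: "\<And>z. z \<in> D \<Longrightarrow> (g has_field_derivative P z) (at z within D)"
    using holomorphic_convex_primitive[OF Dconv finite.emptyI Pc] Ph intD by (metis Diff_empty)
  have x0D: "of_real x0 \<in> D" using R by (simp add: D_def)
  define N where "N = (\<lambda>z. cis (V x0) + \<i> * of_real lam * (g z - g (of_real x0)))"
  have Nd: "(N has_field_derivative \<i> * of_real lam * P z) (at z within D)" if "z \<in> D" for z
    unfolding N_def by (auto intro!: derivative_eq_intros g that)
  have gd: "norm (g z - g (of_real x0)) \<le> exp C * R" if "z \<in> D" for z
  proof -
    have "norm (g z - g (of_real x0)) \<le> exp C * norm (z - of_real x0)"
      by (rule field_differentiable_bound[OF Dconv g]) (use Pn x0D that in auto)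
    also have "\<dots> \<le> exp C * R" using that by (intro mult_left_mono) (auto simp: D_def dist_norm norm_minus_commute)
    finally show ?thesis .
  qed
  \<comment> \<open>The upper bound on \<open>R\<close> is made for this:
    \<open>lam \<le> pi\<close> and \<open>norm (P z) \<le> exp C\<close> keep \<open>N\<close>
    within \<open>1 / 4\<close> of a unit number, hence free of zeros.\<close>
  have small: "norm (\<i> * of_real lam * (g z - g (of_real x0))) \<le> 1 / 4" if "z \<in> D" for z
  proof -
    have "norm (\<i> * of_real lam * (g z - g (of_real x0))) \<le> pi * (exp C * R)"
      unfolding norm_mult using gd[OF that] lam_le lam by (auto intro!: mult_mono)
    also have "\<dots> \<le> pi * (exp C * (1 / (4 * pi * exp C)))" using R by (intro mult_left_mono) auto
    also have "\<dots> = 1 / 4" by simp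
    finally show ?thesis .
  qed
  have Nn: "norm (N z) \<ge> 1 / 2 \<and> norm (N z) \<le> 3 / 2" if "z \<in> D" for z
  proof -
    have "norm (N z) \<le> norm (cis (V x0)) + 1 / 4" unfolding N_def
      using small[OF that] norm_triangle_ineq[of "cis (V x0)" "\<i> * of_real lam * (g z - g (of_real x0))"] by linarith
    moreover have "norm (cis (V x0)) - 1 / 4 \<le> norm (N z)" unfolding N_def
      using small[OF that] norm_diff_ineq[of "cis (V x0)" "\<i> * of_real lam * (g z - g (of_real x0))"] by linarith
    ultimately show ?thesis by simp
  qed
  have Preal: "P (of_real x) = exp (of_real (u x) + \<i> * of_real (V x))" if "\<bar>x - x0\<bar> \<le> R" for x
  proof -
    have x: "\<bar>x\<bar> \<le> 1" using inI[OF that] by simp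
    have "gpot f (cpt x) = of_real (u x) + \<i> * of_real (V x)"
      using repr[OF x] c[OF x] by (simp add: complex_eq_iff V_def)
    then show ?thesis using x by (simp add: P_def joukowski_inv_real)
  qed
  have Nreal: "N (of_real x) = cis (V x)" if x: "\<bar>x - x0\<bar> \<le> R" for x
  proof -
    define J where "J = {x0 - R..x0 + R}"
    have JD: "of_real y \<in> D" if "y \<in> J" for y using that by (auto simp: D_def J_def dist_of_real dist_real_def abs_le_iff)
    have z: "((\<lambda>x. N (of_real x) - cis (V x)) has_vector_derivative 0) (at y within J)" if y: "y \<in> J" for y
    proof -
      have yR: "\<bar>y - x0\<bar> \<le> R" using y by (auto simp: J_def)
      have "(complex_of_real has_vector_derivative 1) (at y within J)"
        by (auto intro!: derivative_eq_intros simp: scaleR_conv_of_real has_vector_derivative_def)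
      moreover have "(N has_field_derivative \<i> * of_real lam * P (of_real y)) (at (of_real y) within complex_of_real ` J)"
        by (rule has_field_derivative_subset[OF Nd[OF JD[OF y]]]) (use JD in auto)
      ultimately have "((N \<circ> complex_of_real) has_vector_derivative 1 * (\<i> * of_real lam * P (of_real y))) (at y within J)"
        by (rule field_vector_diff_chain_within)
      then have 1: "((\<lambda>x. N (of_real x)) has_vector_derivative \<i> * of_real lam * P (of_real y)) (at y within J)" by (simp add: o_def)
      have "(V has_vector_derivative f y) (at y within J)"
        using Vd[OF inI[OF yR]] by (simp add: has_real_derivative_iff_has_vector_derivative has_vector_derivative_at_within)
      from bounded_linear.has_vector_derivative[OF bounded_linear_of_real this]
      have "((\<lambda>x. complex_of_real (V x)) has_vector_derivative of_real (f y)) (at y within J)" .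
      from bounded_linear.has_vector_derivative[OF bounded_linear_mult_right this]
      have d1: "((\<lambda>x. \<i> * complex_of_real (V x)) has_vector_derivative \<i> * of_real (f y)) (at y within J)" .
      have "((exp \<circ> (\<lambda>x. \<i> * complex_of_real (V x))) has_vector_derivative \<i> * of_real (f y) * exp (\<i> * complex_of_real (V y))) (at y within J)"
        by (rule field_vector_diff_chain_within[OF d1]) (rule has_field_derivative_at_within[OF DERIV_exp])
      then have 2: "((\<lambda>x. cis (V x)) has_vector_derivative \<i> * of_real (f y) * cis (V y)) (at y within J)"
        by (simp only: o_def cis_conv_exp)
      \<comment> \<open>On the real segment \<open>P\<close> is \<open>exp u\<close> times
        \<open>cis V\<close>, and \<open>lam * exp u\<close> is \<open>f\<close>, the derivative of
        \<open>V\<close>. So \<open>N\<close> and \<open>cis V\<close> have equal derivatives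
        there.\<close>
      have "\<i> * of_real lam * P (of_real y) = \<i> * of_real (f y) * cis (V y)"
        unfolding Preal[OF yR] by (simp add: f_def exp_add cis_conv_exp exp_of_real)
      then have "\<i> * of_real lam * P (of_real y) - \<i> * of_real (f y) * cis (V y) = 0" by (simp only: diff_self)
      then show ?thesis using has_vector_derivative_diff[OF 1 2] by (simp only:)
    qed
    have "convex J" by (simp add: J_def)
    from has_vector_derivative_zero_constant[OF this z] obtain k where "\<And>y. y \<in> J \<Longrightarrow> N (of_real y) - cis (V y) = k" by blast
    moreover have "x \<in> J" "x0 \<in> J" using x R by (auto simp: J_def abs_le_iff)
    ultimately have "N (of_real x) - cis (V x) = N (of_real x0) - cis (V x0)" by metis
    then show ?thesis by (simp add: N_def)
  qed
  define lower where "lower = (\<lambda>z. P z / (N z)\<^sup>2)"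
  define Q where "Q = (\<lambda>z. if Im z \<ge> 0 then P z else cnj (lower (cnj z)))"
  define B where "B = ball (complex_of_real x0) R"
  have cnjB: "cnj z \<in> B \<longleftrightarrow> z \<in> B" for z
  proof -
    have "norm (cnj z - of_real x0) = norm (cnj (z - of_real x0))" by simp
    then have "norm (cnj z - of_real x0) = norm (z - of_real x0)" by (simp only: complex_mod_cnj)
    then show ?thesis by (simp add: B_def dist_norm norm_minus_commute)
  qed
  have BD: "z \<in> D" if "z \<in> B" "Im z \<ge> 0" for z using that by (auto simp: B_def D_def)
  have BDc: "cnj z \<in> D" if "z \<in> B" "Im z \<le> 0" for z using that cnjB[of z] by (intro BD) auto
  have agree: "cnj (lower (cnj z)) = P z" if "z \<in> B" "Im z = 0" for z
  proof -
    have z: "z = of_real (Re z)" "\<bar>Re z - x0\<bar> \<le> R" using real_in[of z] that by (auto simp: B_def)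
    define x where "x = Re z"
    have x: "\<bar>x - x0\<bar> \<le> R" using z by (simp add: x_def)
    have "P (of_real x) = of_real (exp (u x)) * cis (V x)" unfolding Preal[OF x] by (simp add: exp_add cis_conv_exp exp_of_real)
    moreover have "N (of_real x) = cis (V x)" by (rule Nreal[OF x])
    ultimately have "cnj (lower (of_real x)) = of_real (exp (u x)) * (cis (- V x) / (cis (- V x))\<^sup>2)"
      by (simp add: lower_def cis_cnj)
    also have "cis (- V x) / (cis (- V x))\<^sup>2 = cis (V x)"
      by (simp add: power2_eq_square cis_divide[symmetric] cis_mult) (simp add: cis_divide)
    finally have "cnj (lower (of_real x)) = P (of_real x)" using \<open>P (of_real x) = _\<close> by simp
    moreover have "z = of_real x" "cnj z = of_real x" using z(1) by (auto simp: x_def complex_eq_iff)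
    ultimately show ?thesis by simp
  qed
  have Nc: "continuous_on D N" using Nd by (rule DERIV_continuous_on)
  have N0: "N z \<noteq> 0" if "z \<in> D" for z using Nn[OF that] by auto
  have lc: "continuous_on D lower" unfolding lower_def using N0 by (intro continuous_intros Pc Nc) auto
  have Qc: "continuous_on B Q" unfolding Q_def
  proof (rule continuous_on_cases_local[of "B \<inter> {z. Im z \<ge> 0}" "B \<inter> {z. Im z \<le> 0}", THEN continuous_on_subset])
    show "closedin (top_of_set (B \<inter> {z. Im z \<ge> 0} \<union> B \<inter> {z. Im z \<le> 0})) (B \<inter> {z. Im z \<ge> 0})"
    proof -
      have "B \<inter> {z. Im z \<ge> 0} \<union> B \<inter> {z. Im z \<le> 0} = B" by auto
      then show ?thesis by (simp add: closedin_closed_Int closed_halfspace_Im_ge)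
    qed
    show "closedin (top_of_set (B \<inter> {z. Im z \<ge> 0} \<union> B \<inter> {z. Im z \<le> 0})) (B \<inter> {z. Im z \<le> 0})"
    proof -
      have "B \<inter> {z. Im z \<ge> 0} \<union> B \<inter> {z. Im z \<le> 0} = B" by auto
      then show ?thesis by (simp add: closedin_closed_Int closed_halfspace_Im_le)
    qed
    show "continuous_on (B \<inter> {z. Im z \<ge> 0}) P" by (rule continuous_on_subset[OF Pc]) (use BD in auto)
    show "continuous_on (B \<inter> {z. Im z \<le> 0}) (\<lambda>z. cnj (lower (cnj z)))"
      by (intro continuous_intros continuous_on_compose2[OF lc]) (use BDc in auto)
  qed (use agree in auto)
  have up: "Q holomorphic_on B \<inter> {z. Im z > 0}"
  proof -
    have "P holomorphic_on B \<inter> {z. Im z > 0}"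
      unfolding holomorphic_on_def
    proof
      fix z assume "z \<in> B \<inter> {z. Im z > 0}"
      then have "P field_differentiable at z" by (intro Ph n1) (auto simp: B_def)
      then show "P field_differentiable at z within B \<inter> {z. Im z > 0}" by (rule field_differentiable_at_within)
    qed
    then show ?thesis by (rule holomorphic_transform) (auto simp: Q_def)
  qed
  have oB: "open (B \<inter> {z. Im z > 0})" unfolding B_def by (intro open_Int open_ball open_halfspace_Im_gt)
  have lo: "Q holomorphic_on B \<inter> {z. Im z < 0}"
  proof -
    have *: "lower field_differentiable at z" if z: "z \<in> B" "Im z > 0" for z
    proof -
      have zD: "z \<in> D" using BD z by auto
      have "z \<in> interior D"
      proof (rule interiorI[OF oB])
        show "B \<inter> {z. Im z > 0} \<subseteq> D" using BD by auto
      qed (use z in auto)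
      then have "(N has_field_derivative \<i> * of_real lam * P z) (at z)"
        using Nd[OF zD] by (simp only: at_within_interior)
      then have "N field_differentiable at z" by (auto simp: field_differentiable_def)
      then show ?thesis unfolding lower_def using N0[OF zD] z
        by (intro field_differentiable_divide field_differentiable_power Ph n1) (auto simp: B_def)
    qed
    have "lower holomorphic_on cnj ` (B \<inter> {z. Im z < 0})"
      unfolding holomorphic_on_def
    proof
      fix z assume "z \<in> cnj ` (B \<inter> {z. Im z < 0})"
      then obtain w where "w \<in> B" "Im w < 0" "z = cnj w" by blast
      then have "lower field_differentiable at z" using cnjB[of w] by (intro *) auto
      then show "lower field_differentiable at z within cnj ` (B \<inter> {z. Im z < 0})" by (rule field_differentiable_at_within)
    qed
    moreover have "open (B \<inter> {z. Im z < 0})" unfolding B_def by (intro open_Int open_ball open_halfspace_Im_lt)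
    ultimately have "cnj \<circ> lower \<circ> cnj holomorphic_on B \<inter> {z. Im z < 0}" by (rule holomorphic_on_compose_cnj_cnj)
    then show ?thesis by (rule holomorphic_transform) (auto simp: Q_def)
  qed
  have Qh: "Q holomorphic_on B"
    by (rule holomorphic_on_paste_across_line[of B "\<i>" _ 0])
       (use up lo Qc in \<open>auto simp: B_def inner_complex_def\<close>)
  have Qn: "norm (Q z) \<le> 4 * exp C \<and> norm (Q z) \<ge> 4 / 9" if "z \<in> B" for z
  proof (cases "Im z \<ge> 0")
    case True
    have "1 \<le> norm (P z)" "norm (P z) \<le> exp C" using Pn[OF BD[OF that True]] by auto
    moreover have "norm (Q z) = norm (P z)" using True by (simp add: Q_def)
    moreover have "0 \<le> exp C" by simp
    ultimately show ?thesis by linarith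
  next
    case False
    have d: "cnj z \<in> D" using BDc that False by auto
    define n where "n = norm (N (cnj z))"
    have n: "1 / 2 \<le> n" "n \<le> 3 / 2" using Nn[OF d] by (auto simp: n_def)
    have n2: "(1 / 2)\<^sup>2 \<le> n\<^sup>2" "n\<^sup>2 \<le> (3 / 2)\<^sup>2" using n by (auto intro!: power_mono)
    have Q: "norm (Q z) = norm (P (cnj z)) / n\<^sup>2" using False by (simp add: Q_def lower_def norm_divide norm_power n_def)
    have "norm (P (cnj z)) / n\<^sup>2 \<le> exp C / (1 / 2)\<^sup>2" using n2 Pn[OF d] by (intro frac_le) auto
    moreover have "1 / (3 / 2)\<^sup>2 \<le> norm (P (cnj z)) / n\<^sup>2" using n2 n Pn[OF d] by (intro frac_le) auto
    ultimately show ?thesis unfolding Q by (simp add: power2_eq_square)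
  qed
  show ?thesis
  proof (rule that[of Q V])
    show "Q (of_real x) = exp (of_real (u x) + \<i> * of_real (V x))" if "\<bar>x - x0\<bar> < R" for x
      using Preal[of x] that by (simp add: Q_def)
    show "(V has_real_derivative f x) (at x)" if "\<bar>x - x0\<bar> < R" for x using Vd[OF inI[of x]] that by simp
  qed (use Qh Qn in \<open>auto simp: B_def\<close>)
qed

end

context liouville
begin

text \<open>On the real segment the logarithmic derivative \<open>l\<close> of \<open>Q\<close>
  equals \<open>u' + \<i> * f\<close>, so derivatives of \<open>u\<close> are real parts of
  derivatives of \<open>l\<close>. Cauchy's inequality is used twice: radius \<open>R / 4\<close>
  bounds the derivative of \<open>Q\<close> by \<open>16 * exp C / R\<close>, which the lower bound
  \<open>4 / 9\<close> for \<open>Q\<close> turns into 36; radius \<open>R / 2\<close> then bounds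
  the derivatives of \<open>l\<close>.\<close>

lemma higher_deriv_bound:
  assumes C: "\<And>x. u x \<le> C" and R: "0 < R" "R < 1 - \<bar>x0\<bar>" "R \<le> 1 / (4 * pi * exp C)"
    and sm: "smooth_on {-1<..<1} u"
  shows "\<bar>(deriv ^^ Suc n) u x0\<bar> \<le> fact n * (36 * exp C / R) / (R / 2) ^ n"
proof -
  obtain Q V where Qh: "Q holomorphic_on ball (complex_of_real x0) R"
    and Qn: "\<And>z. z \<in> ball (complex_of_real x0) R \<Longrightarrow> norm (Q z) \<le> 4 * exp C \<and> norm (Q z) \<ge> 4 / 9"
    and Qr: "\<And>x. \<bar>x - x0\<bar> < R \<Longrightarrow> Q (of_real x) = exp (of_real (u x) + \<i> * of_real (V x))"
    and V: "\<And>x. \<bar>x - x0\<bar> < R \<Longrightarrow> (V has_real_derivative f x) (at x)"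
    using analytic_extension[OF C R] by blast
  define B where "B = ball (complex_of_real x0) R"
  have Q0: "Q z \<noteq> 0" if "z \<in> B" for z using Qn[of z] that by (auto simp: B_def)
  define l where "l = (\<lambda>z. deriv Q z / Q z)"
  have lh: "l holomorphic_on B" unfolding l_def using Q0 Qh
    by (intro holomorphic_intros holomorphic_deriv) (auto simp: B_def)
  have inI: "x \<in> {-1<..<1}" if "\<bar>x - x0\<bar> < R" for x using that R by (auto simp: abs_if split: if_splits)
  have inB: "of_real x \<in> B" if "\<bar>x - x0\<bar> < R" for x
    using that by (simp add: B_def dist_of_real dist_real_def abs_minus_commute)
  define W where "W = {x0 - R<..<x0 + R}"
  have W: "x \<in> W \<longleftrightarrow> \<bar>x - x0\<bar> < R" for x by (auto simp: W_def abs_less_iff)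
  have d0: "deriv u x = Re (l (of_real x))" if x: "\<bar>x - x0\<bar> < R" for x
  proof -
    have "(u has_real_derivative deriv u x) (at x)" using smooth_on_deriv[OF sm _ inI[OF x], of 0] by simp
    then have "(u has_vector_derivative deriv u x) (at x)" by (simp add: has_real_derivative_iff_has_vector_derivative)
    from bounded_linear.has_vector_derivative[OF bounded_linear_of_real this]
    have 1: "((\<lambda>x. complex_of_real (u x)) has_vector_derivative of_real (deriv u x)) (at x)" .
    have "(V has_vector_derivative f x) (at x)" using V[OF x] by (simp add: has_real_derivative_iff_has_vector_derivative)
    from bounded_linear.has_vector_derivative[OF bounded_linear_of_real this]
    have "((\<lambda>x. complex_of_real (V x)) has_vector_derivative of_real (f x)) (at x)" .
    from bounded_linear.has_vector_derivative[OF bounded_linear_mult_right this]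
    have 2: "((\<lambda>x. \<i> * complex_of_real (V x)) has_vector_derivative \<i> * of_real (f x)) (at x)" .
    define E where "E = (\<lambda>x. exp (complex_of_real (u x) + \<i> * of_real (V x)))"
    have "((exp \<circ> (\<lambda>x. complex_of_real (u x) + \<i> * of_real (V x))) has_vector_derivative (of_real (deriv u x) + \<i> * of_real (f x)) * E x) (at x)"
      unfolding E_def by (rule field_vector_diff_chain_at[OF has_vector_derivative_add[OF 1 2] DERIV_exp])
    then have "(E has_vector_derivative (of_real (deriv u x) + \<i> * of_real (f x)) * E x) (at x)" by (simp only: o_def E_def)
    then have 3: "((\<lambda>x. Q (of_real x)) has_vector_derivative (of_real (deriv u x) + \<i> * of_real (f x)) * E x) (at x)"
      by (rule has_vector_derivative_transform_within_open[of _ _ _ W]) (use Qr x in \<open>auto simp: W[symmetric] E_def W_def\<close>)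
    have "(Q has_field_derivative deriv Q (of_real x)) (at (of_real x))"
      using Qh inB[OF x] by (intro holomorphic_derivI[of _ B]) (auto simp: B_def)
    moreover have "(complex_of_real has_vector_derivative 1) (at x)"
      by (auto intro!: derivative_eq_intros simp: scaleR_conv_of_real has_vector_derivative_def)
    ultimately have "((Q \<circ> complex_of_real) has_vector_derivative 1 * deriv Q (of_real x)) (at x)"
      by (intro field_vector_diff_chain_at)
    then have 4: "((\<lambda>x. Q (of_real x)) has_vector_derivative deriv Q (of_real x)) (at x)" by (simp add: o_def)
    have "deriv Q (of_real x) = (of_real (deriv u x) + \<i> * of_real (f x)) * Q (of_real x)"
      using vector_derivative_unique_at[OF 4 3] Qr[OF x] by (simp add: E_def)
    then have "l (of_real x) = of_real (deriv u x) + \<i> * of_real (f x)" using Q0[OF inB[OF x]] by (simp add: l_def)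
    then show ?thesis by simp
  qed
  have dn: "(deriv ^^ Suc n) u x = Re ((deriv ^^ n) l (of_real x))" if "\<bar>x - x0\<bar> < R" for x n
    using that
  proof (induction n arbitrary: x)
    case 0
    then show ?case using d0 by simp
  next
    case (Suc n)
    have "(deriv ^^ n) l holomorphic_on B" by (rule holomorphic_higher_deriv[OF lh]) (simp add: B_def)
    then have "((deriv ^^ n) l has_field_derivative (deriv ^^ Suc n) l (of_real x)) (at (of_real x))"
      using inB[OF Suc.prems] by (simp add: holomorphic_derivI[of _ B] B_def)
    moreover have "(complex_of_real has_vector_derivative 1) (at x)"
      by (auto intro!: derivative_eq_intros simp: scaleR_conv_of_real has_vector_derivative_def)
    ultimately have "(((deriv ^^ n) l \<circ> complex_of_real) has_vector_derivative 1 * (deriv ^^ Suc n) l (of_real x)) (at x)"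
      by (intro field_vector_diff_chain_at)
    from bounded_linear.has_vector_derivative[OF bounded_linear_Re this]
    have "((\<lambda>x. Re ((deriv ^^ n) l (of_real x))) has_real_derivative Re ((deriv ^^ Suc n) l (of_real x))) (at x)"
      by (simp only: o_def mult_1 has_real_derivative_iff_has_vector_derivative)
    then have "((deriv ^^ Suc n) u has_real_derivative Re ((deriv ^^ Suc n) l (of_real x))) (at x)"
      by (rule has_field_derivative_transform_within_open[of _ _ _ W]) (use Suc W in \<open>auto simp: W_def\<close>)
    from DERIV_imp_deriv[OF this] show ?case by simp
  qed
  have x0B: "z \<in> B" if "z \<in> cball (of_real x0) (R / 2)" for z using that R by (auto simp: B_def)
  have lb: "norm (l z) \<le> 36 * exp C / R" if z: "z \<in> cball (of_real x0) (R / 2)" for z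
  proof -
    have sub: "cball z (R / 4) \<subseteq> B"
    proof
      fix y assume "y \<in> cball z (R / 4)"
      then have "dist (of_real x0) y \<le> R / 2 + R / 4" using z dist_triangle[of "of_real x0" y z] by (simp add: dist_commute)
      then show "y \<in> B" using R by (simp add: B_def)
    qed
    have "norm ((deriv ^^ 1) Q z) \<le> fact 1 * (4 * exp C) / (R / 4) ^ 1"
    proof (rule Cauchy_inequality)
      show "Q holomorphic_on ball z (R / 4)" using Qh sub by (auto intro!: holomorphic_on_subset[OF Qh] simp: B_def)
      show "continuous_on (cball z (R / 4)) Q"
        by (rule continuous_on_subset[OF holomorphic_on_imp_continuous_on[OF Qh]]) (use sub in \<open>simp add: B_def\<close>)
      show "norm (Q x) \<le> 4 * exp C" if "norm (z - x) = R / 4" for x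
      proof -
        have "x \<in> cball z (R / 4)" using that by (simp add: dist_norm)
        then show ?thesis using sub Qn[of x] by (auto simp: B_def)
      qed
    qed (use R in auto)
    then have 1: "norm (deriv Q z) \<le> 16 * exp C / R" by simp
    have "norm (Q z) \<ge> 4 / 9" using Qn[of z] x0B[OF z] by (simp add: B_def)
    then have "norm (l z) \<le> (16 * exp C / R) / (4 / 9)" unfolding l_def norm_divide using 1 R(1) by (intro frac_le) auto
    then show ?thesis by simp
  qed
  have "norm ((deriv ^^ n) l (of_real x0)) \<le> fact n * (36 * exp C / R) / (R / 2) ^ n"
  proof (rule Cauchy_inequality)
    show "l holomorphic_on ball (of_real x0) (R / 2)" by (rule holomorphic_on_subset[OF lh]) (use x0B in auto)
    show "continuous_on (cball (of_real x0) (R / 2)) l"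
      by (rule continuous_on_subset[OF holomorphic_on_imp_continuous_on[OF lh]]) (use x0B in auto)
    show "norm (l z) \<le> 36 * exp C / R" if "norm (of_real x0 - z) = R / 2" for z using that by (intro lb) (simp add: dist_norm)
  qed (use R in auto)
  moreover have "\<bar>(deriv ^^ Suc n) u x0\<bar> \<le> norm ((deriv ^^ n) l (of_real x0))"
    using dn[of x0 n] R abs_Re_le_cmod[of "(deriv ^^ n) l (of_real x0)"] by simp
  ultimately show ?thesis by linarith
qed

end

section \<open>From solutions to potentials\<close>

text \<open>The Hoelder seminorm itself serves as \<open>L\<close>, and \<open>lam\<close> is
  \<open>\<rho>\<close> divided by the integral of \<open>exp u\<close>; the representation then
  comes from \<open>eq_Re_gpot\<close>.\<close>

lemma half_liouville_solution_liouville: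
  assumes \<rho>: "\<rho> > 0" and sol: "half_liouville_solution \<rho> u"
  obtains L lam f where "liouville u L lam f" "integral {-1..1} f = \<rho>" "smooth_on {-1<..<1} u"
proof -
  have hn: "holder_norm (1/2) UNIV u < \<infinity>" and sm: "smooth_on {-1<..<1} u"
    and hl: "\<And>x. x \<in> {-1<..<1} \<Longrightarrow> has_half_laplacian u x (\<rho> * (exp (u x) / (LBINT y:{-1<..<1}. exp (u y))))"
    and out: "\<And>x. x \<notin> {-1<..<1} \<Longrightarrow> u x = 0"
    using sol unfolding half_liouville_solution_def by auto
  have sn: "holder_seminorm (1/2) UNIV u < \<infinity>"
    using hn unfolding holder_norm_def by (auto simp: less_top)
  define L where "L = enn2real (holder_seminorm (1/2) UNIV u)"
  have hol: "\<bar>u x - u y\<bar> \<le> L * sqrt \<bar>x - y\<bar>" for x y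
  proof (cases "x = y")
    case False
    have "ennreal (\<bar>u x - u y\<bar> / \<bar>x - y\<bar> powr (1/2)) \<le> holder_seminorm (1/2) UNIV u"
      unfolding holder_seminorm_def by (rule SUP_upper2[of "(x, y)"]) (use False in auto)
    also have "\<dots> = ennreal L" using sn by (simp add: L_def less_top)
    finally have "\<bar>u x - u y\<bar> / \<bar>x - y\<bar> powr (1/2) \<le> L" by (simp add: L_def)
    then show ?thesis using False by (simp add: powr_half_sqrt field_simps)
  qed simp
  have L0: "L \<ge> 0" by (simp add: L_def)
  interpret half_order u L by unfold_locales (use L0 hol out in auto)
  define Z where "Z = (LBINT y:{-1<..<1}. exp (u y))"
  have ec: "continuous_on {-1..1} (\<lambda>y. exp (u y))" by (intro continuous_intros)
  have Z: "Z = integral {-1..1} (\<lambda>y. exp (u y))" unfolding Z_def by (rule set_lebesgue_integral_eq_integral_Icc(2)[OF ec])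
  have "integral {-1..1} (\<lambda>y::real. exp (- M)) \<le> Z" unfolding Z
  proof (intro integral_le integrable_continuous_real continuous_intros)
    fix y :: real
    have "- M \<le> u y" using bound[of y] by linarith
    then show "exp (- M) \<le> exp (u y)" by simp
  qed
  then have "2 * exp (- M) \<le> Z" by simp
  then have Z0: "Z > 0" using exp_gt_zero[of "- M"] by linarith
  define lam where "lam = \<rho> / Z"
  have lam: "lam > 0" using \<rho> Z0 by (simp add: lam_def)
  define f where "f = (\<lambda>y. lam * exp (u y))"
  have fc: "continuous_on UNIV f" unfolding f_def by (intro continuous_intros)
  have repr: "u x = Re (gpot f (cpt x))" if "\<bar>x\<bar> \<le> 1" for x
  proof (rule eq_Re_gpot[OF sm fc _ _ _ that])
    show "\<bar>f y - f x\<bar> \<le> (lam * exp M * L) * sqrt (norm (cpt y - cpt x))" for x y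
      unfolding f_def by (rule exp_holder) (use lam in auto)
    show "lam * exp M * L \<ge> 0" using lam L by simp
    show "has_half_laplacian u x (f x)" if "\<bar>x\<bar> < 1" for x
      using hl[of x] that by (simp add: f_def lam_def Z_def abs_less_iff)
  qed
  show ?thesis
  proof (rule that)
    show "liouville u L lam f" by unfold_locales (use lam repr in \<open>auto simp: f_def\<close>)
    have "integral {-1..1} f = lam * Z" unfolding Z f_def by simp
    then show "integral {-1..1} f = \<rho>" using Z0 by (simp add: lam_def)
  qed (rule sm)
qed

section \<open>Mass near the centre\<close>

context liouville
begin

text \<open>Chebyshev's inequality for the measure with density \<open>f\<close>.\<close>

lemma mass_off_le:
  assumes s: "s > 0" and A: "A \<in> sets lborel" "A \<subseteq> {-1<..<1}" "\<And>y. y \<in> A \<Longrightarrow> s \<le> \<bar>y\<bar>"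
  shows "(LBINT y:A. f y) \<le> q2 / s\<^sup>2"
proof -
  have q: "q2 = (LBINT y:{-1<..<1}. y\<^sup>2 * f y)"
    by (intro set_lebesgue_integral_eq_integral_Icc(2)[symmetric] continuous_intros)
  have qi: "set_integrable lborel {-1<..<1} (\<lambda>y. y\<^sup>2 * f y)"
    by (intro set_lebesgue_integral_eq_integral_Icc(1) continuous_intros)
  have "s\<^sup>2 * (LBINT y:A. f y) = (LBINT y:A. s\<^sup>2 * f y)" by simp
  also have "\<dots> \<le> q2" unfolding q set_lebesgue_integral_def
  proof (intro integral_mono)
    show "integrable lborel (\<lambda>y. indicator A y *\<^sub>R (s\<^sup>2 * f y))"
      using f_integrable[OF A(1,2)] by (fold set_integrable_def) (intro set_integrable_mult_right)
    show "integrable lborel (\<lambda>y. indicator {-1<..<1} y *\<^sub>R (y\<^sup>2 * f y))" using qi by (simp add: set_integrable_def)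
    fix y :: real
    show "indicator A y *\<^sub>R (s\<^sup>2 * f y) \<le> indicator {-1<..<1} y *\<^sub>R (y\<^sup>2 * f y)"
    proof (cases "y \<in> A")
      case True
      have "s\<^sup>2 \<le> \<bar>y\<bar>\<^sup>2" using s A(3)[OF True] by (intro power_mono) auto
      then show ?thesis using True subsetD[OF A(2) True] f_pos[of y] by (auto simp: indicator_def intro!: mult_right_mono less_imp_le)
    next
      case False
      then show ?thesis using f_pos[of y] by (auto simp: indicator_def less_imp_le)
    qed
  qed
  finally show ?thesis using s by (simp add: field_simps)
qed

lemma mass_center:
  assumes s: "0 < s"
  shows "(LBINT y:{-1<..<1} \<inter> {-s<..<s}. f y) = \<rho> - (LBINT y:{-1<..<1} - {-s<..<s}. f y)"
    and "0 \<le> (LBINT y:{-1<..<1} - {-s<..<s}. f y)" "(LBINT y:{-1<..<1} - {-s<..<s}. f y) \<le> q2 / s\<^sup>2"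
proof -
  have "\<rho> = (LBINT y:({-1<..<1} \<inter> {-s<..<s}) \<union> ({-1<..<1} - {-s<..<s}). f y)"
    unfolding \<rho>_eq by (intro arg_cong[where f = "\<lambda>A. set_lebesgue_integral lborel A f"]) auto
  also have "\<dots> = (LBINT y:{-1<..<1} \<inter> {-s<..<s}. f y) + (LBINT y:{-1<..<1} - {-s<..<s}. f y)"
    by (intro set_integral_Un f_integrable) auto
  finally show "(LBINT y:{-1<..<1} \<inter> {-s<..<s}. f y) = \<rho> - (LBINT y:{-1<..<1} - {-s<..<s}. f y)" by simp
  show "0 \<le> (LBINT y:{-1<..<1} - {-s<..<s}. f y)" unfolding set_lebesgue_integral_def
    using f_pos less_imp_le by (intro integral_nonneg_AE) (auto simp: indicator_def)
  show "(LBINT y:{-1<..<1} - {-s<..<s}. f y) \<le> q2 / s\<^sup>2"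
    by (intro mass_off_le s) (auto simp: abs_if)
qed

text \<open>For \<open>\<bar>y\<bar> < s\<close> the Green kernel with pole 0 is at least
  \<open>ln (1 / s)\<close>, and by \<open>mass_center\<close> almost all of the mass sits
  there.\<close>

lemma u_zero_ge:
  assumes s: "0 < s" "s < 1"
  shows "u 0 \<ge> ln (1 / s) / pi * (\<rho> - q2 / s\<^sup>2)"
proof -
  define B where "B = {-1<..<1} \<inter> {-s<..<s}"
  have B: "B \<in> sets lborel" "B \<subseteq> {-1<..<1}" by (auto simp: B_def)
  have l: "ln (1 / s) \<ge> 0" using s by simp
  have "ln (1 / s) * (\<rho> - q2 / s\<^sup>2) \<le> ln (1 / s) * (LBINT y:B. f y)"
    using mass_center[OF s(1)] l unfolding B_def by (intro mult_left_mono) auto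
  also have "\<dots> = (LBINT y:B. ln (1 / s) * f y)" by simp
  also have "\<dots> \<le> (LBINT y:{-1<..<1}. f y * gf 0 y)" unfolding set_lebesgue_integral_def
  proof (rule integral_mono_AE)
    show "integrable lborel (\<lambda>y. indicator B y *\<^sub>R (ln (1 / s) * f y))"
      using f_integrable[OF B] by (fold set_integrable_def) (intro set_integrable_mult_right)
    show "integrable lborel (\<lambda>y. indicator {-1<..<1} y *\<^sub>R (f y * gf 0 y))"
      using f_gf_integrable[of 0 "{-1<..<1}"] by (simp add: set_integrable_def)
    show "AE y in lborel. indicator B y *\<^sub>R (ln (1 / s) * f y) \<le> indicator {-1<..<1} y *\<^sub>R (f y * gf 0 y)"
      using AE_lborel_neq[of 0]
    proof eventually_elim
      case (elim y)
      show ?case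
      proof (cases "y \<in> B")
        case True
        then have yI: "y \<in> {-1<..<1}" and y: "\<bar>y\<bar> < s" by (auto simp: B_def)
        have "1 / s \<le> (1 - 0 * y + sqrt (1 - 0\<^sup>2) * sqrt (1 - y\<^sup>2)) / \<bar>0 - y\<bar>"
          using y s elim by (intro frac_le) (auto simp: abs_square_le_1)
        then have "ln (1 / s) \<le> gf 0 y" using gf_eq(1)[of 0 y] y s elim by (auto intro!: ln_mono)
        then show ?thesis using True yI f_pos[of y] by (simp add: mult.commute)
      next
        case False
        have "0 \<le> f y * gf 0 y" if "y \<in> {-1<..<1}"
          using that f_pos[of y] gf_nonneg[of 0 y] elim by (intro mult_nonneg_nonneg) auto
        then show ?thesis using False by (auto simp: indicator_def)
      qed
    qed
  qed
  also have "\<dots> = pi * u 0" using u_eq[of 0] by simp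
  finally show ?thesis by (simp add: field_simps)
qed

text \<open>The ball of radius \<open>r / 2\<close> around \<open>x\<close> stays at distance
  \<open>r / 2\<close> from 0, so by \<open>mass_off_le\<close> its mass is at most
  \<open>q2 / (r / 2)\<^sup>2\<close>. The factor \<open>pi / 8\<close> makes this
  \<open>pi / 2\<close>, safely below the critical \<open>pi\<close> of
  \<open>local_bound\<close>.\<close>

lemma bound_off_center:
  assumes r: "0 < r" "r \<le> 1" and q: "q2 \<le> pi / 8 * r\<^sup>2" and x: "\<bar>x\<bar> \<le> 1" "r \<le> \<bar>x\<bar>"
  shows "u x \<le> bnd (r / 2) (pi / 2)"
proof (rule local_bound[of "r / 2" "pi / 2" x])
  have "(LBINT y:{-1<..<1} \<inter> {x - r / 2<..<x + r / 2}. f y) \<le> q2 / (r / 2)\<^sup>2"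
    using x r by (intro mass_off_le) (auto simp: abs_if split: if_splits)
  also have "\<dots> \<le> (pi / 8 * r\<^sup>2) / (r / 2)\<^sup>2" using q by (intro divide_right_mono) auto
  also have "\<dots> = pi / 2" using r by (simp add: power2_eq_square)
  finally show "(LBINT y:{-1<..<1} \<inter> {x - r / 2<..<x + r / 2}. f y) \<le> pi / 2" .
qed (use r x in auto)

end

section \<open>Blow-up at the critical mass\<close>

lemma gf_commute: "\<bar>x\<bar> \<le> 1 \<Longrightarrow> \<bar>y\<bar> \<le> 1 \<Longrightarrow> x \<noteq> y \<Longrightarrow> gf x y = gf y x"
  by (simp add: gf_eq(1) mult.commute abs_minus_commute)

text \<open>Clamping covers points outside the interval, where the left side is 0 by definition and
  \<open>gf\<close> vanishes at the endpoint.\<close>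

lemma green_0_clamp1: "x \<noteq> 0 \<Longrightarrow> 2 * pi * green 0 x = 2 * gf (clamp1 x) 0"
proof (cases "\<bar>x\<bar> < 1")
  case True
  assume "x \<noteq> 0"
  then show ?thesis using True gf_commute[of 0 x] by (simp add: green_eq_gf clamp1(3))
next
  case False
  then have g: "green 0 x = 0" by (auto simp: green_def abs_less_iff)
  have c: "\<bar>clamp1 x\<bar> = 1" using False clamp1(3)[of x] clamp1(4)[of x] by linarith
  then have "(clamp1 x)\<^sup>2 = 1" by (metis power2_abs one_power2)
  then have "gf (clamp1 x) 0 = 0" using c gf_eq(1)[of "clamp1 x" 0] by auto
  then show ?thesis using g by simp
qed

definition center_const :: real where "center_const = 8 * (3 + 2 * pi)"

lemma center_const_pos: "center_const > 0"
  unfolding center_const_def using pi_gt_zero by (intro mult_pos_pos add_pos_pos) auto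

text \<open>By symmetry the varying point becomes the first argument of the kernel, where
  \<open>gker_diff_le\<close> with \<open>\<alpha> = 1\<close> applies. The passage from chords to
  the interval leaves \<open>sqrt \<bar>y\<bar>\<close>; the constants 2, 2 and \<open>2 / r\<close>
  multiply to \<open>center_const\<close>.\<close>

lemma gf_center_diff:
  assumes r: "0 < r" and x: "\<bar>x\<bar> \<le> 1" "2 * r \<le> \<bar>x\<bar>" and y: "\<bar>y\<bar> \<le> r"
  shows "\<bar>gf x y - gf x 0\<bar> \<le> center_const * sqrt \<bar>y\<bar> / r"
proof -
  have y1: "\<bar>y\<bar> \<le> 1" "x \<noteq> y" "x \<noteq> 0" and d: "r \<le> \<bar>x - y\<bar>" "r \<le> \<bar>x\<bar>" using r x y by auto
  have "\<bar>gf x y - gf x 0\<bar> = \<bar>Re (gker (cpt y) x - gker (cpt 0) x)\<bar>"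
    using gf_commute[of x y] gf_commute[of x 0] x y1 by (simp add: gf_def)
  also have "\<dots> \<le> norm (gker (cpt y) x - gker (cpt 0) x)" by (rule abs_Re_le_cmod)
  also have "\<dots> \<le> 2 * (3 / 1 + 2 * pi) * norm (cpt y - cpt 0) powr 1 * (\<bar>x - Im (cpt y)\<bar> powr (-1) + \<bar>x - Im (cpt 0)\<bar> powr (-1))"
    by (rule gker_diff_le) (use x y1 in auto)
  also have "\<dots> \<le> 2 * (3 / 1 + 2 * pi) * (2 * sqrt \<bar>y\<bar>) * (1 / r + 1 / r)"
  proof (intro mult_mono add_mono)
    show "norm (cpt y - cpt 0) powr 1 \<le> 2 * sqrt \<bar>y\<bar>" using norm_cpt_diff_le[of y 0] y1 by simp
    show "\<bar>x - Im (cpt y)\<bar> powr (-1) \<le> 1 / r" using d r by (simp add: powr_minus_divide frac_le)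
    show "\<bar>x - Im (cpt 0)\<bar> powr (-1) \<le> 1 / r" using d r by (simp add: powr_minus_divide frac_le)
  qed (use r pi_gt_zero in \<open>auto intro!: mult_nonneg_nonneg add_nonneg_nonneg\<close>)
  also have "\<dots> = center_const * sqrt \<bar>y\<bar> / r" by (simp add: center_const_def algebra_simps add_divide_distrib)
  finally show ?thesis .
qed

text \<open>The bound of \<open>exp u\<close> outside the central interval of half-length
  \<open>s\<close> that \<open>bound_off_center\<close> gives.\<close>

definition outer_bound :: "real \<Rightarrow> real" where "outer_bound s = exp (bnd (s / 2) (pi / 2))"

definition off_center_const :: "real \<Rightarrow> real \<Rightarrow> real" where
  "off_center_const \<alpha> r = 16 * (3 / \<alpha> + 2 * pi) * r powr (-\<alpha>) + gpot_const \<alpha> * (pi * outer_bound r)"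

lemma off_center_const_nonneg: "0 < \<alpha> \<Longrightarrow> \<alpha> < 1 \<Longrightarrow> off_center_const \<alpha> r \<ge> 0"
  unfolding off_center_const_def outer_bound_def
  by (intro add_nonneg_nonneg mult_nonneg_nonneg gpot_const_nonneg) auto

context liouville
begin

text \<open>The outer part is again a potential, of a density that is small or at least bounded once
  the centre is removed, so \<open>gpot_holder\<close> applies to it.\<close>

lemma split_center:
  assumes x: "\<bar>x\<bar> \<le> 1"
  shows "u x = (LBINT y:{-1<..<1} \<inter> {-s<..<s}. f y * gf x y) / pi
    + Re (gpot (\<lambda>y. if \<bar>y\<bar> < s then 0 else f y) (cpt x))"
proof -
  define B where "B = {-1<..<1} \<inter> {-s<..<s}"
  have B: "B \<in> sets lborel" "B \<subseteq> {-1<..<1}" by (auto simp: B_def)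
  define h where "h = (\<lambda>y. if \<bar>y\<bar> < s then 0 else f y)"
  have hm: "h \<in> borel_measurable borel" unfolding h_def by measurable
  have hb: "\<bar>h y\<bar> \<le> lam * exp M" if "y \<in> {-1<..<1}" for y using f_le[of y] lam by (auto simp: h_def)
  have "Re (gpot h (cpt x)) = (LBINT y:{-1<..<1}. h y * gf x y) / pi"
    using Re_gpot(1)[OF _ hm hb, of "cpt x"] x by (simp add: gf_def)
  also have "(LBINT y:{-1<..<1}. h y * gf x y) = (LBINT y:{-1<..<1} - B. f y * gf x y)"
    unfolding set_lebesgue_integral_def
    by (intro Bochner_Integration.integral_cong refl) (auto simp: indicator_def h_def B_def abs_less_iff)
  finally have 1: "Re (gpot h (cpt x)) = (LBINT y:{-1<..<1} - B. f y * gf x y) / pi" .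
  have "(LBINT y:{-1<..<1}. f y * gf x y) = (LBINT y:B \<union> ({-1<..<1} - B). f y * gf x y)"
    using B(2) by (simp add: Un_absorb1)
  also have "\<dots> = (LBINT y:B. f y * gf x y) + (LBINT y:{-1<..<1} - B. f y * gf x y)"
    using B by (intro set_integral_Un f_gf_integrable x) auto
  finally have "u x = (LBINT y:B. f y * gf x y) / pi + Re (gpot h (cpt x))"
    using u_eq[OF x] 1 by (simp add: add_divide_distrib)
  then show ?thesis by (simp add: B_def h_def)
qed

lemma outer_density:
  assumes s: "0 < s" "s \<le> 1" and q: "q2 \<le> pi / 8 * s\<^sup>2" and y: "y \<in> {-1<..<1}"
  shows "\<bar>if \<bar>y\<bar> < s then 0 else f y\<bar> \<le> lam * outer_bound s"
proof (cases "\<bar>y\<bar> < s")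
  case False
  have "u y \<le> bnd (s / 2) (pi / 2)" using y False by (intro bound_off_center s q) auto
  then have "f y \<le> lam * outer_bound s" using lam by (simp add: f_def outer_bound_def)
  then show ?thesis using False f_pos[of y] by simp
qed (use lam in \<open>simp add: outer_bound_def\<close>)

lemma outer_measurable: "(\<lambda>y. if \<bar>y\<bar> < s then 0 else f y) \<in> borel_measurable borel"
  by measurable

lemma q2_le_gap: "q2 \<le> 2 * pi - \<rho>"
proof -
  have "2 * pi * q2 \<le> \<rho> * (2 * pi - \<rho>)" by (rule moment_lower)
  also have "\<dots> \<le> 2 * pi * (2 * pi - \<rho>)" using \<rho>_less by (intro mult_right_mono) auto
  finally show ?thesis by simp
qed

text \<open>Three errors, in the order of the bound: the central mass is spread over length
  \<open>s\<close> instead of sitting at 0; it differs from \<open>2 * pi\<close> by at most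
  \<open>\<delta> + \<delta> / s\<^sup>2\<close>; the outer density carries the factor
  \<open>lam \<le> 3 / 2 * \<delta>\<close>.\<close>

lemma deviation_le:
  assumes s: "0 < s" "s \<le> r" and r: "r \<le> 1 / 2" and x: "\<bar>x\<bar> \<le> 1" "2 * r \<le> \<bar>x\<bar>"
    and \<delta>: "2 * pi - \<rho> \<le> \<delta>" "\<delta> \<le> pi / 8 * s\<^sup>2"
  shows "\<bar>u x - 2 * gf x 0\<bar> \<le> 2 * center_const * sqrt s / r + (\<delta> + \<delta> / s\<^sup>2) * ln (1 / r) / pi
    + gpot_const (1/2) * (3 / 2 * \<delta> * outer_bound s)"
proof -
  define B where "B = {-1<..<1} \<inter> {-s<..<s}"
  have B: "B \<in> sets lborel" "B \<subseteq> {-1<..<1}" by (auto simp: B_def)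
  define h where "h = (\<lambda>y. if \<bar>y\<bar> < s then 0 else f y)"
  define m where "m = (LBINT y:B. f y)"
  define c where "c = center_const * sqrt s / r"
  have r0: "r > 0" using s by simp
  have c0: "c \<ge> 0" using center_const_pos s r0 by (simp add: c_def)
  have q\<delta>: "q2 \<le> \<delta>" "q2 \<le> pi / 8 * s\<^sup>2" using q2_le_gap \<delta> by auto
  have \<delta>0: "\<delta> \<ge> 0" using q\<delta> q2_pos by linarith
  have m: "0 \<le> m" "m \<le> 2 * pi" "2 * pi - m \<le> \<delta> + \<delta> / s\<^sup>2"
  proof -
    have "q2 / s\<^sup>2 \<le> \<delta> / s\<^sup>2" using q\<delta> by (intro divide_right_mono) auto
    then show "2 * pi - m \<le> \<delta> + \<delta> / s\<^sup>2" "m \<le> 2 * pi" using mass_center[OF s(1)] \<rho>_less \<delta> by (auto simp: m_def B_def)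
    show "0 \<le> m" unfolding m_def set_lebesgue_integral_def
      using f_pos less_imp_le by (intro integral_nonneg_AE) (auto simp: indicator_def)
  qed
  have i0: "set_integrable lborel B (\<lambda>y. f y * gf x 0)" using f_integrable[OF B] by simp
  have i: "set_integrable lborel B (\<lambda>y. f y * gf x y)" by (intro f_gf_integrable x B)
  have "\<bar>(LBINT y:B. f y * gf x y) - (LBINT y:B. f y * gf x 0)\<bar> = \<bar>LBINT y:B. f y * gf x y - f y * gf x 0\<bar>"
    by (simp add: set_integral_diff(2)[OF i i0])
  also have "\<dots> \<le> (LBINT y:B. c * f y)" unfolding set_lebesgue_integral_def
  proof (rule integral_abs_bound_integral)
    show "integrable lborel (\<lambda>y. indicator B y *\<^sub>R (f y * gf x y - f y * gf x 0))"
      using set_integral_diff(1)[OF i i0] by (simp add: set_integrable_def)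
    show "integrable lborel (\<lambda>y. indicator B y *\<^sub>R (c * f y))"
      using f_integrable[OF B] by (fold set_integrable_def) (intro set_integrable_mult_right)
    fix y :: real
    show "\<bar>indicator B y *\<^sub>R (f y * gf x y - f y * gf x 0)\<bar> \<le> indicator B y *\<^sub>R (c * f y)"
    proof (cases "y \<in> B")
      case True
      then have ys: "\<bar>y\<bar> \<le> s" by (auto simp: B_def)
      have "\<bar>gf x y - gf x 0\<bar> \<le> center_const * sqrt \<bar>y\<bar> / r" using ys s by (intro gf_center_diff r0 x) auto
      also have "\<dots> \<le> c" unfolding c_def using ys center_const_pos r0
        by (intro divide_right_mono mult_left_mono) auto
      finally have "f y * \<bar>gf x y - gf x 0\<bar> \<le> f y * c" using f_pos[of y] by (intro mult_left_mono) auto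
      moreover have "\<bar>f y * gf x y - f y * gf x 0\<bar> = f y * \<bar>gf x y - gf x 0\<bar>"
        using f_pos[of y] by (simp add: right_diff_distrib[symmetric] abs_mult)
      ultimately show ?thesis using True by (simp add: mult.commute)
    qed simp
  qed
  also have "\<dots> = c * m" by (simp add: m_def)
  also have "\<dots> \<le> c * (2 * pi)" using m c0 by (intro mult_left_mono)
  finally have 1: "\<bar>(LBINT y:B. f y * gf x y) - m * gf x 0\<bar> \<le> c * (2 * pi)" by (simp add: m_def)
  have g: "0 \<le> gf x 0" "gf x 0 \<le> ln (1 / r)"
  proof -
    have x0: "x \<noteq> 0" using x r0 by auto
    show "0 \<le> gf x 0" using x x0 by (intro gf_bounds) auto
    have "gf x 0 \<le> ln (2 / \<bar>0 - x\<bar>)" using x x0 by (intro gf_bounds) auto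
    also have "\<dots> \<le> ln (2 / (2 * r))" using x x0 r0 by (intro ln_mono divide_left_mono) auto
    finally show "gf x 0 \<le> ln (1 / r)" by simp
  qed
  have 2: "\<bar>m * gf x 0 - 2 * pi * gf x 0\<bar> \<le> (\<delta> + \<delta> / s\<^sup>2) * ln (1 / r)"
  proof -
    have "\<bar>m * gf x 0 - 2 * pi * gf x 0\<bar> = (2 * pi - m) * gf x 0"
      using m g by (simp add: left_diff_distrib[symmetric] abs_mult)
    also have "\<dots> \<le> (\<delta> + \<delta> / s\<^sup>2) * ln (1 / r)" using m g \<delta>0 by (intro mult_mono) auto
    finally show ?thesis .
  qed
  have 3: "\<bar>Re (gpot h (cpt x))\<bar> \<le> gpot_const (1/2) * (3 / 2 * \<delta> * outer_bound s)"
  proof -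
    have "\<bar>Re (gpot h (cpt x))\<bar> \<le> norm (gpot h (cpt x) - gpot h 0)"
      using abs_Re_le_cmod[of "gpot h (cpt x)"] by (simp add: gpot_def)
    also have "\<dots> \<le> gpot_const (1/2) * (lam * outer_bound s) * norm (cpt x - 0) powr (1/2)"
      unfolding h_def using x s r q\<delta> by (intro gpot_holder outer_measurable outer_density) auto
    also have "\<dots> = gpot_const (1/2) * (lam * outer_bound s)" using x by simp
    also have "\<dots> \<le> gpot_const (1/2) * (3 / 2 * \<delta> * outer_bound s)"
      using lam_le_q2 q\<delta> by (intro mult_left_mono mult_right_mono gpot_const_nonneg) (auto simp: outer_bound_def)
    finally show ?thesis .
  qed
  define U where "U = (LBINT y:B. f y * gf x y)"
  define R where "R = Re (gpot h (cpt x))"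
  have "u x - 2 * gf x 0 = ((U - m * gf x 0) + (m * gf x 0 - 2 * pi * gf x 0)) / pi + R"
    using split_center[OF x(1), of s] by (simp add: U_def R_def B_def h_def field_simps)
  also have "\<bar>\<dots>\<bar> \<le> (\<bar>U - m * gf x 0\<bar> + \<bar>m * gf x 0 - 2 * pi * gf x 0\<bar>) / pi + \<bar>R\<bar>"
    by (intro order_trans[OF abs_triangle_ineq] add_right_mono) (auto simp: abs_divide intro!: divide_right_mono)
  also have "\<dots> \<le> (c * (2 * pi) + (\<delta> + \<delta> / s\<^sup>2) * ln (1 / r)) / pi + gpot_const (1/2) * (3 / 2 * \<delta> * outer_bound s)"
    using 1 2 3 by (intro add_mono divide_right_mono) (auto simp: U_def R_def)
  also have "\<dots> = 2 * center_const * sqrt s / r + (\<delta> + \<delta> / s\<^sup>2) * ln (1 / r) / pi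
    + gpot_const (1/2) * (3 / 2 * \<delta> * outer_bound s)" by (simp add: c_def add_divide_distrib)
  finally show ?thesis .
qed

lemma gf_diff_le:
  assumes \<alpha>: "0 < \<alpha>" "\<alpha> \<le> 1" and d: "0 < d" "d \<le> \<bar>y - x\<bar>" "d \<le> \<bar>y - x'\<bar>"
    and x: "\<bar>x\<bar> \<le> 1" "\<bar>x'\<bar> \<le> 1" "\<bar>y\<bar> \<le> 1"
  shows "\<bar>gf x y - gf x' y\<bar> \<le> 4 * (3 / \<alpha> + 2 * pi) * d powr (-\<alpha>) * norm (cpt x - cpt x') powr \<alpha>"
proof -
  have "\<bar>gf x y - gf x' y\<bar> \<le> norm (gker (cpt x) y - gker (cpt x') y)"
    using abs_Re_le_cmod[of "gker (cpt x) y - gker (cpt x') y"] by (simp add: gf_def)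
  also have "\<dots> \<le> 2 * (3 / \<alpha> + 2 * pi) * norm (cpt x - cpt x') powr \<alpha> *
           (\<bar>y - Im (cpt x)\<bar> powr (-\<alpha>) + \<bar>y - Im (cpt x')\<bar> powr (-\<alpha>))"
    by (rule gker_diff_le) (use \<alpha> d x in auto)
  also have "\<dots> \<le> 2 * (3 / \<alpha> + 2 * pi) * norm (cpt x - cpt x') powr \<alpha> * (d powr (-\<alpha>) + d powr (-\<alpha>))"
    using d \<alpha> by (intro mult_left_mono add_mono) (auto intro!: powr_mono2')
  also have "\<dots> = 4 * (3 / \<alpha> + 2 * pi) * d powr (-\<alpha>) * norm (cpt x - cpt x') powr \<alpha>" by (simp add: algebra_simps)
  finally show ?thesis .
qed

text \<open>No smallness is claimed here, only a bound uniform over solutions with exponent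
  \<open>\<alpha>\<close> as close to 1 as desired; the convergence in lower Hoelder norms comes
  from interpolating with the sup estimate. With \<open>c\<close> the kernel bound, the centre
  contributes \<open>2 * c\<close> and the limit \<open>2 * gf\<close> another \<open>2 * c\<close>,
  hence the 16 in \<open>off_center_const\<close>.\<close>

lemma deviation_holder:
  assumes r: "0 < r" "r \<le> 1 / 2" and \<alpha>: "0 < \<alpha>" "\<alpha> < 1" and q: "q2 \<le> pi / 8 * r\<^sup>2"
    and x: "\<bar>x\<bar> \<le> 1" "2 * r \<le> \<bar>x\<bar>" "\<bar>x'\<bar> \<le> 1" "2 * r \<le> \<bar>x'\<bar>"
  shows "\<bar>(u x - 2 * gf x 0) - (u x' - 2 * gf x' 0)\<bar> \<le> off_center_const \<alpha> r * norm (cpt x - cpt x') powr \<alpha>"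
proof -
  define B where "B = {-1<..<1} \<inter> {-r<..<r}"
  have B: "B \<in> sets lborel" "B \<subseteq> {-1<..<1}" by (auto simp: B_def)
  define h where "h = (\<lambda>y. if \<bar>y\<bar> < r then 0 else f y)"
  define m where "m = (LBINT y:B. f y)"
  define n where "n = norm (cpt x - cpt x') powr \<alpha>"
  define k where "k = 3 / \<alpha> + 2 * pi"
  define c where "c = 4 * k * r powr (-\<alpha>) * n"
  have n0: "n \<ge> 0" by (simp add: n_def)
  have k0: "k \<ge> 0" using \<alpha> by (simp add: k_def)
  have c0: "c \<ge> 0" using n0 k0 by (simp add: c_def)
  have c: "\<bar>gf x y - gf x' y\<bar> \<le> c" if "\<bar>y\<bar> \<le> r" for y
    unfolding c_def k_def n_def using that x r \<alpha> by (intro gf_diff_le) auto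
  have m: "m \<le> 2 * pi" using mass_center[OF r(1)] \<rho>_less by (auto simp: m_def B_def)
  have i: "set_integrable lborel B (\<lambda>y. f y * gf x y)" "set_integrable lborel B (\<lambda>y. f y * gf x' y)"
    by (intro f_gf_integrable x B)+
  have "\<bar>(LBINT y:B. f y * gf x y) - (LBINT y:B. f y * gf x' y)\<bar> = \<bar>LBINT y:B. f y * gf x y - f y * gf x' y\<bar>"
    by (simp add: set_integral_diff(2)[OF i])
  also have "\<dots> \<le> (LBINT y:B. c * f y)" unfolding set_lebesgue_integral_def
  proof (rule integral_abs_bound_integral)
    show "integrable lborel (\<lambda>y. indicator B y *\<^sub>R (f y * gf x y - f y * gf x' y))"
      using set_integral_diff(1)[OF i] by (simp add: set_integrable_def)
    show "integrable lborel (\<lambda>y. indicator B y *\<^sub>R (c * f y))"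
      using f_integrable[OF B] by (fold set_integrable_def) (intro set_integrable_mult_right)
    fix y :: real
    show "\<bar>indicator B y *\<^sub>R (f y * gf x y - f y * gf x' y)\<bar> \<le> indicator B y *\<^sub>R (c * f y)"
    proof (cases "y \<in> B")
      case True
      then have "\<bar>y\<bar> \<le> r" by (auto simp: B_def)
      then have "f y * \<bar>gf x y - gf x' y\<bar> \<le> f y * c" using f_pos[of y] c by (intro mult_left_mono) auto
      moreover have "\<bar>f y * gf x y - f y * gf x' y\<bar> = f y * \<bar>gf x y - gf x' y\<bar>"
        using f_pos[of y] by (simp add: right_diff_distrib[symmetric] abs_mult)
      ultimately show ?thesis using True by (simp add: mult.commute)
    qed simp
  qed
  also have "\<dots> = c * m" by (simp add: m_def)
  also have "\<dots> \<le> c * (2 * pi)" using m c0 by (intro mult_left_mono)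
  finally have 1: "\<bar>(LBINT y:B. f y * gf x y) - (LBINT y:B. f y * gf x' y)\<bar> \<le> c * (2 * pi)" .
  have 2: "\<bar>Re (gpot h (cpt x)) - Re (gpot h (cpt x'))\<bar> \<le> gpot_const \<alpha> * (pi * outer_bound r) * n"
  proof -
    have "\<bar>Re (gpot h (cpt x)) - Re (gpot h (cpt x'))\<bar> \<le> norm (gpot h (cpt x) - gpot h (cpt x'))"
      using abs_Re_le_cmod[of "gpot h (cpt x) - gpot h (cpt x')"] by simp
    also have "\<dots> \<le> gpot_const \<alpha> * (lam * outer_bound r) * norm (cpt x - cpt x') powr \<alpha>"
      unfolding h_def using x r \<alpha> q by (intro gpot_holder outer_measurable outer_density) auto
    also have "\<dots> \<le> gpot_const \<alpha> * (pi * outer_bound r) * n" unfolding n_def using lam_le \<alpha>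
      by (intro mult_left_mono mult_right_mono gpot_const_nonneg) (auto simp: outer_bound_def)
    finally show ?thesis .
  qed
  have 3: "\<bar>gf x 0 - gf x' 0\<bar> \<le> c" using c[of 0] r by simp
  define U U' where "U = (LBINT y:B. f y * gf x y)" and "U' = (LBINT y:B. f y * gf x' y)"
  define R where "R = Re (gpot h (cpt x)) - Re (gpot h (cpt x'))"
  have "(u x - 2 * gf x 0) - (u x' - 2 * gf x' 0) = (U - U') / pi + R - 2 * (gf x 0 - gf x' 0)"
    using split_center[OF x(1), of r] split_center[OF x(3), of r]
    by (simp add: U_def U'_def R_def B_def h_def diff_divide_distrib)
  also have "\<bar>\<dots>\<bar> \<le> \<bar>U - U'\<bar> / pi + \<bar>R\<bar> + 2 * \<bar>gf x 0 - gf x' 0\<bar>"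
  proof -
    have "\<bar>a + R - 2 * b\<bar> \<le> \<bar>a\<bar> + \<bar>R\<bar> + 2 * \<bar>b\<bar>" for a b :: real by linarith
    from this[of "(U - U') / pi" "gf x 0 - gf x' 0"] show ?thesis by (simp add: abs_divide)
  qed
  also have "\<dots> \<le> c * (2 * pi) / pi + gpot_const \<alpha> * (pi * outer_bound r) * n + 2 * c"
    using 1 2 3 by (intro add_mono divide_right_mono) (auto simp: U_def U'_def R_def)
  also have "\<dots> = off_center_const \<alpha> r * n" by (simp only: off_center_const_def c_def k_def[symmetric]) (simp add: algebra_simps)
  finally show ?thesis by (simp add: n_def)
qed

end

text \<open>The order of choices matters: \<open>s\<close> makes the spreading error, which is
  independent of the gap, at most \<open>\<eta> / 2\<close>; with \<open>s\<close> fixed the other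
  errors are linear in \<open>\<delta>\<close>.\<close>

lemma blowup_uniform:
  assumes r: "0 < r" "r \<le> 1 / 2" and \<eta>: "\<eta> > 0"
  shows "\<exists>\<delta>>0. \<forall>u L lam f x. liouville u L lam f \<and> 2 * pi - \<delta> \<le> integral {-1..1} f \<and> \<bar>x\<bar> \<le> 1 \<and> 2 * r \<le> \<bar>x\<bar>
    \<longrightarrow> \<bar>u x - 2 * gf x 0\<bar> \<le> \<eta>"
proof -
  define t where "t = \<eta> * r / (4 * center_const)"
  have t: "t > 0" using r \<eta> center_const_pos by (simp add: t_def)
  define s where "s = min r (t\<^sup>2)"
  have s: "0 < s" "s \<le> r" using r t by (auto simp: s_def)
  have "sqrt s \<le> sqrt (t\<^sup>2)" unfolding s_def by (intro real_sqrt_le_mono) simp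
  then have "2 * center_const * sqrt s / r \<le> 2 * center_const * t / r"
    using r t center_const_pos by (intro divide_right_mono mult_left_mono) auto
  also have "\<dots> = \<eta> / 2" using r center_const_pos by (simp add: t_def field_simps)
  finally have 1: "2 * center_const * sqrt s / r \<le> \<eta> / 2" .
  define A where "A = (1 + 1 / s\<^sup>2) * ln (1 / r) / pi + gpot_const (1/2) * (3 / 2 * outer_bound s)"
  have A: "A \<ge> 0" unfolding A_def outer_bound_def using r
    by (intro add_nonneg_nonneg mult_nonneg_nonneg divide_nonneg_nonneg gpot_const_nonneg) auto
  define \<delta> where "\<delta> = min (pi / 8 * s\<^sup>2) (\<eta> / (2 * (A + 1)))"
  have \<delta>: "\<delta> > 0" "\<delta> \<le> pi / 8 * s\<^sup>2"
  proof -
    show "\<delta> > 0" unfolding \<delta>_def min_less_iff_conj using s \<eta> A by (intro conjI divide_pos_pos mult_pos_pos) auto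
    show "\<delta> \<le> pi / 8 * s\<^sup>2" unfolding \<delta>_def by (rule min.cobounded1)
  qed
  have "\<delta> * A \<le> \<eta> / (2 * (A + 1)) * (A + 1)" using A \<delta> \<eta> by (intro mult_mono) (auto simp: \<delta>_def)
  also have "\<dots> = \<eta> / 2" using A by (simp add: field_simps)
  finally have 2: "\<delta> * A \<le> \<eta> / 2" .
  show ?thesis
  proof (intro exI[of _ \<delta>] conjI allI impI)
    fix u L lam f x
    assume *: "liouville u L lam f \<and> 2 * pi - \<delta> \<le> integral {-1..1} f \<and> \<bar>x\<bar> \<le> 1 \<and> 2 * r \<le> \<bar>x\<bar>"
    then interpret liouville u L lam f by simp
    have "\<bar>u x - 2 * gf x 0\<bar> \<le> 2 * center_const * sqrt s / r + (\<delta> + \<delta> / s\<^sup>2) * ln (1 / r) / pi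
      + gpot_const (1/2) * (3 / 2 * \<delta> * outer_bound s)"
      using * \<delta> by (intro deviation_le s r) auto
    also have "\<dots> = 2 * center_const * sqrt s / r + \<delta> * A" by (simp add: A_def algebra_simps)
    finally show "\<bar>u x - 2 * gf x 0\<bar> \<le> \<eta>" using 1 2 by linarith
  qed (rule \<delta>)
qed

text \<open>With \<open>s = exp (- T)\<close> and gap at most \<open>s\<^sup>2\<close>, the mass
  outside the central interval is at most 1, so at least \<open>pi\<close> remains inside, and
  \<open>ln (1 / s) = T\<close>.\<close>

lemma blowup_at_zero:
  assumes "T > 0"
  shows "\<exists>\<delta>>0. \<forall>u L lam f. liouville u L lam f \<and> 2 * pi - \<delta> \<le> integral {-1..1} f \<longrightarrow> T \<le> u 0"
proof -
  define s where "s = exp (- T)"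
  have s: "0 < s" "s < 1" using assms by (auto simp: s_def)
  show ?thesis
  proof (intro exI[of _ "s\<^sup>2"] conjI allI impI)
    fix u L lam f
    assume *: "liouville u L lam f \<and> 2 * pi - s\<^sup>2 \<le> integral {-1..1} f"
    then interpret liouville u L lam f by simp
    have "q2 / s\<^sup>2 \<le> s\<^sup>2 / s\<^sup>2" using q2_le_gap * by (intro divide_right_mono) auto
    then have q: "q2 / s\<^sup>2 \<le> 1" using s by simp
    have "s\<^sup>2 \<le> 1" using s by (simp add: power_le_one)
    then have "pi \<le> \<rho> - q2 / s\<^sup>2" using q * pi_gt3 by linarith
    then have "T / pi * pi \<le> T / pi * (\<rho> - q2 / s\<^sup>2)" using assms by (intro mult_left_mono) auto
    also have "\<dots> \<le> u 0" using u_zero_ge[OF s] by (simp add: s_def ln_div)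
    finally show "T \<le> u 0" by simp
  qed (use s in simp)
qed

section \<open>Hoelder norms and limits along the sequence\<close>

lemma sup_norm_on_le: "(\<And>x. x \<in> S \<Longrightarrow> \<bar>g x\<bar> \<le> C) \<Longrightarrow> sup_norm_on S g \<le> ennreal C"
  unfolding sup_norm_on_def by (intro SUP_least ennreal_leI)

lemma holder_seminorm_le:
  assumes "\<And>x y. x \<in> S \<Longrightarrow> y \<in> S \<Longrightarrow> x \<noteq> y \<Longrightarrow> \<bar>g x - g y\<bar> \<le> C * \<bar>x - y\<bar> powr \<sigma>"
  shows "holder_seminorm \<sigma> S g \<le> ennreal C"
  unfolding holder_seminorm_def
proof (intro SUP_least, clarify)
  fix x y assume "x \<in> S" "y \<in> S" "x \<noteq> y"
  then show "ennreal (\<bar>g x - g y\<bar> / \<bar>x - y\<bar> powr \<sigma>) \<le> ennreal C"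
    using assms[of x y] by (intro ennreal_leI) (simp add: divide_le_eq)
qed

lemma holder_norm_le:
  assumes "\<And>x. x \<in> S \<Longrightarrow> \<bar>g x\<bar> \<le> A" "A \<ge> 0" "C \<ge> 0"
    "\<And>x y. x \<in> S \<Longrightarrow> y \<in> S \<Longrightarrow> x \<noteq> y \<Longrightarrow> \<bar>g x - g y\<bar> \<le> C * \<bar>x - y\<bar> powr \<sigma>"
  shows "holder_norm \<sigma> S g \<le> ennreal (A + C)"
  unfolding holder_norm_def ennreal_plus[OF assms(2,3)]
  by (intro add_mono sup_norm_on_le holder_seminorm_le assms)

text \<open>For pairs closer than \<open>\<tau>\<close> the surplus exponent
  \<open>\<beta> - \<sigma>\<close> makes the quotient small; for the other pairs the sup norm
  suffices, since the denominator is at least \<open>\<tau> powr \<sigma>\<close>.\<close>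

lemma holder_norm_interpolation:
  assumes sup: "\<And>\<eta>. \<eta> > 0 \<Longrightarrow> eventually (\<lambda>k. \<forall>x\<in>K. \<bar>d k x\<bar> \<le> \<eta>) F"
    and hol: "eventually (\<lambda>k. \<forall>x\<in>K. \<forall>y\<in>K. \<bar>d k x - d k y\<bar> \<le> H * \<bar>x - y\<bar> powr \<beta>) F"
    and H: "H \<ge> 0" and \<sigma>: "\<sigma> < \<beta>" "0 < \<sigma>"
  shows "((\<lambda>k. holder_norm \<sigma> K (d k)) \<longlongrightarrow> 0) F"
proof (rule order_tendstoI)
  fix a :: ennreal assume "0 < a"
  then obtain b where b: "0 < b" "b < a" using dense by blast
  define \<epsilon> where "\<epsilon> = enn2real b"
  have be: "b = ennreal \<epsilon>" unfolding \<epsilon>_def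
    by (rule ennreal_enn2real[symmetric]) (rule less_le_trans[OF b(2) top_greatest])
  have \<epsilon>: "\<epsilon> > 0" using b unfolding be by simp
  define \<tau> where "\<tau> = (\<epsilon> / (2 * (H + 1))) powr (1 / (\<beta> - \<sigma>))"
  have \<tau>: "\<tau> > 0" using \<epsilon> H by (auto simp: \<tau>_def)
  have "H * \<tau> powr (\<beta> - \<sigma>) = H * (\<epsilon> / (2 * (H + 1)))" using \<epsilon> H \<sigma> by (simp add: \<tau>_def powr_powr)
  also have "\<dots> \<le> (H + 1) * (\<epsilon> / (2 * (H + 1)))" using H \<epsilon> by (intro mult_right_mono) auto
  also have "\<dots> = \<epsilon> / 2" using H by (simp add: field_simps)
  finally have H\<tau>: "H * \<tau> powr (\<beta> - \<sigma>) \<le> \<epsilon> / 2" .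
  define \<eta> where "\<eta> = min (\<epsilon> / 2) (\<epsilon> * \<tau> powr \<sigma> / 4)"
  have \<eta>: "\<eta> > 0" using \<epsilon> \<tau> by (simp add: \<eta>_def)
  show "eventually (\<lambda>k. holder_norm \<sigma> K (d k) < a) F"
    using sup[OF \<eta>] hol
  proof eventually_elim
    case (elim k)
    have "holder_norm \<sigma> K (d k) \<le> ennreal (\<epsilon> / 2 + \<epsilon> / 2)"
    proof (rule holder_norm_le)
      show "\<bar>d k x\<bar> \<le> \<epsilon> / 2" if "x \<in> K" for x using elim(1) that by (auto simp: \<eta>_def)
      fix x y assume x: "x \<in> K" "y \<in> K" "x \<noteq> y"
      show "\<bar>d k x - d k y\<bar> \<le> \<epsilon> / 2 * \<bar>x - y\<bar> powr \<sigma>"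
      proof (cases "\<bar>x - y\<bar> \<le> \<tau>")
        case True
        have "\<bar>d k x - d k y\<bar> \<le> H * \<bar>x - y\<bar> powr \<beta>" using elim(2) x by blast
        also have "\<bar>x - y\<bar> powr \<beta> = \<bar>x - y\<bar> powr (\<beta> - \<sigma>) * \<bar>x - y\<bar> powr \<sigma>" by (simp add: powr_add[symmetric])
        also have "H * (\<bar>x - y\<bar> powr (\<beta> - \<sigma>) * \<bar>x - y\<bar> powr \<sigma>) \<le> H * (\<tau> powr (\<beta> - \<sigma>) * \<bar>x - y\<bar> powr \<sigma>)"
          using H True \<sigma> by (intro mult_left_mono mult_right_mono powr_mono2) auto
        also have "\<dots> = (H * \<tau> powr (\<beta> - \<sigma>)) * \<bar>x - y\<bar> powr \<sigma>" by simp
        also have "\<dots> \<le> \<epsilon> / 2 * \<bar>x - y\<bar> powr \<sigma>" using H\<tau> by (intro mult_right_mono) auto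
        finally show ?thesis .
      next
        case False
        have "\<bar>d k x - d k y\<bar> \<le> \<bar>d k x\<bar> + \<bar>d k y\<bar>" by simp
        also have "\<dots> \<le> \<epsilon> * \<tau> powr \<sigma> / 4 + \<epsilon> * \<tau> powr \<sigma> / 4" using elim(1) x by (intro add_mono) (auto simp: \<eta>_def)
        also have "\<dots> = \<epsilon> / 2 * \<tau> powr \<sigma>" by simp
        also have "\<dots> \<le> \<epsilon> / 2 * \<bar>x - y\<bar> powr \<sigma>" using False \<tau> \<epsilon> \<sigma> by (intro mult_left_mono powr_mono2) auto
        finally show ?thesis .
      qed
    qed (use \<epsilon> in auto)
    also have "\<dots> = b" by (simp add: be)
    finally show ?case using b by (rule_tac le_less_trans)
  qed
qed simp

lemma liouville_gap_eventually:
  assumes lv: "\<And>k. liouville (u k) (L k) (lam k) (f k)"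
    and conv: "(\<lambda>k. integral {-1..1} (f k)) \<longlonglongrightarrow> 2 * pi" and \<delta>: "\<delta> > 0"
  shows "eventually (\<lambda>k. 2 * pi - \<delta> \<le> integral {-1..1} (f k)) sequentially"
  using order_tendstoD(1)[OF conv, of "2 * pi - \<delta>"] \<delta> by (auto elim: eventually_mono)

lemma liouville_tendsto_green:
  assumes lv: "\<And>k. liouville (u k) (L k) (lam k) (f k)"
    and conv: "(\<lambda>k. integral {-1..1} (f k)) \<longlonglongrightarrow> 2 * pi"
    and \<sigma>: "0 < \<sigma>" "\<sigma> < 1/2"
  shows "tendsto_in_holder_loc \<sigma> (UNIV - {0}) u (\<lambda>y. 2 * pi * green 0 y)"
  unfolding tendsto_in_holder_loc_def
proof (intro allI impI)
  fix K :: "real set" assume K: "compact K \<and> K \<subseteq> UNIV - {0}"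
  obtain R where R: "R > 0" "\<And>x. x \<in> K \<Longrightarrow> R \<le> \<bar>x\<bar>"
  proof -
    have "open (- K)" "0 \<in> - K" using K compact_imp_closed by auto
    then obtain R where "R > 0" "ball 0 R \<subseteq> - K" using open_contains_ball by blast
    then show ?thesis by (intro that[of R]) (auto simp: subset_iff not_less[symmetric])
  qed
  \<comment> \<open>Both bounds are needed after clamping: a point of \<open>K\<close> in the
    interval keeps \<open>\<bar>x\<bar> \<ge> R \<ge> 2 * r\<close>, and one outside goes to modulus
    \<open>1 \<ge> 2 * r\<close>.\<close>
  define r where "r = min (R / 2) (1 / 2)"
  have r: "0 < r" "r \<le> 1 / 2" using R by (auto simp: r_def)
  have rK: "\<bar>clamp1 x\<bar> \<le> 1 \<and> 2 * r \<le> \<bar>clamp1 x\<bar>" "x \<noteq> 0" if "x \<in> K" for x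
  proof -
    have "2 * r \<le> \<bar>x\<bar>" using R(2)[OF that] by (auto simp: r_def)
    then show "\<bar>clamp1 x\<bar> \<le> 1 \<and> 2 * r \<le> \<bar>clamp1 x\<bar>" using clamp1(1,3,4)[of x] r by (cases "\<bar>x\<bar> \<le> 1") auto
    show "x \<noteq> 0" using that K by auto
  qed
  define d where "d = (\<lambda>k x. u k x - 2 * pi * green 0 x)"
  have d: "d k x = u k (clamp1 x) - 2 * gf (clamp1 x) 0" if "x \<in> K" for k x
  proof -
    interpret liouville "u k" "L k" "lam k" "f k" by (rule lv)
    show ?thesis using green_0_clamp1[OF rK(2)[OF that]] u_clamp1[of x] by (simp add: d_def)
  qed
  \<comment> \<open>The midpoint of \<open>2 * \<sigma>\<close> and 1. An exponent
    \<open>\<alpha>\<close> in chords is \<open>\<alpha> / 2\<close> on the line, which must exceed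
    \<open>\<sigma>\<close>; with \<open>\<alpha> < 1\<close> this is where
    \<open>\<sigma> < 1/2\<close> is used.\<close>
  define \<alpha> where "\<alpha> = \<sigma> + 1 / 2"
  have \<alpha>: "0 < \<alpha>" "\<alpha> < 1" "\<sigma> < \<alpha> / 2" using \<sigma> by (auto simp: \<alpha>_def)
  have "((\<lambda>k. holder_norm \<sigma> K (d k)) \<longlongrightarrow> 0) sequentially"
  proof (rule holder_norm_interpolation[where \<beta> = "\<alpha> / 2" and H = "off_center_const \<alpha> r * 2 powr \<alpha>"])
    fix \<eta> :: real assume \<eta>: "\<eta> > 0"
    obtain \<delta> where \<delta>: "\<delta> > 0" "\<And>u L lam f x. liouville u L lam f \<and> 2 * pi - \<delta> \<le> integral {-1..1} f \<and> \<bar>x\<bar> \<le> 1 \<and> 2 * r \<le> \<bar>x\<bar>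
        \<Longrightarrow> \<bar>u x - 2 * gf x 0\<bar> \<le> \<eta>"
      using blowup_uniform[OF r \<eta>] by blast
    show "eventually (\<lambda>k. \<forall>x\<in>K. \<bar>d k x\<bar> \<le> \<eta>) sequentially"
      using liouville_gap_eventually[OF lv conv \<delta>(1)]
      by eventually_elim (use lv rK d in \<open>auto intro!: \<delta>(2)\<close>)
  next
    have "pi / 8 * r\<^sup>2 > 0" using r by simp
    from liouville_gap_eventually[OF lv conv this]
    show "eventually (\<lambda>k. \<forall>x\<in>K. \<forall>y\<in>K. \<bar>d k x - d k y\<bar> \<le> off_center_const \<alpha> r * 2 powr \<alpha> * \<bar>x - y\<bar> powr (\<alpha> / 2)) sequentially"
    proof (eventually_elim, intro ballI)
      fix k x y assume k: "2 * pi - pi / 8 * r\<^sup>2 \<le> integral {-1..1} (f k)" and xy: "x \<in> K" "y \<in> K"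
      interpret liouville "u k" "L k" "lam k" "f k" by (rule lv)
      have q: "q2 \<le> pi / 8 * r\<^sup>2" using q2_le_gap k by linarith
      have "\<bar>d k x - d k y\<bar> \<le> off_center_const \<alpha> r * norm (cpt (clamp1 x) - cpt (clamp1 y)) powr \<alpha>"
        unfolding d[OF xy(1)] d[OF xy(2)] using rK[OF xy(1)] rK[OF xy(2)] by (intro deviation_holder r \<alpha> q) auto
      also have "\<dots> \<le> off_center_const \<alpha> r * (2 * sqrt \<bar>x - y\<bar>) powr \<alpha>"
      proof -
        have "norm (cpt (clamp1 x) - cpt (clamp1 y)) \<le> 2 * sqrt \<bar>clamp1 x - clamp1 y\<bar>"
          by (intro norm_cpt_diff_le clamp1)
        also have "\<dots> \<le> 2 * sqrt \<bar>x - y\<bar>" using clamp1(2)[of x y] by simp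
        finally show ?thesis using \<alpha> by (intro mult_left_mono powr_mono2 off_center_const_nonneg) auto
      qed
      also have "(2 * sqrt \<bar>x - y\<bar>) powr \<alpha> = 2 powr \<alpha> * \<bar>x - y\<bar> powr (\<alpha> / 2)"
        by (simp add: powr_mult powr_half_sqrt[symmetric] powr_powr)
      finally show "\<bar>d k x - d k y\<bar> \<le> off_center_const \<alpha> r * 2 powr \<alpha> * \<bar>x - y\<bar> powr (\<alpha> / 2)"
        by (simp only: mult.assoc)
    qed
  qed (use \<alpha> \<sigma> off_center_const_nonneg[of \<alpha> r] in auto)
  then show "(\<lambda>k. holder_norm \<sigma> K (\<lambda>x. u k x - 2 * pi * green 0 x)) \<longlonglongrightarrow> 0" by (simp only: d_def)
qed

lemma liouville_blowup_at_zero: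
  assumes lv: "\<And>k. liouville (u k) (L k) (lam k) (f k)"
    and conv: "(\<lambda>k. integral {-1..1} (f k)) \<longlonglongrightarrow> 2 * pi"
  shows "filterlim (\<lambda>k. u k 0) at_top sequentially"
  unfolding filterlim_at_top_gt[of _ _ 0]
proof (intro allI impI)
  fix T :: real assume "0 < T"
  from blowup_at_zero[OF this] obtain \<delta> where \<delta>: "\<delta> > 0"
    "\<And>u L lam f. liouville u L lam f \<and> 2 * pi - \<delta> \<le> integral {-1..1} f \<Longrightarrow> T \<le> u 0" by blast
  show "eventually (\<lambda>k. T \<le> u k 0) sequentially"
    using liouville_gap_eventually[OF lv conv \<delta>(1)] by eventually_elim (use lv \<delta>(2) in blast)
qed

lemma liouville_bounded:
  assumes lv: "\<And>k. liouville (u k) (L k) (lam k) (f k)" and sm: "\<And>k. smooth_on {-1<..<1} (u k)"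
    and C: "\<And>k x. u k x \<le> C"
  shows "bounded_in_holder (1/2) UNIV u" and "bounded_in_Cl_loc l {-1<..<1} u"
proof -
  have C0: "C \<ge> 0"
  proof -
    interpret liouville "u 0" "L 0" "lam 0" "f 0" by (rule lv)
    show ?thesis using u_nonneg[of 0] C[of 0 0] by linarith
  qed
  have abs: "\<bar>u k x\<bar> \<le> C" for k x
  proof -
    interpret liouville "u k" "L k" "lam k" "f k" by (rule lv)
    show ?thesis using u_nonneg[of x] C[of k x] by simp
  qed
  have hc: "hconst C \<ge> 0" by (simp add: hconst_def gpot_const_nonneg)
  show "bounded_in_holder (1/2) UNIV u" unfolding bounded_in_holder_def
  proof (intro exI[of _ "C + hconst C"] allI)
    fix k
    interpret liouville "u k" "L k" "lam k" "f k" by (rule lv)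
    show "holder_norm (1/2) UNIV (u k) \<le> ennreal (C + hconst C)"
      using half_holder_bound[OF C[of k]] abs C0 hc by (intro holder_norm_le) (auto simp: powr_half_sqrt)
  qed
  show "bounded_in_Cl_loc l {-1<..<1} u" unfolding bounded_in_Cl_loc_def
  proof (intro allI impI)
    fix K :: "real set" assume K: "compact K \<and> K \<subseteq> {-1<..<1}"
    obtain R where R: "R > 0" "\<And>x. x \<in> K \<Longrightarrow> R < 1 - \<bar>x\<bar>"
    proof (cases "K = {}")
      case False
      have "compact ((\<lambda>x. 1 - \<bar>x\<bar>) ` K)" using K by (intro compact_continuous_image continuous_intros) auto
      from compact_attains_inf[OF this] obtain z where z: "z \<in> K" "\<And>x. x \<in> K \<Longrightarrow> 1 - \<bar>z\<bar> \<le> 1 - \<bar>x\<bar>"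
        using False by auto
      have "z \<in> {-1<..<1}" using K z by blast
      then have "1 - \<bar>z\<bar> > 0" by auto
      then show ?thesis using z(2) by (intro that[of "(1 - \<bar>z\<bar>) / 2"]) force+
    qed (rule that[of 1], auto)
    define R' where "R' = min R (1 / (4 * pi * exp C))"
    have R': "0 < R'" "R' \<le> 1 / (4 * pi * exp C)" "\<And>x. x \<in> K \<Longrightarrow> R' < 1 - \<bar>x\<bar>"
      using R by (auto simp: R'_def min_less_iff_disj)
    \<comment> \<open>Order 0 is the sup bound of \<open>u\<close> itself;
      \<open>higher_deriv_bound\<close> starts at order 1, hence the shift.\<close>
    define A where "A = (\<lambda>j. case j of 0 \<Rightarrow> C | Suc n \<Rightarrow> fact n * (36 * exp C / R') / (R' / 2) ^ n)"
    have A: "A j \<ge> 0" for j using C0 R' by (auto simp: A_def split: nat.split)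
    have "Cl_norm l K (u k) \<le> ennreal (\<Sum>j\<le>l. A j)" for k
    proof -
      interpret liouville "u k" "L k" "lam k" "f k" by (rule lv)
      have "\<bar>(deriv ^^ j) (u k) x\<bar> \<le> A j" if "x \<in> K" for j x
      proof (cases j)
        case (Suc n)
        then show ?thesis using higher_deriv_bound[OF C R'(1) R'(3)[OF that] R'(2) sm, of n] by (simp add: A_def)
      qed (use abs in \<open>simp add: A_def\<close>)
      then have "Cl_norm l K (u k) \<le> (\<Sum>j\<le>l. ennreal (A j))"
        unfolding Cl_norm_def by (intro sum_mono sup_norm_on_le)
      also have "\<dots> = ennreal (\<Sum>j\<le>l. A j)" using A by (intro sum_ennreal)
      finally show ?thesis .
    qed
    then show "\<exists>C. \<forall>k. Cl_norm l K (u k) \<le> ennreal C" by blast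
  qed
qed

lemma increasing_subsequence_to_sup:
  fixes \<rho> :: "nat \<Rightarrow> real"
  assumes less: "\<And>k. \<rho> k < b" and app: "\<And>\<epsilon> N. \<epsilon> > 0 \<Longrightarrow> \<exists>k\<ge>N. b - \<epsilon> < \<rho> k"
  obtains r where "strict_mono r" "incseq (\<lambda>n. \<rho> (r n))" "(\<lambda>n. \<rho> (r n)) \<longlonglongrightarrow> b"
proof -
  have "\<exists>r. \<forall>n. b - 1 / (real n + 1) < \<rho> (r n) \<and> (r n < r (Suc n) \<and> \<rho> (r n) \<le> \<rho> (r (Suc n)))"
  proof (rule dependent_nat_choice)
    show "\<exists>k. b - 1 / (real 0 + 1) < \<rho> k" using app[of 1 0] by auto
    fix k n assume "b - 1 / (real n + 1) < \<rho> k"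
    \<comment> \<open>The first entry gives the rate of convergence. The second, positive because
      \<open>b\<close> is never attained, makes the next value exceed the current one.\<close>
    define \<epsilon> where "\<epsilon> = min (1 / (real (Suc n) + 1)) (b - \<rho> k)"
    have "\<epsilon> > 0" using less[of k] by (simp add: \<epsilon>_def)
    from app[OF this, of "Suc k"] obtain k' where "k' \<ge> Suc k" "b - \<epsilon> < \<rho> k'" by blast
    then show "\<exists>k'. b - 1 / (real (Suc n) + 1) < \<rho> k' \<and> (k < k' \<and> \<rho> k \<le> \<rho> k')"
      by (intro exI[of _ k']) (auto simp: \<epsilon>_def)
  qed
  then obtain r where r: "\<And>n. b - 1 / (real n + 1) < \<rho> (r n)" "\<And>n. r n < r (Suc n)" "\<And>n. \<rho> (r n) \<le> \<rho> (r (Suc n))" by blast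
  show ?thesis
  proof (rule that[of r])
    show "strict_mono r" using r(2) by (simp add: strict_mono_Suc_iff)
    show "incseq (\<lambda>n. \<rho> (r n))" using r(3) by (rule incseq_SucI)
    show "(\<lambda>n. \<rho> (r n)) \<longlonglongrightarrow> b"
    proof (rule tendsto_sandwich[of "\<lambda>n. b - 1 / (real n + 1)" _ _ "\<lambda>_. b"])
      show "(\<lambda>n. b - 1 / (real n + 1)) \<longlonglongrightarrow> b" by real_asymp
    qed (use r(1) less in \<open>auto intro!: always_eventually less_imp_le\<close>)
  qed
qed

theorem theorem1:
  fixes \<rho> :: "nat \<Rightarrow> real" and u :: "nat \<Rightarrow> real \<Rightarrow> real"
  assumes "\<And>k. \<rho> k > 0"
    and "\<And>k. half_liouville_solution (\<rho> k) (u k)"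
  shows "\<exists>r :: nat \<Rightarrow> nat. strict_mono r \<and>
    ((bounded_in_holder (1/2) UNIV (\<lambda>k. u (r k)) \<and>
      (\<forall>l. bounded_in_Cl_loc l {-1<..<1} (\<lambda>k. u (r k)))) \<or>
     (filterlim (\<lambda>k. u (r k) 0) at_top sequentially \<and>
      incseq (\<lambda>k. \<rho> (r k)) \<and>
      filterlim (\<lambda>k. \<rho> (r k)) (at_left (2 * pi)) sequentially \<and>
      (\<forall>\<sigma>. 0 < \<sigma> \<and> \<sigma> < 1/2 \<longrightarrow>
        tendsto_in_holder_loc \<sigma> (UNIV - {0}) (\<lambda>k. u (r k)) (\<lambda>y. 2 * pi * green 0 y))))"
proof -
  have "\<exists>L lam f. liouville (u k) L lam f \<and> integral {-1..1} f = \<rho> k \<and> smooth_on {-1<..<1} (u k)" for k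
    using half_liouville_solution_liouville[OF assms] by metis
  then obtain L lam f where lv: "\<And>k. liouville (u k) (L k) (lam k) (f k)"
    and \<rho>: "\<And>k. integral {-1..1} (f k) = \<rho> k" and sm: "\<And>k. smooth_on {-1<..<1} (u k)" by metis
  have less: "\<rho> k < 2 * pi" for k
  proof -
    interpret liouville "u k" "L k" "lam k" "f k" by (rule lv)
    show ?thesis using \<rho>_less \<rho>[of k] by simp
  qed
  show ?thesis
  proof (cases "\<exists>\<epsilon>>0. \<exists>N. \<forall>k\<ge>N. \<rho> k \<le> 2 * pi - \<epsilon>")
    case True
    then obtain \<epsilon> N where \<epsilon>: "\<epsilon> > 0" "\<And>k. k \<ge> N \<Longrightarrow> \<rho> k \<le> 2 * pi - \<epsilon>" by blast
    from uniform_sup_bound[OF \<epsilon>(1)] obtain C where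
      C: "\<And>u L lam f x. liouville u L lam f \<Longrightarrow> integral {-1..1} f \<le> 2 * pi - \<epsilon> \<Longrightarrow> u x \<le> C" by blast
    \<comment> \<open>The subsequence is the tail from \<open>N\<close> on, where the mass gap
      holds.\<close>
    have C': "u (k + N) x \<le> C" for k x using C[OF lv] \<epsilon>(2)[of "k + N"] \<rho> by simp
    note b = liouville_bounded[of "\<lambda>k. u (k + N)" "\<lambda>k. L (k + N)" "\<lambda>k. lam (k + N)" "\<lambda>k. f (k + N)" C, OF lv sm C']
    have "strict_mono (\<lambda>k. k + N)" by (simp add: strict_mono_def)
    then show ?thesis using b by (intro exI[of _ "\<lambda>k. k + N"] conjI disjI1 allI)
  next
    case False
    obtain r where r: "strict_mono r" "incseq (\<lambda>n. \<rho> (r n))" "(\<lambda>n. \<rho> (r n)) \<longlonglongrightarrow> 2 * pi"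
    proof (rule increasing_subsequence_to_sup[OF less])
      fix \<epsilon> :: real and N assume "\<epsilon> > 0"
      then show "\<exists>k\<ge>N. 2 * pi - \<epsilon> < \<rho> k" using False by (meson not_less)
    qed blast
    have conv: "(\<lambda>k. integral {-1..1} (f (r k))) \<longlonglongrightarrow> 2 * pi" using r(3) by (simp add: \<rho>)
    note b = liouville_blowup_at_zero[of "\<lambda>k. u (r k)" "\<lambda>k. L (r k)" "\<lambda>k. lam (r k)" "\<lambda>k. f (r k)", OF lv conv]
      liouville_tendsto_green[of "\<lambda>k. u (r k)" "\<lambda>k. L (r k)" "\<lambda>k. lam (r k)" "\<lambda>k. f (r k)", OF lv conv]
    \<comment> \<open>Approach from the left requires the strict bound
      \<open>\<rho> k < 2 * pi\<close> along the sequence in addition to convergence.\<close>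
    have "filterlim (\<lambda>k. \<rho> (r k)) (at_left (2 * pi)) sequentially"
      using r(3) less by (auto simp: filterlim_at less_imp_neq)
    then show ?thesis using r b by (intro exI[of _ r] conjI disjI2 allI impI) auto
  qed
qed

end
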